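(* Fix $\delta\in\mathbb{R}$, let $\rho=\rho_N=\frac12+\delta 2^{-4/3}N^{-1/3}$, and for $\tau\in(0,1)$ let $$\mathcal{L}_N^{\mathrm{pp}}(0,1)=\frac{L^{\mathrm{pp}}(N,N)-4N}{2^{4/3}N^{1/3}},\qquad \mathcal{L}_N^{\mathrm{pp}}(0,\tau)=\frac{L^{\mathrm{pp}}(\tau N,\tau N)-4\tau N}{2^{4/3}N^{1/3}},$$ where $L^{\mathrm{pp}}$ is the point-to-point half-space last passage time with diagonal parameter $\rho$ (both quantities computed in the same environment). Then, for any $0<\theta<1/3$, as $\tau\to1$, $$\lim_{N\to\infty}\mathrm{Cov}\big(\mathcal{L}_N^{\mathrm{pp}}(0,1),\mathcal{L}_N^{\mathrm{pp}}(0,\tau)\big)=\tfrac12\mathrm{Var}\big(\mathcal{A}^{\mathrm{pp}}_\delta(0)\big)+\tfrac12\tau^{2/3}\mathrm{Var}\big(\mathcal{A}^{\mathrm{pp}}_{\delta\tau^{1/3}}(0)\big)-\tfrac12(1-\tau)^{2/3}\mathrm{Var}\big(\mathcal{A}^{\mathrm{st,hs}}_{\delta(1-\tau)^{1/3}}(0)\big)+\mathcal{O}\big((1-\tau)^{1-\theta}\big).$$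
   Context: Half-space last passage percolation (LPP): given weights $\omega_{i,j}$ on $\{(i,j)\in\mathbb{Z}^2: i\ge j\ge 0\}$, put $L(a,b)=\max_{\pi:a\to b}\sum_{(i,j)\in\pi\setminus\{a\}}\omega_{i,j}$, the maximum being over up-right lattice paths in the half-space from $a$ to $b$; $L(b):=L((0,0),b)$. Non-integer points are rounded: $(x,y)$ means $(\lfloor x\rfloor,\lfloor y\rfloor)$. $\exp(a)$ is the exponential law with rate $a$ (mean $1/a$). Stationary model $L^{\mathrm{st},\rho}$, $\rho\in(0,1)$: independent weights $\omega_{0,0}=0$, $\omega_{i,i}\sim\exp(\rho)$ and $\omega_{i,0}\sim\exp(1-\rho)$ for $i\ge 1$, $\omega_{i,j}\sim\exp(1)$ for $0<j<i$. Point-to-point model $L^{\mathrm{pp}}$ with diagonal parameter $\rho$: independent weights $\omega_{0,0}=0$, $\omega_{i,i}\sim\exp(\rho)$ and $\omega_{i,0}=0$ for $i\ge1$, $\omega_{i,j}\sim\exp(1)$ for $0<j<i$. Limit processes: let $Q(u)=(N+u(2N)^{2/3},N-u(2N)^{2/3})$, $u\ge0$. It is known that for every $\delta\in\mathbb{R}$, with $\rho=\frac12+\delta2^{-4/3}N^{-1/3}$, the processes $\frac{L^{\mathrm{pp}}(Q(u))-4N}{2^{4/3}N^{1/3}}$ and $\frac{L^{\mathrm{st},\rho}(Q(u))-4N}{2^{4/3}N^{1/3}}$ converge as $N\to\infty$ in the sense of finite-dimensional distributions; the limits are denoted $\mathcal{A}^{\mathrm{pp}}_\delta(u)-u^2$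 and $\mathcal{A}^{\mathrm{st,hs}}_\delta(u)$ respectively (this defines $\mathcal{A}^{\mathrm{pp}}_\delta$ and $\mathcal{A}^{\mathrm{st,hs}}_\delta$ in law). *)

theory Defs
  imports "HOL-Probability.Probability" "HOL-Library.Landau_Symbols"
begin

section \<open>Half-space last passage percolation\<close>

definition half_space :: "(int \<times> int) set" where
  "half_space = {(i, j). 0 \<le> j \<and> j \<le> i}"

definition up_right_paths :: "int \<times> int \<Rightarrow> int \<times> int \<Rightarrow> (int \<times> int) list set" where
  "up_right_paths a b = {\<pi>. \<pi> \<noteq> [] \<and> hd \<pi> = a \<and> last \<pi> = b \<and> set \<pi> \<subseteq> half_space \<and>
     successively (\<lambda>p q. q - p \<in> {(1, 0), (0, 1)}) \<pi>}"

text \<open>The maximum is over a finite set. It is unspecified when no path from \<open>a\<close> to \<open>b\<close> exists,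
  in particular when \<open>b\<close> is outside the half-space; the end points used below are in the
  half-space for all large \<open>N\<close>.\<close>

definition last_passage :: "(int \<times> int \<Rightarrow> real) \<Rightarrow> int \<times> int \<Rightarrow> int \<times> int \<Rightarrow> real" where
  "last_passage \<omega> a b = Max ((\<lambda>\<pi>. \<Sum>p\<in>set \<pi> - {a}. \<omega> p) ` up_right_paths a b)"

definition lpp :: "(int \<times> int \<Rightarrow> real) \<Rightarrow> real \<times> real \<Rightarrow> real" where
  "lpp \<omega> b = last_passage \<omega> (0, 0) (\<lfloor>fst b\<rfloor>, \<lfloor>snd b\<rfloor>)"

section \<open>Random environments\<close>

text \<open>This is a probability measure only for a positive rate; below, rates are positive for all
  large \<open>N\<close>.\<close>

definition exponential_law :: "real \<Rightarrow> real measure" where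
  "exponential_law a = density lborel (exponential_density a)"

definition pp_weight_law :: "real \<Rightarrow> int \<times> int \<Rightarrow> real measure" where
  "pp_weight_law \<rho> = (\<lambda>(i, j).
     if j = 0 then return borel 0
     else if i = j then exponential_law \<rho>
     else exponential_law 1)"

definition st_weight_law :: "real \<Rightarrow> int \<times> int \<Rightarrow> real measure" where
  "st_weight_law \<rho> = (\<lambda>(i, j).
     if i = 0 \<and> j = 0 then return borel 0
     else if j = 0 then exponential_law (1 - \<rho>)
     else if i = j then exponential_law \<rho>
     else exponential_law 1)"

definition pp_env :: "real \<Rightarrow> (int \<times> int \<Rightarrow> real) measure" where
  "pp_env \<rho> = PiM half_space (pp_weight_law \<rho>)"

definition st_env :: "real \<Rightarrow> (int \<times> int \<Rightarrow> real) measure" where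
  "st_env \<rho> = PiM half_space (st_weight_law \<rho>)"

section \<open>Scaling\<close>

definition rho :: "real \<Rightarrow> nat \<Rightarrow> real" where
  "rho \<delta> N = 1 / 2 + \<delta> * 2 powr (- 4 / 3) * real N powr (- 1 / 3)"

definition Q :: "nat \<Rightarrow> real \<Rightarrow> real \<times> real" where
  "Q N u = (real N + u * (2 * real N) powr (2 / 3), real N - u * (2 * real N) powr (2 / 3))"

definition scaled_lpp_process :: "nat \<Rightarrow> real \<Rightarrow> (int \<times> int \<Rightarrow> real) \<Rightarrow> real" where
  "scaled_lpp_process N u \<omega> =
     (lpp \<omega> (Q N u) - 4 * real N) / (2 powr (4 / 3) * real N powr (1 / 3))"

definition scaled_lpp_time :: "nat \<Rightarrow> real \<Rightarrow> (int \<times> int \<Rightarrow> real) \<Rightarrow> real" where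
  "scaled_lpp_time N \<tau> \<omega> =
     (lpp \<omega> (\<tau> * real N, \<tau> * real N) - 4 * \<tau> * real N)
       / (2 powr (4 / 3) * real N powr (1 / 3))"

section \<open>Limit processes\<close>

text \<open>Convergence in distribution of the random vectors \<open>(X N u)\<^sub>u\<^sub>\<in>\<^sub>I\<close> for every finite set \<open>I\<close> of
  nonnegative times, tested against bounded continuous functions on \<open>\<real>\<^sup>I\<close>. The processes
  may live on different probability spaces.\<close>

definition fdd_convergence ::
  "(nat \<Rightarrow> 'e measure) \<Rightarrow> (nat \<Rightarrow> real \<Rightarrow> 'e \<Rightarrow> real) \<Rightarrow> 'a measure \<Rightarrow> (real \<Rightarrow> 'a \<Rightarrow> real) \<Rightarrow> bool"
where
  "fdd_convergence E X M Y \<longleftrightarrow>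
     (\<forall>I f. finite I \<and> I \<subseteq> {0..} \<and>
        continuous_map (product_topology (\<lambda>_. euclideanreal) I) euclideanreal f \<and>
        bounded (f ` (\<Pi>\<^sub>E u\<in>I. UNIV)) \<longrightarrow>
        (\<lambda>N. \<integral>\<omega>. f (\<lambda>u\<in>I. X N u \<omega>) \<partial>E N) \<longlonglongrightarrow> (\<integral>x. f (\<lambda>u\<in>I. Y u x) \<partial>M))"

text \<open>The limit processes are determined in law only: each of the following predicates says that
  \<open>A\<close>, defined on the probability space \<open>M\<close>, is a version of the process in question.\<close>

definition is_A_pp :: "real \<Rightarrow> 'a measure \<Rightarrow> (real \<Rightarrow> 'a \<Rightarrow> real) \<Rightarrow> bool" where
  "is_A_pp \<delta> M A \<longleftrightarrow> prob_space M \<and> (\<forall>u\<ge>0. A u \<in> borel_measurable M) \<and>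
     fdd_convergence (\<lambda>N. pp_env (rho \<delta> N)) scaled_lpp_process M (\<lambda>u x. A u x - u\<^sup>2)"

definition is_A_st_hs :: "real \<Rightarrow> 'a measure \<Rightarrow> (real \<Rightarrow> 'a \<Rightarrow> real) \<Rightarrow> bool" where
  "is_A_st_hs \<delta> M A \<longleftrightarrow> prob_space M \<and> (\<forall>u\<ge>0. A u \<in> borel_measurable M) \<and>
     fdd_convergence (\<lambda>N. st_env (rho \<delta> N)) scaled_lpp_process M A"

definition covariance :: "'a measure \<Rightarrow> ('a \<Rightarrow> real) \<Rightarrow> ('a \<Rightarrow> real) \<Rightarrow> real" where
  "covariance M X Y =
     (\<integral>x. (X x - (\<integral>y. X y \<partial>M)) * (Y x - (\<integral>y. Y y \<partial>M)) \<partial>M)"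

end

theory Submission
  imports Defs "HOL-Real_Asymp.Real_Asymp"
begin

text \<open>All models are functions of one family \<open>e\<close> of independent \<open>exp(1)\<close> variables. Let \<open>X\<close> and \<open>Y\<close> be
  the two scaled times and \<open>U = X - Y\<close>. Since \<open>Cov(X, Y) = (Var X + Var Y - Var U) / 2\<close>, it suffices to
  compare \<open>U\<close> with the increment \<open>V\<close> of the stationary model with the same bulk and diagonal weights.
  By Burke's theorem \<open>V\<close> has the law of a stationary passage time of size \<open>(1 - \<tau>) N\<close>. Attractiveness
  gives \<open>U \<le> V\<close>. The mean of \<open>V - U\<close> is \<open>O(1 - \<tau>)\<close>, because the mean of \<open>V\<close> is explicit and the mean
  of the limit \<open>A\<^sub>p\<^sub>p(0)\<close> is convex in \<open>\<delta>\<close>. As \<open>U\<close> and \<open>V\<close> have fourth moments of order \<open>1 - \<tau>\<close> at most, this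
  gives \<open>Var V - Var U = O(1 - \<tau>)\<close>.

  The mixed moment of \<open>X\<close> and \<open>Y\<close> converges, because \<open>X\<close> is close in \<open>L\<^sup>1\<close> to a maximum, over finitely many
  points of a cut through \<open>(\<tau> N, \<tau> N)\<close>, of sums of two independent point-to-point times, and the
  finite-dimensional distributions of both summands converge. The errors are controlled by partial
  sums of the stationary increments, which dominate those of the point-to-point model and are
  independent along down-right paths. Fourth moments are bounded from above by an explicit
  moment generating function and from below by superadditivity, starting from tightness.\<close>

section \<open>Independent exponential variables\<close>

text \<open>The hypotheses give convergence of finite-dimensional laws only: no moments, no tails,
  and no joint law of the times at (N, N) and (\<tau> N, \<tau> N). These gaps shape the proof.
  Moments of the limits are reached through fourth moments before the limit, bounded uniformly in N.
  The joint law is avoided except for one mixed moment, of which only the existence of a limit is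
  needed. The error is governed by a sandwich L \<le> U \<le> V, where L is the point-to-point time
  of the environment shifted beyond (\<tau> N, \<tau> N). L and V fluctuate on the scale (1 -
  \<tau>)^(1/3), so their fourth moments are at most of order (1 - \<tau>)^(4/3), and nothing has to
  be known about where maximizing paths run. What remains is a one-sided estimate on means. It would
  follow from differentiability of the mean of the limit in \<delta>; convexity, which passes to the
  limit, replaces this. All comparisons are between different parameters in the same environment,
  which is why one family of variables carries every model.\<close>

definition expo :: "real measure" where
  "expo = exponential_law 1"

definition env :: "(nat \<times> nat => real) measure" where
  "env = PiM UNIV (\<lambda>_. expo)"

lemma sets_expo [simp, measurable_cong]: "sets expo = sets borel"
  by (simp add: expo_def exponential_law_def)

lemma space_expo [simp]: "space expo = UNIV" by (simp add: expo_def exponential_law_def)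

lemma prob_space_expo: "prob_space expo"
  unfolding expo_def exponential_law_def by (rule prob_space_exponential_density) simp

lemma space_env [simp]: "space env = UNIV" by (simp add: env_def space_PiM)

lemma sets_env [measurable_cong]: "sets env = sets (PiM UNIV (\<lambda>_. borel))"
  unfolding env_def by (intro sets_PiM_cong) auto

lemma measurable_env_component: "(\<lambda>e. e p) \<in> borel_measurable env"
  by (simp add: measurable_cong_sets[OF sets_env refl])

interpretation expo: prob_space expo by (rule prob_space_expo)

lemma prob_space_env: "prob_space env"
  unfolding env_def by (intro prob_space_PiM prob_space_expo)

interpretation env: prob_space env by (rule prob_space_env)

abbreviation env_mean :: "((nat \<times> nat => real) => real) => real" (binder "\<bbbE>" 10) where
  "env_mean f \<equiv> integral\<^sup>L env f"

abbreviation env_nn_mean :: "((nat \<times> nat => real) => ennreal) => ennreal" (binder "\<bbbE>\<^sup>+" 10) where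
  "env_nn_mean f \<equiv> integral\<^sup>N env f"

abbreviation ev :: "(nat => bool) => bool" where
  "ev P \<equiv> eventually P sequentially"

lemma integral_env_close:
  assumes "integrable env f" "integrable env g" and h: "integrable env h" "\<And>e. \<bar>f e - g e\<bar> \<le> h e"
  shows "\<bar>(\<bbbE> e. f e) - (\<bbbE> e. g e)\<bar> \<le> (\<bbbE> e. h e)"
proof -
  have "\<bar>(\<bbbE> e. f e) - (\<bbbE> e. g e)\<bar> = \<bar>\<bbbE> e. f e - g e\<bar>" using assms by simp
  also have "\<dots> \<le> (\<bbbE> e. \<bar>f e - g e\<bar>)" by (rule integral_abs_bound)
  also have "\<dots> \<le> (\<bbbE> e. h e)" using assms by (intro integral_mono) auto
  finally show ?thesis .
qed

lemma measurable_into_env: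
  assumes "\<And>p. (\<lambda>x. f x p) \<in> borel_measurable M"
  shows "f \<in> measurable M env"
proof -
  have "(\<lambda>x. \<lambda>p\<in>UNIV. f x p) \<in> measurable M (PiM UNIV (\<lambda>_. borel))"
    by (rule measurable_restrict) (use assms in auto)
  then have "f \<in> measurable M (PiM UNIV (\<lambda>_. borel))" by (simp add: restrict_def)
  then show ?thesis by (subst measurable_cong_sets[OF refl sets_env])
qed

lemma measurable_env_update [measurable]:
  "(\<lambda>(x, e). e(p := x)) \<in> measurable (expo \<Otimes>\<^sub>M env) env"
  by (rule measurable_into_env) (auto simp: case_prod_beta')

lemma distr_env_update: "distr (expo \<Otimes>\<^sub>M env) env (\<lambda>(x, e). e(p := x)) = env"
  using distr_pair_PiM_eq_PiM[of UNIV "\<lambda>_. expo" p] prob_space_expo unfolding env_def by simp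

lemma measurable_env_update2 [measurable]:
  "f \<in> borel_measurable M ==> g \<in> measurable M env ==> (\<lambda>x. (g x)(p := f x)) \<in> measurable M env"
proof (rule measurable_into_env)
  fix q
  assume "f \<in> borel_measurable M" "g \<in> measurable M env"
  then show "(\<lambda>x. ((g x)(p := f x)) q) \<in> borel_measurable M"
    using measurable_compose[OF _ measurable_env_component, of g M q] by (cases "q = p") auto
qed

lemma nn_integral_env_update:
  assumes [measurable]: "F \<in> borel_measurable env"
  shows "(\<bbbE>\<^sup>+ e. F e) = (\<bbbE>\<^sup>+ e. \<integral>\<^sup>+x. F (e(p := x)) \<partial>expo)"
proof -
  interpret P: pair_sigma_finite expo env ..
  have "(\<bbbE>\<^sup>+ e. F e) = (\<integral>\<^sup>+z. F ((snd z)(p := fst z)) \<partial>(expo \<Otimes>\<^sub>M env))"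
    by (subst distr_env_update[symmetric, of p], subst nn_integral_distr)
      (auto simp: case_prod_beta')
  also have "\<dots> = (\<bbbE>\<^sup>+ e. \<integral>\<^sup>+x. F (e(p := x)) \<partial>expo)"
    by (subst P.nn_integral_snd[symmetric]) auto
  finally show ?thesis .
qed

lemma distr_env_reindex:
  assumes "inj \<sigma>"
  shows "distr env env (\<lambda>e p. e (\<sigma> p)) = env"
proof -
  have "distr env env (\<lambda>e p. e (\<sigma> p)) = distr (PiM UNIV (\<lambda>_. expo)) (PiM UNIV (\<lambda>_. expo)) (\<lambda>\<omega>. \<lambda>n\<in>UNIV. \<omega> (\<sigma> n))"
    by (simp add: env_def restrict_def)
  also have "\<dots> = env" using assms unfolding env_def by (intro distr_PiM_reindex prob_space_expo) auto
  finally show ?thesis .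
qed

lemma measurable_env_reindex: "(\<lambda>e p. e (\<sigma> p)) \<in> measurable env env"
  by (rule measurable_into_env) auto

section \<open>Splicing two environments, and independence of disjoint coordinates\<close>

definition splice :: "(nat \<times> nat) set => (nat \<times> nat => real) => (nat \<times> nat => real) => nat \<times> nat => real" where
  "splice A e e' = (\<lambda>p. if p \<in> A then e p else e' p)"

lemma measurable_splice [measurable]:
  "(\<lambda>z. splice A (fst z) (snd z)) \<in> measurable (env \<Otimes>\<^sub>M env) env"
  by (rule measurable_into_env) (auto simp: splice_def)

text \<open>Independence of disjoint families of coordinates takes this form: functions of the
  coordinates inside and outside \<open>A\<close> turn into functions of two independent
  environments. Both laws agree on cylinders, whose bases split along \<open>A\<close>.\<close>

lemma distr_env_splice: "distr (env \<Otimes>\<^sub>M env) env (\<lambda>z. splice A (fst z) (snd z)) = env"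
  unfolding env_def
proof (rule measure_eqI_PiM_infinite[symmetric, OF refl])
  have env: "PiM UNIV (\<lambda>_. expo) = env" by (simp add: env_def)
  show "finite_measure (PiM UNIV (\<lambda>_. expo) :: (nat \<times> nat => real) measure)"
    unfolding env by standard simp
  fix J :: "(nat \<times> nat) set" and B assume J: "finite J" and B: "\<And>i. i \<in> J ==> B i \<in> sets expo"
  let ?X = "prod_emb UNIV (\<lambda>_. expo) J (Pi\<^sub>E J B)"
  have X: "?X = {e. \<forall>i\<in>J. e i \<in> B i}" by (auto simp: prod_emb_def PiE_iff)
  have emb: "emeasure env {e. \<forall>i\<in>K. e i \<in> B i} = (\<Prod>i\<in>K. emeasure expo (B i))" if "K \<subseteq> J" for K
  proof -
    have "{e. \<forall>i\<in>K. e i \<in> B i} = prod_emb UNIV (\<lambda>_. expo) K (Pi\<^sub>E K B)"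
      by (auto simp: prod_emb_def PiE_iff)
    then show ?thesis using that J B unfolding env_def
      by (auto intro!: emeasure_PiM_emb prob_space_expo intro: finite_subset)
  qed
  have mX: "?X \<in> sets env" unfolding env_def using J B by (intro sets_PiM_I) auto
  have m: "{e. \<forall>i\<in>K. e i \<in> B i} \<in> sets env" if "K \<subseteq> J" for K
  proof -
    have "{e. \<forall>i\<in>K. e i \<in> B i} = prod_emb UNIV (\<lambda>_. expo) K (Pi\<^sub>E K B)"
      by (auto simp: prod_emb_def PiE_iff)
    then show ?thesis using that J B unfolding env_def by (auto intro!: sets_PiM_I intro: finite_subset)
  qed
  have vim: "(\<lambda>z. splice A (fst z) (snd z)) -` ?X \<inter> space (env \<Otimes>\<^sub>M env)
      = {e. \<forall>i\<in>J \<inter> A. e i \<in> B i} \<times> {e. \<forall>i\<in>J - A. e i \<in> B i}" (is "?l = ?r")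
  proof (rule set_eqI)
    fix z :: "(nat \<times> nat => real) \<times> (nat \<times> nat => real)"
    have "z \<in> ?l \<longleftrightarrow> (\<forall>i\<in>J. (if i \<in> A then fst z i else snd z i) \<in> B i)"
      by (simp add: X splice_def space_pair_measure)
    also have "\<dots> \<longleftrightarrow> (\<forall>i\<in>J \<inter> A. fst z i \<in> B i) \<and> (\<forall>i\<in>J - A. snd z i \<in> B i)"
      by (metis DiffE DiffI IntE IntI)
    also have "\<dots> \<longleftrightarrow> z \<in> ?r" by (cases z) simp
    finally show "z \<in> ?l \<longleftrightarrow> z \<in> ?r" .
  qed
  have "emeasure (distr (env \<Otimes>\<^sub>M env) env (\<lambda>z. splice A (fst z) (snd z))) ?X
      = emeasure (env \<Otimes>\<^sub>M env) ({e. \<forall>i\<in>J \<inter> A. e i \<in> B i} \<times> {e. \<forall>i\<in>J - A. e i \<in> B i})"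
    unfolding vim[symmetric] by (rule emeasure_distr[OF measurable_splice mX])
  also have "\<dots> = (\<Prod>i\<in>J \<inter> A. emeasure expo (B i)) * (\<Prod>i\<in>J - A. emeasure expo (B i))"
    by (subst env.emeasure_pair_measure_Times[OF m m]) (simp_all only: emb Int_lower1 Diff_subset)
  also have "\<dots> = (\<Prod>i\<in>J. emeasure expo (B i))"
    using J by (subst prod.union_disjoint[symmetric]) (auto intro!: prod.cong)
  also have "\<dots> = emeasure env ?X" using emb[of J] X by simp
  finally show "emeasure (PiM UNIV (\<lambda>_. expo)) ?X = emeasure (distr (PiM UNIV (\<lambda>_. expo) \<Otimes>\<^sub>M PiM UNIV (\<lambda>_. expo))
     (PiM UNIV (\<lambda>_. expo)) (\<lambda>z. splice A (fst z) (snd z))) ?X" by (simp add: env)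
qed simp

definition depends_on :: "(nat \<times> nat) set => ((nat \<times> nat => real) => 'c) => bool" where
  "depends_on A F \<longleftrightarrow> (\<forall>e e'. (\<forall>p\<in>A. e p = e' p) \<longrightarrow> F e = F e')"

lemma integral_env_splice:
  fixes F :: "(nat \<times> nat => real) => real"
  assumes [measurable]: "F \<in> borel_measurable env"
  shows "(\<bbbE> e. F e) = (\<integral>z. F (splice A (fst z) (snd z)) \<partial>(env \<Otimes>\<^sub>M env))"
  using integral_distr[OF measurable_splice assms, of A] by (simp only: distr_env_splice)

text \<open>After splicing along \<open>A\<close> the first factor sees only the first environment
  and the second factor only the second one, so Fubini applies.\<close>

lemma integral_env_mult:
  fixes F G :: "(nat \<times> nat => real) => real"
  assumes "depends_on A F" "depends_on B G" "A \<inter> B = {}"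
    and [measurable]: "F \<in> borel_measurable env" "G \<in> borel_measurable env"
    and "integrable env F" "integrable env G"
  shows "integrable env (\<lambda>e. F e * G e)"
    and "(\<bbbE> e. F e * G e) = (\<bbbE> e. F e) * (\<bbbE> e. G e)"
proof -
  interpret P: pair_sigma_finite env env ..
  have sp: "F (splice A e e') * G (splice A e e') = F e * G e'" for e e'
  proof -
    have "F (splice A e e') = F e" using assms(1) by (auto simp: depends_on_def splice_def)
    moreover have "G (splice A e e') = G e'"
      using assms(2,3) unfolding depends_on_def by (metis disjoint_iff splice_def)
    ultimately show ?thesis by simp
  qed
  have int: "integrable (env \<Otimes>\<^sub>M env) (\<lambda>z. F (fst z) * G (snd z))"
    using assms(6,7) by (intro P.Fubini_integrable) (auto simp: abs_mult)
  have m: "(\<lambda>e. F e * G e) \<in> borel_measurable env" by measurable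
  show "integrable env (\<lambda>e. F e * G e)" using integrable_distr_eq[OF measurable_splice m, of A] int
    by (simp only: distr_env_splice sp)
  have "(\<bbbE> e. F e * G e) = (\<integral>z. F (fst z) * G (snd z) \<partial>(env \<Otimes>\<^sub>M env))"
    using integral_env_splice[OF m, of A] by (simp only: sp)
  also have "\<dots> = (\<bbbE> e. (\<bbbE> e'. F e * G e'))" using int by (subst P.integral_fst'[symmetric]) auto
  finally show "(\<bbbE> e. F e * G e) = (\<bbbE> e. F e) * (\<bbbE> e. G e)" by simp
qed

lemma AE_expo_nonneg: "AE x in expo. 0 \<le> x"
  unfolding expo_def exponential_law_def by (subst AE_density) (auto simp: exponential_density_def)

lemma AE_env_nonneg: "AE e in env. \<forall>p. 0 \<le> e p"
  unfolding AE_all_countable env_def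
  by (intro allI AE_PiM_component[where P="\<lambda>x. 0 \<le> x"] prob_space_expo AE_expo_nonneg) auto

lemma nn_integral_expo:
  "f \<in> borel_measurable borel ==>
    (\<integral>\<^sup>+x. f x \<partial>expo) = (\<integral>\<^sup>+x. ennreal (exp (- x)) * indicator {0..} x * f x \<partial>lborel)"
  unfolding expo_def exponential_law_def by (subst nn_integral_density)
    (auto simp: exponential_density_def intro!: nn_integral_cong split: split_indicator)

section \<open>The last passage recursion\<close>

text \<open>The weights are read off the environment \<open>e\<close>: diagonal entries are multiplied by \<open>\<alpha>\<close> (which is
  \<open>1 / \<rho>\<close> below) and entries of row \<open>0\<close> by \<open>\<beta>\<close> (\<open>1 / (1 - \<rho>)\<close> in the stationary and \<open>0\<close> in the
  point-to-point model). The values with \<open>i < j\<close> have no meaning.\<close>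

fun G :: "real => real => (nat \<times> nat => real) => nat => nat => real" where
  "G \<alpha> \<beta> e 0 j = 0"
| "G \<alpha> \<beta> e (Suc i) 0 = G \<alpha> \<beta> e i 0 + \<beta> * e (Suc i, 0)"
| "G \<alpha> \<beta> e (Suc i) (Suc j) =
    (if j < i then e (Suc i, Suc j) + max (G \<alpha> \<beta> e i (Suc j)) (G \<alpha> \<beta> e (Suc i) j)
     else \<alpha> * e (Suc i, Suc j) + G \<alpha> \<beta> e (Suc i) j)"

definition weight :: "real => (nat \<times> nat => real) => nat => nat => real" where
  "weight \<alpha> e i j = (if j < i then e (i, j) else \<alpha> * e (i, j))"

definition nonneg :: "(nat \<times> nat => real) => bool" where
  "nonneg e \<longleftrightarrow> (\<forall>p. 0 \<le> e p)"

lemma AE_env_pos: "AE e in env. nonneg e"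
  using AE_env_nonneg by (simp add: nonneg_def)

lemma weight_nonneg: "nonneg e ==> 0 \<le> \<alpha> ==> 0 \<le> weight \<alpha> e i j"
  by (simp add: weight_def nonneg_def)

lemma G_row0: "G \<alpha> \<beta> e i 0 = \<beta> * (\<Sum>k=1..i. e (k, 0))"
  by (induction i) (auto simp: algebra_simps)

lemma G_pp_row0 [simp]: "G \<alpha> 0 e i 0 = 0" by (simp add: G_row0)

lemma G_step_right: "1 \<le> j ==> j \<le> i ==> G \<alpha> \<beta> e i j + weight \<alpha> e (Suc i) j \<le> G \<alpha> \<beta> e (Suc i) j"
  by (cases j) (auto simp: weight_def)

lemma G_step_up: "Suc j \<le> i ==> G \<alpha> \<beta> e i j + weight \<alpha> e i (Suc j) \<le> G \<alpha> \<beta> e i (Suc j)"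
  by (cases i) (auto simp: weight_def)

lemma G_mono_right:
  assumes "nonneg e" "0 \<le> \<alpha>" "0 \<le> \<beta>" "j \<le> i"
  shows "G \<alpha> \<beta> e i j \<le> G \<alpha> \<beta> e (Suc i) j"
proof (cases j)
  case 0
  then show ?thesis using assms by (simp add: nonneg_def)
next
  case (Suc k)
  then show ?thesis using G_step_right[of j i \<alpha> \<beta> e] weight_nonneg[of e \<alpha> "Suc i" j] assms by simp
qed

lemma G_mono_up:
  assumes "nonneg e" "0 \<le> \<alpha>" "Suc j \<le> i"
  shows "G \<alpha> \<beta> e i j \<le> G \<alpha> \<beta> e i (Suc j)"
  using G_step_up[of j i \<alpha> \<beta> e] weight_nonneg[of e \<alpha> i "Suc j"] assms by simp

lemma G_mono_right':
  assumes "nonneg e" "0 \<le> \<alpha>" "0 \<le> \<beta>" "j \<le> i" "i \<le> i'"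
  shows "G \<alpha> \<beta> e i j \<le> G \<alpha> \<beta> e i' j"
  using assms(5)
proof (induction i' rule: dec_induct)
  case (step n)
  then show ?case using G_mono_right[of e \<alpha> \<beta> j n] assms by simp
qed simp

lemma G_mono_up':
  assumes "nonneg e" "0 \<le> \<alpha>" "j \<le> j'" "j' \<le> i"
  shows "G \<alpha> \<beta> e i j \<le> G \<alpha> \<beta> e i j'"
  using assms(3,4)
proof (induction j' rule: dec_induct)
  case (step n)
  then show ?case using G_mono_up[of e \<alpha> n i \<beta>] assms by simp
qed simp

lemma G_nonneg:
  assumes "nonneg e" "0 \<le> \<alpha>" "0 \<le> \<beta>" "j \<le> i"
  shows "0 \<le> G \<alpha> \<beta> e i j"
proof -
  have "0 \<le> G \<alpha> \<beta> e i 0" using assms by (simp add: G_row0 nonneg_def sum_nonneg)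
  also have "\<dots> \<le> G \<alpha> \<beta> e i j" using assms by (intro G_mono_up') auto
  finally show ?thesis .
qed

section \<open>Increments and attractiveness\<close>

definition Inc :: "real => real => (nat \<times> nat => real) => nat => nat => real" where
  "Inc \<alpha> \<beta> e i j = G \<alpha> \<beta> e i j - G \<alpha> \<beta> e (i - 1) j"

definition Jnc :: "real => real => (nat \<times> nat => real) => nat => nat => real" where
  "Jnc \<alpha> \<beta> e i j = G \<alpha> \<beta> e i j - G \<alpha> \<beta> e i (j - 1)"

lemma Inc_row0: "Inc \<alpha> \<beta> e (Suc i) 0 = \<beta> * e (Suc i, 0)" by (simp add: Inc_def)

lemma Jnc_diag: "Jnc \<alpha> \<beta> e (Suc i) (Suc i) = \<alpha> * e (Suc i, Suc i)"
  by (simp add: Jnc_def)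

lemma Inc_rec:
  "j < i ==> Inc \<alpha> \<beta> e (Suc i) (Suc j) =
    e (Suc i, Suc j) + max 0 (Inc \<alpha> \<beta> e (Suc i) j - Jnc \<alpha> \<beta> e i (Suc j))"
  by (auto simp: Inc_def Jnc_def max_def)

lemma Jnc_rec:
  "j < i ==> Jnc \<alpha> \<beta> e (Suc i) (Suc j) =
    e (Suc i, Suc j) + max 0 (Jnc \<alpha> \<beta> e i (Suc j) - Inc \<alpha> \<beta> e (Suc i) j)"
  by (auto simp: Inc_def Jnc_def max_def)

text \<open>By \<open>Inc_rec\<close> and \<open>Jnc_rec\<close>, the horizontal increment out of a
  vertex increases with the incoming horizontal and decreases with the incoming vertical one, and
  conversely for the vertical increment. The order therefore propagates from row 0, where it comes
  from the boundary multipliers, and from the diagonal, where the vertical increments coincide. Each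
  claim feeds the other, hence the joint induction.\<close>

lemma increments_compare:
  assumes "nonneg e" "\<beta> \<le> \<beta>'"
  shows "(j < i \<longrightarrow> Inc \<alpha> \<beta> e i j \<le> Inc \<alpha> \<beta>' e i j) \<and>
    (1 \<le> j \<and> j \<le> i \<longrightarrow> Jnc \<alpha> \<beta>' e i j \<le> Jnc \<alpha> \<beta> e i j)"
proof (induction j arbitrary: i)
  case 0
  show ?case using assms by (cases i) (auto simp: Inc_row0 nonneg_def mult_right_mono)
next
  case (Suc j)
  note IHj = Suc.IH
  show ?case
  proof (induction i)
    case 0
    show ?case by simp
  next
    case (Suc i)
    consider "i < j" | "i = j" | "j < i" by linarith
    then show ?case
    proof cases
      case 3
      have "Inc \<alpha> \<beta> e (Suc i) j \<le> Inc \<alpha> \<beta>' e (Suc i) j" using IHj[of "Suc i"] 3 by simp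
      moreover have "Jnc \<alpha> \<beta>' e i (Suc j) \<le> Jnc \<alpha> \<beta> e i (Suc j)" using Suc 3 by simp
      ultimately show ?thesis using 3 by (simp add: Inc_rec Jnc_rec max_def)
    qed (auto simp: Jnc_diag)
  qed
qed

lemma Inc_compare: "nonneg e ==> \<beta> \<le> \<beta>' ==> j < i ==> Inc \<alpha> \<beta> e i j \<le> Inc \<alpha> \<beta>' e i j"
  using increments_compare by blast

lemma Jnc_compare:
  "nonneg e ==> \<beta> \<le> \<beta>' ==> 1 \<le> j ==> j \<le> i ==> Jnc \<alpha> \<beta>' e i j \<le> Jnc \<alpha> \<beta> e i j"
  using increments_compare by blast

lemma G_sum_Inc: "i \<le> i' ==> G \<alpha> \<beta> e i' j = G \<alpha> \<beta> e i j + (\<Sum>k\<in>{i<..i'}. Inc \<alpha> \<beta> e k j)"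
proof (induction i' rule: dec_induct)
  case (step n)
  have "{i<..Suc n} = insert (Suc n) {i<..n}" using step by auto
  then show ?case using step by (simp add: Inc_def)
qed simp

lemma G_sum_Jnc: "j \<le> j' ==> G \<alpha> \<beta> e i j' = G \<alpha> \<beta> e i j + (\<Sum>k\<in>{j<..j'}. Jnc \<alpha> \<beta> e i k)"
proof (induction j' rule: dec_induct)
  case (step n)
  have "{j<..Suc n} = insert (Suc n) {j<..n}" using step by auto
  then show ?case using step by (simp add: Jnc_def)
qed simp

text \<open>The induction principle that follows the recursion for \<open>G\<close> on the triangle:
  boundary row, diagonal point reached from below, interior point reached from the left and from
  below.\<close>

lemma shifted_induct [consumes 1, case_names row diag step]:
  fixes P :: "nat => nat => bool"
  assumes "j \<le> i" and "\<And>i. P i 0" and "\<And>i. P (Suc i) i ==> P (Suc i) (Suc i)"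
    and "\<And>i j. j < i ==> P i (Suc j) ==> P (Suc i) j ==> P (Suc i) (Suc j)"
  shows "P i j"
  using assms(1)
proof (induction j arbitrary: i)
  case (Suc j)
  note IHj = Suc.IH
  from Suc.prems show ?case
  proof (induction i)
    case (Suc i)
    then show ?case using assms(3)[of i] assms(4)[of j i] IHj[of "Suc i"] by (cases "i = j") auto
  qed simp
qed (rule assms)

text \<open>On row n the claim is a sum of increment comparisons. Above it the recursion adds the
  same weights in both models and commutes with subtracting a constant, so the inequality
  persists.\<close>

lemma G_attractive:
  assumes "nonneg e" "\<beta> \<le> \<beta>'" "j \<le> i"
  shows "G \<alpha> \<beta> e (n + i) (n + j) - G \<alpha> \<beta> e n n \<le> G \<alpha> \<beta>' e (n + i) (n + j) - G \<alpha> \<beta>' e n n"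
  using assms(3)
proof (induction i j rule: shifted_induct)
  case (row i)
  show ?case using assms by (subst (1 2) G_sum_Inc[of n "n + i"]) (auto intro!: sum_mono Inc_compare)
qed (use assms in auto)

section \<open>Restarting at a diagonal point\<close>

definition shift :: "nat => (nat \<times> nat => real) => nat \<times> nat => real" where
  "shift n e = (\<lambda>p. e (n + fst p, n + snd p))"

lemma shift_apply [simp]: "shift n e (i, j) = e (n + i, n + j)" by (simp add: shift_def)

lemma nonneg_shift: "nonneg e ==> nonneg (shift n e)"
  by (simp add: nonneg_def shift_def)

text \<open>With zero boundary row the shifted time is the best continuation from (n, n): its free
  motion along row 0 corresponds to motion along row n, where \<open>G\<close> does not
  decrease.\<close>

lemma G_superadditive:
  assumes "nonneg e" "0 \<le> \<alpha>" "j \<le> i"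
  shows "G \<alpha> 0 e n n + G \<alpha> 0 (shift n e) i j \<le> G \<alpha> 0 e (n + i) (n + j)"
  using assms(3)
proof (induction i j rule: shifted_induct)
  case (row i)
  show ?case using assms G_mono_right'[of e \<alpha> 0 n n "n + i"] by simp
qed auto

text \<open>Beyond (n, n) the past enters only through the horizontal increments along row n, which
  act as the boundary row of a restarted model. The range is limited to \<open>m\<close> because the
  environment to which this is applied carries these increments only that far.\<close>

lemma G_shift:
  assumes "j \<le> i" "\<And>i j. 1 \<le> j ==> j \<le> i ==> e' (i, j) = e (n + i, n + j)"
    and "\<And>i. 1 \<le> i ==> i \<le> m ==> \<beta> * e' (i, 0) = Inc \<alpha> \<beta> e (n + i) n"
    and "i \<le> m"
  shows "G \<alpha> \<beta> e (n + i) (n + j) = G \<alpha> \<beta> e n n + G \<alpha> \<beta> e' i j"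
  using assms(1,4)
proof (induction i j rule: shifted_induct)
  case (row i)
  then show ?case
  proof (induction i)
    case (Suc i)
    then show ?case using assms(3)[of "Suc i"] by (simp add: Inc_def)
  qed simp
next
  case (diag i)
  then show ?case using assms(2) by simp
next
  case (step i j)
  then show ?case using assms(2) by simp
qed

section \<open>Dependence on the parameters\<close>

lemma G_mono_params:
  assumes "nonneg e" "\<alpha> \<le> \<alpha>'" "\<beta> \<le> \<beta>'" "j \<le> i"
  shows "G \<alpha> \<beta> e i j \<le> G \<alpha>' \<beta>' e i j"
  using assms(4)
proof (induction i j rule: shifted_induct)
  case (row i)
  show ?case using assms by (auto simp: G_row0 nonneg_def intro!: mult_right_mono sum_nonneg)
next
  case (diag i)
  have "\<alpha> * e (Suc i, Suc i) \<le> \<alpha>' * e (Suc i, Suc i)"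
    using assms by (simp add: nonneg_def mult_right_mono)
  then show ?case using diag by simp
qed auto

text \<open>Every path value is affine in the diagonal multiplier, and a maximum of affine functions
  is convex; the induction carries this through the recursion.\<close>

lemma G_convex:
  assumes "0 \<le> t" "t \<le> 1" "j \<le> i"
  shows "G ((1 - t) * \<alpha> + t * \<alpha>') 0 e i j \<le> (1 - t) * G \<alpha> 0 e i j + t * G \<alpha>' 0 e i j"
  using assms(3)
proof (induction i j rule: shifted_induct)
  case (step i j)
  let ?A = "max (G \<alpha> 0 e i (Suc j)) (G \<alpha> 0 e (Suc i) j)"
  let ?B = "max (G \<alpha>' 0 e i (Suc j)) (G \<alpha>' 0 e (Suc i) j)"
  have "(1 - t) * G \<alpha> 0 e i (Suc j) + t * G \<alpha>' 0 e i (Suc j) \<le> (1 - t) * ?A + t * ?B"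
    using assms by (intro add_mono mult_left_mono) auto
  moreover have "(1 - t) * G \<alpha> 0 e (Suc i) j + t * G \<alpha>' 0 e (Suc i) j \<le> (1 - t) * ?A + t * ?B"
    using assms by (intro add_mono mult_left_mono) auto
  ultimately have "max (G ((1 - t) * \<alpha> + t * \<alpha>') 0 e i (Suc j)) (G ((1 - t) * \<alpha> + t * \<alpha>') 0 e (Suc i) j)
      \<le> (1 - t) * ?A + t * ?B" using step(2,3) by (intro max.boundedI) (auto intro: order_trans)
  moreover have "(1 - t) * (e (Suc i, Suc j) + ?A) + t * (e (Suc i, Suc j) + ?B)
      = e (Suc i, Suc j) + ((1 - t) * ?A + t * ?B)" by (simp only: algebra_simps)
  ultimately show ?case using step(1) by (simp only: G.simps if_True)
qed (auto simp: algebra_simps)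

lemma G_lipschitz:
  assumes "nonneg e" "j \<le> i"
  shows "\<bar>G \<alpha> \<beta> e i j - G \<alpha>' \<beta>' e i j\<bar>
    \<le> \<bar>\<alpha> - \<alpha>'\<bar> * (\<Sum>k=1..j. e (k, k)) + \<bar>\<beta> - \<beta>'\<bar> * (\<Sum>k=1..i. e (k, 0))"
  using assms(2)
proof (induction i j rule: shifted_induct)
  case (row i)
  have "0 \<le> (\<Sum>k=1..i. e (k, 0))" using assms by (simp add: nonneg_def sum_nonneg)
  then show ?case by (simp add: G_row0 left_diff_distrib[symmetric] abs_mult)
next
  case (diag i)
  have "\<bar>\<alpha> * e (Suc i, Suc i) - \<alpha>' * e (Suc i, Suc i)\<bar> = \<bar>\<alpha> - \<alpha>'\<bar> * e (Suc i, Suc i)"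
    using assms by (simp add: nonneg_def left_diff_distrib[symmetric] abs_mult)
  then have "\<bar>(\<alpha> * e (Suc i, Suc i) + G \<alpha> \<beta> e (Suc i) i) - (\<alpha>' * e (Suc i, Suc i) + G \<alpha>' \<beta>' e (Suc i) i)\<bar>
      \<le> \<bar>\<alpha> - \<alpha>'\<bar> * e (Suc i, Suc i) + \<bar>G \<alpha> \<beta> e (Suc i) i - G \<alpha>' \<beta>' e (Suc i) i\<bar>"
    by linarith
  then show ?case using diag by (simp add: algebra_simps)
next
  case (step i j)
  have nn: "0 \<le> \<bar>\<alpha> - \<alpha>'\<bar> * e (Suc j, Suc j)" "0 \<le> \<bar>\<beta> - \<beta>'\<bar> * e (Suc i, 0)"
    using assms by (simp_all add: nonneg_def)
  have mx: "\<bar>max a b - max a' b'\<bar> \<le> c" if "\<bar>a - a'\<bar> \<le> c" "\<bar>b - b'\<bar> \<le> c" for a b a' b' c :: real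
    using that by (auto simp: max_def)
  let ?r = "\<bar>\<alpha> - \<alpha>'\<bar> * (\<Sum>k=1..Suc j. e (k, k)) + \<bar>\<beta> - \<beta>'\<bar> * (\<Sum>k=1..Suc i. e (k, 0))"
  have "\<bar>max (G \<alpha> \<beta> e i (Suc j)) (G \<alpha> \<beta> e (Suc i) j) - max (G \<alpha>' \<beta>' e i (Suc j)) (G \<alpha>' \<beta>' e (Suc i) j)\<bar> \<le> ?r"
    by (rule mx) (use step nn in \<open>simp_all add: algebra_simps\<close>)
  then show ?case using step(1) by simp
qed

text \<open>The last premise exempts row 0 when \<beta> = 0, so point-to-point times depend only on
  entries with \<open>1 \<le> l\<close>. The independence of pieces of the environment rests on
  this.\<close>

lemma G_cong:
  assumes "j \<le> i" "\<And>k l. l \<le> k ==> k \<le> i ==> l \<le> j ==> 1 \<le> k ==> \<beta> \<noteq> 0 \<or> 1 \<le> l ==> e (k, l) = e' (k, l)"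
  shows "G \<alpha> \<beta> e i j = G \<alpha> \<beta> e' i j"
proof -
  have "i' \<le> i ==> j' \<le> j ==> G \<alpha> \<beta> e i' j' = G \<alpha> \<beta> e' i' j'" if "j' \<le> i'" for i' j'
    using that
  proof (induction i' j' rule: shifted_induct)
    case (row i')
    then show ?case using assms(2) by (cases "\<beta> = 0") (auto simp: G_row0 intro!: sum.cong)
  next
    case (diag i')
    then show ?case using assms(2)[of "Suc i'" "Suc i'"] by auto
  next
    case (step i' j')
    then show ?case using assms(2)[of "Suc j'" "Suc i'"] by auto
  qed
  then show ?thesis using assms(1) by blast
qed

lemma measurable_G [measurable]: "(\<lambda>e. G \<alpha> \<beta> e i j) \<in> borel_measurable env"
proof (induction \<alpha> \<beta> "\<lambda>_::nat\<times>nat. 0::real" i j rule: G.induct)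
  case (3 \<alpha> \<beta> i j)
  then show ?case by (cases "j < i") simp_all
qed simp_all

text \<open>Reflection of the triangle \<open>1 \<le> j \<le> i \<le> N\<close>. The unused entries \<open>(0, k)\<close> become the boundary
  row of the reflected environment, which is thereby independent of the original boundary row.\<close>

definition reflect :: "nat => nat \<times> nat => nat \<times> nat" where
  "reflect N = (\<lambda>(i, j). if 1 \<le> j \<and> j \<le> i \<and> i \<le> N then (N + 1 - j, N + 1 - i)
    else if i = 0 \<or> j = 0 then (j, i) else (i, j))"

definition rev_env :: "nat => (nat \<times> nat => real) => nat \<times> nat => real" where
  "rev_env N e = (\<lambda>p. e (reflect N p))"

lemma reflect_reflect: "reflect N (reflect N p) = p" by (cases p) (auto simp: reflect_def)

lemma distr_rev_env: "distr env env (rev_env N) = env"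
  using distr_env_reindex[of "reflect N"] reflect_reflect unfolding rev_env_def[abs_def] by (metis injI)

lemma measurable_rev_env [measurable]: "rev_env N \<in> measurable env env"
  unfolding rev_env_def[abs_def] by (rule measurable_env_reindex)

lemma nonneg_rev_env: "nonneg e ==> nonneg (rev_env N e)"
  unfolding nonneg_def rev_env_def by blast

lemma weight_rev_env:
  assumes "1 \<le> y" "y \<le> x" "x \<le> N"
  shows "weight \<alpha> (rev_env N e) (N + 1 - y) (N + 1 - x) = weight \<alpha> e x y"
proof -
  have "N + 1 - x < N + 1 - y \<longleftrightarrow> y < x" using assms by auto
  moreover have "reflect N (N + 1 - y, N + 1 - x) = (x, y)" using assms by (auto simp: reflect_def)
  ultimately show ?thesis unfolding weight_def rev_env_def by simp
qed

lemma G_pred_cases: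
  assumes "1 \<le> j" "j \<le> i"
  obtains "j < i" "G \<alpha> \<beta> e i j = weight \<alpha> e i j + G \<alpha> \<beta> e (i - 1) j"
    | "G \<alpha> \<beta> e i j = weight \<alpha> e i j + G \<alpha> \<beta> e i (j - 1)"
proof -
  obtain i' j' where "i = Suc i'" "j = Suc j'" using assms by (cases i; cases j) auto
  then show ?thesis
    using that by (cases "j' < i'"; cases "G \<alpha> \<beta> e i' (Suc j') \<le> G \<alpha> \<beta> e (Suc i') j'")
      (auto simp: weight_def max_def)
qed

text \<open>A path through (x, y) splits there, and the reflected time measures its second half; the
  common weight is subtracted once. The free row 0 of the reflected model corresponds to ending
  anywhere on column N, from where (N, N) is reached without loss. The induction follows the second
  half forwards.\<close>

lemma G_rev_lower:
  assumes "nonneg e" "0 \<le> \<alpha>" and xy: "1 \<le> y" "y \<le> x" "x \<le> N"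
  shows "G \<alpha> 0 e x y + G \<alpha> 0 (rev_env N e) (N + 1 - y) (N + 1 - x) - weight \<alpha> e x y \<le> G \<alpha> 0 e N N"
  using xy
proof (induction "2 * N - (x + y)" arbitrary: x y rule: less_induct)
  case less
  let ?G' = "G \<alpha> 0 (rev_env N e)"
  let ?i = "N + 1 - y" and ?j = "N + 1 - x"
  have w: "weight \<alpha> (rev_env N e) ?i ?j = weight \<alpha> e x y"
    using less.prems by (intro weight_rev_env) auto
  have ij: "1 \<le> ?j" "?j \<le> ?i" using less.prems by auto
  \<comment> \<open>A maximizing predecessor in the reflected triangle is the next vertex of the
    path: (x, y + 1) in the first case, (x + 1, y) in the second.\<close>
  from ij show ?case
  proof (cases rule: G_pred_cases[of _ _ \<alpha> 0 "rev_env N e"])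
    case 1
    then have "y < x" by auto
    have eq: "?i - 1 = N + 1 - Suc y" by auto
    have "G \<alpha> 0 e x y + weight \<alpha> e x (Suc y) \<le> G \<alpha> 0 e x (Suc y)"
      using \<open>y < x\<close> by (intro G_step_up) auto
    moreover have "G \<alpha> 0 e x (Suc y) + ?G' (N + 1 - Suc y) ?j - weight \<alpha> e x (Suc y) \<le> G \<alpha> 0 e N N"
      using less.prems \<open>y < x\<close> by (intro less.hyps) auto
    ultimately show ?thesis using 1 w eq by simp
  next
    case 2
    show ?thesis
    proof (cases "x < N")
      case True
      have eq: "?j - 1 = N + 1 - Suc x" by auto
      have "G \<alpha> 0 e x y + weight \<alpha> e (Suc x) y \<le> G \<alpha> 0 e (Suc x) y"
        using less.prems by (intro G_step_right) auto
      moreover have "G \<alpha> 0 e (Suc x) y + ?G' ?i (N + 1 - Suc x) - weight \<alpha> e (Suc x) y \<le> G \<alpha> 0 e N N"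
        using less.prems True by (intro less.hyps) auto
      ultimately show ?thesis using 2 w eq by simp
    next
      case False
      then have "x = N" using less.prems by auto
      then have "?G' ?i ?j = weight \<alpha> e x y" using 2 w by simp
      then show ?thesis using \<open>x = N\<close> less.prems G_mono_up'[of e \<alpha> y N N 0] assms by simp
    qed
  qed
qed

text \<open>Here the second half starts at (x + 1, y), so no weight is counted twice. For x = N it
  is empty and has value 0.\<close>

lemma G_rev_lower':
  assumes "nonneg e" "0 \<le> \<alpha>" "1 \<le> y" "y \<le> x" "x \<le> N"
  shows "G \<alpha> 0 e x y + G \<alpha> 0 (rev_env N e) (N + 1 - y) (N - x) \<le> G \<alpha> 0 e N N"
proof -
  have "G \<alpha> 0 (rev_env N e) (N + 1 - y) (N - x) + weight \<alpha> (rev_env N e) (N + 1 - y) (Suc (N - x))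
      \<le> G \<alpha> 0 (rev_env N e) (N + 1 - y) (Suc (N - x))" using assms by (intro G_step_up) auto
  moreover have "Suc (N - x) = N + 1 - x" using assms by auto
  ultimately show ?thesis using G_rev_lower[OF assms] weight_rev_env[of y x N \<alpha> e] assms by simp
qed

text \<open>A path to \<open>(N, N)\<close> is followed backwards until it meets a point at which the bound is known.\<close>

lemma G_cut_bound:
  assumes "nonneg e" "0 \<le> \<alpha>" "1 \<le> N"
    and Out: "Out \<subseteq> {(x, y). 1 \<le> y \<and> y \<le> x \<and> x \<le> N}" "(N, N) \<in> Out"
    and step: "\<And>x y. (x, y) \<in> Out ==>
      G \<alpha> \<beta> e x y + G \<alpha> 0 (rev_env N e) (N + 1 - y) (N + 1 - x) \<le> B \<or>
      (y < x \<longrightarrow> (x - 1, y) \<in> Out) \<and>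
      (if y = 1 then (y < x \<and> G \<alpha> \<beta> e x 0 \<le> G \<alpha> \<beta> e (x - 1) 1) \<or>
          G \<alpha> \<beta> e x 0 + G \<alpha> 0 (rev_env N e) N (N + 1 - x) \<le> B
        else (x, y - 1) \<in> Out)"
  shows "G \<alpha> \<beta> e N N \<le> B"
proof -
  let ?G = "G \<alpha> \<beta> e" and ?G' = "G \<alpha> 0 (rev_env N e)"
  \<comment> \<open>The left side is the best value of a path through (x, y). Passing to the
    maximizing predecessor does not decrease it, so it suffices that the backward path meets a point
    where \<open>B\<close> is known.\<close>
  have "?G x y + ?G' (N + 1 - y) (N + 1 - x) - weight \<alpha> e x y \<le> B" if "(x, y) \<in> Out" for x y using that
  proof (induction "x + y" arbitrary: x y rule: less_induct)
    case less
    have xy: "1 \<le> y" "y \<le> x" "x \<le> N" using less.prems Out by auto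
    have w: "0 \<le> weight \<alpha> e x y" using assms by (intro weight_nonneg)
    have left: ?case if "y < x" "(x - 1, y) \<in> Out" "?G x y = weight \<alpha> e x y + ?G (x - 1) y"
    proof -
      have "?G (x - 1) y + ?G' (N + 1 - y) (N + 1 - (x - 1)) - weight \<alpha> e (x - 1) y \<le> B"
        using that xy by (intro less.hyps) auto
      moreover have "?G' (N + 1 - y) (N + 1 - x) + weight \<alpha> (rev_env N e) (N + 1 - y) (Suc (N + 1 - x))
          \<le> ?G' (N + 1 - y) (Suc (N + 1 - x))" using that xy by (intro G_step_up) auto
      moreover have "Suc (N + 1 - x) = N + 1 - (x - 1)" using that xy by auto
      moreover have "weight \<alpha> (rev_env N e) (N + 1 - y) (N + 1 - (x - 1)) = weight \<alpha> e (x - 1) y"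
        using that xy by (intro weight_rev_env) auto
      ultimately show ?thesis using that(3) by (simp del: G.simps)
    qed
    show ?case
    proof (cases "?G x y + ?G' (N + 1 - y) (N + 1 - x) \<le> B")
      case True
      then show ?thesis using w by simp
    next
      case False
      note st = step[OF less.prems] False
      from xy(1,2) show ?thesis
      proof (cases rule: G_pred_cases[of _ _ \<alpha> \<beta> e])
        case 1
        then show ?thesis using st by (intro left) auto
      next
        case 2
        show ?thesis
        \<comment> \<open>From y = 1 the path may descend to row 0, which lies outside the reflected
          triangle. The premise then offers a detour through (x - 1, 1) or a bound at (x,
          0).\<close>
        proof (cases "y = 1")
          case True
          then consider "y < x" "?G x 0 \<le> ?G (x - 1) 1" | "?G x 0 + ?G' N (N + 1 - x) \<le> B" using st by auto
          then show ?thesis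
          proof cases
            case a: 1
            have "?G (x - 1) y + weight \<alpha> e (Suc (x - 1)) y \<le> ?G (Suc (x - 1)) y"
              using a xy by (intro G_step_right) auto
            then have "?G x y = weight \<alpha> e x y + ?G (x - 1) y" using 2 a True by simp
            then show ?thesis using a st True by (intro left) auto
          next
            case b: 2
            then show ?thesis using 2 True by simp
          qed
        next
          case False
          have "?G x (y - 1) + ?G' (N + 1 - (y - 1)) (N + 1 - x) - weight \<alpha> e x (y - 1) \<le> B"
            using False st xy by (intro less.hyps) auto
          moreover have "?G' (N + 1 - y) (N + 1 - x) + weight \<alpha> (rev_env N e) (Suc (N + 1 - y)) (N + 1 - x)
              \<le> ?G' (Suc (N + 1 - y)) (N + 1 - x)" using False xy by (intro G_step_right) auto
          moreover have "Suc (N + 1 - y) = N + 1 - (y - 1)" using False xy by auto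
          moreover have "weight \<alpha> (rev_env N e) (N + 1 - (y - 1)) (N + 1 - x) = weight \<alpha> e x (y - 1)"
            using False xy by (intro weight_rev_env) auto
          ultimately show ?thesis using 2 by (simp del: G.simps)
        qed
      qed
    qed
  qed
  from this[OF Out(2)] have "?G N N + ?G' 1 1 - weight \<alpha> e N N \<le> B" by simp
  moreover have "?G' 1 1 = weight \<alpha> e N N"
    using weight_rev_env[of N N N \<alpha> e] assms(3) by (simp add: weight_def)
  ultimately show ?thesis by simp
qed

section \<open>Burke's theorem\<close>

lemma nn_integral_lborel_shift:
  fixes f :: "real => ennreal"
  assumes "f \<in> borel_measurable borel"
  shows "(\<integral>\<^sup>+x. f (x + c) \<partial>lborel) = (\<integral>\<^sup>+x. f x \<partial>lborel)"
  using nn_integral_real_affine[OF assms, of 1 c] by (simp add: add.commute)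

text \<open>The change of variables d = x - y, m = min x y. For fixed d it is a translation in y, so
  its Jacobian is 1.\<close>

lemma nn_integral_lborel_diff_min:
  fixes H :: "real => real => ennreal"
  assumes [measurable]: "case_prod H \<in> borel_measurable (borel \<Otimes>\<^sub>M borel)"
  shows "(\<integral>\<^sup>+x. \<integral>\<^sup>+y. H x y \<partial>lborel \<partial>lborel)
    = (\<integral>\<^sup>+d. \<integral>\<^sup>+m. H (m + max 0 d) (m + max 0 (- d)) \<partial>lborel \<partial>lborel)"
proof -
  have "(\<integral>\<^sup>+x. \<integral>\<^sup>+y. H x y \<partial>lborel \<partial>lborel) = (\<integral>\<^sup>+y. \<integral>\<^sup>+x. H x y \<partial>lborel \<partial>lborel)"
    by (rule lborel_pair.Fubini') simp
  also have "\<dots> = (\<integral>\<^sup>+y. \<integral>\<^sup>+d. H (d + y) y \<partial>lborel \<partial>lborel)"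
    by (subst nn_integral_lborel_shift) simp_all
  also have "\<dots> = (\<integral>\<^sup>+d. \<integral>\<^sup>+y. H (d + y) y \<partial>lborel \<partial>lborel)"
    by (rule lborel_pair.Fubini'[symmetric]) simp
  also have "\<dots> = (\<integral>\<^sup>+d. \<integral>\<^sup>+m. H (m + max 0 d) (m + max 0 (- d)) \<partial>lborel \<partial>lborel)"
  proof (rule nn_integral_cong)
    fix d :: real
    have "(\<integral>\<^sup>+y. H (d + y) y \<partial>lborel) = (\<integral>\<^sup>+y. H (d + (y + max 0 (- d))) (y + max 0 (- d)) \<partial>lborel)"
      by (rule nn_integral_lborel_shift[symmetric]) simp
    also have "\<dots> = (\<integral>\<^sup>+m. H (m + max 0 d) (m + max 0 (- d)) \<partial>lborel)"
      by (intro nn_integral_cong arg_cong2[where f=H]) (auto simp: max_def)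
    finally show "(\<integral>\<^sup>+y. H (d + y) y \<partial>lborel) = \<dots>" .
  qed
  finally show ?thesis .
qed

lemma nn_integral_expo_scale:
  fixes f :: "real => ennreal"
  assumes [measurable]: "f \<in> borel_measurable borel" and "0 < r"
  shows "(\<integral>\<^sup>+x. f x \<partial>expo) = (\<integral>\<^sup>+x. ennreal (r * exp (- r * x)) * indicator {0..} x * f (r * x) \<partial>lborel)"
proof -
  have "(\<integral>\<^sup>+x. f x \<partial>expo) = ennreal \<bar>r\<bar> *
      (\<integral>\<^sup>+x. ennreal (exp (- (r * x))) * indicator {0..} (r * x) * f (r * x) \<partial>lborel)"
    using \<open>0 < r\<close> by (subst nn_integral_expo, simp, subst nn_integral_real_affine[where c=r and t=0]) auto
  also have "\<dots> = (\<integral>\<^sup>+x. ennreal r * (ennreal (exp (- (r * x))) * indicator {0..} (r * x) * f (r * x)) \<partial>lborel)"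
    using \<open>0 < r\<close> by (subst nn_integral_cmult) auto
  also have "\<dots> = (\<integral>\<^sup>+x. ennreal (r * exp (- r * x)) * indicator {0..} x * f (r * x) \<partial>lborel)"
    using \<open>0 < r\<close> by (intro nn_integral_cong)
      (auto simp: ennreal_mult' mult.assoc zero_le_mult_iff split: split_indicator)
  finally show ?thesis .
qed

text \<open>In the coordinates \<open>m = min I J\<close> and \<open>d = I - J\<close> the joint density is symmetric in
  \<open>m\<close> and \<open>w\<close>, and the map below exchanges these two.\<close>

lemma burke_vertex:
  fixes K :: "real => real => real => ennreal"
  assumes \<rho>: "0 < \<rho>" "\<rho> < 1"
    and m [measurable]: "(\<lambda>(x, y, w). K x y w) \<in> borel_measurable (borel \<Otimes>\<^sub>M borel \<Otimes>\<^sub>M borel)"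
  shows "(\<integral>\<^sup>+x. \<integral>\<^sup>+y. \<integral>\<^sup>+w. K ((1 - \<rho>) * (w + max 0 (x / (1 - \<rho>) - y / \<rho>)))
            (\<rho> * (w + max 0 (y / \<rho> - x / (1 - \<rho>)))) (min (x / (1 - \<rho>)) (y / \<rho>)) \<partial>expo \<partial>expo \<partial>expo)
    = (\<integral>\<^sup>+x. \<integral>\<^sup>+y. \<integral>\<^sup>+w. K x y w \<partial>expo \<partial>expo \<partial>expo)"
proof -
  define D where "D x y w = ennreal ((1 - \<rho>) * exp (- (1 - \<rho>) * x)) * indicator {0..} x *
    (ennreal (\<rho> * exp (- \<rho> * y)) * indicator {0..} y * (ennreal (exp (- w)) * indicator {0..} w))"
    for x y w :: real
  have [measurable]: "(\<lambda>z. K (f z) (g z) (h z)) \<in> borel_measurable M"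
    if "f \<in> borel_measurable M" "g \<in> borel_measurable M" "h \<in> borel_measurable M" for f g h and M :: "'z measure"
    using measurable_compose[OF measurable_Pair[OF that(1) measurable_Pair[OF that(2,3)]] m] by simp
  have Dm [measurable]: "(\<lambda>z. D (f z) (g z) (h z)) \<in> borel_measurable M"
    if [measurable]: "f \<in> borel_measurable M" "g \<in> borel_measurable M" "h \<in> borel_measurable M" for f g h and M :: "'z measure"
    unfolding D_def by measurable
  have expand: "(\<integral>\<^sup>+x. \<integral>\<^sup>+y. \<integral>\<^sup>+w. L x y w \<partial>expo \<partial>expo \<partial>expo)
      = (\<integral>\<^sup>+x. \<integral>\<^sup>+y. \<integral>\<^sup>+w. D x y w * L ((1 - \<rho>) * x) (\<rho> * y) w \<partial>lborel \<partial>lborel \<partial>lborel)"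
    if Lm [measurable]: "(\<lambda>(x, y, w). L x y w) \<in> borel_measurable (borel \<Otimes>\<^sub>M borel \<Otimes>\<^sub>M borel)"
    for L :: "real => real => real => ennreal"
  proof -
    have [measurable]: "(\<lambda>z. L (f z) (g z) (h z)) \<in> borel_measurable M"
      if "f \<in> borel_measurable M" "g \<in> borel_measurable M" "h \<in> borel_measurable M" for f g h and M :: "'z measure"
      using measurable_compose[OF measurable_Pair[OF that(1) measurable_Pair[OF that(2,3)]] Lm] by simp
    have "(\<integral>\<^sup>+x. \<integral>\<^sup>+y. \<integral>\<^sup>+w. L x y w \<partial>expo \<partial>expo \<partial>expo)
      = (\<integral>\<^sup>+x. \<integral>\<^sup>+y. \<integral>\<^sup>+w. ennreal (exp (- w)) * indicator {0..} w * L x y w \<partial>lborel \<partial>expo \<partial>expo)"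
      by (intro nn_integral_cong nn_integral_expo) measurable
    also have "\<dots> = (\<integral>\<^sup>+x. \<integral>\<^sup>+y. ennreal (\<rho> * exp (- \<rho> * y)) * indicator {0..} y *
        (\<integral>\<^sup>+w. ennreal (exp (- w)) * indicator {0..} w * L x (\<rho> * y) w \<partial>lborel) \<partial>lborel \<partial>expo)"
      using \<rho> by (intro nn_integral_cong nn_integral_expo_scale) measurable
    also have "\<dots> = (\<integral>\<^sup>+x. ennreal ((1 - \<rho>) * exp (- (1 - \<rho>) * x)) * indicator {0..} x *
        (\<integral>\<^sup>+y. ennreal (\<rho> * exp (- \<rho> * y)) * indicator {0..} y *
        (\<integral>\<^sup>+w. ennreal (exp (- w)) * indicator {0..} w * L ((1 - \<rho>) * x) (\<rho> * y) w \<partial>lborel) \<partial>lborel) \<partial>lborel)"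
      using \<rho> by (intro nn_integral_expo_scale) auto
    also have "\<dots> = (\<integral>\<^sup>+x. \<integral>\<^sup>+y. \<integral>\<^sup>+w. D x y w * L ((1 - \<rho>) * x) (\<rho> * y) w \<partial>lborel \<partial>lborel \<partial>lborel)"
      unfolding D_def by (simp add: nn_integral_cmult[symmetric] mult.assoc)
    finally show ?thesis .
  qed
  let ?p = "\<lambda>d::real. max 0 d" and ?n = "\<lambda>d::real. max 0 (- d)"
  have sym: "D (w + ?p d) (w + ?n d) m = D (m + ?p d) (m + ?n d) w" for w m d
  proof -
    \<comment> \<open>The rates 1 - \<rho> and \<rho> add up to 1, so m and w enter the exponent
      with equal coefficients; this makes the density symmetric in them.\<close>
    have *: "D (w + ?p d) (w + ?n d) m = ennreal ((1 - \<rho>) * \<rho> * exp (- (w + m + (1 - \<rho>) * ?p d + \<rho> * ?n d)))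
        * indicator {0..} w * indicator {0..} m" for w m
    proof (cases "0 \<le> w \<and> 0 \<le> m")
      case True
      have "exp (- (w + m + (1 - \<rho>) * ?p d + \<rho> * ?n d))
          = exp (- (1 - \<rho>) * (w + ?p d)) * (exp (- \<rho> * (w + ?n d)) * exp (- m))"
        by (simp only: exp_add[symmetric]) (simp add: algebra_simps)
      then show ?thesis using True \<rho> unfolding D_def
        by (auto simp: ennreal_mult'[symmetric] mult_ac indicator_def)
    next
      case False
      then show ?thesis unfolding D_def by (auto simp: indicator_def max_def)
    qed
    show ?thesis unfolding *[of w m] *[of m w] by (simp only: add.commute[of m w] mult_ac)
  qed
  have "(\<integral>\<^sup>+x. \<integral>\<^sup>+y. \<integral>\<^sup>+w. K ((1 - \<rho>) * (w + max 0 (x / (1 - \<rho>) - y / \<rho>)))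
            (\<rho> * (w + max 0 (y / \<rho> - x / (1 - \<rho>)))) (min (x / (1 - \<rho>)) (y / \<rho>)) \<partial>expo \<partial>expo \<partial>expo)
    = (\<integral>\<^sup>+x. \<integral>\<^sup>+y. \<integral>\<^sup>+w. D x y w * K ((1 - \<rho>) * (w + max 0 (x - y)))
            (\<rho> * (w + max 0 (y - x))) (min x y) \<partial>lborel \<partial>lborel \<partial>lborel)"
    using \<rho> by (subst expand) (auto simp: case_prod_beta')
  also have "\<dots> = (\<integral>\<^sup>+d. \<integral>\<^sup>+m. \<integral>\<^sup>+w. D (m + ?p d) (m + ?n d) w * K ((1 - \<rho>) * (w + max 0 ((m + ?p d) - (m + ?n d))))
            (\<rho> * (w + max 0 ((m + ?n d) - (m + ?p d)))) (min (m + ?p d) (m + ?n d)) \<partial>lborel \<partial>lborel \<partial>lborel)"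
    by (rule nn_integral_lborel_diff_min) (auto simp: case_prod_beta')
  also have "\<dots> = (\<integral>\<^sup>+d. \<integral>\<^sup>+m. \<integral>\<^sup>+w. D (w + ?p d) (w + ?n d) m * K ((1 - \<rho>) * (w + ?p d))
            (\<rho> * (w + ?n d)) m \<partial>lborel \<partial>lborel \<partial>lborel)"
  proof (intro nn_integral_cong)
    fix d m w :: real
    have "max 0 ((m + ?p d) - (m + ?n d)) = ?p d" "max 0 ((m + ?n d) - (m + ?p d)) = ?n d"
      "min (m + ?p d) (m + ?n d) = m" by (auto simp: max_def min_def)
    then show "D (m + ?p d) (m + ?n d) w * K ((1 - \<rho>) * (w + max 0 ((m + ?p d) - (m + ?n d))))
            (\<rho> * (w + max 0 ((m + ?n d) - (m + ?p d)))) (min (m + ?p d) (m + ?n d))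
      = D (w + ?p d) (w + ?n d) m * K ((1 - \<rho>) * (w + ?p d)) (\<rho> * (w + ?n d)) m"
      by (simp only: sym[of m d w])
  qed
  also have "\<dots> = (\<integral>\<^sup>+d. \<integral>\<^sup>+w. \<integral>\<^sup>+m. D (w + ?p d) (w + ?n d) m * K ((1 - \<rho>) * (w + ?p d))
            (\<rho> * (w + ?n d)) m \<partial>lborel \<partial>lborel \<partial>lborel)"
    by (intro nn_integral_cong lborel_pair.Fubini') (auto simp: case_prod_beta')
  also have "\<dots> = (\<integral>\<^sup>+x. \<integral>\<^sup>+y. \<integral>\<^sup>+m. D x y m * K ((1 - \<rho>) * x) (\<rho> * y) m \<partial>lborel \<partial>lborel \<partial>lborel)"
    by (rule nn_integral_lborel_diff_min[symmetric]) (auto simp: case_prod_beta')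
  also have "\<dots> = (\<integral>\<^sup>+x. \<integral>\<^sup>+y. \<integral>\<^sup>+w. K x y w \<partial>expo \<partial>expo \<partial>expo)"
    by (rule expand[symmetric]) measurable
  finally show ?thesis .
qed

text \<open>One vertex of the lattice: p and q hold the incoming horizontal and vertical increments,
  scaled to rate 1, and z holds the weight. The outgoing vertical increment is written to z, since z
  is the slot q of the next vertex on the right. The minimum, a weight of the dual model, stays in
  q.\<close>

definition flip :: "real => nat \<times> nat => nat \<times> nat => nat \<times> nat => (nat \<times> nat => real) => nat \<times> nat => real" where
  "flip \<rho> p q z e = e(q := min (e p / (1 - \<rho>)) (e q / \<rho>),
     p := (1 - \<rho>) * (e z + max 0 (e p / (1 - \<rho>) - e q / \<rho>)),
     z := \<rho> * (e z + max 0 (e q / \<rho> - e p / (1 - \<rho>))))"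

lemma measurable_flip [measurable]: "flip \<rho> p q z \<in> measurable env env"
  unfolding flip_def[abs_def] by measurable

lemma measure_preservingI:
  assumes [measurable]: "f \<in> measurable env env"
    and "\<And>A. A \<in> sets env ==> (\<bbbE>\<^sup>+ e. indicator A (f e)) = emeasure env A"
  shows "distr env env f = env"
proof (rule measure_eqI)
  fix A assume "A \<in> sets (distr env env f)"
  then have A [measurable]: "A \<in> sets env" by simp
  have "emeasure (distr env env f) A = (\<integral>\<^sup>+e. indicator A e \<partial>distr env env f)" by simp
  also have "\<dots> = (\<bbbE>\<^sup>+ e. indicator A (f e))" by (subst nn_integral_distr) auto
  finally show "emeasure (distr env env f) A = emeasure env A" using assms(2)[OF A] by simp
qed simp

lemma distr_flip:
  assumes \<rho>: "0 < \<rho>" "\<rho> < 1" and dist: "p \<noteq> q" "p \<noteq> z" "q \<noteq> z"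
  shows "distr env env (flip \<rho> p q z) = env"
proof (rule measure_preservingI)
  fix A :: "(nat \<times> nat => real) set" assume [measurable]: "A \<in> sets env"
  have upd: "(\<bbbE>\<^sup>+ e. F e) = (\<bbbE>\<^sup>+ e. \<integral>\<^sup>+x. \<integral>\<^sup>+y. \<integral>\<^sup>+w. F (e(p := x, q := y, z := w)) \<partial>expo \<partial>expo \<partial>expo)"
    if [measurable]: "F \<in> borel_measurable env" for F
  proof -
    have "(\<bbbE>\<^sup>+ e. F e) = (\<bbbE>\<^sup>+ e. \<integral>\<^sup>+w. F (e(z := w)) \<partial>expo)"
      by (rule nn_integral_env_update) measurable
    also have "\<dots> = (\<bbbE>\<^sup>+ e. \<integral>\<^sup>+y. \<integral>\<^sup>+w. F (e(q := y, z := w)) \<partial>expo \<partial>expo)"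
      by (rule nn_integral_env_update) measurable
    also have "\<dots> = (\<bbbE>\<^sup>+ e. \<integral>\<^sup>+x. \<integral>\<^sup>+y. \<integral>\<^sup>+w. F (e(p := x, q := y, z := w)) \<partial>expo \<partial>expo \<partial>expo)"
      by (rule nn_integral_env_update) measurable
    finally show ?thesis .
  qed
  have fl: "flip \<rho> p q z (e(p := x, q := y, z := w)) =
     e(p := (1 - \<rho>) * (w + max 0 (x / (1 - \<rho>) - y / \<rho>)), q := min (x / (1 - \<rho>)) (y / \<rho>),
       z := \<rho> * (w + max 0 (y / \<rho> - x / (1 - \<rho>))))" for e x y w
    using dist by (auto simp: flip_def fun_eq_iff)
  \<comment> \<open>\<open>burke_vertex\<close> returns the minimum as its third output, whereas
    \<open>flip\<close> stores it in q and the vertical increment in z; hence the two inner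
    integrals are exchanged.\<close>
  have swap: "(\<integral>\<^sup>+x. \<integral>\<^sup>+y. \<integral>\<^sup>+w. indicator A (e(p := x, q := y, z := w)) \<partial>expo \<partial>expo \<partial>expo)
     = (\<integral>\<^sup>+x. \<integral>\<^sup>+w. \<integral>\<^sup>+y. indicator A (e(p := x, q := y, z := w)) \<partial>expo \<partial>expo \<partial>expo)" for e
  proof -
    interpret P: pair_sigma_finite expo expo ..
    show ?thesis by (intro nn_integral_cong P.Fubini') (auto simp: case_prod_beta')
  qed
  have "(\<bbbE>\<^sup>+ e. indicator A (flip \<rho> p q z e))
    = (\<bbbE>\<^sup>+ e. \<integral>\<^sup>+x. \<integral>\<^sup>+y. \<integral>\<^sup>+w. indicator A (flip \<rho> p q z (e(p := x, q := y, z := w))) \<partial>expo \<partial>expo \<partial>expo)"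
    by (rule upd) measurable
  also have "\<dots> = (\<bbbE>\<^sup>+ e. \<integral>\<^sup>+x. \<integral>\<^sup>+y. \<integral>\<^sup>+w. indicator A (e(p := x, q := y, z := w)) \<partial>expo \<partial>expo \<partial>expo)"
    unfolding fl swap
    by (intro nn_integral_cong burke_vertex[OF \<rho>, where K="\<lambda>x y w. indicator A (e(p := x, q := w, z := y))" for e])
      (auto simp: case_prod_beta')
  also have "\<dots> = (\<bbbE>\<^sup>+ e. indicator A e)" by (rule upd[symmetric]) measurable
  finally show "(\<bbbE>\<^sup>+ e. indicator A (flip \<rho> p q z e)) = emeasure env A" by simp
qed measurable

section \<open>Measure-preserving maps of the environment\<close>

definition preserving :: "((nat \<times> nat => real) => nat \<times> nat => real) => bool" where
  "preserving \<Phi> \<longleftrightarrow> \<Phi> \<in> measurable env env \<and> distr env env \<Phi> = env"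

lemma preserving_comp: "preserving \<Phi> ==> preserving \<Psi> ==> preserving (\<lambda>e. \<Phi> (\<Psi> e))"
  unfolding preserving_def using distr_distr[of \<Phi> env env \<Psi> env]
  by (auto simp: comp_def intro: measurable_compose)

lemma preserving_id: "preserving (\<lambda>e. e)" by (simp add: preserving_def distr_id2)

lemma preserving_flip:
  "0 < \<rho> ==> \<rho> < 1 ==> p \<noteq> q ==> p \<noteq> z ==> q \<noteq> z ==> preserving (flip \<rho> p q z)"
  by (simp add: preserving_def distr_flip)

lemma preserving_reindex: "inj \<sigma> ==> preserving (\<lambda>e p. e (\<sigma> p))"
  by (simp add: preserving_def distr_env_reindex measurable_env_reindex)

lemma preserving_rev_env: "preserving (rev_env N)" by (simp add: preserving_def distr_rev_env)

lemma preserving_shift: "preserving (shift n)"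
  unfolding shift_def[abs_def] by (rule preserving_reindex) (auto simp: inj_def)

lemma preserving_nn_integral:
  assumes "preserving \<Phi>" "f \<in> borel_measurable env"
  shows "(\<bbbE>\<^sup>+ e. f (\<Phi> e)) = (\<bbbE>\<^sup>+ e. f e)"
  using assms nn_integral_distr[of \<Phi> env env f] by (simp add: preserving_def)

lemma preserving_integral:
  fixes f :: "(nat \<times> nat => real) => real"
  assumes "preserving \<Phi>" "f \<in> borel_measurable env"
  shows "(\<bbbE> e. f (\<Phi> e)) = (\<bbbE> e. f e)"
  using assms integral_distr[of \<Phi> env env f] by (simp add: preserving_def)

lemma preserving_integrable:
  fixes f :: "(nat \<times> nat => real) => real"
  assumes "preserving \<Phi>" "f \<in> borel_measurable env"
  shows "integrable env (\<lambda>e. f (\<Phi> e)) \<longleftrightarrow> integrable env f"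
  using assms integrable_distr_eq[of \<Phi> env env f] by (simp add: preserving_def)

lemma preserving_measurable:
  "preserving \<Phi> ==> f \<in> borel_measurable env ==> (\<lambda>e. f (\<Phi> e)) \<in> borel_measurable env"
  by (auto simp: preserving_def intro: measurable_compose)

text \<open>The vertices of row y are treated from left to right. The first one is (y + 1, y): the
  diagonal entry (y, y) is already the vertical increment there, scaled to rate 1.\<close>

fun burke_row :: "real => nat => nat => (nat \<times> nat => real) => nat \<times> nat => real" where
  "burke_row \<rho> y 0 e = e"
| "burke_row \<rho> y (Suc k) e =
    (if y \<le> k then flip \<rho> (Suc k, 0) (k, y) (Suc k, y) (burke_row \<rho> y k e) else e)"

text \<open>\<open>burke \<rho> K y\<close> moves the stationary boundary from row \<open>0\<close> up to row \<open>y\<close>: the scaled horizontal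
  increments along row \<open>y\<close> are stored in row \<open>0\<close>, the vertical ones along column \<open>K\<close> in that column.\<close>

fun burke :: "real => nat => nat => (nat \<times> nat => real) => nat \<times> nat => real" where
  "burke \<rho> K 0 e = e"
| "burke \<rho> K (Suc y) e = burke_row \<rho> (Suc y) K (burke \<rho> K y e)"

lemma preserving_burke_row:
  assumes "0 < \<rho>" "\<rho> < 1" "1 \<le> y"
  shows "preserving (burke_row \<rho> y k)"
proof (induction k)
  case (Suc k)
  then show ?case using preserving_comp[OF preserving_flip Suc, of \<rho> "(Suc k, 0)" "(k, y)" "(Suc k, y)"] assms
    by (cases "y \<le> k") (auto simp: preserving_id)
qed (simp add: preserving_id)

lemma preserving_burke:
  assumes "0 < \<rho>" "\<rho> < 1"
  shows "preserving (burke \<rho> K y)"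
proof (induction y)
  case (Suc y)
  then show ?case using preserving_comp[OF preserving_burke_row Suc] assms by simp
qed (simp add: preserving_id)

lemma burke_row_other: "j \<noteq> 0 ==> j \<noteq> y ==> burke_row \<rho> y k e (x, j) = e (x, j)"
  by (induction k) (auto simp: flip_def)

lemma burke_row_right: "k < x ==> burke_row \<rho> y k e (x, j) = e (x, j)"
  by (induction k) (auto simp: flip_def)

abbreviation Ist :: "real => (nat \<times> nat => real) => nat => nat => real" where
  "Ist \<rho> \<equiv> Inc (1 / \<rho>) (1 / (1 - \<rho>))"

abbreviation Jst :: "real => (nat \<times> nat => real) => nat => nat => real" where
  "Jst \<rho> \<equiv> Jnc (1 / \<rho>) (1 / (1 - \<rho>))"

text \<open>State of the sweep after column k: the entry in column k is the vertical increment about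
  to enter the next vertex, and the boundary slots up to k have been replaced by horizontal
  increments of the new row.\<close>

lemma burke_row_inv:
  assumes \<rho>: "0 < \<rho>" "\<rho> < 1" and k: "Suc y \<le> k" "k \<le> K"
    and I: "\<And>x. y < x ==> x \<le> K ==> s (x, 0) = (1 - \<rho>) * Ist \<rho> e x y"
    and W: "\<And>x. s (x, Suc y) = e (x, Suc y)"
  shows "burke_row \<rho> (Suc y) k s (k, Suc y) = \<rho> * Jst \<rho> e k (Suc y) \<and>
    (\<forall>x. Suc y < x \<and> x \<le> k \<longrightarrow> burke_row \<rho> (Suc y) k s (x, 0) = (1 - \<rho>) * Ist \<rho> e x (Suc y))"
  using k
proof (induction k rule: dec_induct)
  case base
  have "burke_row \<rho> (Suc y) (Suc y) s = s" by simp
  then show ?case using \<rho> by (simp add: W Jnc_diag del: burke_row.simps)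
next
  case (step k)
  let ?r = "burke_row \<rho> (Suc y) k s"
  have p: "?r (Suc k, 0) = (1 - \<rho>) * Ist \<rho> e (Suc k) y"
    using step I[of "Suc k"] by (simp add: burke_row_right)
  have z: "?r (Suc k, Suc y) = e (Suc k, Suc y)" using W by (simp add: burke_row_right)
  have q: "?r (k, Suc y) = \<rho> * Jst \<rho> e k (Suc y)" using step by simp
  have r: "burke_row \<rho> (Suc y) (Suc k) s = flip \<rho> (Suc k, 0) (k, Suc y) (Suc k, Suc y) ?r"
    using step by simp
  have "y < k" using step by simp
  show ?case unfolding r using step \<rho> \<open>y < k\<close> by (auto simp: flip_def p q z Jnc_rec Inc_rec)
qed

text \<open>With \<open>preserving_burke\<close> this is the Burke property: the increments along
  row y up to column K, those down column K, and the weights above row y sit at distinct coordinates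
  of an environment of law \<open>env\<close>, so they are independent with the stationary
  rates.\<close>

lemma burke_inv:
  assumes \<rho>: "0 < \<rho>" "\<rho> < 1"
  shows "y \<le> K ==> (\<forall>x. y < x \<and> x \<le> K \<longrightarrow> burke \<rho> K y e (x, 0) = (1 - \<rho>) * Ist \<rho> e x y) \<and>
    (\<forall>j. 1 \<le> j \<and> j \<le> y \<longrightarrow> burke \<rho> K y e (K, j) = \<rho> * Jst \<rho> e K j) \<and>
    (\<forall>x j. y < j \<longrightarrow> burke \<rho> K y e (x, j) = e (x, j))"
proof (induction y)
  case 0
  have "burke \<rho> K 0 e (x, 0) = (1 - \<rho>) * Ist \<rho> e x 0" if "0 < x" for x
    using \<rho> that by (cases x) (auto simp: Inc_row0)
  then show ?case by simp
next
  case (Suc y)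
  let ?s = "burke \<rho> K y e"
  have IH: "\<And>x. y < x ==> x \<le> K ==> ?s (x, 0) = (1 - \<rho>) * Ist \<rho> e x y"
    "\<And>j. 1 \<le> j ==> j \<le> y ==> ?s (K, j) = \<rho> * Jst \<rho> e K j"
    "\<And>x j. y < j ==> ?s (x, j) = e (x, j)" using Suc by auto
  have row: "burke_row \<rho> (Suc y) K ?s (K, Suc y) = \<rho> * Jst \<rho> e K (Suc y)"
    "\<And>x. Suc y < x ==> x \<le> K ==> burke_row \<rho> (Suc y) K ?s (x, 0) = (1 - \<rho>) * Ist \<rho> e x (Suc y)"
    using burke_row_inv[OF \<rho>, of y K K ?s e] Suc.prems IH by auto
  have "burke_row \<rho> (Suc y) K ?s (K, j) = \<rho> * Jst \<rho> e K j" if "1 \<le> j" "j \<le> Suc y" for j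
    using that IH(2)[of j] row(1) by (cases "j = Suc y") (auto simp: burke_row_other)
  moreover have "burke_row \<rho> (Suc y) K ?s (x, j) = e (x, j)" if "Suc y < j" for x j
    using that IH(3) by (simp add: burke_row_other)
  ultimately show ?case using row(2) by simp
qed

section \<open>Fourth moments\<close>

text \<open>The nonnegative integral makes the bound include finiteness, so integrability of all
  powers up to the fourth follows.\<close>

definition m4 :: "((nat \<times> nat => real) => real) => real => bool" where
  "m4 f C \<longleftrightarrow> f \<in> borel_measurable env \<and> (\<bbbE>\<^sup>+ e. ennreal (f e ^ 4)) \<le> ennreal C"

lemma emeasure_env_UNIV [simp]: "emeasure env UNIV = 1"
  using env.emeasure_space_1 by simp

lemma emeasure_expo_UNIV [simp]: "emeasure expo UNIV = 1"
  using expo.emeasure_space_1 by simp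

lemma sets_env_Collect: "Measurable.pred env P ==> {e. P e} \<in> sets env"
  by (simp add: pred_def)

lemma m4_measurable: "m4 f C ==> f \<in> borel_measurable env" by (simp add: m4_def)

lemma abs_power4 [simp]: "\<bar>x::real\<bar> ^ 4 = x ^ 4" by (simp add: power_even_abs)

lemma power4_mono: "\<bar>x\<bar> \<le> \<bar>y\<bar> ==> (x::real) ^ 4 \<le> y ^ 4"
  using power_mono[of "\<bar>x\<bar>" "\<bar>y\<bar>" 4] by simp

lemma power4_add: "((x::real) + y) ^ 4 \<le> 8 * (x ^ 4 + y ^ 4)"
proof -
  have "(x + y)\<^sup>2 \<le> 2 * (x\<^sup>2 + y\<^sup>2)" using sum_squares_ge_zero[of "x - y" 0] by (simp add: power2_eq_square algebra_simps)
  then have "((x + y)\<^sup>2)\<^sup>2 \<le> (2 * (x\<^sup>2 + y\<^sup>2))\<^sup>2" by (intro power_mono) auto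
  also have "\<dots> \<le> 8 * ((x\<^sup>2)\<^sup>2 + (y\<^sup>2)\<^sup>2)"
    using zero_le_power2[of "x\<^sup>2 - y\<^sup>2"] by (simp add: power2_eq_square algebra_simps)
  finally show ?thesis by (simp add: power_mult[symmetric])
qed

lemma m4_mono: "m4 f C ==> C \<le> C' ==> m4 f C'"
  unfolding m4_def using ennreal_leI order_trans by blast

lemma m4_dom:
  assumes "m4 g C" "f \<in> borel_measurable env" "AE e in env. \<bar>f e\<bar> \<le> \<bar>g e\<bar>"
  shows "m4 f C"
proof -
  have "(\<bbbE>\<^sup>+ e. ennreal (f e ^ 4)) \<le> (\<bbbE>\<^sup>+ e. ennreal (g e ^ 4))"
    using assms(3) by (intro nn_integral_mono_AE) (auto intro!: ennreal_leI power4_mono)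
  then show ?thesis using assms unfolding m4_def by (auto intro: order_trans)
qed

lemma m4_add:
  assumes "m4 f A" "m4 g B" "0 \<le> A" "0 \<le> B"
  shows "m4 (\<lambda>e. f e + g e) (8 * (A + B))"
proof -
  have [measurable]: "f \<in> borel_measurable env" "g \<in> borel_measurable env" using assms by (auto simp: m4_def)
  have "(\<bbbE>\<^sup>+ e. ennreal ((f e + g e) ^ 4)) \<le> (\<bbbE>\<^sup>+ e. ennreal 8 * (ennreal (f e ^ 4) + ennreal (g e ^ 4)))"
    by (intro nn_integral_mono) (use power4_add in \<open>simp add: ennreal_plus[symmetric] ennreal_mult'[symmetric] del: ennreal_plus ennreal_numeral\<close>)
  also have "\<dots> = ennreal 8 * ((\<bbbE>\<^sup>+ e. ennreal (f e ^ 4)) + (\<bbbE>\<^sup>+ e. ennreal (g e ^ 4)))"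
    by (subst nn_integral_cmult) (auto simp: nn_integral_add)
  also have "\<dots> \<le> ennreal 8 * (ennreal A + ennreal B)"
    using assms by (intro mult_left_mono add_mono) (auto simp: m4_def)
  also have "\<dots> = ennreal (8 * (A + B))"
    using assms by (simp add: ennreal_plus[symmetric] ennreal_mult'[symmetric] del: ennreal_plus ennreal_numeral)
  finally show ?thesis by (simp add: m4_def)
qed

lemma m4_cmult:
  assumes "m4 f A"
  shows "m4 (\<lambda>e. c * f e) (c ^ 4 * A)"
proof -
  have [measurable]: "f \<in> borel_measurable env" using assms by (auto simp: m4_def)
  have "(\<bbbE>\<^sup>+ e. ennreal ((c * f e) ^ 4)) = ennreal (c ^ 4) * (\<bbbE>\<^sup>+ e. ennreal (f e ^ 4))"
    by (simp add: power_mult_distrib ennreal_mult' nn_integral_cmult)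
  also have "\<dots> \<le> ennreal (c ^ 4) * ennreal A" using assms by (intro mult_left_mono) (auto simp: m4_def)
  finally show ?thesis by (simp add: m4_def ennreal_mult'[symmetric])
qed

lemma m4_const: "m4 (\<lambda>_. c) (c ^ 4)" by (simp add: m4_def)

lemma m4_preserving: "m4 f C ==> preserving \<Phi> ==> m4 (\<lambda>e. f (\<Phi> e)) C"
  unfolding m4_def using preserving_nn_integral[of \<Phi> "\<lambda>e. ennreal (f e ^ 4)"]
  by (auto intro: preserving_measurable)

lemma m4_integrable4:
  assumes "m4 f C"
  shows "integrable env (\<lambda>e. f e ^ 4)"
proof -
  have "(\<bbbE>\<^sup>+ e. ennreal (f e ^ 4)) < \<infinity>"
    using assms unfolding m4_def by (auto intro: le_less_trans)
  then show ?thesis using assms by (intro integrableI_nonneg) (auto simp: m4_def)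
qed

lemma m4_integral4:
  assumes "m4 f C" "0 \<le> C"
  shows "(\<bbbE> e. f e ^ 4) \<le> C"
  using assms nn_integral_eq_integral[OF m4_integrable4[OF assms(1)]] by (simp add: m4_def)

lemma power_le_1_plus_power4:
  assumes "k \<le> 4"
  shows "\<bar>x::real\<bar> ^ k \<le> 1 + x ^ 4"
proof (cases "\<bar>x\<bar> \<le> 1")
  case True
  then have "\<bar>x\<bar> ^ k \<le> 1" by (simp add: power_le_one)
  also have "\<dots> \<le> 1 + x ^ 4" by simp
  finally show ?thesis .
next
  case False
  then have "\<bar>x\<bar> ^ k \<le> \<bar>x\<bar> ^ 4" using assms by (intro power_increasing) auto
  then show ?thesis by simp
qed

lemma m4_integrable_power:
  assumes "m4 f C" "k \<le> 4"
  shows "integrable env (\<lambda>e. f e ^ k)"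
proof (rule Bochner_Integration.integrable_bound)
  show "integrable env (\<lambda>e. 1 + f e ^ 4)" using m4_integrable4[OF assms(1)] by simp
  show "(\<lambda>e. f e ^ k) \<in> borel_measurable env" using m4_measurable[OF assms(1)] by measurable
  show "AE e in env. norm (f e ^ k) \<le> norm (1 + f e ^ 4)"
    using power_le_1_plus_power4[OF assms(2)] by (auto simp: power_abs)
qed

lemma m4_integrable: "m4 f C ==> integrable env f"
  using m4_integrable_power[of f C 1] by simp

lemma m4_integrable2:
  assumes "m4 f A" "m4 g B"
  shows "integrable env (\<lambda>e. f e * g e)"
proof (rule Bochner_Integration.integrable_bound)
  show "integrable env (\<lambda>e. f e ^ 2 + g e ^ 2)"
    using m4_integrable_power[OF assms(1), of 2] m4_integrable_power[OF assms(2), of 2] by simp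
  show "(\<lambda>e. f e * g e) \<in> borel_measurable env"
    using m4_measurable[OF assms(1)] m4_measurable[OF assms(2)] by measurable
  have "\<bar>x * y\<bar> \<le> x\<^sup>2 + y\<^sup>2" for x y :: real
    using zero_le_power2[of "x - y"] zero_le_power2[of "x + y"] sum_power2_ge_zero[of x y]
    unfolding power2_diff power2_sum by (auto simp: abs_if)
  then show "AE e in env. norm (f e * g e) \<le> norm (f e ^ 2 + g e ^ 2)" by auto
qed

lemma m4_abs_integral:
  assumes "m4 f C" "0 \<le> C" "0 < t"
  shows "(\<bbbE> e. \<bar>f e\<bar>) \<le> t + C / t ^ 3"
proof -
  have pt: "\<bar>x\<bar> \<le> t + x ^ 4 / t ^ 3" for x
  proof (cases "\<bar>x\<bar> \<le> t")
    case True
    moreover have "0 \<le> x ^ 4 / t ^ 3" using assms by simp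
    ultimately show ?thesis by linarith
  next
    case False
    have "t ^ 3 * \<bar>x\<bar> \<le> \<bar>x\<bar> ^ 3 * \<bar>x\<bar>"
      using False assms by (intro mult_right_mono power_mono) auto
    also have "\<bar>x\<bar> ^ 3 * \<bar>x\<bar> = x ^ 4"
      using power_Suc2[of "\<bar>x\<bar>" 3] abs_power4[of x] by (simp del: abs_power4)
    finally have "\<bar>x\<bar> \<le> x ^ 4 / t ^ 3" using assms by (simp add: field_simps)
    then show ?thesis using assms by simp
  qed
  have "(\<bbbE> e. \<bar>f e\<bar>) \<le> (\<bbbE> e. t + f e ^ 4 / t ^ 3)"
    using m4_integrable[OF assms(1)] m4_integrable4[OF assms(1)] pt by (intro integral_mono) auto
  also have "\<dots> = t + (\<bbbE> e. f e ^ 4) / t ^ 3"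
    using m4_integrable4[OF assms(1)] by (subst Bochner_Integration.integral_add) (use env.prob_space in auto)
  also have "\<dots> \<le> t + C / t ^ 3" using m4_integral4[OF assms(1,2)] assms by (simp add: divide_right_mono)
  finally show ?thesis .
qed

lemma power4_le_exp: "0 \<le> (x::real) ==> x ^ 4 \<le> 256 * exp x"
proof -
  assume x: "0 \<le> x"
  have "x / 4 \<le> exp (x / 4)" using exp_ge_add_one_self[of "x / 4"] by linarith
  then have "(x / 4) ^ 4 \<le> exp (x / 4) ^ 4" using x by (intro power_mono) auto
  also have "exp (x / 4) ^ 4 = exp x" by (simp add: exp_of_nat_mult[symmetric])
  finally show ?thesis by (simp add: power_divide)
qed

lemma m4_exp:
  assumes [measurable]: "f \<in> borel_measurable env" and "0 < s" "0 \<le> C"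
    and "(\<bbbE>\<^sup>+ e. ennreal (exp (s * f e))) \<le> ennreal C"
  shows "m4 (\<lambda>e. max 0 (f e)) (256 * C / s ^ 4)"
proof -
  have pt: "max 0 (f e) ^ 4 \<le> 256 / s ^ 4 * exp (s * f e)" for e
  proof (cases "0 \<le> f e")
    case True
    then show ?thesis
      using power4_le_exp[of "s * f e"] \<open>0 < s\<close> by (simp add: power_mult_distrib field_simps)
  qed (use \<open>0 < s\<close> in simp)
  have "(\<bbbE>\<^sup>+ e. ennreal (max 0 (f e) ^ 4)) \<le> (\<bbbE>\<^sup>+ e. ennreal (256 / s ^ 4) * ennreal (exp (s * f e)))"
    using \<open>0 < s\<close> by (intro nn_integral_mono) (use pt in \<open>simp add: ennreal_mult'[symmetric] ennreal_leI\<close>)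
  also have "\<dots> = ennreal (256 / s ^ 4) * (\<bbbE>\<^sup>+ e. ennreal (exp (s * f e)))"
    by (rule nn_integral_cmult) measurable
  also have "\<dots> \<le> ennreal (256 / s ^ 4) * ennreal C" by (intro mult_left_mono assms) simp
  also have "\<dots> = ennreal (256 * C / s ^ 4)" using assms by (simp add: ennreal_mult'[symmetric])
  finally show ?thesis by (simp add: m4_def)
qed

text \<open>The sum over n of 4096 exp((n + 1) / 2) exp(- n), as it arises in
  \<open>m4_tail\<close>; 4096 is the product of 2^4 and 4^4.\<close>

definition C4 :: real where
  "C4 = 4096 * (exp (1 / 2) * (1 / (1 - exp (- 1 / 2))))"

lemma C4_pos: "0 < C4" by (simp add: C4_def)

text \<open>The range of s f is cut into unit layers. The fourth power is bounded by the exponential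
  of half the argument, which leaves a geometric series of ratio exp(-1/2) against the tail.\<close>

lemma m4_tail:
  assumes [measurable]: "f \<in> borel_measurable env" and "0 < s" and "\<And>e. 0 \<le> f e"
    and tail: "\<And>x. 0 \<le> x ==> emeasure env {e. x \<le> f e} \<le> ennreal (exp (- s * x))"
  shows "m4 f (C4 / s ^ 4)"
proof -
  have ev [measurable]: "{e. x \<le> f e} \<in> sets env" for x using assms(1) by (simp add: borel_measurable_iff_ge)
  have pt: "ennreal (f e ^ 4) \<le> (\<Sum>n. ennreal (4096 / s ^ 4 * exp ((real n + 1) / 2)) * indicator {e. real n / s \<le> f e} e)"
    (is "_ \<le> suminf ?h") for e
  proof -
    define n where "n = nat \<lfloor>s * f e\<rfloor>"
    have y: "0 \<le> s * f e" using assms(2) assms(3)[of e] by simp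
    have n: "real n \<le> s * f e" "s * f e \<le> real n + 1" using y unfolding n_def by linarith+
    have "(s * f e / 2) ^ 4 \<le> 256 * exp (s * f e / 2)" using y by (intro power4_le_exp) simp
    also have "\<dots> \<le> 256 * exp ((real n + 1) / 2)" using n by simp
    finally have "f e ^ 4 \<le> 4096 / s ^ 4 * exp ((real n + 1) / 2)"
      using \<open>0 < s\<close> by (simp add: power_mult_distrib power_divide field_simps)
    moreover have "real n / s \<le> f e" using n \<open>0 < s\<close> by (simp add: field_simps)
    ultimately have "ennreal (f e ^ 4) \<le> ?h n" by (simp add: ennreal_leI)
    also have "\<dots> \<le> suminf ?h"
    proof -
      have "h n \<le> suminf h" for h :: "nat => ennreal" using sum_le_suminf[of h "{n}"] by simp
      then show ?thesis .
    qed
    finally show ?thesis .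
  qed
  have geo: "summable (\<lambda>n. exp (- 1 / 2 :: real) ^ n)" "(\<Sum>n. exp (- 1 / 2 :: real) ^ n) = 1 / (1 - exp (- 1 / 2))"
    by (auto intro!: suminf_geometric summable_geometric)
  have "(\<bbbE>\<^sup>+ e. ennreal (f e ^ 4)) \<le>
      (\<bbbE>\<^sup>+ e. (\<Sum>n. ennreal (4096 / s ^ 4 * exp ((real n + 1) / 2)) * indicator {e. real n / s \<le> f e} e))"
    by (intro nn_integral_mono pt)
  also have "\<dots> = (\<Sum>n. (\<bbbE>\<^sup>+ e. ennreal (4096 / s ^ 4 * exp ((real n + 1) / 2)) * indicator {e. real n / s \<le> f e} e))"
    by (rule nn_integral_suminf) measurable
  also have "\<dots> = (\<Sum>n. ennreal (4096 / s ^ 4 * exp ((real n + 1) / 2)) * emeasure env {e. real n / s \<le> f e})"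
    by (intro suminf_cong nn_integral_cmult_indicator ev)
  also have "\<dots> \<le> (\<Sum>n. ennreal (4096 / s ^ 4 * exp (1 / 2) * exp (- 1 / 2) ^ n))"
  proof (intro suminf_le summableI)
    fix n
    have "ennreal (4096 / s ^ 4 * exp ((real n + 1) / 2)) * emeasure env {e. real n / s \<le> f e}
      \<le> ennreal (4096 / s ^ 4 * exp ((real n + 1) / 2)) * ennreal (exp (- s * (real n / s)))"
      using \<open>0 < s\<close> by (intro mult_left_mono tail) auto
    also have "\<dots> = ennreal (4096 / s ^ 4 * (exp ((real n + 1) / 2) * exp (- real n)))"
      using \<open>0 < s\<close> by (simp add: ennreal_mult'[symmetric])
    also have "exp ((real n + 1) / 2) * exp (- real n) = exp (1 / 2) * exp (- 1 / 2) ^ n"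
      by (simp add: exp_of_nat_mult[symmetric] exp_add[symmetric] field_simps)
    finally show "ennreal (4096 / s ^ 4 * exp ((real n + 1) / 2)) * emeasure env {e. real n / s \<le> f e}
      \<le> ennreal (4096 / s ^ 4 * exp (1 / 2) * exp (- 1 / 2) ^ n)" by (simp add: mult.assoc)
  qed
  also have "\<dots> = ennreal (\<Sum>n. 4096 / s ^ 4 * exp (1 / 2) * exp (- 1 / 2) ^ n)"
    using geo(1) by (intro suminf_ennreal2) (auto intro: summable_mult)
  also have "(\<Sum>n. 4096 / s ^ 4 * exp (1 / 2) * exp (- 1 / 2 :: real) ^ n) = C4 / s ^ 4"
    using geo by (subst suminf_mult) (auto simp: C4_def)
  finally show ?thesis by (simp add: m4_def)
qed

section \<open>Running maxima of sums of independent variables\<close>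

lemma nn_integral_expo_exp:
  assumes "c < 1"
  shows "(\<integral>\<^sup>+x. ennreal (exp (c * x)) \<partial>expo) = ennreal (1 / (1 - c))"
proof -
  have "ennreal 1 = (\<integral>\<^sup>+x. 1 \<partial>expo)" by simp
  also have "\<dots> = (\<integral>\<^sup>+x. ennreal ((1 - c) * exp (- (1 - c) * x)) * indicator {0..} x * 1 \<partial>lborel)"
    using assms by (intro nn_integral_expo_scale) auto
  also have "\<dots> = (\<integral>\<^sup>+x. ennreal (1 - c) * (ennreal (exp (- x)) * indicator {0..} x * ennreal (exp (c * x))) \<partial>lborel)"
    using assms by (intro nn_integral_cong)
      (auto simp: ennreal_mult'[symmetric] exp_add[symmetric] algebra_simps split: split_indicator)
  also have "\<dots> = ennreal (1 - c) * (\<integral>\<^sup>+x. ennreal (exp (c * x)) \<partial>expo)"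
    by (subst nn_integral_expo, simp, subst nn_integral_cmult) auto
  finally have "ennreal (1 / (1 - c)) * ennreal 1 = ennreal (1 / (1 - c)) * (ennreal (1 - c) * (\<integral>\<^sup>+x. ennreal (exp (c * x)) \<partial>expo))"
    by simp
  then show ?thesis using assms by (simp add: mult.assoc[symmetric] ennreal_mult'[symmetric])
qed

lemma nn_integral_expo_cmult_exp:
  assumes "u < 1" "0 \<le> c"
  shows "(\<integral>\<^sup>+x. ennreal c * ennreal (exp (u * x)) \<partial>expo) = ennreal (c / (1 - u))"
proof -
  have m: "(\<lambda>x. ennreal (exp (u * x))) \<in> borel_measurable expo" by measurable
  show ?thesis unfolding nn_integral_cmult[OF m] nn_integral_expo_exp[OF assms(1)]
    using assms by (simp add: ennreal_mult'[symmetric])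
qed

text \<open>A maximal inequality for the supermartingale exp(s S_k). In place of a stopping time,
  the first variable is resampled, and the other ones have to exceed the level reduced by it; hence
  p and x vary in the induction.\<close>

lemma partial_sums_tail:
  fixes p :: "nat => nat \<times> nat"
  assumes "0 < s" and [measurable]: "\<xi> \<in> borel_measurable borel"
    and mgf: "(\<integral>\<^sup>+x. ennreal (exp (s * \<xi> x)) \<partial>expo) \<le> 1"
    and inj: "inj_on p {..<K}"
  shows "emeasure env {e. \<exists>k\<le>K. x \<le> (\<Sum>i<k. \<xi> (e (p i)))} \<le> ennreal (exp (- s * x))"
  using inj
proof (induction K arbitrary: p x )
  case 0
  show ?case
  proof (cases "x \<le> 0")
    case True
    then have "1 \<le> exp (- s * x)" using \<open>0 < s\<close> by (simp add: mult_le_0_iff)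
    then have "ennreal 1 \<le> ennreal (exp (- s * x))" by (rule ennreal_leI)
    moreover have "emeasure env A \<le> ennreal 1" for A using env.emeasure_le_1[of A] by simp
    ultimately show ?thesis by (blast intro: order_trans)
  qed simp
next
  case (Suc K)
  show ?case
  proof (cases "x \<le> 0")
    case True
    then have "1 \<le> exp (- s * x)" using \<open>0 < s\<close> by (simp add: mult_le_0_iff)
    then have "ennreal 1 \<le> ennreal (exp (- s * x))" by (rule ennreal_leI)
    moreover have "emeasure env A \<le> ennreal 1" for A using env.emeasure_le_1[of A] by simp
    ultimately show ?thesis by (blast intro: order_trans)
  next
    case False
    interpret P: pair_sigma_finite expo env ..
    let ?A = "{e. \<exists>k\<le>Suc K. x \<le> (\<Sum>i<k. \<xi> (e (p i)))}"
    let ?B = "\<lambda>t. {e. \<exists>k\<le>K. x - \<xi> t \<le> (\<Sum>i<k. \<xi> (e (p (Suc i))))}"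
    have A [measurable]: "?A \<in> sets env" by (rule sets_env_Collect) measurable
    have sub: "e \<in> ?B t" if AA: "e(p 0 := t) \<in> ?A" for e t
    proof -
      obtain k where k: "k \<le> Suc K" "x \<le> (\<Sum>i<k. \<xi> ((e(p 0 := t)) (p i)))" using AA by auto
      \<comment> \<open>The level is positive here, which excludes the empty sum.\<close>
      then obtain k' where k': "k = Suc k'" using False by (cases k) auto
      have "(\<Sum>i<k. \<xi> ((e(p 0 := t)) (p i))) = \<xi> t + (\<Sum>i<k'. \<xi> ((e(p 0 := t)) (p (Suc i))))"
        unfolding k' sum.lessThan_Suc_shift by simp
      also have "(\<Sum>i<k'. \<xi> ((e(p 0 := t)) (p (Suc i)))) = (\<Sum>i<k'. \<xi> (e (p (Suc i))))"
      proof (intro sum.cong refl)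
        fix i assume "i \<in> {..<k'}"
        then have "p (Suc i) \<noteq> p 0" using inj_onD[OF Suc.prems, of "Suc i" 0] k k' by auto
        then show "\<xi> ((e(p 0 := t)) (p (Suc i))) = \<xi> (e (p (Suc i)))" by simp
      qed
      finally show ?thesis using k k' by (auto intro!: exI[of _ k'])
    qed
    have inj: "inj_on (\<lambda>i. p (Suc i)) {..<K}" using Suc.prems by (auto simp: inj_on_def)
    have "emeasure env ?A = (\<bbbE>\<^sup>+ e. \<integral>\<^sup>+t. indicator ?A (e(p 0 := t)) \<partial>expo)"
      by (subst nn_integral_env_update[symmetric]) auto
    also have "\<dots> = (\<integral>\<^sup>+t. (\<bbbE>\<^sup>+ e. indicator ?A (e(p 0 := t))) \<partial>expo)"
      by (rule P.Fubini') (auto simp: case_prod_beta')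
    also have "\<dots> \<le> (\<integral>\<^sup>+t. ennreal (exp (- s * (x - \<xi> t))) \<partial>expo)"
    proof (rule nn_integral_mono)
      fix t
      have [measurable]: "?B t \<in> sets env" by (rule sets_env_Collect) measurable
      have "(\<bbbE>\<^sup>+ e. indicator ?A (e(p 0 := t))) \<le> (\<bbbE>\<^sup>+ e. indicator (?B t) e)"
        using sub by (intro nn_integral_mono) (auto simp: indicator_def)
      also have "\<dots> \<le> ennreal (exp (- s * (x - \<xi> t)))" using Suc.IH[OF inj, of "x - \<xi> t"] by simp
      finally show "(\<bbbE>\<^sup>+ e. indicator ?A (e(p 0 := t))) \<le> ennreal (exp (- s * (x - \<xi> t)))" .
    qed
    also have "\<dots> = (\<integral>\<^sup>+t. ennreal (exp (- s * x)) * ennreal (exp (s * \<xi> t)) \<partial>expo)"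
      by (intro nn_integral_cong) (simp add: ennreal_mult'[symmetric] exp_add[symmetric] algebra_simps)
    also have "\<dots> = ennreal (exp (- s * x)) * (\<integral>\<^sup>+t. ennreal (exp (s * \<xi> t)) \<partial>expo)"
      by (rule nn_integral_cmult) measurable
    also have "\<dots> \<le> ennreal (exp (- s * x)) * 1" by (intro mult_left_mono mgf) simp
    finally show ?thesis by simp
  qed
qed

definition runmax :: "(nat => real) => nat => real" where
  "runmax \<xi> K = Max ((\<lambda>k. \<Sum>i<k. \<xi> i) ` {..K})"

lemma runmax_ge: "k \<le> K ==> (\<Sum>i<k. \<xi> i) \<le> runmax \<xi> K"
  unfolding runmax_def by (rule Max_ge) auto

lemma runmax_nonneg: "0 \<le> runmax \<xi> K"
  using runmax_ge[of 0 K \<xi>] by simp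

lemma le_runmax_iff: "x \<le> runmax \<xi> K \<longleftrightarrow> (\<exists>k\<le>K. x \<le> (\<Sum>i<k. \<xi> i))"
  unfolding runmax_def by (subst Max_ge_iff) auto

lemma m4_runmax:
  fixes p :: "nat => nat \<times> nat"
  assumes "0 < s" and [measurable]: "\<xi> \<in> borel_measurable borel"
    and mgf: "(\<integral>\<^sup>+x. ennreal (exp (s * \<xi> x)) \<partial>expo) \<le> 1"
    and inj: "inj_on p {..<K}"
  shows "m4 (\<lambda>e. runmax (\<lambda>i. \<xi> (e (p i))) K) (C4 / s ^ 4)"
proof (rule m4_tail)
  show "(\<lambda>e. runmax (\<lambda>i. \<xi> (e (p i))) K) \<in> borel_measurable env"
    unfolding borel_measurable_iff_ge le_runmax_iff by (intro allI) measurable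
  show "emeasure env {e. x \<le> runmax (\<lambda>i. \<xi> (e (p i))) K} \<le> ennreal (exp (- s * x))" for x
    unfolding le_runmax_iff by (rule partial_sums_tail[OF assms])
qed (use assms runmax_nonneg in auto)

text \<open>A drift \<theta> above the mean 1 / r by 2 s / r^2 pays for the second-order term, as
  -ln(1 - u) \<le> u + 2 u^2 for u \<le> 1/2.\<close>

lemma mgf_up:
  assumes "0 < r" "0 < s" "s \<le> r / 2" "1 / r + 2 * s / r\<^sup>2 \<le> \<theta>"
  shows "(\<integral>\<^sup>+x. ennreal (exp (s * (x / r - \<theta>))) \<partial>expo) \<le> 1"
proof -
  have u: "0 \<le> s / r" "s / r \<le> 1 / 2" using assms by (auto simp: field_simps)
  then have u1: "s / r < 1" by linarith
  have "(\<integral>\<^sup>+x. ennreal (exp (s * (x / r - \<theta>))) \<partial>expo) = (\<integral>\<^sup>+x. ennreal (exp (- s * \<theta>)) * ennreal (exp (s / r * x)) \<partial>expo)"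
    by (intro nn_integral_cong) (simp add: ennreal_mult'[symmetric] exp_add[symmetric] algebra_simps)
  also have "\<dots> = ennreal (exp (- s * \<theta>) / (1 - s / r))"
    using u1 by (intro nn_integral_expo_cmult_exp) simp_all
  also have "\<dots> = ennreal (exp (- s * \<theta> - ln (1 - s / r)))" using u1 by (subst exp_diff) simp
  also have "\<dots> \<le> ennreal (exp 0)"
  proof (intro ennreal_leI, subst exp_le_cancel_iff)
    have "- (s / r) - 2 * (s / r)\<^sup>2 \<le> ln (1 - s / r)" using u by (rule ln_one_minus_pos_lower_bound)
    moreover have "s * (1 / r + 2 * s / r\<^sup>2) \<le> s * \<theta>" using assms by (intro mult_left_mono) auto
    moreover have "s * (1 / r + 2 * s / r\<^sup>2) = s / r + 2 * (s / r)\<^sup>2"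
      using assms by (simp add: power2_eq_square field_simps)
    ultimately show "- s * \<theta> - ln (1 - s / r) \<le> 0" by simp
  qed
  finally show ?thesis by simp
qed

text \<open>For downward deviations ln(1 + u) \<ge> u - u^2 is enough, so the margin below the mean
  is s / r^2.\<close>

lemma mgf_down:
  assumes "0 < r" "0 < s" "s \<le> r" "\<theta> \<le> 1 / r - s / r\<^sup>2"
  shows "(\<integral>\<^sup>+x. ennreal (exp (s * (\<theta> - x / r))) \<partial>expo) \<le> 1"
proof -
  have u: "0 \<le> s / r" "s / r \<le> 1" using assms by (auto simp: field_simps)
  have "(\<integral>\<^sup>+x. ennreal (exp (s * (\<theta> - x / r))) \<partial>expo) = (\<integral>\<^sup>+x. ennreal (exp (s * \<theta>)) * ennreal (exp (- (s / r) * x)) \<partial>expo)"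
    by (intro nn_integral_cong) (simp add: ennreal_mult'[symmetric] exp_add[symmetric] algebra_simps)
  also have "\<dots> = ennreal (exp (s * \<theta>) / (1 - (- (s / r))))"
    using u by (intro nn_integral_expo_cmult_exp) simp_all
  also have "\<dots> = ennreal (exp (s * \<theta> - ln (1 + s / r)))" using u by (subst exp_diff) simp
  also have "\<dots> \<le> ennreal (exp 0)"
  proof (intro ennreal_leI, subst exp_le_cancel_iff)
    have "s / r - (s / r)\<^sup>2 \<le> ln (1 + s / r)" using u by (rule ln_one_plus_pos_lower_bound)
    moreover have "s * \<theta> \<le> s * (1 / r - s / r\<^sup>2)" using assms by (intro mult_left_mono) auto
    moreover have "s * (1 / r - s / r\<^sup>2) = s / r - (s / r)\<^sup>2"
      using assms by (simp add: power2_eq_square field_simps)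
    ultimately show "s * \<theta> - ln (1 + s / r) \<le> 0" by simp
  qed
  finally show ?thesis by simp
qed

text \<open>The increments along row y are, up to the factor 1 / (1 - \<rho>), coordinates of
  \<open>burke\<close>, so their partial sums are those of independent exponentials.\<close>

lemma m4_row:
  assumes \<rho>: "0 < \<rho>" "\<rho> < 1" and "y \<le> x"
    and s: "0 < s" "s \<le> (1 - \<rho>) / 2" and "1 / (1 - \<rho>) + 2 * s / (1 - \<rho>)\<^sup>2 \<le> \<theta>"
  shows "m4 (\<lambda>e. runmax (\<lambda>i. Ist \<rho> e (x + Suc i) y - \<theta>) K) (C4 / s ^ 4)"
proof -
  let ?\<Phi> = "burke \<rho> (x + K) y"
  have "Ist \<rho> e (x + Suc i) y = ?\<Phi> e (x + Suc i, 0) / (1 - \<rho>)" if "i < K" for e i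
    using burke_inv[OF \<rho>, of y "x + K" e] that \<rho> \<open>y \<le> x\<close> by simp
  then have "runmax (\<lambda>i. Ist \<rho> e (x + Suc i) y - \<theta>) K
      = runmax (\<lambda>i. ?\<Phi> e (x + Suc i, 0) / (1 - \<rho>) - \<theta>) K" for e
    unfolding runmax_def by (intro arg_cong[where f=Max] image_cong refl sum.cong) auto
  moreover have "m4 (\<lambda>e. runmax (\<lambda>i. e (x + Suc i, 0) / (1 - \<rho>) - \<theta>) K) (C4 / s ^ 4)"
    using \<rho> s assms by (intro m4_runmax[where p="\<lambda>i. (x + Suc i, 0)" and \<xi>="\<lambda>t. t / (1 - \<rho>) - \<theta>"] mgf_up)
      (auto simp: inj_on_def)
  ultimately show ?thesis using m4_preserving[OF _ preserving_burke[OF \<rho>]] by simp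
qed

lemma m4_col:
  assumes \<rho>: "0 < \<rho>" "\<rho> < 1" and "K \<le> y" "y \<le> x"
    and s: "0 < s" "s \<le> \<rho>" and "\<theta> \<le> 1 / \<rho> - s / \<rho>\<^sup>2"
  shows "m4 (\<lambda>e. runmax (\<lambda>i. \<theta> - Jst \<rho> e x (y - i)) K) (C4 / s ^ 4)"
proof -
  let ?\<Phi> = "burke \<rho> x y"
  have "Jst \<rho> e x (y - i) = ?\<Phi> e (x, y - i) / \<rho>" if "i < K" for e i
    using burke_inv[OF \<rho>, of y x e] that \<rho> assms by simp
  then have "runmax (\<lambda>i. \<theta> - Jst \<rho> e x (y - i)) K
      = runmax (\<lambda>i. \<theta> - ?\<Phi> e (x, y - i) / \<rho>) K" for e
    unfolding runmax_def by (intro arg_cong[where f=Max] image_cong refl sum.cong) auto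
  moreover have "m4 (\<lambda>e. runmax (\<lambda>i. \<theta> - e (x, y - i) / \<rho>) K) (C4 / s ^ 4)"
    using \<rho> s assms by (intro m4_runmax[where p="\<lambda>i. (x, y - i)" and \<xi>="\<lambda>t. \<theta> - t / \<rho>"] mgf_down)
      (auto simp: inj_on_def)
  ultimately show ?thesis using m4_preserving[OF _ preserving_burke[OF \<rho>]] by simp
qed

section \<open>Upper tails\<close>

text \<open>Weighting exp(1) by exp(c x) gives, up to total mass, the law exp(1 - c).\<close>

lemma nn_integral_expo_tilt:
  fixes f :: "real => ennreal"
  assumes [measurable]: "f \<in> borel_measurable borel" and c: "c < 1"
  shows "(\<integral>\<^sup>+x. f x * ennreal (exp (c * x)) \<partial>expo) = ennreal (1 / (1 - c)) * (\<integral>\<^sup>+x. f (x / (1 - c)) \<partial>expo)"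
proof -
  have "(\<integral>\<^sup>+x. f (x / (1 - c)) \<partial>expo)
      = (\<integral>\<^sup>+x. ennreal ((1 - c) * exp (- (1 - c) * x)) * indicator {0..} x * f x \<partial>lborel)"
    using c by (subst nn_integral_expo_scale[where r="1 - c"]) auto
  also have "\<dots> = (\<integral>\<^sup>+x. ennreal (1 - c) * (ennreal (exp (- x)) * indicator {0..} x * (f x * ennreal (exp (c * x)))) \<partial>lborel)"
  proof (intro nn_integral_cong)
    fix x :: real
    have "(1 - c) * exp (- (1 - c) * x) = (1 - c) * (exp (- x) * exp (c * x))"
      by (simp only: exp_add[symmetric]) (simp add: algebra_simps)
    then show "ennreal ((1 - c) * exp (- (1 - c) * x)) * indicator {0..} x * f x
      = ennreal (1 - c) * (ennreal (exp (- x)) * indicator {0..} x * (f x * ennreal (exp (c * x))))"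
      using c by (simp add: ennreal_mult' mult_ac)
  qed
  also have "\<dots> = ennreal (1 - c) * (\<integral>\<^sup>+x. f x * ennreal (exp (c * x)) \<partial>expo)"
    by (subst nn_integral_expo, simp, subst nn_integral_cmult) auto
  finally show ?thesis using c by (simp add: mult.assoc[symmetric] ennreal_mult'[symmetric])
qed

definition tilt :: "real => (nat \<times> nat) set => (nat \<times> nat => real) => nat \<times> nat => real" where
  "tilt c S e = (\<lambda>p. if p \<in> S then e p / (1 - c) else e p)"

lemma measurable_tilt [measurable]: "tilt c S \<in> measurable env env"
proof (rule measurable_into_env)
  show "(\<lambda>e. tilt c S e p) \<in> borel_measurable env" for p
    using measurable_env_component[of p] by (cases "p \<in> S") (auto simp: tilt_def)
qed

lemma nn_integral_env_tilt:
  fixes F :: "(nat \<times> nat => real) => ennreal"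
  assumes "finite S" and c: "c < 1" and F: "F \<in> borel_measurable env"
  shows "(\<bbbE>\<^sup>+ e. F e * ennreal (exp (c * (\<Sum>p\<in>S. e p))))
    = ennreal (1 / (1 - c)) ^ card S * (\<bbbE>\<^sup>+ e. F (tilt c S e))" using assms(1) F
proof (induction S arbitrary: F)
  case empty
  then show ?case by (simp add: tilt_def)
next
  case (insert p S)
  note [measurable] = insert.prems
  let ?F = "\<lambda>e. F (tilt c S e)"
  have [measurable]: "?F \<in> borel_measurable env" by (rule measurable_compose[OF measurable_tilt insert.prems])
  have [measurable]: "(\<lambda>e. e p) \<in> borel_measurable env" by (rule measurable_env_component)
  have "(\<bbbE>\<^sup>+ e. F e * ennreal (exp (c * (\<Sum>q\<in>insert p S. e q))))
     = (\<bbbE>\<^sup>+ e. (F e * ennreal (exp (c * e p))) * ennreal (exp (c * (\<Sum>q\<in>S. e q))))"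
    using insert.hyps by (intro nn_integral_cong) (simp add: distrib_left exp_add ennreal_mult' mult_ac)
  also have "\<dots> = ennreal (1 / (1 - c)) ^ card S * (\<bbbE>\<^sup>+ e. F (tilt c S e) * ennreal (exp (c * tilt c S e p)))"
    by (rule insert.IH) measurable
  also have "(\<bbbE>\<^sup>+ e. F (tilt c S e) * ennreal (exp (c * tilt c S e p)))
     = (\<bbbE>\<^sup>+ e. ?F e * ennreal (exp (c * e p)))" using insert.hyps by (simp add: tilt_def)
  also have "\<dots> = (\<bbbE>\<^sup>+ e. \<integral>\<^sup>+x. ?F (e(p := x)) * ennreal (exp (c * x)) \<partial>expo)"
    by (subst nn_integral_env_update[of _ p]) auto
  also have "\<dots> = (\<bbbE>\<^sup>+ e. ennreal (1 / (1 - c)) * (\<integral>\<^sup>+x. ?F (e(p := x / (1 - c))) \<partial>expo))"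
  proof (intro nn_integral_cong nn_integral_expo_tilt c)
    fix e
    have "(\<lambda>x. e(p := x)) \<in> measurable borel env" by measurable
    then show "(\<lambda>x. ?F (e(p := x))) \<in> borel_measurable borel" by (rule measurable_compose) measurable
  qed
  also have "\<dots> = ennreal (1 / (1 - c)) * (\<bbbE>\<^sup>+ e. \<integral>\<^sup>+x. ?F (e(p := x / (1 - c))) \<partial>expo)"
  proof (rule nn_integral_cmult)
    have "(\<lambda>z. (fst z)(p := snd z / (1 - c))) \<in> measurable (env \<Otimes>\<^sub>M expo) env" by measurable
    then have "(\<lambda>z. ?F ((fst z)(p := snd z / (1 - c)))) \<in> borel_measurable (env \<Otimes>\<^sub>M expo)"
      by (rule measurable_compose) measurable
    then show "(\<lambda>e. \<integral>\<^sup>+x. ?F (e(p := x / (1 - c))) \<partial>expo) \<in> borel_measurable env"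
      using expo.borel_measurable_nn_integral_fst[of "\<lambda>z. ?F ((fst z)(p := snd z / (1 - c)))" env] by simp
  qed
  also have "(\<bbbE>\<^sup>+ e. \<integral>\<^sup>+x. ?F (e(p := x / (1 - c))) \<partial>expo) = (\<bbbE>\<^sup>+ e. ?F (e(p := e p / (1 - c))))"
  proof -
    have "(\<lambda>e. e(p := e p / (1 - c))) \<in> measurable env env" by measurable
    then have "(\<lambda>e. ?F (e(p := e p / (1 - c)))) \<in> borel_measurable env"
      by (rule measurable_compose) measurable
    then show ?thesis by (subst nn_integral_env_update[of _ p]) auto
  qed
  also have "\<dots> = (\<bbbE>\<^sup>+ e. F (tilt c (insert p S) e))"
  proof -
    have "tilt c S (e(p := e p / (1 - c))) = tilt c (insert p S) e" for e
      using insert.hyps by (auto simp: tilt_def fun_eq_iff)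
    then show ?thesis by simp
  qed
  finally show ?case using insert.hyps by (simp add: mult_ac)
qed

text \<open>For \<open>s > 0\<close> the factor \<open>exp (s * G(N, 0))\<close> tilts the boundary row to the rate at which the
  model is stationary, and \<open>G(N, N) - G(N, 0)\<close> is then a sum of independent exponentials.\<close>

lemma G_mgf:
  assumes \<rho>: "0 < \<rho>" "\<rho> < 1" and r: "0 < r" "r < 1" and s: "s = r + \<rho> - 1" "0 < s"
  shows "(\<bbbE>\<^sup>+ e. ennreal (exp (s * G (1 / \<rho>) (1 / r) e N N)))
    = ennreal ((r * \<rho> / ((1 - \<rho>) * (1 - r))) ^ N)"
proof -
  let ?S = "(\<lambda>k. (k, 0::nat)) ` {1..N}" and ?T = "(\<lambda>j. (N, j)) ` {1..N}"
  let ?G = "G (1 / \<rho>) (1 / r)"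
  let ?F = "\<lambda>e. ennreal (exp (s * (?G e N N - ?G e N 0)))"
  have cS: "card ?S = N" "card ?T = N" by (auto simp: card_image inj_on_def)
  \<comment> \<open>Tilting by s lowers the boundary rate from r to r - s = 1 - \<rho>, the
    stationary one for diagonal rate \<rho>. In the same way \<rho> - s = 1 - r in the factor from
    column N.\<close>
  have c: "s / r < 1" "1 - s / r = (1 - \<rho>) / r" using r \<rho> s by (auto simp: field_simps)
  have d: "s / \<rho> < 1" "1 - s / \<rho> = (1 - r) / \<rho>" using r \<rho> s by (auto simp: field_simps)
  have "(\<bbbE>\<^sup>+ e. ennreal (exp (s * ?G e N N))) = (\<bbbE>\<^sup>+ e. ?F e * ennreal (exp (s / r * (\<Sum>p\<in>?S. e p))))"
  proof (intro nn_integral_cong)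
    fix e
    have "?G e N 0 = (\<Sum>p\<in>?S. e p) / r" by (simp add: G_row0 sum.reindex inj_on_def)
    then have "s * ?G e N N = s * (?G e N N - ?G e N 0) + s / r * (\<Sum>p\<in>?S. e p)" by (simp add: algebra_simps)
    then show "ennreal (exp (s * ?G e N N)) = ?F e * ennreal (exp (s / r * (\<Sum>p\<in>?S. e p)))"
      by (simp add: exp_add ennreal_mult')
  qed
  also have "\<dots> = ennreal (1 / (1 - s / r)) ^ N * (\<bbbE>\<^sup>+ e. ?F (tilt (s / r) ?S e))"
    using c by (subst nn_integral_env_tilt) (simp_all add: cS del: One_nat_def)
  also have "(\<bbbE>\<^sup>+ e. ?F (tilt (s / r) ?S e)) = (\<bbbE>\<^sup>+ e. 1 * ennreal (exp (s / \<rho> * (\<Sum>p\<in>?T. burke \<rho> N N e p))))"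
  proof (intro nn_integral_cong)
    fix e
    have "?G (tilt (s / r) ?S e) i j = G (1 / \<rho>) (1 / (1 - \<rho>)) e i j" if "j \<le> i" "i \<le> N" for i j
      using that
    proof (induction i j rule: shifted_induct)
      case (row i)
      have "(\<Sum>k=1..i. tilt (s / r) ?S e (k, 0)) = (\<Sum>k=1..i. e (k, 0)) / ((1 - \<rho>) / r)"
        unfolding sum_divide_distrib using row by (intro sum.cong) (auto simp: tilt_def c)
      then show ?case using r by (simp only: G_row0) simp
    next
      case (diag i)
      then show ?case by (auto simp: tilt_def)
    next
      case (step i j)
      then show ?case by (auto simp: tilt_def)
    qed
    then have "?G (tilt (s / r) ?S e) N N - ?G (tilt (s / r) ?S e) N 0 = (\<Sum>j\<in>{0<..N}. Jst \<rho> e N j)"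
      using G_sum_Jnc[of 0 N "1 / \<rho>" "1 / (1 - \<rho>)" e N] by simp
    also have "\<dots> = (\<Sum>j\<in>{1..N}. burke \<rho> N N e (N, j) / \<rho>)"
      using burke_inv[OF \<rho>, of N N e] \<rho> by (intro sum.cong) auto
    also have "\<dots> = (\<Sum>p\<in>?T. burke \<rho> N N e p) / \<rho>"
      by (simp add: sum.reindex inj_on_def sum_divide_distrib)
    finally show "?F (tilt (s / r) ?S e) = 1 * ennreal (exp (s / \<rho> * (\<Sum>p\<in>?T. burke \<rho> N N e p)))"
      by (simp del: sum_divide_distrib)
  qed
  also have "\<dots> = (\<bbbE>\<^sup>+ e. 1 * ennreal (exp (s / \<rho> * (\<Sum>p\<in>?T. e p))))"
    by (rule preserving_nn_integral[OF preserving_burke[OF \<rho>]]) measurable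
  also have "\<dots> = ennreal (1 / (1 - s / \<rho>)) ^ N"
    using d by (subst nn_integral_env_tilt) (simp_all add: cS del: One_nat_def)
  also have "ennreal (1 / (1 - s / r)) ^ N * ennreal (1 / (1 - s / \<rho>)) ^ N = ennreal ((r * \<rho> / ((1 - \<rho>) * (1 - r))) ^ N)"
    using c d r \<rho> by (simp add: ennreal_power ennreal_mult'[symmetric] power_mult_distrib[symmetric])
  finally show ?thesis .
qed

text \<open>The log-odds of the rate 1/2 + x. The logarithm of the base in \<open>G_mgf\<close> is
  the sum of the log-odds of r and \<rho>.\<close>

definition rate_ln :: "real => real" where
  "rate_ln x = ln (1 / 2 + x) - ln (1 / 2 - x)"

lemma rate_ln_deriv:
  assumes "\<bar>x\<bar> < 1 / 2"
  shows "(rate_ln has_real_derivative 1 / (1 / 4 - x\<^sup>2)) (at x)"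
proof -
  have "(1 / 2 + x) * (1 / 2 - x) = 1 / 4 - x\<^sup>2" by (simp add: power2_eq_square algebra_simps)
  moreover have "1 / (1 / 2 + x) + 1 / (1 / 2 - x) = (1 * (1 / 2 - x) + 1 * (1 / 2 + x)) / ((1 / 2 + x) * (1 / 2 - x))"
    using assms by (intro add_frac_eq) auto
  ultimately have "1 / (1 / 2 + x) + 1 / (1 / 2 - x) = 1 / (1 / 4 - x\<^sup>2)" by simp
  moreover have "(rate_ln has_real_derivative 1 / (1 / 2 + x) + 1 / (1 / 2 - x)) (at x)"
    using assms unfolding rate_ln_def[abs_def] by (auto intro!: derivative_eq_intros)
  ultimately show ?thesis by simp
qed

text \<open>The linear term 4 x matches the centring 4 N exactly. The remainder is cubic, hence
  bounded after multiplication by N when x is of order N^(-1/3).\<close>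

lemma rate_ln_bounds:
  assumes "0 \<le> x" "x \<le> 1 / 4"
  shows "4 * x \<le> rate_ln x" "rate_ln x \<le> 4 * x + 8 * x ^ 3"
proof -
  have r0: "rate_ln 0 = 0" by (simp add: rate_ln_def)
  have "(\<lambda>x. rate_ln x - 4 * x) 0 \<le> (\<lambda>x. rate_ln x - 4 * x) x"
  proof (rule DERIV_nonneg_imp_nondecreasing[OF assms(1)])
    fix y assume y: "0 \<le> y" "y \<le> x"
    then have y': "\<bar>y\<bar> < 1 / 2" using assms by auto
    then have "y\<^sup>2 < (1 / 2)\<^sup>2" using y by (intro power_strict_mono) auto
    then have "4 \<le> 1 / (1 / 4 - y\<^sup>2)" by (simp add: field_simps power2_eq_square)
    then show "\<exists>z. ((\<lambda>x. rate_ln x - 4 * x) has_real_derivative z) (at y) \<and> 0 \<le> z"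
      by (intro exI[of _ "1 / (1 / 4 - y\<^sup>2) - 4"]) (auto intro!: derivative_eq_intros rate_ln_deriv y')
  qed
  then show "4 * x \<le> rate_ln x" by (simp add: r0)
  have "(\<lambda>x. 4 * x + 8 * x ^ 3 - rate_ln x) 0 \<le> (\<lambda>x. 4 * x + 8 * x ^ 3 - rate_ln x) x"
  proof (rule DERIV_nonneg_imp_nondecreasing[OF assms(1)])
    fix y assume y: "0 \<le> y" "y \<le> x"
    then have y': "\<bar>y\<bar> < 1 / 2" using assms by auto
    have y2: "y\<^sup>2 \<le> (1 / 4)\<^sup>2" using y assms by (intro power_mono) auto
    have "1 \<le> (4 + 24 * y\<^sup>2) * (1 / 4 - y\<^sup>2)"
    proof -
      have "0 \<le> y\<^sup>2 * (2 - 24 * y\<^sup>2)"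
        using y2 by (intro mult_nonneg_nonneg) (auto simp: power2_eq_square)
      then show ?thesis by (simp add: algebra_simps power2_eq_square)
    qed
    then have "1 / (1 / 4 - y\<^sup>2) \<le> 4 + 24 * y\<^sup>2"
      using y2 by (subst pos_divide_le_eq) (auto simp: power2_eq_square)
    then show "\<exists>z. ((\<lambda>x. 4 * x + 8 * x ^ 3 - rate_ln x) has_real_derivative z) (at y) \<and> 0 \<le> z"
      by (intro exI[of _ "4 + 24 * y\<^sup>2 - 1 / (1 / 4 - y\<^sup>2)"])
        (auto intro!: derivative_eq_intros rate_ln_deriv y' simp: power2_eq_square)
  qed
  then show "rate_ln x \<le> 4 * x + 8 * x ^ 3" by (simp add: r0)
qed

abbreviation Gpp :: "real => (nat \<times> nat => real) => nat => nat => real" where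
  "Gpp a \<equiv> G (1 / (1 / 2 + a)) 0"

abbreviation Gst :: "real => (nat \<times> nat => real) => nat => nat => real" where
  "Gst a \<equiv> G (1 / (1 / 2 + a)) (1 / (1 / 2 - a))"

lemma pp_upper_tail:
  assumes h: "0 < h" "h \<le> 1 / 8" and H: "real N * h ^ 3 \<le> H"
  shows "m4 (\<lambda>e. max 0 (Gpp (- h) e N N - 4 * real N)) (256 * exp (64 * H) / h ^ 4)"
proof (rule m4_exp)
  \<comment> \<open>With these rates r + \<rho> - 1 = h, so \<open>G_mgf\<close> gives the
    exponential moment at s = h. Adding a boundary row with multiplier 1 / r only increases the
    time.\<close>
  let ?\<rho> = "1 / 2 - h" and ?r = "1 / 2 + 2 * h"
  let ?q = "?r * ?\<rho> / ((1 - ?\<rho>) * (1 - ?r))"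
  have q: "0 < ?q" "ln ?q = rate_ln (2 * h) - rate_ln h" using h by (auto simp: rate_ln_def ln_div ln_mult)
  have "(\<bbbE>\<^sup>+ e. ennreal (exp (h * (Gpp (- h) e N N - 4 * real N))))
    \<le> (\<bbbE>\<^sup>+ e. ennreal (exp (- 4 * real N * h)) * ennreal (exp (h * G (1 / ?\<rho>) (1 / ?r) e N N)))"
  proof (rule nn_integral_mono_AE)
    show "AE e in env. ennreal (exp (h * (Gpp (- h) e N N - 4 * real N)))
      \<le> ennreal (exp (- 4 * real N * h)) * ennreal (exp (h * G (1 / ?\<rho>) (1 / ?r) e N N))" using AE_env_pos
    proof eventually_elim
      case (elim e)
      have "Gpp (- h) e N N \<le> G (1 / ?\<rho>) (1 / ?r) e N N" using elim h by (intro G_mono_params) auto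
      then have "h * Gpp (- h) e N N \<le> h * G (1 / ?\<rho>) (1 / ?r) e N N" using h by (intro mult_left_mono) auto
      then show ?case by (simp add: ennreal_mult'[symmetric] exp_add[symmetric] algebra_simps)
    qed
  qed
  also have "\<dots> = ennreal (exp (- 4 * real N * h)) * ennreal (?q ^ N)"
    using h by (subst nn_integral_cmult, simp, subst G_mgf) auto
  also have "\<dots> = ennreal (exp (- 4 * real N * h + real N * ln ?q))"
  proof -
    have "exp (real N * ln ?q) = ?q ^ N" unfolding exp_of_nat_mult exp_ln[OF q(1)] ..
    then show ?thesis by (simp only: exp_add ennreal_mult'[OF exp_ge_zero])
  qed
  also have "\<dots> \<le> ennreal (exp (64 * H))"
  proof (intro ennreal_leI, subst exp_le_cancel_iff)
    have "ln ?q \<le> 4 * h + 64 * h ^ 3" unfolding q using rate_ln_bounds(1)[of h] rate_ln_bounds(2)[of "2 * h"] h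
      by (simp add: power_mult_distrib)
    then have "real N * ln ?q \<le> real N * (4 * h + 64 * h ^ 3)" by (intro mult_left_mono) auto
    then show "- 4 * real N * h + real N * ln ?q \<le> 64 * H" using H by (simp add: algebra_simps)
  qed
  finally show "(\<bbbE>\<^sup>+ e. ennreal (exp (h * (Gpp (- h) e N N - 4 * real N)))) \<le> ennreal (exp (64 * H))" .
qed (use h in \<open>auto\<close>)

section \<open>Exit from the boundary row\<close>

lemma sum_down: "q \<le> n ==> (\<Sum>k\<in>{n - q<..n}. f k) = (\<Sum>i<q. f (n - i))" for f :: "nat => real"
  by (rule sum.reindex_bij_witness[of _ "\<lambda>i. n - i" "\<lambda>k. n - k"]) auto

lemma sum_up: "(\<Sum>k\<in>{x<..x + q}. f k) = (\<Sum>i<q. f (x + Suc i))" for f :: "nat => real"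
  by (rule sum.reindex_bij_witness[of _ "\<lambda>i. x + Suc i" "\<lambda>k. k - Suc x"]) auto

text \<open>A path leaves row 0 at some x. Row 0 contributes at most \<theta> x plus a running
  maximum. Lowering the end point of the reflected time by x - 1 along column N costs at least
  \<theta> (x - 1) minus a running maximum, by comparison with a model with boundary multiplier
  \<beta>'. The extra \<theta> is the difference between x and x - 1.\<close>

lemma G_exit_bound:
  assumes e: "nonneg e" and "0 \<le> \<alpha>" "0 \<le> \<beta>'" "1 \<le> N" "0 \<le> \<theta>"
  shows "G \<alpha> \<beta> e N N \<le> G \<alpha> 0 (rev_env N e) N N + runmax (\<lambda>i. \<beta> * e (Suc i, 0) - \<theta>) N
    + runmax (\<lambda>i. \<theta> - Jnc \<alpha> \<beta>' (rev_env N e) N (N - i)) N + \<theta>"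
    (is "_ \<le> ?B")
\<comment> \<open>\<open>Out\<close> is the whole triangle, so the exit to row 0 is the only place
  where the bound has to be shown.\<close>
proof (rule G_cut_bound[where Out="{(x, y). 1 \<le> y \<and> y \<le> x \<and> x \<le> N}"])
  fix x y assume xy: "(x, y) \<in> {(x, y). 1 \<le> y \<and> y \<le> x \<and> x \<le> N}"
  let ?e' = "rev_env N e"
  have "G \<alpha> \<beta> e x 0 + G \<alpha> 0 ?e' N (N + 1 - x) \<le> ?B"
  proof -
    have "1 \<le> x" "x \<le> N" using xy by auto
    then have eq: "N + 1 - x = N - (x - 1)" by simp
    have "G \<alpha> \<beta> e x 0 = (\<Sum>i<x. \<beta> * e (Suc i, 0) - \<theta>) + \<theta> * real x"
      using sum_up[where x=0 and q=x and f="\<lambda>k. \<beta> * e (k, 0)"]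
      by (simp add: G_row0 sum_distrib_left sum_subtractf atLeastSucAtMost_greaterThanAtMost)
    also have "\<dots> \<le> runmax (\<lambda>i. \<beta> * e (Suc i, 0) - \<theta>) N + \<theta> * real x"
      using \<open>x \<le> N\<close> by (intro add_right_mono runmax_ge)
    finally have 1: "G \<alpha> \<beta> e x 0 \<le> runmax (\<lambda>i. \<beta> * e (Suc i, 0) - \<theta>) N + \<theta> * real x" .
    have "G \<alpha> 0 ?e' N N = G \<alpha> 0 ?e' N (N + 1 - x) + (\<Sum>i<x - 1. Jnc \<alpha> 0 ?e' N (N - i))"
      using G_sum_Jnc[of "N - (x - 1)" N \<alpha> 0 ?e' N] \<open>x \<le> N\<close> unfolding eq by (simp add: sum_down)
    moreover have "(\<Sum>i<x - 1. Jnc \<alpha> \<beta>' ?e' N (N - i)) \<le> (\<Sum>i<x - 1. Jnc \<alpha> 0 ?e' N (N - i))"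
      using assms \<open>x \<le> N\<close> by (intro sum_mono Jnc_compare nonneg_rev_env) auto
    moreover have "(\<Sum>i<x - 1. \<theta> - Jnc \<alpha> \<beta>' ?e' N (N - i)) \<le> runmax (\<lambda>i. \<theta> - Jnc \<alpha> \<beta>' ?e' N (N - i)) N"
      using \<open>x \<le> N\<close> by (intro runmax_ge) auto
    ultimately have "G \<alpha> 0 ?e' N (N + 1 - x) \<le> G \<alpha> 0 ?e' N N
        + runmax (\<lambda>i. \<theta> - Jnc \<alpha> \<beta>' ?e' N (N - i)) N - \<theta> * real (x - 1)"
      by (simp add: sum_subtractf mult.commute)
    moreover have "\<theta> * real (x - 1) = \<theta> * real x - \<theta>"
      using \<open>1 \<le> x\<close> by (simp add: of_nat_diff algebra_simps)
    ultimately show ?thesis using 1 by linarith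
  qed
  then show "G \<alpha> \<beta> e x y + G \<alpha> 0 (rev_env N e) (N + 1 - y) (N + 1 - x) \<le> ?B \<or>
      (y < x \<longrightarrow> (x - 1, y) \<in> {(x, y). 1 \<le> y \<and> y \<le> x \<and> x \<le> N}) \<and>
      (if y = 1 then (y < x \<and> G \<alpha> \<beta> e x 0 \<le> G \<alpha> \<beta> e (x - 1) 1) \<or>
          G \<alpha> \<beta> e x 0 + G \<alpha> 0 (rev_env N e) N (N + 1 - x) \<le> ?B
        else (x, y - 1) \<in> {(x, y). 1 \<le> y \<and> y \<le> x \<and> x \<le> N})" using xy by auto
qed (use assms in auto)

text \<open>The stationary time is compared with the point-to-point one of diagonal rate 1/2 - h,
  whose vertical increments dominate stationary ones of larger mean. As |a| \<le> h / 2, the slope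
  \<theta> fits between the boundary mean 1 / (1/2 - a) and the vertical mean 1 / (1/2 - h) with
  room of order h on both sides. The constant C depends on H only.\<close>

lemma st_upper_tail:
  obtains C where "0 \<le> C"
    "\<And>N h a. 1 \<le> N ==> 0 < h ==> h \<le> 1 / 8 ==> real N * h ^ 3 \<le> H ==> \<bar>a\<bar> \<le> h / 2 ==>
      m4 (\<lambda>e. max 0 (Gst a e N N - 4 * real N)) (C / h ^ 4)"
proof
  let ?K = "C4 * 10 ^ 4"
  let ?C = "8 * (8 * (8 * (256 * exp (64 * H) + ?K) + ?K) + 1)"
  show "0 \<le> ?C" using C4_pos by simp
  fix N :: nat and h a :: real
  assume N: "1 \<le> N" and h: "0 < h" "h \<le> 1 / 8" and H: "real N * h ^ 3 \<le> H" and a: "\<bar>a\<bar> \<le> h / 2"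
  \<comment> \<open>The gap between the two means is at least 2 h = 20 s. The exponential moments on
    its two sides use up (512/49) s and (64/9) s, together less than 18 s.\<close>
  define s where "s = h / 10"
  define \<theta> where "\<theta> = 1 / (1 / 2 - a) + 2 * s / (1 / 2 - a)\<^sup>2"
  have a7: "7 / 16 \<le> 1 / 2 - a" using a h by auto
  have sq: "(7 / 16)\<^sup>2 \<le> (1 / 2 - a)\<^sup>2" using a7 by (intro power_mono) auto
  have sqh: "(3 / 8)\<^sup>2 \<le> (1 / 2 - h)\<^sup>2" using h by (intro power_mono) auto
  have s: "0 < s" "s \<le> 1 / 80" using h by (auto simp: s_def)
  have \<theta>0: "0 \<le> \<theta>" "\<theta> \<le> 4"
  proof -
    have "1 / (1 / 2 - a) \<le> 1 / (7 / 16)" using a7 by (intro divide_left_mono) auto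
    moreover have "2 * s / (1 / 2 - a)\<^sup>2 \<le> (1 / 40) / (7 / 16)\<^sup>2"
      using sq s a7 by (intro frac_le) auto
    ultimately show "\<theta> \<le> 4" unfolding \<theta>_def by (simp add: power2_eq_square)
    show "0 \<le> \<theta>" unfolding \<theta>_def using s a7 by auto
  qed
  have \<theta>1: "\<theta> \<le> 1 / (1 / 2 - h) - s / (1 / 2 - h)\<^sup>2"
  proof -
    have "2 * s / (1 / 2 - a)\<^sup>2 \<le> 2 * s / (7 / 16)\<^sup>2" using sq s a7 by (intro divide_left_mono) auto
    moreover have "s / (1 / 2 - h)\<^sup>2 \<le> s / (3 / 8)\<^sup>2" using sqh s h by (intro divide_left_mono) auto
    moreover have "2 * h \<le> 1 / (1 / 2 - h) - 1 / (1 / 2 - a)"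
    proof -
      have "(1 / 2 - h) * (1 / 2 - a) \<le> (1 / 2 - h) * (1 / 2 + h)" using a h by (intro mult_left_mono) auto
      also have "\<dots> \<le> 1 / 4" by (simp add: algebra_simps)
      finally have p: "(1 / 2 - h) * (1 / 2 - a) \<le> 1 / 4" .
      have "2 * h \<le> (h - a) / (1 / 4)" using a by auto
      also have "\<dots> \<le> (h - a) / ((1 / 2 - h) * (1 / 2 - a))" using p a h a7 by (intro divide_left_mono) auto
      also have "\<dots> = 1 / (1 / 2 - h) - 1 / (1 / 2 - a)" using h a7 by (subst diff_frac_eq) auto
      finally show ?thesis .
    qed
    moreover have "2 * s / (7 / 16)\<^sup>2 = 2 * s * (256 / 49)" "s / (3 / 8)\<^sup>2 = s * (64 / 9)" "h = 10 * s"
      by (simp_all add: power2_eq_square s_def)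
    ultimately show ?thesis unfolding \<theta>_def using s by linarith
  qed
  let ?W1 = "\<lambda>e. runmax (\<lambda>i. 1 / (1 / 2 - a) * e (Suc i, 0) - \<theta>) N"
  let ?W2 = "\<lambda>e. runmax (\<lambda>i. \<theta> - Jst (1 / 2 - h) e N (N - i)) N"
  let ?P = "\<lambda>e. max 0 (Gpp (- h) e N N - 4 * real N)"
  have m1: "m4 ?W1 (?K / h ^ 4)"
  proof -
    have "m4 ?W1 (C4 / s ^ 4)" using s a7 unfolding times_divide_eq_left mult_1_left
      by (intro m4_runmax[where p="\<lambda>i. (Suc i, 0)" and \<xi>="\<lambda>t. t / (1 / 2 - a) - \<theta>"] mgf_up)
        (auto simp: inj_on_def \<theta>_def)
    then show ?thesis by (simp add: s_def power_divide)
  qed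
  have m2: "m4 ?W2 (?K / h ^ 4)"
  proof -
    have "m4 ?W2 (C4 / s ^ 4)" using s h \<theta>1 by (intro m4_col) auto
    then show ?thesis by (simp add: s_def power_divide)
  qed
  have m0: "m4 ?P (256 * exp (64 * H) / h ^ 4)" by (rule pp_upper_tail[OF h H])
  have m3: "m4 (\<lambda>e. \<theta>) (1 / h ^ 4)"
  proof (rule m4_mono[OF m4_const])
    have "\<theta> ^ 4 \<le> 4 ^ 4" using \<theta>0 by (intro power_mono) auto
    also have "\<dots> \<le> 1 / (1 / 8) ^ 4" by (simp add: power_divide)
    also have "\<dots> \<le> 1 / h ^ 4" using h by (intro divide_left_mono power_mono) auto
    finally show "\<theta> ^ 4 \<le> 1 / h ^ 4" .
  qed
  have "m4 (\<lambda>e. ?P (rev_env N e) + ?W2 (rev_env N e) + ?W1 e + \<theta>)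
     (8 * (8 * (8 * (256 * exp (64 * H) / h ^ 4 + ?K / h ^ 4) + ?K / h ^ 4) + 1 / h ^ 4))"
    using C4_pos h by (intro m4_add m1 m3 m4_preserving[OF m2] m4_preserving[OF m0] preserving_rev_env) auto
  then have m: "m4 (\<lambda>e. ?P (rev_env N e) + ?W2 (rev_env N e) + ?W1 e + \<theta>) (?C / h ^ 4)"
    by (simp add: add_divide_distrib[symmetric])
  show "m4 (\<lambda>e. max 0 (Gst a e N N - 4 * real N)) (?C / h ^ 4)"
  proof (rule m4_dom[OF m])
    show "AE e in env. \<bar>max 0 (Gst a e N N - 4 * real N)\<bar> \<le> \<bar>?P (rev_env N e) + ?W2 (rev_env N e) + ?W1 e + \<theta>\<bar>"
      using AE_env_pos
    proof eventually_elim
      case (elim e)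
      have "1 / (1 / 2 + a) \<le> 1 / (1 / 2 - h)" using a h by (intro divide_left_mono) auto
      then have "Gst a e N N \<le> G (1 / (1 / 2 - h)) (1 / (1 / 2 - a)) e N N"
        using elim by (intro G_mono_params) auto
      also have "\<dots> \<le> Gpp (- h) (rev_env N e) N N + ?W1 e + ?W2 (rev_env N e) + \<theta>"
        using G_exit_bound[OF elim, of "1 / (1 / 2 - h)" "1 / (1 - (1 / 2 - h))" N \<theta> "1 / (1 / 2 - a)"] h N \<theta>0
        by simp
      finally have "Gst a e N N - 4 * real N \<le> ?P (rev_env N e) + ?W2 (rev_env N e) + ?W1 e + \<theta>"
        by linarith
      moreover have "0 \<le> ?P (rev_env N e) + ?W2 (rev_env N e) + ?W1 e + \<theta>"
        using \<theta>0 runmax_nonneg by (intro add_nonneg_nonneg) auto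
      ultimately show ?case by simp
    qed
  qed measurable
qed

section \<open>Lower tail\<close>

definition cbrt :: "nat => real" where
  "cbrt N = real N powr (1 / 3)"

lemma cbrt_pos: "1 \<le> N ==> 0 < cbrt N" by (simp add: cbrt_def)

lemma cbrt_nonneg: "0 \<le> cbrt N" by (simp add: cbrt_def)

lemma cbrt_cube: "cbrt N ^ 3 = real N"
  by (cases "N = 0") (simp_all add: cbrt_def powr_realpow[symmetric] powr_powr)

lemma cbrt_mono: "n \<le> m ==> cbrt n \<le> cbrt m"
  by (simp add: cbrt_def powr_mono2)

text \<open>With y = x / s: below \<eta> the power is at most \<eta>, above 1 / \<eta> it is at most
  \<eta> y^4, and in between it is at most 1 / \<eta>^3 on an event that tightness makes
  rare.\<close>

lemma moment_split:
  fixes x s \<eta> :: real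
  assumes "0 \<le> x" "0 < s" "0 < \<eta>" "\<eta> \<le> 1" and p: "1 \<le> p" "p \<le> 3"
  shows "x ^ p \<le> s ^ p * (\<eta> + \<eta> / s ^ 4 * x ^ 4 + (if \<eta> * s < x then 1 / \<eta> ^ 3 else 0))"
proof -
  define y where "y = x / s"
  have y: "0 \<le> y" "x = y * s" using assms by (auto simp: y_def)
  have "y ^ p \<le> \<eta> + \<eta> * y ^ 4 + (if \<eta> < y then 1 / \<eta> ^ 3 else 0)"
  proof (cases "\<eta> < y")
    case False
    have "y ^ p \<le> y ^ 1" using False assms y by (intro power_decreasing) auto
    moreover have "0 \<le> \<eta> * y ^ 4" using assms y by simp
    ultimately show ?thesis using False by simp
  next
    case True
    show ?thesis
    proof (cases "1 / \<eta> \<le> y")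
      case big: True
      then have "1 \<le> \<eta> * y" using assms by (simp add: field_simps)
      have "1 \<le> y" using big assms by (metis divide_le_eq_1_pos le_divide_eq_1_pos order_trans)
      then have "y ^ p \<le> y ^ 3" using p by (intro power_increasing) auto
      also have "y ^ 3 = 1 * y ^ 3" by simp
      also have "\<dots> \<le> (\<eta> * y) * y ^ 3" using \<open>1 \<le> \<eta> * y\<close> y by (intro mult_right_mono) auto
      also have "\<dots> = \<eta> * y ^ 4" by (simp add: power3_eq_cube power4_eq_xxxx)
      finally show ?thesis using assms by (simp add: add_increasing2 add_increasing)
    next
      case False
      have "y ^ p \<le> max 1 y ^ p" using y by (intro power_mono) auto
      also have "\<dots> \<le> max 1 y ^ 3" using p by (intro power_increasing) auto
      also have "\<dots> \<le> (1 / \<eta>) ^ 3" using False assms by (intro power_mono) auto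
      finally have "y ^ p \<le> 1 / \<eta> ^ 3" by (simp add: power_one_over)
      moreover have "0 \<le> \<eta> + \<eta> * y ^ 4" using assms y by simp
      ultimately show ?thesis using True by simp
    qed
  qed
  then have "y ^ p * s ^ p \<le> (\<eta> + \<eta> * y ^ 4 + (if \<eta> < y then 1 / \<eta> ^ 3 else 0)) * s ^ p"
    using assms by (intro mult_right_mono) auto
  moreover have "\<eta> * s < x \<longleftrightarrow> \<eta> < y" using assms by (simp add: y)
  moreover have "\<eta> / s ^ 4 * x ^ 4 = \<eta> * y ^ 4" using assms by (simp add: y power_mult_distrib)
  moreover have "y ^ p * s ^ p = x ^ p" by (simp add: y(2) power_mult_distrib)
  ultimately show ?thesis by (simp only: mult.commute[of "s ^ p"])
qed

text \<open>Given tightness at level \<eta> s, the moments of orders 1 to 3 gain a factor of order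
  \<eta> over what the fourth moment alone provides. This is what defeats the cross terms in the
  halving argument.\<close>

lemma moments_small:
  assumes X: "m4 X (s ^ 4)" "\<And>e. 0 \<le> X e" and s: "0 < s" and \<eta>: "0 < \<eta>" "\<eta> \<le> 1"
    and tight: "env.prob {e. \<eta> * s < X e} \<le> \<eta> ^ 4" and p: "1 \<le> p" "p \<le> 3"
  shows "(\<bbbE> e. X e ^ p) \<le> 3 * \<eta> * s ^ p"
proof -
  note [measurable] = m4_measurable[OF X(1)]
  have m: "{e. \<eta> * s < X e} \<in> sets env" by (rule sets_env_Collect) measurable
  let ?I = "indicator {e. \<eta> * s < X e} :: _ => real"
  have i4: "integrable env (\<lambda>e. X e ^ 4)" by (rule m4_integrable4[OF X(1)])
  have iI: "integrable env ?I" using m by (simp add: env.emeasure_eq_measure)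
  have "(\<bbbE> e. X e ^ p) \<le> (\<bbbE> e. s ^ p * (\<eta> + \<eta> / s ^ 4 * X e ^ 4 + 1 / \<eta> ^ 3 * ?I e))"
  proof (rule integral_mono)
    show "integrable env (\<lambda>e. X e ^ p)" using m4_integrable_power[OF X(1)] p by simp
    show "integrable env (\<lambda>e. s ^ p * (\<eta> + \<eta> / s ^ 4 * X e ^ 4 + 1 / \<eta> ^ 3 * ?I e))"
      using i4 iI by simp
    show "X e ^ p \<le> s ^ p * (\<eta> + \<eta> / s ^ 4 * X e ^ 4 + 1 / \<eta> ^ 3 * ?I e)" for e
      using moment_split[OF X(2)[of e] s \<eta> p] by (simp add: indicator_def split: if_splits)
  qed
  also have "\<dots> = s ^ p * (\<eta> + \<eta> / s ^ 4 * (\<bbbE> e. X e ^ 4) + 1 / \<eta> ^ 3 * env.prob {e. \<eta> * s < X e})"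
    using i4 iI env.prob_space by (simp add: m)
  also have "\<dots> \<le> s ^ p * (\<eta> + \<eta> / s ^ 4 * s ^ 4 + 1 / \<eta> ^ 3 * \<eta> ^ 4)"
    using s \<eta> tight m4_integral4[OF X(1)] by (intro mult_left_mono add_mono mult_left_mono) auto
  also have "\<dots> = 3 * \<eta> * s ^ p" using s \<eta> by (simp add: power4_eq_xxxx power3_eq_cube)
  finally show ?thesis .
qed

section \<open>The deficit below 4 N and the halving argument\<close>

definition pp_deficit :: "real => nat => (nat \<times> nat => real) => real" where
  "pp_deficit a N e = max 0 (4 * real N - Gpp a e N N)"

lemma measurable_pp_deficit [measurable]: "pp_deficit a N \<in> borel_measurable env"
  unfolding pp_deficit_def[abs_def] by measurable

lemma pp_deficit_nonneg: "0 \<le> pp_deficit a N e" by (simp add: pp_deficit_def)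

lemma pp_deficit_mono:
  assumes "nonneg e" "- 1 / 2 < a" "a \<le> a'"
  shows "pp_deficit a N e \<le> pp_deficit a' N e"
proof -
  have "1 / (1 / 2 + a') \<le> 1 / (1 / 2 + a)" using assms by (intro divide_left_mono) auto
  then have "Gpp a' e N N \<le> Gpp a e N N" using assms by (intro G_mono_params) auto
  then show ?thesis by (simp add: pp_deficit_def)
qed

lemma m4_pp_deficit_trivial: "- 1 / 2 < a ==> m4 (pp_deficit a N) ((4 * real N) ^ 4)"
proof (rule m4_dom[OF m4_const])
  assume a: "- 1 / 2 < a"
  show "AE e in env. \<bar>pp_deficit a N e\<bar> \<le> \<bar>4 * real N\<bar>" using AE_env_pos
  proof eventually_elim
    case (elim e)
    have "0 \<le> Gpp a e N N" using elim a by (intro G_nonneg) auto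
    then show ?case by (simp add: pp_deficit_def)
  qed
qed measurable

lemma depends_pp_deficit: "depends_on {(i, j). i \<le> N} (pp_deficit a N)"
  unfolding depends_on_def pp_deficit_def
proof (intro allI impI)
  fix e e' :: "nat \<times> nat => real" assume "\<forall>p\<in>{(i, j). i \<le> N}. e p = e' p"
  then have "Gpp a e N N = Gpp a e' N N" by (intro G_cong) auto
  then show "max 0 (4 * real N - Gpp a e N N) = max 0 (4 * real N - Gpp a e' N N)" by simp
qed

lemma depends_pp_deficit_shift: "depends_on {(i, j). n < i} (\<lambda>e. pp_deficit a N (shift n e))"
  unfolding depends_on_def pp_deficit_def
proof (intro allI impI)
  fix e e' :: "nat \<times> nat => real" assume "\<forall>p\<in>{(i, j). n < i}. e p = e' p"
  then have "Gpp a (shift n e) N N = Gpp a (shift n e') N N" by (intro G_cong) auto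
  then show "max 0 (4 * real N - Gpp a (shift n e) N N) = max 0 (4 * real N - Gpp a (shift n e') N N)" by simp
qed

lemma depends_on_power: "depends_on A f ==> depends_on A (\<lambda>e. f e ^ k)"
  unfolding depends_on_def by metis

text \<open>Superadditivity and halving: the fourth moment of a sum of two independent copies is less than
  \<open>2 powr (4 / 3)\<close> times a single one as soon as the lower moments are small in comparison, and
  those are small by tightness.\<close>

lemma pp_deficit_halving:
  assumes n: "1 \<le> n" "n \<le> m" and a: "0 \<le> a" "a \<le> a\<^sub>n" "a \<le> a\<^sub>m"
    and s: "0 < s" and \<eta>: "\<eta> = 1 / 25"
    and X: "m4 (pp_deficit a\<^sub>n n) (s ^ 4)" "env.prob {e. \<eta> * s < pp_deficit a\<^sub>n n e} \<le> \<eta> ^ 4"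
    and Y: "m4 (pp_deficit a\<^sub>m m) (s ^ 4)" "env.prob {e. \<eta> * s < pp_deficit a\<^sub>m m e} \<le> \<eta> ^ 4"
  shows "m4 (pp_deficit a (n + m)) (2.21 * s ^ 4)"
proof -
  let ?X = "pp_deficit a\<^sub>n n" and ?Z = "pp_deficit a\<^sub>m m"
  let ?Y = "\<lambda>e. ?Z (shift n e)"
  have Ym: "m4 ?Y (s ^ 4)" by (rule m4_preserving[OF Y(1) preserving_shift])
  have \<eta>': "0 < \<eta>" "\<eta> \<le> 1" using \<eta> by auto
  have x: "(\<bbbE> e. ?X e ^ p) \<le> 3 * \<eta> * s ^ p" if "1 \<le> p" "p \<le> 3" for p
    using that by (intro moments_small[OF X(1) _ s \<eta>' X(2)] pp_deficit_nonneg)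
  have y: "(\<bbbE> e. ?Y e ^ p) \<le> 3 * \<eta> * s ^ p" if "1 \<le> p" "p \<le> 3" for p
  proof -
    have "(\<bbbE> e. ?Y e ^ p) = (\<bbbE> e. ?Z e ^ p)" by (rule preserving_integral[OF preserving_shift]) measurable
    also have "\<dots> \<le> 3 * \<eta> * s ^ p"
      using that by (intro moments_small[OF Y(1) _ s \<eta>' Y(2)] pp_deficit_nonneg)
    finally show ?thesis .
  qed
  have ix: "integrable env (\<lambda>e. ?X e ^ p)" if "p \<le> 4" for p using m4_integrable_power[OF X(1) that] .
  have iy: "integrable env (\<lambda>e. ?Y e ^ p)" if "p \<le> 4" for p using m4_integrable_power[OF Ym that] .
  have xy: "integrable env (\<lambda>e. ?X e ^ p * ?Y e ^ q)"
    "(\<bbbE> e. ?X e ^ p * ?Y e ^ q) = (\<bbbE> e. ?X e ^ p) * (\<bbbE> e. ?Y e ^ q)" if "p \<le> 4" "q \<le> 4" for p q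
    using that m4_measurable[OF X(1)] m4_measurable[OF Ym]
    by (intro integral_env_mult[of "{(i, j). i \<le> n}" _ "{(i, j). n < i}"] depends_on_power
        depends_pp_deficit depends_pp_deficit_shift ix iy; auto)+
  have xyb: "(\<bbbE> e. ?X e ^ p * ?Y e ^ q) \<le> (3 * \<eta> * s ^ p) * (3 * \<eta> * s ^ q)"
    if "1 \<le> p" "p \<le> 3" "1 \<le> q" "q \<le> 3" for p q
  proof -
    have "(\<bbbE> e. ?X e ^ p * ?Y e ^ q) = (\<bbbE> e. ?X e ^ p) * (\<bbbE> e. ?Y e ^ q)"
      using that by (intro xy(2)) auto
    also have "\<dots> \<le> (3 * \<eta> * s ^ p) * (3 * \<eta> * s ^ q)"
    proof (rule mult_mono[OF x[OF that(1,2)] y[OF that(3,4)]])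
      show "0 \<le> 3 * \<eta> * s ^ p" using s \<eta>' by simp
      show "0 \<le> (\<bbbE> e. ?Y e ^ q)"
        by (intro Bochner_Integration.integral_nonneg) (simp add: pp_deficit_nonneg)
    qed
    finally show ?thesis .
  qed
  have expand: "(u + v) ^ 4 = u ^ 4 + 4 * (u ^ 3 * v ^ 1) + 6 * (u ^ 2 * v ^ 2) + 4 * (u ^ 1 * v ^ 3) + v ^ 4" for u v :: real
    by (simp add: power4_eq_xxxx power3_eq_cube power2_eq_square algebra_simps)
  have i4: "integrable env (\<lambda>e. (?X e + ?Y e) ^ 4)"
    unfolding expand using ix[of 4] iy[of 4] xy(1)[of 3 1] xy(1)[of 2 2] xy(1)[of 1 3] by simp
  have "(\<bbbE> e. (?X e + ?Y e) ^ 4) = (\<bbbE> e. ?X e ^ 4) + 4 * (\<bbbE> e. ?X e ^ 3 * ?Y e ^ 1)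
      + 6 * (\<bbbE> e. ?X e ^ 2 * ?Y e ^ 2) + 4 * (\<bbbE> e. ?X e ^ 1 * ?Y e ^ 3) + (\<bbbE> e. ?Y e ^ 4)"
    unfolding expand using ix[of 4] iy[of 4] xy(1)[of 3 1] xy(1)[of 2 2] xy(1)[of 1 3] by simp
  also have "\<dots> \<le> s ^ 4 + 4 * ((3 * \<eta> * s ^ 3) * (3 * \<eta> * s ^ 1)) + 6 * ((3 * \<eta> * s ^ 2) * (3 * \<eta> * s ^ 2))
      + 4 * ((3 * \<eta> * s ^ 1) * (3 * \<eta> * s ^ 3)) + s ^ 4" using m4_integral4[OF X(1)] m4_integral4[OF Ym] s
    by (intro add_mono mult_left_mono xyb) auto
  \<comment> \<open>126 is 9 times 4 + 6 + 4, as each cross term carries two factors 3 \<eta>. For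
    \<eta> = 1/25 the excess over 2 is 126/625 < 0.21.\<close>
  also have "\<dots> = (2 + 126 * \<eta>\<^sup>2) * s ^ 4"
    by (simp add: power4_eq_xxxx power3_eq_cube power2_eq_square algebra_simps)
  also have "\<dots> \<le> 2.21 * s ^ 4" by (intro mult_right_mono) (auto simp: \<eta> power2_eq_square)
  finally have I: "(\<bbbE> e. (?X e + ?Y e) ^ 4) \<le> 2.21 * s ^ 4" .
  have "(\<bbbE>\<^sup>+ e. ennreal ((?X e + ?Y e) ^ 4)) \<le> ennreal (2.21 * s ^ 4)"
    using I i4 by (subst nn_integral_eq_integral) (auto intro: ennreal_leI)
  then have "m4 (\<lambda>e. ?X e + ?Y e) (2.21 * s ^ 4)"
    using m4_measurable[OF X(1)] m4_measurable[OF Ym] by (simp add: m4_def)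
  then show ?thesis
  proof (rule m4_dom)
    show "AE e in env. \<bar>pp_deficit a (n + m) e\<bar> \<le> \<bar>?X e + ?Y e\<bar>" using AE_env_pos
    proof eventually_elim
      case (elim e)
      have "Gpp a e n n + Gpp a (shift n e) m m \<le> Gpp a e (n + m) (n + m)"
        using elim a by (intro G_superadditive) auto
      then have "pp_deficit a (n + m) e \<le> pp_deficit a n e + pp_deficit a m (shift n e)"
        by (auto simp: pp_deficit_def)
      also have "\<dots> \<le> ?X e + ?Y e" using elim a by (intro add_mono pp_deficit_mono nonneg_shift) auto
      finally show ?case by (simp add: pp_deficit_nonneg)
    qed
  qed measurable
qed

abbreviation deficit_tight :: "real => bool" where
  "deficit_tight D \<equiv>
    \<forall>\<epsilon>>0. \<exists>K N\<^sub>0. \<forall>N\<ge>N\<^sub>0. env.prob {e. K * cbrt N < pp_deficit (D / cbrt N) N e} \<le> \<epsilon>"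

text \<open>Strong induction on N by halving. The deficit increases with a, so the extreme value D /
  cbrt N suffices, and the halves are bounded with their own, larger, extreme values. The fourth
  moment grows by a factor of at most 2.21 while the claim allows (N / m)^(4/3), m being the larger
  half.\<close>

lemma pp_lower_tail:
  assumes D: "0 \<le> D"
    and tight: "deficit_tight D"
  obtains B N\<^sub>0 where "0 \<le> B" "1 \<le> N\<^sub>0"
    "\<And>N a. N\<^sub>0 \<le> N ==> - 1 / 2 < a ==> a \<le> D / cbrt N ==> m4 (pp_deficit a N) (B * cbrt N ^ 4)"
proof -
  define \<eta> :: real where "\<eta> = 1 / 25"
  obtain K N1 where K: "\<And>N. N1 \<le> N ==> env.prob {e. K * cbrt N < pp_deficit (D / cbrt N) N e} \<le> \<eta> ^ 4"
    using tight[rule_format, of "\<eta> ^ 4"] by (auto simp: \<eta>_def)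
  \<comment> \<open>From N = 19 on, 1.9 m \<le> N for the larger half m, and 1.9^(4/3) >
    2.21.\<close>
  define N0 where "N0 = max N1 19"
  \<comment> \<open>25 K turns the tightness level K into one below \<eta> b, and 8 N0 dominates the
    trivial deficit 4 N for N < 2 N0.\<close>
  define b where "b = max (25 * K) (8 * real N0)"
  have b: "K \<le> \<eta> * b" "8 * real N0 \<le> b" "0 < b" by (auto simp: b_def \<eta>_def N0_def)
  let ?V = "\<lambda>N. pp_deficit (D / cbrt N) N"
  have main: "m4 (?V N) ((b * cbrt N) ^ 4)" if "N0 \<le> N" for N using that
  proof (induction N rule: less_induct)
    case (less N)
    have "0 \<le> D / cbrt N" using D cbrt_nonneg[of N] by simp
    then have D': "- 1 / 2 < D / cbrt N" by linarith
    show ?case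
    proof (cases "N < 2 * N0")
      case True
      have "1 \<le> N" using less.prems by (simp add: N0_def)
      then have "1 \<le> cbrt N" using cbrt_mono[of 1 N] by (simp add: cbrt_def)
      then have "b * 1 \<le> b * cbrt N" using b by (intro mult_left_mono) auto
      moreover have "real N \<le> 2 * real N0" using True by simp
      ultimately have "4 * real N \<le> b * cbrt N" using b by linarith
      then have "(4 * real N) ^ 4 \<le> (b * cbrt N) ^ 4" by (intro power_mono) auto
      then show ?thesis using m4_mono[OF m4_pp_deficit_trivial[OF D']] by blast
    next
      case False
      define n m where "n = N div 2" and "m = N - n"
      have nm: "1 \<le> n" "n \<le> m" "n + m = N" "N0 \<le> n" "N0 \<le> m" "n < N" "m < N" "2 * m \<le> N + 1" "19 \<le> N"
        using False less.prems by (auto simp: n_def m_def N0_def)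
      define s where "s = b * cbrt m"
      have c: "0 < cbrt n" "0 < cbrt m" "0 < cbrt N" using nm by (auto intro!: cbrt_pos)
      have s: "0 < s" using b c by (simp add: s_def)
      have cs: "b * cbrt n \<le> s" using b cbrt_mono[OF nm(2)] by (simp add: s_def)
      have pr: "env.prob {e. \<eta> * s < ?V k e} \<le> \<eta> ^ 4" if "N0 \<le> k" "k \<le> m" for k
      proof -
        have "K * cbrt k \<le> \<eta> * b * cbrt m"
        proof -
          have "K * cbrt k \<le> \<eta> * b * cbrt k" using b cbrt_nonneg by (intro mult_right_mono) auto
          also have "\<dots> \<le> \<eta> * b * cbrt m" using b that by (intro mult_left_mono cbrt_mono) (auto simp: \<eta>_def)
          finally show ?thesis .
        qed
        then have "K * cbrt k \<le> \<eta> * s" by (simp add: s_def mult.assoc)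
        then have "{e. \<eta> * s < ?V k e} \<subseteq> {e. K * cbrt k < ?V k e}" by auto
        then have "env.prob {e. \<eta> * s < ?V k e} \<le> env.prob {e. K * cbrt k < ?V k e}"
          by (intro env.finite_measure_mono sets_env_Collect) measurable
        also have "\<dots> \<le> \<eta> ^ 4" using that by (intro K) (auto simp: N0_def)
        finally show ?thesis .
      qed
      have mm: "m4 (?V k) (s ^ 4)" if "N0 \<le> k" "k \<le> m" for k
      proof (rule m4_mono[OF less.IH])
        have "b * cbrt k \<le> s" unfolding s_def using b that by (intro mult_left_mono cbrt_mono) auto
        then show "(b * cbrt k) ^ 4 \<le> s ^ 4" using b cbrt_nonneg by (intro power_mono) auto
      qed (use that nm in auto)
      have "m4 (pp_deficit (D / cbrt N) (n + m)) (2.21 * s ^ 4)" using nm D c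
        by (intro pp_deficit_halving[where \<eta>=\<eta> and a\<^sub>n="D / cbrt n" and a\<^sub>m="D / cbrt m"] s mm pr)
          (auto simp: \<eta>_def intro!: divide_left_mono cbrt_mono)
      then have "m4 (?V N) (2.21 * s ^ 4)" using nm(3) by simp
      moreover have "2.21 * s ^ 4 \<le> (b * cbrt N) ^ 4"
      proof -
        define t where "t = cbrt N / cbrt m"
        have t: "0 < t" "cbrt N = t * cbrt m" using c by (auto simp: t_def)
        have "t ^ 3 * real m = real N" using cbrt_cube[of N] cbrt_cube[of m] by (simp add: t(2) power_mult_distrib)
        moreover have "1.9 * real m \<le> real N"
        proof -
          have "2 * real m \<le> real N + 1" "19 \<le> real N" using nm(8,9) by linarith+
          then show ?thesis by simp
        qed
        ultimately have "1.9 * real m \<le> t ^ 3 * real m" by simp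
        then have t3: "1.9 \<le> t ^ 3" using nm by simp
        have "1.23 \<le> t"
        proof (rule ccontr)
          assume "\<not> 1.23 \<le> t"
          then have "t ^ 3 \<le> 1.23 ^ 3" using t by (intro power_mono) auto
          then show False using t3 by (simp add: power3_eq_cube)
        qed
        then have "1.9 * 1.23 \<le> t ^ 3 * t" using t3 t by (intro mult_mono) auto
        then have "2.21 \<le> t ^ 4" by (simp add: power4_eq_xxxx power3_eq_cube)
        then have "2.21 * s ^ 4 \<le> t ^ 4 * s ^ 4" using s by (intro mult_right_mono) auto
        also have "\<dots> = (b * cbrt N) ^ 4" by (simp add: s_def t(2) power_mult_distrib)
        finally show ?thesis .
      qed
      ultimately show ?thesis by (rule m4_mono)
    qed
  qed
  show thesis
  proof (rule that[of "b ^ 4" N0])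
    fix N a assume N: "N0 \<le> N" and a: "- 1 / 2 < a" "a \<le> D / cbrt N"
    have "AE e in env. \<bar>pp_deficit a N e\<bar> \<le> \<bar>?V N e\<bar>" using AE_env_pos
    proof eventually_elim
      case (elim e)
      then show ?case using pp_deficit_mono[OF elim a, of N] by (simp add: pp_deficit_nonneg)
    qed
    then show "m4 (pp_deficit a N) (b ^ 4 * cbrt N ^ 4)" using m4_dom[OF main[OF N]] by (simp add: power_mult_distrib)
  qed (auto simp: N0_def)
qed

section \<open>Last passage times as functions of the environment\<close>

abbreviation path_value :: "(int \<times> int => real) => (int \<times> int) list => real" where
  "path_value \<omega> \<pi> \<equiv> \<Sum>p\<in>set \<pi> - {(0, 0)}. \<omega> p"

text \<open>The sum of the coordinates increases along a path. Hence the end point is visited only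
  once, and a sum over the set of vertices counts its weight exactly once.\<close>

lemma path_below_last:
  assumes "successively (\<lambda>p q. q - p \<in> {(1, 0), (0, 1::int)}) \<pi>" "q \<in> set \<pi>"
  shows "fst q + snd q \<le> fst (last \<pi>) + snd (last \<pi>)"
  using assms
proof (induction \<pi> rule: rev_induct)
  case (snoc p \<pi>)
  show ?case
  proof (cases "\<pi> = [] \<or> q = p")
    case False
    then have *: "successively (\<lambda>p q. q - p \<in> {(1, 0), (0, 1)}) \<pi>" "p - last \<pi> \<in> {(1, 0), (0, 1)}" "q \<in> set \<pi>"
      using snoc.prems by (auto simp: successively_append_iff)
    have "fst q + snd q \<le> fst (last \<pi>) + snd (last \<pi>)" using snoc.IH * by blast
    moreover have "fst p + snd p = fst (last \<pi>) + snd (last \<pi>) + 1"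
      using *(2) by (cases p; cases "last \<pi>") auto
    ultimately show ?thesis by simp
  qed (use snoc.prems in auto)
qed simp

lemma up_right_paths_nonempty: "\<pi> \<in> up_right_paths a b ==> \<pi> \<noteq> [] \<and> hd \<pi> = a \<and> last \<pi> = b \<and> \<pi> = butlast \<pi> @ [b]"
  unfolding up_right_paths_def using append_butlast_last_id by fastforce

lemma up_right_paths_append:
  assumes "\<pi> \<noteq> []"
  shows "\<pi> @ [b] \<in> up_right_paths a b \<longleftrightarrow>
    b \<in> half_space \<and> b - last \<pi> \<in> {(1, 0), (0, 1)} \<and> \<pi> \<in> up_right_paths a (last \<pi>)"
  using assms unfolding up_right_paths_def mem_Collect_eq successively_append_iff by force

lemma up_right_paths_snoc:
  assumes "b \<in> half_space" "b \<noteq> (0, 0)"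
  shows "up_right_paths (0, 0) b =
    (\<lambda>\<pi>. \<pi> @ [b]) ` (up_right_paths (0, 0) (b - (1, 0)) \<union> up_right_paths (0, 0) (b - (0, 1)))"
proof (intro equalityI subsetI)
  fix \<pi> assume \<pi>: "\<pi> \<in> up_right_paths (0, 0) b"
  define \<pi>' where "\<pi>' = butlast \<pi>"
  have \<pi>': "\<pi> = \<pi>' @ [b]" "hd \<pi> = (0, 0)" using up_right_paths_nonempty[OF \<pi>] by (auto simp: \<pi>'_def)
  then have ne: "\<pi>' \<noteq> []" using assms(2) by auto
  have "b - last \<pi>' \<in> {(1, 0), (0, 1)}" "\<pi>' \<in> up_right_paths (0, 0) (last \<pi>')"
    using \<pi> ne unfolding \<pi>'(1) up_right_paths_append[OF ne] by auto
  moreover from this have "last \<pi>' = b - (1, 0) \<or> last \<pi>' = b - (0, 1)"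
    by (cases b; cases "last \<pi>'") auto
  ultimately show "\<pi> \<in> (\<lambda>\<pi>. \<pi> @ [b]) ` (up_right_paths (0, 0) (b - (1, 0)) \<union> up_right_paths (0, 0) (b - (0, 1)))"
    unfolding \<pi>'(1) by (intro imageI) (metis UnI1 UnI2)
next
  fix \<pi> assume "\<pi> \<in> (\<lambda>\<pi>. \<pi> @ [b]) ` (up_right_paths (0, 0) (b - (1, 0)) \<union> up_right_paths (0, 0) (b - (0, 1)))"
  then obtain \<pi>' where \<pi>': "\<pi> = \<pi>' @ [b]" "\<pi>' \<in> up_right_paths (0, 0) (b - (1, 0)) \<or> \<pi>' \<in> up_right_paths (0, 0) (b - (0, 1))"
    by blast
  then obtain d where d: "d \<in> {(1, 0), (0, 1)}" "\<pi>' \<in> up_right_paths (0, 0) (b - d)" by blast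
  note * = up_right_paths_nonempty[OF d(2)]
  then have "last \<pi>' = b - d" "b - last \<pi>' = d" by auto
  then show "\<pi> \<in> up_right_paths (0, 0) b"
    using * d assms(1) unfolding \<pi>'(1) by (subst up_right_paths_append) auto
qed

lemma path_value_snoc:
  assumes "\<pi> \<in> up_right_paths (0, 0) (b - (1, 0)) \<union> up_right_paths (0, 0) (b - (0, 1))" "b \<noteq> (0, 0)"
  shows "path_value \<omega> (\<pi> @ [b]) = path_value \<omega> \<pi> + \<omega> b"
proof -
  have "b \<notin> set \<pi>"
  proof
    assume "b \<in> set \<pi>"
    then have "fst b + snd b \<le> fst (last \<pi>) + snd (last \<pi>)"
      using assms path_below_last unfolding up_right_paths_def by blast
    moreover have "last \<pi> = b - (1, 0) \<or> last \<pi> = b - (0, 1)"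
      using assms(1) unfolding up_right_paths_def by blast
    ultimately show False by auto
  qed
  then have "set (\<pi> @ [b]) - {(0, 0)} = insert b (set \<pi> - {(0, 0)})" "b \<notin> set \<pi> - {(0, 0)}"
    using assms(2) by auto
  then show ?thesis by (simp add: add.commute)
qed

lemma up_right_paths_origin: "up_right_paths (0, 0) (0, 0) = {[(0, 0)]}"
proof (intro equalityI subsetI)
  fix \<pi> assume \<pi>: "\<pi> \<in> up_right_paths (0, 0) (0, 0)"
  define \<pi>' where "\<pi>' = butlast \<pi>"
  have \<pi>': "\<pi> = \<pi>' @ [(0, 0)]" using up_right_paths_nonempty[OF \<pi>] by (auto simp: \<pi>'_def)
  have "\<pi>' = []"
  proof (rule ccontr)
    assume ne: "\<pi>' \<noteq> []"
    then have h: "(0, 0) - last \<pi>' \<in> {(1, 0), (0, 1)}" "\<pi>' \<in> up_right_paths (0, 0) (last \<pi>')"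
      using \<pi> unfolding \<pi>' up_right_paths_append[OF ne] by auto
    have "(0, 0) \<in> set \<pi>'" using up_right_paths_nonempty[OF h(2)] ne by (metis hd_in_set)
    then have "0 \<le> fst (last \<pi>') + snd (last \<pi>')"
      using h(2) path_below_last[of \<pi>' "(0, 0)"] unfolding up_right_paths_def by simp
    then show False using h(1) by (cases "last \<pi>'") auto
  qed
  then show "\<pi> \<in> {[(0, 0)]}" using \<pi>' by simp
qed (auto simp: up_right_paths_def half_space_def)

lemma up_right_paths_outside: "b \<notin> half_space ==> up_right_paths a b = {}"
  unfolding up_right_paths_def by (auto dest: last_in_set)

lemma last_passage_step:
  assumes b: "b \<in> half_space" "b \<noteq> (0, 0)"
    and P: "P = up_right_paths (0, 0) (b - (1, 0)) \<union> up_right_paths (0, 0) (b - (0, 1))"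
    and fin: "finite P" "P \<noteq> {}"
  shows "finite (up_right_paths (0, 0) b)" "up_right_paths (0, 0) b \<noteq> {}"
    "last_passage \<omega> (0, 0) b = \<omega> b + Max (path_value \<omega> ` P)"
proof -
  note eq = up_right_paths_snoc[OF b, folded P]
  show "finite (up_right_paths (0, 0) b)" "up_right_paths (0, 0) b \<noteq> {}" unfolding eq using fin by auto
  have "path_value \<omega> ` up_right_paths (0, 0) b = (\<lambda>\<pi>. path_value \<omega> \<pi> + \<omega> b) ` P"
    unfolding eq image_image using path_value_snoc[OF _ b(2)] P by (intro image_cong) auto
  then show "last_passage \<omega> (0, 0) b = \<omega> b + Max (path_value \<omega> ` P)"
    unfolding last_passage_def using Max_add_commute[OF fin, of "path_value \<omega>" "\<omega> b"] by simp
qed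

text \<open>Finiteness and nonemptiness of the set of paths are part of the induction, since
  \<open>Max\<close> obeys the recursion only under these conditions.\<close>

lemma last_passage_G:
  assumes \<omega>: "\<And>i j. j \<le> i ==> 1 \<le> i ==> \<omega> (int i, int j) =
      (if j = 0 then \<beta> * e (i, 0) else if i = j then \<alpha> * e (i, i) else e (i, j))"
    and "j \<le> i"
  shows "finite (up_right_paths (0, 0) (int i, int j)) \<and> up_right_paths (0, 0) (int i, int j) \<noteq> {} \<and>
    last_passage \<omega> (0, 0) (int i, int j) = G \<alpha> \<beta> e i j" using assms(2)
proof (induction i j rule: shifted_induct)
  case (row i)
  show ?case
  proof (induction i)
    case 0
    then show ?case by (simp add: up_right_paths_origin last_passage_def)
  next
    case (Suc i)
    let ?b = "(int (Suc i), int 0)"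
    have P: "up_right_paths (0, 0) (int i, int 0) =
        up_right_paths (0, 0) (?b - (1, 0)) \<union> up_right_paths (0, 0) (?b - (0, 1))"
      using up_right_paths_outside[of "?b - (0, 1)" "(0, 0)"] by (simp add: half_space_def)
    show ?case
      using last_passage_step(1,2)[OF _ _ P] last_passage_step(3)[OF _ _ P, of \<omega>] Suc \<omega>[of 0 "Suc i"]
      by (auto simp: half_space_def last_passage_def)
  qed
next
  case (diag i)
  let ?b = "(int (Suc i), int (Suc i))"
  have P: "up_right_paths (0, 0) (int (Suc i), int i) =
      up_right_paths (0, 0) (?b - (1, 0)) \<union> up_right_paths (0, 0) (?b - (0, 1))"
    using up_right_paths_outside[of "?b - (1, 0)" "(0, 0)"] by (simp add: half_space_def)
  show ?case
    using last_passage_step(1,2)[OF _ _ P] last_passage_step(3)[OF _ _ P, of \<omega>] diag \<omega>[of "Suc i" "Suc i"]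
    by (auto simp: half_space_def last_passage_def)
next
  case (step i j)
  let ?b = "(int (Suc i), int (Suc j))"
  have P: "up_right_paths (0, 0) (int i, int (Suc j)) \<union> up_right_paths (0, 0) (int (Suc i), int j) =
      up_right_paths (0, 0) (?b - (1, 0)) \<union> up_right_paths (0, 0) (?b - (0, 1))" by simp
  have "Max (path_value \<omega> ` (up_right_paths (0, 0) (int i, int (Suc j)) \<union> up_right_paths (0, 0) (int (Suc i), int j)))
      = max (G \<alpha> \<beta> e i (Suc j)) (G \<alpha> \<beta> e (Suc i) j)"
    using step unfolding image_Un by (subst Max_Un) (auto simp: last_passage_def)
  then show ?case
    using last_passage_step(1,2)[OF _ _ P] last_passage_step(3)[OF _ _ P, of \<omega>] step \<omega>[of "Suc j" "Suc i"]
    by (auto simp: half_space_def)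
qed

lemma lpp_G:
  assumes "\<And>i j. j \<le> i ==> 1 \<le> i ==> \<omega> (int i, int j) =
      (if j = 0 then \<beta> * e (i, 0) else if i = j then \<alpha> * e (i, i) else e (i, j))"
    and "0 \<le> \<lfloor>snd b\<rfloor>" "\<lfloor>snd b\<rfloor> \<le> \<lfloor>fst b\<rfloor>"
  shows "lpp \<omega> b = G \<alpha> \<beta> e (nat \<lfloor>fst b\<rfloor>) (nat \<lfloor>snd b\<rfloor>)"
proof -
  have b: "int (nat \<lfloor>fst b\<rfloor>) = \<lfloor>fst b\<rfloor>" "int (nat \<lfloor>snd b\<rfloor>) = \<lfloor>snd b\<rfloor>" "nat \<lfloor>snd b\<rfloor> \<le> nat \<lfloor>fst b\<rfloor>"
    using assms(2,3) by linarith+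
  show ?thesis using last_passage_G[OF assms(1) b(3)] unfolding lpp_def b(1,2) by blast
qed

lemma measurable_lpp:
  assumes "0 \<le> \<lfloor>snd b\<rfloor>" "\<lfloor>snd b\<rfloor> \<le> \<lfloor>fst b\<rfloor>" and \<nu>: "\<And>p. sets (\<nu> p) = sets borel"
  shows "(\<lambda>\<omega>. lpp \<omega> b) \<in> borel_measurable (PiM half_space \<nu>)"
proof -
  let ?P = "up_right_paths (0, 0) (\<lfloor>fst b\<rfloor>, \<lfloor>snd b\<rfloor>)"
  have fin: "finite ?P"
  proof -
    \<comment> \<open>The set of paths does not depend on the weights, so its finiteness can be read
      off from \<open>last_passage_G\<close> with zero weights.\<close>
    let ?\<omega> = "\<lambda>(i::int, j::int). 0::real"
    have b: "int (nat \<lfloor>fst b\<rfloor>) = \<lfloor>fst b\<rfloor>" "int (nat \<lfloor>snd b\<rfloor>) = \<lfloor>snd b\<rfloor>" "nat \<lfloor>snd b\<rfloor> \<le> nat \<lfloor>fst b\<rfloor>"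
      using assms(1,2) by linarith+
    have "finite (up_right_paths (0, 0) (int (nat \<lfloor>fst b\<rfloor>), int (nat \<lfloor>snd b\<rfloor>)))"
      using last_passage_G[of ?\<omega> 0 "\<lambda>_. 0" 0 "nat \<lfloor>snd b\<rfloor>" "nat \<lfloor>fst b\<rfloor>"] b(3) by auto
    then show ?thesis unfolding b(1,2) .
  qed
  have comp: "(\<lambda>\<omega>. \<omega> p) \<in> borel_measurable (PiM half_space \<nu>)" if "p \<in> half_space" for p
    using measurable_component_singleton[OF that, of \<nu>] by (simp add: measurable_cong_sets[OF refl \<nu>])
  have "(\<lambda>\<omega>. path_value \<omega> \<pi>) \<in> borel_measurable (PiM half_space \<nu>)" if "\<pi> \<in> ?P" for \<pi>
    using that by (intro borel_measurable_sum comp) (auto simp: up_right_paths_def)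
  then show ?thesis unfolding lpp_def last_passage_def using fin by (intro borel_measurable_Max) auto
qed

text \<open>A product of images of exp(1) is itself an image of \<open>env\<close>; it suffices to
  compare the probabilities of cylinders. Injectivity of \<sigma> keeps the factors
  independent.\<close>

lemma distr_env_PiM:
  fixes \<nu> :: "'i => real measure"
  assumes \<sigma>: "inj_on \<sigma> I" and f: "\<And>i. i \<in> I ==> f i \<in> borel_measurable borel"
    and \<nu>: "\<And>i. i \<in> I ==> \<nu> i = distr expo borel (f i)"
  shows "distr env (PiM I \<nu>) (\<lambda>e. \<lambda>i\<in>I. f i (e (\<sigma> i))) = PiM I \<nu>"
proof (rule measure_eqI_PiM_infinite[symmetric, OF refl])
  have prob: "prob_space (\<nu> i)" if "i \<in> I" for i
    using f[OF that] unfolding \<nu>[OF that] by (intro expo.prob_space_distr) simp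
  show "finite_measure (PiM I \<nu>)"
  proof -
    interpret prob_space "PiM I \<nu>" by (rule prob_space_PiM) (rule prob)
    show ?thesis by unfold_locales
  qed
  have m: "(\<lambda>e. \<lambda>i\<in>I. f i (e (\<sigma> i))) \<in> measurable env (PiM I \<nu>)"
  proof (rule measurable_restrict)
    fix i assume "i \<in> I"
    then show "(\<lambda>e. f i (e (\<sigma> i))) \<in> measurable env (\<nu> i)"
      using measurable_compose[OF measurable_env_component f] by (simp add: \<nu>)
  qed
  fix A J assume J: "finite J" "J \<subseteq> I" and A: "\<And>i. i \<in> J ==> A i \<in> sets (\<nu> i)"
  have A': "A i \<in> sets borel" if "i \<in> J" for i using A[OF that] J that by (simp add: \<nu> subset_iff)
  let ?X = "prod_emb I \<nu> J (Pi\<^sub>E J A)" and ?inv = "the_inv_into J \<sigma>"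
  have inj: "inj_on \<sigma> J" by (rule inj_on_subset[OF \<sigma> J(2)])
  have mX: "?X \<in> sets (PiM I \<nu>)" using J A by (intro sets_PiM_I) auto
  have sp: "space (\<nu> i) = UNIV" if "i \<in> I" for i using \<nu>[OF that] by simp
  have "emeasure (distr env (PiM I \<nu>) (\<lambda>e. \<lambda>i\<in>I. f i (e (\<sigma> i)))) ?X
    = emeasure env ((\<lambda>e. \<lambda>i\<in>I. f i (e (\<sigma> i))) -` ?X \<inter> space env)"
    by (rule emeasure_distr[OF m mX])
  also have "(\<lambda>e. \<lambda>i\<in>I. f i (e (\<sigma> i))) -` ?X \<inter> space env
    = prod_emb UNIV (\<lambda>_. expo) (\<sigma> ` J) (\<Pi>\<^sub>E q\<in>\<sigma> ` J. f (?inv q) -` A (?inv q))"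
    using J sp by (auto simp: prod_emb_def PiE_iff the_inv_into_f_f[OF inj] subset_iff)
  also have "emeasure env \<dots> = (\<Prod>q\<in>\<sigma> ` J. emeasure expo (f (?inv q) -` A (?inv q)))"
    unfolding env_def
  proof (rule emeasure_PiM_emb)
    fix q assume "q \<in> \<sigma> ` J"
    then obtain i where i: "i \<in> J" "q = \<sigma> i" by auto
    show "f (?inv q) -` A (?inv q) \<in> sets expo"
      using measurable_sets[OF f A'[OF i(1)], of i] i J by (auto simp: the_inv_into_f_f[OF inj] subset_iff)
  qed (use J prob_space_expo in auto)
  also have "\<dots> = (\<Prod>i\<in>J. emeasure expo (f i -` A i))"
    by (simp add: prod.reindex[OF inj] the_inv_into_f_f[OF inj])
  also have "\<dots> = (\<Prod>i\<in>J. emeasure (\<nu> i) (A i))"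
    using J A' f by (intro prod.cong refl) (auto simp: \<nu> subset_iff emeasure_distr)
  also have "\<dots> = emeasure (PiM I \<nu>) ?X" using J A prob by (intro emeasure_PiM_emb[symmetric]) auto
  finally show "emeasure (PiM I \<nu>) ?X = emeasure (distr env (PiM I \<nu>) (\<lambda>e. \<lambda>i\<in>I. f i (e (\<sigma> i)))) ?X" ..
qed simp

lemma exponential_law_distr:
  assumes "0 < r"
  shows "exponential_law r = distr expo borel (\<lambda>x. x / r)"
proof (rule measure_eqI)
  fix A assume "A \<in> sets (exponential_law r)"
  then have A [measurable]: "A \<in> sets borel" by (simp add: exponential_law_def)
  have "emeasure (distr expo borel (\<lambda>x. x / r)) A = (\<integral>\<^sup>+x. indicator A x \<partial>distr expo borel (\<lambda>x. x / r))" by simp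
  also have "\<dots> = (\<integral>\<^sup>+x. indicator A (x / r) \<partial>expo)" by (subst nn_integral_distr) auto
  also have "\<dots> = (\<integral>\<^sup>+x. ennreal (r * exp (- r * x)) * indicator {0..} x * indicator A (r * x / r) \<partial>lborel)"
    using assms by (intro nn_integral_expo_scale) auto
  also have "\<dots> = (\<integral>\<^sup>+x. ennreal (exponential_density r x) * indicator A x \<partial>lborel)"
    using assms by (intro nn_integral_cong) (auto simp: exponential_density_def mult.commute split: split_indicator)
  also have "\<dots> = emeasure (exponential_law r) A"
    unfolding exponential_law_def by (rule emeasure_density[symmetric]) auto
  finally show "emeasure (exponential_law r) A = emeasure (distr expo borel (\<lambda>x. x / r)) A" ..
qed (simp add: exponential_law_def)

lemma return_distr: "return borel (0::real) = distr expo borel (\<lambda>_. 0)"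
proof (rule measure_eqI)
  fix A assume "A \<in> sets (return borel (0::real))"
  then show "emeasure (return borel 0) A = emeasure (distr expo borel (\<lambda>_. 0)) A"
    by (auto simp: emeasure_distr indicator_def vimage_def)
qed simp

definition hs_weight :: "real => real => int \<times> int => real => real" where
  "hs_weight \<alpha> \<beta> p x = (if p = (0, 0) then 0 else if snd p = 0 then \<beta> * x else if fst p = snd p then \<alpha> * x else x)"

definition hs_env :: "real => real => (nat \<times> nat => real) => int \<times> int => real" where
  "hs_env \<alpha> \<beta> e = (\<lambda>p\<in>half_space. hs_weight \<alpha> \<beta> p (e (nat (fst p), nat (snd p))))"

lemma measurable_hs_weight [measurable]: "hs_weight \<alpha> \<beta> p \<in> borel_measurable borel"
  unfolding hs_weight_def[abs_def] by measurable

lemma lpp_hs_env: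
  assumes "0 \<le> \<lfloor>snd b\<rfloor>" "\<lfloor>snd b\<rfloor> \<le> \<lfloor>fst b\<rfloor>"
  shows "lpp (hs_env \<alpha> \<beta> e) b = G \<alpha> \<beta> e (nat \<lfloor>fst b\<rfloor>) (nat \<lfloor>snd b\<rfloor>)"
  by (rule lpp_G[OF _ assms]) (auto simp: hs_env_def half_space_def hs_weight_def)

lemma inj_nat_half_space: "inj_on (\<lambda>p. (nat (fst p), nat (snd p))) half_space"
  by (auto simp: inj_on_def half_space_def)

lemma sets_weight_law: "sets (pp_weight_law \<rho> p) = sets borel" "sets (st_weight_law \<rho> p) = sets borel"
  by (auto simp: pp_weight_law_def st_weight_law_def exponential_law_def split: prod.split)

lemma pp_env_distr: "0 < \<rho> ==> distr env (pp_env \<rho>) (hs_env (1 / \<rho>) 0) = pp_env \<rho>"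
  unfolding pp_env_def hs_env_def[abs_def]
proof (rule distr_env_PiM[OF inj_nat_half_space measurable_hs_weight])
  fix p :: "int \<times> int" assume "0 < \<rho>"
  obtain i j where p: "p = (i, j)" by (cases p)
  have "(\<lambda>x::real. x) = (\<lambda>x. x / 1)" by simp
  then have "exponential_law 1 = distr expo borel (\<lambda>x. x)"
    using exponential_law_distr[of 1] by (metis zero_less_one)
  then show "pp_weight_law \<rho> p = distr expo borel (hs_weight (1 / \<rho>) 0 p)"
    using \<open>0 < \<rho>\<close> exponential_law_distr[of \<rho>] return_distr
    unfolding p pp_weight_law_def hs_weight_def[abs_def] by auto
qed

lemma st_env_distr: "0 < \<rho> ==> \<rho> < 1 ==> distr env (st_env \<rho>) (hs_env (1 / \<rho>) (1 / (1 - \<rho>))) = st_env \<rho>"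
  unfolding st_env_def hs_env_def[abs_def]
proof (rule distr_env_PiM[OF inj_nat_half_space measurable_hs_weight])
  fix p :: "int \<times> int" assume "0 < \<rho>" "\<rho> < 1"
  obtain i j where p: "p = (i, j)" by (cases p)
  have "(\<lambda>x::real. x) = (\<lambda>x. x / 1)" by simp
  then have "exponential_law 1 = distr expo borel (\<lambda>x. x)"
    using exponential_law_distr[of 1] by (metis zero_less_one)
  then show "st_weight_law \<rho> p = distr expo borel (hs_weight (1 / \<rho>) (1 / (1 - \<rho>)) p)"
    using \<open>0 < \<rho>\<close> \<open>\<rho> < 1\<close> exponential_law_distr[of \<rho>] exponential_law_distr[of "1 - \<rho>"] return_distr
    unfolding p st_weight_law_def hs_weight_def[abs_def] by auto
qed

lemma measurable_hs_env:
  "hs_env \<alpha> \<beta> \<in> measurable env (pp_env \<rho>)" "hs_env \<alpha> \<beta> \<in> measurable env (st_env \<rho>)"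
proof -
  have "hs_env \<alpha> \<beta> \<in> measurable env (PiM half_space \<nu>)" if "\<And>p. sets (\<nu> p) = sets borel" for \<nu>
    unfolding hs_env_def[abs_def]
  proof (rule measurable_restrict)
    fix p
    show "(\<lambda>e. hs_weight \<alpha> \<beta> p (e (nat (fst p), nat (snd p)))) \<in> measurable env (\<nu> p)"
      using measurable_compose[OF measurable_env_component measurable_hs_weight]
      by (simp add: measurable_cong_sets[OF refl that])
  qed
  then show "hs_env \<alpha> \<beta> \<in> measurable env (pp_env \<rho>)" "hs_env \<alpha> \<beta> \<in> measurable env (st_env \<rho>)"
    unfolding pp_env_def st_env_def by (auto simp: sets_weight_law)
qed

lemma integral_pp_env:
  fixes f :: "_ => real"
  assumes "0 < \<rho>" "f \<in> borel_measurable (pp_env \<rho>)"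
  shows "(\<integral>\<omega>. f \<omega> \<partial>pp_env \<rho>) = (\<bbbE> e. f (hs_env (1 / \<rho>) 0 e))"
  using integral_distr[OF measurable_hs_env(1) assms(2), of "1 / \<rho>" 0] pp_env_distr[OF assms(1)] by simp

lemma integral_st_env:
  fixes f :: "_ => real"
  assumes "0 < \<rho>" "\<rho> < 1" "f \<in> borel_measurable (st_env \<rho>)"
  shows "(\<integral>\<omega>. f \<omega> \<partial>st_env \<rho>) = (\<bbbE> e. f (hs_env (1 / \<rho>) (1 / (1 - \<rho>)) e))"
  using integral_distr[OF measurable_hs_env(2) assms(3), of "1 / \<rho>" "1 / (1 - \<rho>)"] st_env_distr[OF assms(1,2)] by simp

lemma measurable_lpp_env:
  assumes "0 \<le> \<lfloor>snd b\<rfloor>" "\<lfloor>snd b\<rfloor> \<le> \<lfloor>fst b\<rfloor>"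
  shows "(\<lambda>\<omega>. lpp \<omega> b) \<in> borel_measurable (pp_env \<rho>)" "(\<lambda>\<omega>. lpp \<omega> b) \<in> borel_measurable (st_env \<rho>)"
  unfolding pp_env_def st_env_def using assms by (auto intro!: measurable_lpp sets_weight_law)

section \<open>Weak convergence\<close>

lemma approx_limit:
  fixes a :: "nat => real"
  assumes "\<And>\<epsilon>. 0 < \<epsilon> ==> \<exists>b l'. b \<longlonglongrightarrow> l' \<and> ev (\<lambda>N. \<bar>a N - b N\<bar> \<le> \<epsilon>) \<and> \<bar>l' - l\<bar> \<le> \<epsilon>"
  shows "a \<longlonglongrightarrow> l"
proof (rule tendstoI)
  fix r :: real assume "0 < r"
  then obtain b l' where b: "b \<longlonglongrightarrow> l'" and ab: "ev (\<lambda>N. \<bar>a N - b N\<bar> \<le> r / 4)"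
    and l: "\<bar>l' - l\<bar> \<le> r / 4"
    using assms[of "r / 4"] by auto
  have "ev (\<lambda>N. dist (b N) l' < r / 4)" using b \<open>0 < r\<close> by (intro tendstoD) auto
  with ab show "ev (\<lambda>N. dist (a N) l < r)"
  proof eventually_elim
    case (elim N)
    then show ?case using l \<open>0 < r\<close> unfolding dist_real_def by linarith
  qed
qed

lemma approx_convergent:
  fixes a :: "nat => real"
  assumes "\<And>\<epsilon>. 0 < \<epsilon> ==> \<exists>b. convergent b \<and> ev (\<lambda>N. \<bar>a N - b N\<bar> \<le> \<epsilon>)"
  shows "convergent a"
  unfolding Cauchy_convergent_iff[symmetric]
proof (rule CauchyI)
  fix r :: real assume "0 < r"
  then obtain b where b: "Cauchy b" and ab: "ev (\<lambda>N. \<bar>a N - b N\<bar> \<le> r / 4)"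
    using assms[of "r / 4"] by (auto simp: Cauchy_convergent_iff)
  obtain M1 where M1: "\<And>m n. M1 \<le> m ==> M1 \<le> n ==> norm (b m - b n) < r / 4"
    using CauchyD[OF b, of "r / 4"] \<open>0 < r\<close> by auto
  obtain M2 where M2: "\<And>n. M2 \<le> n ==> \<bar>a n - b n\<bar> \<le> r / 4"
    using ab by (auto simp: eventually_sequentially)
  show "\<exists>M. \<forall>m\<ge>M. \<forall>n\<ge>M. norm (a m - a n) < r"
  proof (intro exI allI impI)
    fix m n assume "max M1 M2 \<le> m" "max M1 M2 \<le> n"
    then have "norm (b m - b n) < r / 4" "\<bar>a m - b m\<bar> \<le> r / 4" "\<bar>a n - b n\<bar> \<le> r / 4"
      using M1 M2 by auto
    then show "norm (a m - a n) < r" using \<open>0 < r\<close> unfolding real_norm_def by linarith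
  qed
qed

text \<open>Bounded Lipschitz functions of the coordinates in I, taken on all functions and not only
  on extensional ones. The class is stable under fixing a coordinate, rescaling, and integrating out
  an independent part, which are the operations applied to test functions below.\<close>

definition lip_test :: "real set => ((real => real) => real) => bool" where
  "lip_test I f \<longleftrightarrow> (\<exists>L\<ge>0. \<forall>y y'. \<bar>f y - f y'\<bar> \<le> L * (\<Sum>u\<in>I. \<bar>y u - y' u\<bar>)) \<and> (\<exists>B. \<forall>y. \<bar>f y\<bar> \<le> B)"

lemma lip_test_continuous_map:
  assumes "lip_test I f" "finite I"
  shows "continuous_map (product_topology (\<lambda>_. euclideanreal) I) euclideanreal f"
proof -
  let ?X = "product_topology (\<lambda>_. euclideanreal) I"
  obtain L where L: "0 \<le> L" "\<And>y y'. \<bar>f y - f y'\<bar> \<le> L * (\<Sum>u\<in>I. \<bar>y u - y' u\<bar>)"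
    using assms by (auto simp: lip_test_def)
  show ?thesis unfolding continuous_map_def
  proof (intro conjI allI impI)
    fix U assume U: "openin euclideanreal U"
    show "openin ?X {x \<in> topspace ?X. f x \<in> U}"
    proof (subst openin_subopen, intro ballI)
      fix x0 assume x0: "x0 \<in> {x \<in> topspace ?X. f x \<in> U}"
      then obtain r where r: "0 < r" "ball (f x0) r \<subseteq> U" using U by (auto simp: open_contains_ball)
      let ?T = "{x \<in> topspace ?X. (\<Sum>u\<in>I. \<bar>x u - x0 u\<bar>) \<in> {..<r / (L + 1)}}"
      have "continuous_map ?X euclideanreal (\<lambda>x. \<Sum>u\<in>I. \<bar>x u - x0 u\<bar>)" using assms(2)
        by (intro continuous_map_sum continuous_map_real_abs continuous_map_diff
              continuous_map_product_projection) auto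
      then have "openin ?X ?T" by (rule openin_continuous_map_preimage) auto
      moreover have "x0 \<in> ?T" using x0 r L by simp
      moreover have "?T \<subseteq> {x \<in> topspace ?X. f x \<in> U}"
      proof
        fix x assume x: "x \<in> ?T"
        have "\<bar>f x - f x0\<bar> \<le> L * (\<Sum>u\<in>I. \<bar>x u - x0 u\<bar>)" by (rule L)
        also have "\<dots> \<le> (L + 1) * (\<Sum>u\<in>I. \<bar>x u - x0 u\<bar>)" by (intro mult_right_mono sum_nonneg) auto
        also have "\<dots> < r" using x L by (simp add: field_simps)
        finally have "f x \<in> ball (f x0) r" by (simp add: dist_real_def abs_minus_commute)
        then show "x \<in> {x \<in> topspace ?X. f x \<in> U}" using x r by auto
      qed
      ultimately show "\<exists>T. openin ?X T \<and> x0 \<in> T \<and> T \<subseteq> {x \<in> topspace ?X. f x \<in> U}" by blast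
    qed
  qed auto
qed

lemma lip_test_cong:
  assumes "lip_test I f" "\<And>u. u \<in> I ==> y u = y' u"
  shows "f y = f y'"
proof -
  obtain L where "\<bar>f y - f y'\<bar> \<le> L * (\<Sum>u\<in>I. \<bar>y u - y' u\<bar>)"
    using assms(1) by (auto simp: lip_test_def)
  then show ?thesis using assms(2) by simp
qed

lemma fdd_lip:
  assumes "fdd_convergence E X M Y" "finite I" "I \<subseteq> {0..}" "lip_test I f"
  shows "(\<lambda>N. \<integral>\<omega>. f (\<lambda>u. X N u \<omega>) \<partial>E N) \<longlonglongrightarrow> (\<integral>x. f (\<lambda>u. Y u x) \<partial>M)"
proof -
  have "bounded (f ` (\<Pi>\<^sub>E u\<in>I. UNIV))" using assms(4) by (auto simp: lip_test_def bounded_iff)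
  then have "(\<lambda>N. \<integral>\<omega>. f (\<lambda>u\<in>I. X N u \<omega>) \<partial>E N) \<longlonglongrightarrow> (\<integral>x. f (\<lambda>u\<in>I. Y u x) \<partial>M)"
    using assms lip_test_continuous_map[OF assms(4,2)] unfolding fdd_convergence_def by blast
  moreover have "f (\<lambda>u\<in>I. g u) = f g" for g by (rule lip_test_cong[OF assms(4)]) simp
  ultimately show ?thesis by simp
qed

section \<open>Truncation and convergence of moments\<close>

definition clamp_R :: "real => real => real" where
  "clamp_R R x = max (- R) (min R x)"

lemma clamp_R_lip: "\<bar>clamp_R R x - clamp_R R y\<bar> \<le> \<bar>x - y\<bar>"
  unfolding clamp_R_def by linarith

lemma clamp_R_bound: "0 \<le> R ==> \<bar>clamp_R R x\<bar> \<le> R"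
  unfolding clamp_R_def by linarith

lemma clamp_R_le: "0 \<le> R ==> \<bar>clamp_R R x\<bar> \<le> \<bar>x\<bar>"
  unfolding clamp_R_def by linarith

lemma clamp_R_id: "\<bar>x\<bar> \<le> R ==> clamp_R R x = x"
  unfolding clamp_R_def by linarith

lemma measurable_clamp_R [measurable]: "clamp_R R \<in> borel_measurable borel"
  unfolding clamp_R_def[abs_def] by measurable

text \<open>Truncation at R changes a product only where a factor exceeds R, and there R^2 \<le> x^2
  + y^2 trades two more powers for a factor 1 / R^2. Fourth moments thus control truncation
  uniformly in N.\<close>

lemma clamp_product_error:
  assumes "0 < R"
  shows "\<bar>x * y - clamp_R R x * clamp_R R y\<bar> \<le> 4 * (x ^ 4 + y ^ 4) / R\<^sup>2"
proof (cases "\<bar>x\<bar> \<le> R \<and> \<bar>y\<bar> \<le> R")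
  case True
  then show ?thesis by (simp add: clamp_R_id)
next
  case False
  then have "R\<^sup>2 \<le> x\<^sup>2 \<or> R\<^sup>2 \<le> y\<^sup>2"
    using assms by (auto simp: abs_le_square_iff[symmetric])
  then have big: "R\<^sup>2 \<le> x\<^sup>2 + y\<^sup>2" by (smt (verit) zero_le_power2)
  have "\<bar>clamp_R R x * clamp_R R y\<bar> \<le> \<bar>x\<bar> * \<bar>y\<bar>"
    unfolding abs_mult using assms by (intro mult_mono clamp_R_le) auto
  then have "\<bar>x * y - clamp_R R x * clamp_R R y\<bar> \<le> 2 * (\<bar>x\<bar> * \<bar>y\<bar>)"
    using abs_triangle_ineq4[of "x * y" "clamp_R R x * clamp_R R y"] by (simp add: abs_mult)
  also have "\<dots> \<le> x\<^sup>2 + y\<^sup>2"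
    using zero_le_power2[of "\<bar>x\<bar> - \<bar>y\<bar>"] by (simp add: power2_diff)
  finally have "R\<^sup>2 * \<bar>x * y - clamp_R R x * clamp_R R y\<bar> \<le> (x\<^sup>2 + y\<^sup>2) * (x\<^sup>2 + y\<^sup>2)"
    using big by (intro mult_mono) auto
  also have "\<dots> \<le> 4 * (x ^ 4 + y ^ 4)"
    using zero_le_power2[of "x\<^sup>2 - y\<^sup>2"] zero_le_power2[of "x\<^sup>2"] zero_le_power2[of "y\<^sup>2"]
    by (simp add: power2_eq_square power4_eq_xxxx algebra_simps)
  finally show ?thesis using assms by (simp add: pos_le_divide_eq mult.commute)
qed

lemma clamp_product_lip:
  assumes "0 \<le> R"
  shows "\<bar>clamp_R R x * clamp_R R y - clamp_R R x' * clamp_R R y'\<bar> \<le> R * (\<bar>x - x'\<bar> + \<bar>y - y'\<bar>)"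
proof -
  have "clamp_R R x * clamp_R R y - clamp_R R x' * clamp_R R y'
      = (clamp_R R x - clamp_R R x') * clamp_R R y + clamp_R R x' * (clamp_R R y - clamp_R R y')"
    by (simp add: algebra_simps)
  also have "\<bar>\<dots>\<bar> \<le> \<bar>clamp_R R x - clamp_R R x'\<bar> * \<bar>clamp_R R y\<bar> + \<bar>clamp_R R x'\<bar> * \<bar>clamp_R R y - clamp_R R y'\<bar>"
    by (intro order_trans[OF abs_triangle_ineq]) (simp add: abs_mult)
  also have "\<dots> \<le> \<bar>x - x'\<bar> * R + R * \<bar>y - y'\<bar>"
    using assms by (intro add_mono mult_mono clamp_R_lip clamp_R_bound) auto
  finally show ?thesis by (simp add: algebra_simps)
qed

lemma clamp_error:
  assumes "0 < R"
  shows "\<bar>x - clamp_R R x\<bar> \<le> x ^ 4 / R ^ 3"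
proof (cases "\<bar>x\<bar> \<le> R")
  case False
  have "\<bar>x - clamp_R R x\<bar> \<le> \<bar>x\<bar>" using assms unfolding clamp_R_def by linarith
  moreover have "R ^ 3 * \<bar>x\<bar> \<le> \<bar>x\<bar> ^ 3 * \<bar>x\<bar>"
    using False assms by (intro mult_right_mono power_mono) auto
  moreover have "\<bar>x\<bar> ^ 3 * \<bar>x\<bar> = x ^ 4"
    using power_Suc2[of "\<bar>x\<bar>" 3] abs_power4[of x] by (simp del: abs_power4)
  ultimately show ?thesis using assms by (simp add: pos_le_divide_eq) (smt (verit) mult.commute mult_left_mono zero_le_power)
qed (use assms in \<open>simp add: clamp_R_id\<close>)

definition conv_law :: "(nat => (nat \<times> nat => real) => real) => 'a measure => ('a => real) => bool" where
  "conv_law X M A \<longleftrightarrow> (\<forall>f L B. (\<forall>x y. \<bar>f x - f y\<bar> \<le> L * \<bar>x - y\<bar>) \<and> (\<forall>x. \<bar>f x\<bar> \<le> B) \<and> f \<in> borel_measurable borel \<longrightarrow>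
     (\<lambda>N. (\<bbbE> e. f (X N e))) \<longlonglongrightarrow> (\<integral>x. f (A x) \<partial>M))"

text \<open>Fourth moments bounded in N make first and second powers uniformly integrable. The limit
  variable gets its second moment from Fatou along truncations; then the truncation errors vanish on
  both sides.\<close>

lemma weak_moments:
  assumes M: "prob_space M" and [measurable]: "A \<in> borel_measurable M" and conv: "conv_law X M A"
    and X: "ev (\<lambda>N. m4 (X N) C)" and C: "0 \<le> C"
  shows "integrable M (\<lambda>x. (A x)\<^sup>2)" "integrable M A"
    "(\<lambda>N. (\<bbbE> e. X N e)) \<longlonglongrightarrow> (\<integral>x. A x \<partial>M)"
    "(\<lambda>N. (\<bbbE> e. (X N e)\<^sup>2)) \<longlonglongrightarrow> (\<integral>x. (A x)\<^sup>2 \<partial>M)"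
proof -
  interpret M: prob_space M by (rule M)
  have c1: "(\<lambda>N. (\<bbbE> e. clamp_R R (X N e))) \<longlonglongrightarrow> (\<integral>x. clamp_R R (A x) \<partial>M)" if "0 \<le> R" for R
    using conv[unfolded conv_law_def, rule_format, of "clamp_R R" 1 R] clamp_R_lip clamp_R_bound[OF that] by simp
  have c2: "(\<lambda>N. (\<bbbE> e. (clamp_R R (X N e))\<^sup>2)) \<longlonglongrightarrow> (\<integral>x. (clamp_R R (A x))\<^sup>2 \<partial>M)" if "0 \<le> R" for R
  proof (rule conv[unfolded conv_law_def, rule_format, of "\<lambda>x. (clamp_R R x)\<^sup>2" "2 * R" "R\<^sup>2"], intro conjI allI)
    show "\<bar>(clamp_R R x)\<^sup>2 - (clamp_R R y)\<^sup>2\<bar> \<le> 2 * R * \<bar>x - y\<bar>" for x y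
      using clamp_product_lip[OF that, of x x y y] by (simp add: power2_eq_square)
    show "\<bar>(clamp_R R x)\<^sup>2\<bar> \<le> R\<^sup>2" for x
      using clamp_R_bound[OF that, of x] by (simp add: abs_le_square_iff[symmetric] that)
  qed measurable
  have X2: "(\<bbbE> e. (clamp_R R (X N e))\<^sup>2) \<le> 1 + C" if N: "m4 (X N) C" and "0 \<le> R" for R N
  proof -
    note [measurable] = m4_measurable[OF N]
    have "(\<bbbE> e. (clamp_R R (X N e))\<^sup>2) \<le> (\<bbbE> e. 1 + X N e ^ 4)"
    proof (rule integral_mono')
      show "integrable env (\<lambda>e. 1 + X N e ^ 4)" using m4_integrable4[OF N] by simp
      show "(clamp_R R (X N e))\<^sup>2 \<le> 1 + X N e ^ 4" for e
        using power_mono[OF clamp_R_le[OF \<open>0 \<le> R\<close>, of "X N e"], of 2] power_le_1_plus_power4[of 2 "X N e"] by simp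
    qed simp
    also have "\<dots> \<le> 1 + C" using m4_integral4[OF N C] m4_integrable4[OF N] env.prob_space by simp
    finally show ?thesis .
  qed
  have A2: "(\<integral>x. (clamp_R R (A x))\<^sup>2 \<partial>M) \<le> 1 + C" if "0 \<le> R" for R
    using X by (intro tendsto_upperbound[OF c2[OF that]]) (auto elim!: eventually_mono intro: X2 that)
  have bi: "integrable M (\<lambda>x. (clamp_R R (A x)) ^ k)" if "0 \<le> R" for R k using clamp_R_bound[OF that] that
    by (intro M.integrable_const_bound[where B="R ^ k"]) (auto simp: power_abs intro!: power_mono)
  have lim: "(\<lambda>k. (clamp_R (real k) x) ^ n) \<longlonglongrightarrow> x ^ n" for x and n :: nat
  proof (rule tendsto_eventually)
    obtain k0 :: nat where "\<bar>x\<bar> \<le> real k0" using real_arch_simple by blast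
    then have "\<bar>x\<bar> \<le> real k" if "k0 \<le> k" for k using that by (smt (verit) of_nat_mono)
    then show "ev (\<lambda>k. (clamp_R (real k) x) ^ n = x ^ n)"
      by (auto simp: eventually_sequentially clamp_R_id intro!: exI[of _ k0])
  qed
  have nn: "(\<integral>\<^sup>+x. ennreal ((A x)\<^sup>2) \<partial>M) \<le> ennreal (1 + C)"
  proof -
    have "(\<integral>\<^sup>+x. ennreal ((A x)\<^sup>2) \<partial>M) = (\<integral>\<^sup>+x. liminf (\<lambda>k. ennreal ((clamp_R (real k) (A x))\<^sup>2)) \<partial>M)"
      by (intro nn_integral_cong lim_imp_Liminf[symmetric] tendsto_ennrealI lim) auto
    also have "\<dots> \<le> liminf (\<lambda>k. \<integral>\<^sup>+x. ennreal ((clamp_R (real k) (A x))\<^sup>2) \<partial>M)"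
      by (rule nn_integral_liminf) measurable
    also have "\<dots> \<le> ennreal (1 + C)" using A2 bi[of _ 2]
      by (intro Liminf_le always_eventually allI) (auto simp: nn_integral_eq_integral intro!: ennreal_leI)
    finally show ?thesis .
  qed
  show iA2: "integrable M (\<lambda>x. (A x)\<^sup>2)"
    using nn by (intro integrableI_nonneg) (auto intro: le_less_trans)
  show iA: "integrable M A" by (rule M.square_integrable_imp_integrable[OF _ iA2]) measurable
  have l1: "(\<lambda>k. \<integral>x. clamp_R (real k) (A x) \<partial>M) \<longlonglongrightarrow> (\<integral>x. A x \<partial>M)"
    using lim[of _ 1] clamp_R_le iA
    by (intro integral_dominated_convergence[where w="\<lambda>x. \<bar>A x\<bar>"]) auto
  have l2: "(\<lambda>k. \<integral>x. (clamp_R (real k) (A x))\<^sup>2 \<partial>M) \<longlonglongrightarrow> (\<integral>x. (A x)\<^sup>2 \<partial>M)"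
    using lim[of _ 2] iA2 power_mono[OF clamp_R_le, of _ _ 2]
    by (intro integral_dominated_convergence[where w="\<lambda>x. (A x)\<^sup>2"]) auto
  have e1: "\<bar>(\<bbbE> e. X N e) - (\<bbbE> e. clamp_R R (X N e))\<bar> \<le> C / R ^ 3" if N: "m4 (X N) C" and R: "0 < R" for N R
  proof -
    note [measurable] = m4_measurable[OF N]
    have ic: "integrable env (\<lambda>e. clamp_R R (X N e))"
      using clamp_R_bound[of R] R by (intro env.integrable_const_bound[where B=R]) auto
    have "\<bar>(\<bbbE> e. X N e) - (\<bbbE> e. clamp_R R (X N e))\<bar> \<le> (\<bbbE> e. X N e ^ 4 / R ^ 3)"
      using m4_integrable4[OF N] R by (intro integral_env_close m4_integrable[OF N] ic clamp_error) auto
    also have "\<dots> \<le> C / R ^ 3" using m4_integral4[OF N C] R by (simp add: divide_right_mono)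
    finally show ?thesis .
  qed
  have e2: "\<bar>(\<bbbE> e. (X N e)\<^sup>2) - (\<bbbE> e. (clamp_R R (X N e))\<^sup>2)\<bar> \<le> 8 * C / R\<^sup>2" if N: "m4 (X N) C" and R: "0 < R" for N R
  proof -
    note [measurable] = m4_measurable[OF N]
    have ic: "integrable env (\<lambda>e. (clamp_R R (X N e))\<^sup>2)" using clamp_R_bound[of R] R
      by (intro env.integrable_const_bound[where B="R\<^sup>2"]) (auto simp: abs_le_square_iff[symmetric])
    have "\<bar>(\<bbbE> e. (X N e)\<^sup>2) - (\<bbbE> e. (clamp_R R (X N e))\<^sup>2)\<bar> \<le> (\<bbbE> e. 8 * X N e ^ 4 / R\<^sup>2)"
    proof (rule integral_env_close[OF m4_integrable_power[OF N] ic])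
      show "integrable env (\<lambda>e. 8 * X N e ^ 4 / R\<^sup>2)" using m4_integrable4[OF N] by simp
      show "\<bar>(X N e)\<^sup>2 - (clamp_R R (X N e))\<^sup>2\<bar> \<le> 8 * X N e ^ 4 / R\<^sup>2" for e
        using clamp_product_error[OF R, of "X N e" "X N e"] by (simp add: power2_eq_square)
    qed simp
    also have "\<dots> \<le> 8 * C / R\<^sup>2" using m4_integral4[OF N C] R by (simp add: divide_right_mono)
    finally show ?thesis .
  qed
  have small: "\<exists>k::nat. 0 < k \<and> a / real k ^ n \<le> \<epsilon> \<and> \<bar>f k - l\<bar> \<le> \<epsilon>" if "0 < \<epsilon>" "f \<longlonglongrightarrow> l" "0 < n" for \<epsilon> a l :: real and f n
  proof -
    have "(\<lambda>k. a / real k ^ n) \<longlonglongrightarrow> 0"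
      using that(3) by (intro tendsto_divide_0[OF tendsto_const] filterlim_at_top_imp_at_infinity
          filterlim_pow_at_top filterlim_real_sequentially)
    from tendstoD[OF this \<open>0 < \<epsilon>\<close>] tendstoD[OF that(2,1)] eventually_gt_at_top[of 0]
    have "ev (\<lambda>k. 0 < k \<and> a / real k ^ n \<le> \<epsilon> \<and> \<bar>f k - l\<bar> \<le> \<epsilon>)"
    proof eventually_elim
      case (elim k)
      have "a / real k ^ n \<le> \<bar>a / real k ^ n\<bar>" by (rule abs_ge_self)
      with elim show ?case by (simp add: dist_real_def)
    qed
    then show ?thesis by (auto simp: eventually_sequentially)
  qed
  show "(\<lambda>N. (\<bbbE> e. X N e)) \<longlonglongrightarrow> (\<integral>x. A x \<partial>M)"
  proof (rule approx_limit)
    fix \<epsilon> :: real assume "0 < \<epsilon>"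
    from small[OF this l1, of 3 C] obtain k :: nat where k: "0 < k" "C / real k ^ 3 \<le> \<epsilon>"
      "\<bar>(\<integral>x. clamp_R (real k) (A x) \<partial>M) - (\<integral>x. A x \<partial>M)\<bar> \<le> \<epsilon>" by auto
    have "ev (\<lambda>N. \<bar>(\<bbbE> e. X N e) - (\<bbbE> e. clamp_R (real k) (X N e))\<bar> \<le> \<epsilon>)"
      using X by eventually_elim (use e1[of _ "real k"] k in \<open>force intro: order_trans\<close>)
    with k c1[of "real k"] show "\<exists>b l'. b \<longlonglongrightarrow> l' \<and> ev (\<lambda>N. \<bar>(\<bbbE> e. X N e) - b N\<bar> \<le> \<epsilon>)
        \<and> \<bar>l' - (\<integral>x. A x \<partial>M)\<bar> \<le> \<epsilon>" by (intro exI conjI) auto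
  qed
  show "(\<lambda>N. (\<bbbE> e. (X N e)\<^sup>2)) \<longlonglongrightarrow> (\<integral>x. (A x)\<^sup>2 \<partial>M)"
  proof (rule approx_limit)
    fix \<epsilon> :: real assume "0 < \<epsilon>"
    from small[OF this l2, of 2 "8 * C"] obtain k :: nat where k: "0 < k" "8 * C / (real k)\<^sup>2 \<le> \<epsilon>"
      "\<bar>(\<integral>x. (clamp_R (real k) (A x))\<^sup>2 \<partial>M) - (\<integral>x. (A x)\<^sup>2 \<partial>M)\<bar> \<le> \<epsilon>" by auto
    have "ev (\<lambda>N. \<bar>(\<bbbE> e. (X N e)\<^sup>2) - (\<bbbE> e. (clamp_R (real k) (X N e))\<^sup>2)\<bar> \<le> \<epsilon>)"
      using X by eventually_elim (use e2[of _ "real k"] k in \<open>force intro: order_trans\<close>)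
    with k c2[of "real k"] show "\<exists>b l'. b \<longlonglongrightarrow> l' \<and> ev (\<lambda>N. \<bar>(\<bbbE> e. (X N e)\<^sup>2) - b N\<bar> \<le> \<epsilon>)
        \<and> \<bar>l' - (\<integral>x. (A x)\<^sup>2 \<partial>M)\<bar> \<le> \<epsilon>" by (intro exI conjI) auto
  qed
qed

lemma lip_testI:
  assumes "0 \<le> L" "\<And>y y'. \<bar>f y - f y'\<bar> \<le> L * (\<Sum>u\<in>I. \<bar>y u - y' u\<bar>)" "\<And>y. \<bar>f y\<bar> \<le> B"
  shows "lip_test I f"
  using assms unfolding lip_test_def by blast

lemma lip_test_fix:
  assumes "lip_test (insert a I) f" "a \<notin> I" "finite I"
  shows "lip_test I (\<lambda>y. f (y(a := t)))"
proof -
  obtain L B where L: "0 \<le> L" "\<And>y y'. \<bar>f y - f y'\<bar> \<le> L * (\<Sum>u\<in>insert a I. \<bar>y u - y' u\<bar>)" and B: "\<And>y. \<bar>f y\<bar> \<le> B"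
    using assms(1) by (auto simp: lip_test_def)
  have "\<bar>f (y(a := t)) - f (y'(a := t))\<bar> \<le> L * (\<Sum>u\<in>I. \<bar>y u - y' u\<bar>)" for y y'
  proof -
    have "(\<Sum>u\<in>insert a I. \<bar>(y(a := t)) u - (y'(a := t)) u\<bar>) = (\<Sum>u\<in>I. \<bar>y u - y' u\<bar>)"
      using assms by (auto intro!: sum.cong)
    then show ?thesis using L(2)[of "y(a := t)" "y'(a := t)"] by simp
  qed
  then show ?thesis using L(1) B unfolding lip_test_def by blast
qed

lemma floor_grid:
  fixes x \<eta> :: real
  assumes "0 < \<eta>"
  shows "\<bar>\<eta> * of_int \<lfloor>x / \<eta>\<rfloor> - x\<bar> \<le> \<eta>"
proof -
  have "\<eta> * of_int \<lfloor>x / \<eta>\<rfloor> \<le> \<eta> * (x / \<eta>)"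
    using assms by (intro mult_left_mono) linarith+
  moreover have "\<eta> * (x / \<eta>) \<le> \<eta> * (of_int \<lfloor>x / \<eta>\<rfloor> + 1)"
    using assms by (intro mult_left_mono) linarith+
  moreover have "\<eta> * (x / \<eta>) = x" using assms by simp
  ultimately have "\<eta> * of_int \<lfloor>x / \<eta>\<rfloor> \<le> x" "x \<le> \<eta> * of_int \<lfloor>x / \<eta>\<rfloor> + \<eta>"
    by (simp_all add: distrib_left)
  then show ?thesis using assms by linarith
qed

text \<open>Induction on I. Rounding the coordinate a to multiples of 1 / (k + 1) leaves countably
  many functions of the other coordinates, each measurable by induction; the Lipschitz bound makes
  these approximations converge pointwise.\<close>

lemma lip_test_measurable:
  assumes "finite I" "lip_test I f" "\<And>u. u \<in> I ==> g u \<in> borel_measurable M"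
  shows "(\<lambda>\<omega>. f (\<lambda>u. g u \<omega>)) \<in> borel_measurable M"
  using assms
proof (induction I arbitrary: f g rule: finite_induct)
  case empty
  have "f y = f (\<lambda>_. 0)" for y using lip_test_cong[OF empty.prems(1), of y "\<lambda>_. 0"] by simp
  then have "(\<lambda>\<omega>. f (\<lambda>u. g u \<omega>)) = (\<lambda>_. f (\<lambda>_. 0))" by blast
  then show ?case by simp
next
  case (insert a I)
  obtain L where L: "0 \<le> L" "\<And>y y'. \<bar>f y - f y'\<bar> \<le> L * (\<Sum>u\<in>insert a I. \<bar>y u - y' u\<bar>)"
    using insert.prems(1) by (auto simp: lip_test_def)
  define h where "h k \<omega> = f ((\<lambda>u. g u \<omega>)(a := inverse (real (Suc k)) * of_int \<lfloor>g a \<omega> / inverse (real (Suc k))\<rfloor>))" for k \<omega>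
  have ga [measurable]: "g a \<in> borel_measurable M" using insert.prems by simp
  have hm: "h k \<in> borel_measurable M" for k
  proof -
    have "(\<lambda>\<omega>. (\<lambda>(j::int) \<omega>. f ((\<lambda>u. g u \<omega>)(a := inverse (real (Suc k)) * of_int j))) \<lfloor>g a \<omega> / inverse (real (Suc k))\<rfloor> \<omega>)
      \<in> borel_measurable M"
    proof (rule measurable_compose_countable)
      show "(\<lambda>\<omega>. f ((\<lambda>u. g u \<omega>)(a := inverse (real (Suc k)) * of_int j))) \<in> borel_measurable M" for j
        using insert.IH[of "\<lambda>y. f (y(a := inverse (real (Suc k)) * of_int j))" g]
          lip_test_fix[OF insert.prems(1) insert.hyps(2,1)] insert.prems(2) by blast
    qed measurable
    then show ?thesis by (simp add: h_def[abs_def])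
  qed
  have "(\<lambda>k. h k \<omega>) \<longlonglongrightarrow> f (\<lambda>u. g u \<omega>)" for \<omega>
  proof (rule LIMSEQ_I)
    fix r :: real assume r: "0 < r"
    have bound: "\<bar>h k \<omega> - f (\<lambda>u. g u \<omega>)\<bar> \<le> L * inverse (real (Suc k))" for k
    proof -
      let ?y = "(\<lambda>u. g u \<omega>)(a := inverse (real (Suc k)) * of_int \<lfloor>g a \<omega> / inverse (real (Suc k))\<rfloor>)"
      have "(\<Sum>u\<in>insert a I. \<bar>?y u - g u \<omega>\<bar>) = \<bar>?y a - g a \<omega>\<bar> + (\<Sum>u\<in>I. 0)"
        using insert.hyps by (simp, intro sum.neutral) auto
      also have "\<dots> \<le> inverse (real (Suc k))"
        using floor_grid[of "inverse (real (Suc k))" "g a \<omega>"] by simp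
      finally show ?thesis
        unfolding h_def using L(2)[of ?y "\<lambda>u. g u \<omega>"] L(1) by (meson mult_left_mono order_trans)
    qed
    obtain n where n: "inverse (real (Suc n)) < r / (L + 1)" using reals_Archimedean[of "r / (L + 1)"] r L by auto
    show "\<exists>no. \<forall>k\<ge>no. norm (h k \<omega> - f (\<lambda>u. g u \<omega>)) < r"
    proof (intro exI allI impI)
      fix k assume "n \<le> k"
      then have "inverse (real (Suc k)) \<le> inverse (real (Suc n))" by (intro le_imp_inverse_le) auto
      then have k: "inverse (real (Suc k)) < r / (L + 1)" using n by (rule le_less_trans)
      have "\<bar>h k \<omega> - f (\<lambda>u. g u \<omega>)\<bar> \<le> (L + 1) * inverse (real (Suc k))"
        using bound[of k] by (smt (verit) inverse_nonnegative_iff_nonnegative mult_right_mono of_nat_0_le_iff)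
      also have "\<dots> < r" using k L by (simp add: field_simps)
      finally show "norm (h k \<omega> - f (\<lambda>u. g u \<omega>)) < r" by simp
    qed
  qed
  then show ?case
    using borel_measurable_LIMSEQ_real[of M h "\<lambda>\<omega>. f (\<lambda>u. g u \<omega>)"] hm by simp
qed

section \<open>Convergence of finite-dimensional laws over \<open>env\<close>\<close>

definition conv_fdd :: "real set => (nat => real => (nat \<times> nat => real) => real) => 'a measure => (real => 'a => real) => bool" where
  "conv_fdd I Y M A \<longleftrightarrow> prob_space M \<and> finite I \<and> (\<forall>u\<in>I. A u \<in> borel_measurable M) \<and>
     (\<forall>N. \<forall>u\<in>I. Y N u \<in> borel_measurable env) \<and>
     (\<forall>f. lip_test I f \<longrightarrow> (\<lambda>N. (\<bbbE> e. f (\<lambda>u. Y N u e))) \<longlonglongrightarrow> (\<integral>x. f (\<lambda>u. A u x) \<partial>M))"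

lemma conv_fdd_law:
  assumes "conv_fdd I Y M A" "u \<in> I"
  shows "conv_law (\<lambda>N. Y N u) M (A u)"
  unfolding conv_law_def
proof (intro allI impI, elim conjE)
  fix f :: "real => real" and L B assume f: "\<forall>x y. \<bar>f x - f y\<bar> \<le> L * \<bar>x - y\<bar>" "\<forall>x. \<bar>f x\<bar> \<le> B"
  have "lip_test I (\<lambda>y. f (y u))"
  proof (rule lip_testI[of "\<bar>L\<bar>" _ _ B])
    fix y y' :: "real => real"
    have "\<bar>f (y u) - f (y' u)\<bar> \<le> \<bar>L\<bar> * \<bar>y u - y' u\<bar>"
      using f(1) by (meson abs_ge_self abs_ge_zero mult_right_mono order_trans)
    also have "\<dots> \<le> \<bar>L\<bar> * (\<Sum>u\<in>I. \<bar>y u - y' u\<bar>)"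
      using assms by (intro mult_left_mono member_le_sum) (auto simp: conv_fdd_def)
    finally show "\<bar>f (y u) - f (y' u)\<bar> \<le> \<bar>L\<bar> * (\<Sum>u\<in>I. \<bar>y u - y' u\<bar>)" .
  qed (use f in auto)
  then show "(\<lambda>N. (\<bbbE> e. f (Y N u e))) \<longlonglongrightarrow> (\<integral>x. f (A u x) \<partial>M)"
    using assms(1) unfolding conv_fdd_def by fast
qed

lemma conv_law_tight:
  assumes conv: "conv_law Z M A" and M: "prob_space M" and [measurable]: "A \<in> borel_measurable M"
    and Z: "\<And>N. Z N \<in> borel_measurable env" and "0 < \<epsilon>"
  obtains K where "0 < K" "ev (\<lambda>N. env.prob {e. K < \<bar>Z N e\<bar>} \<le> \<epsilon>)"
proof -
  interpret M: prob_space M by (rule M)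
  \<comment> \<open>The test function vanishes up to k and equals 1 from k + 1 on. Dominated
    convergence in k makes its mean under the limit law small.\<close>
  define h where "h k x = min 1 (max 0 (\<bar>x\<bar> - real k))" for k and x :: real
  have [measurable]: "h k \<in> borel_measurable borel" for k unfolding h_def[abs_def] by measurable
  have h01: "0 \<le> h k x" "h k x \<le> 1" for k x by (auto simp: h_def)
  have mm: "\<bar>min 1 (max 0 p) - min 1 (max 0 q)\<bar> \<le> \<bar>p - q\<bar>" for p q :: real
    by (auto simp: min_def max_def)
  have lip: "\<bar>h k x - h k y\<bar> \<le> 1 * \<bar>x - y\<bar>" for k x y
  proof -
    have "\<bar>h k x - h k y\<bar> \<le> \<bar>\<bar>x\<bar> - \<bar>y\<bar>\<bar>"
      unfolding h_def using mm[of "\<bar>x\<bar> - real k" "\<bar>y\<bar> - real k"] by simp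
    also have "\<dots> \<le> 1 * \<bar>x - y\<bar>" using abs_triangle_ineq3[of x y] by simp
    finally show ?thesis .
  qed
  have lim: "(\<lambda>k. \<integral>x. h k (A x) \<partial>M) \<longlonglongrightarrow> (\<integral>x. 0 \<partial>M)"
  proof (rule integral_dominated_convergence[where w="\<lambda>_. 1"])
    show "AE x in M. (\<lambda>k. h k (A x)) \<longlonglongrightarrow> 0"
    proof (intro AE_I2 tendsto_eventually)
      fix x
      obtain k0 :: nat where "\<bar>A x\<bar> \<le> real k0" using real_arch_simple by blast
      then show "ev (\<lambda>k. h k (A x) = 0)"
        unfolding eventually_sequentially by (intro exI[of _ k0]) (auto simp: h_def)
    qed
  qed (use h01 in auto)
  then have "ev (\<lambda>k. \<bar>\<integral>x. h k (A x) \<partial>M\<bar> < \<epsilon>)"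
    using tendstoD[OF lim \<open>0 < \<epsilon>\<close>] by (simp add: dist_real_def)
  then obtain k where "\<bar>\<integral>x. h k (A x) \<partial>M\<bar> < \<epsilon>" using eventually_happens'[OF sequentially_bot] by blast
  then have k: "(\<integral>x. h k (A x) \<partial>M) < \<epsilon>" by linarith
  have "(\<lambda>N. (\<bbbE> e. h k (Z N e))) \<longlonglongrightarrow> (\<integral>x. h k (A x) \<partial>M)"
    using conv[unfolded conv_law_def, rule_format, of "h k" 1 1] lip h01 by auto
  then have "ev (\<lambda>N. (\<bbbE> e. h k (Z N e)) < \<epsilon>)" using k by (rule order_tendstoD(2))
  then have "ev (\<lambda>N. env.prob {e. real k + 1 < \<bar>Z N e\<bar>} \<le> \<epsilon>)"
  proof eventually_elim
    case (elim N)
    note [measurable] = Z[of N]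
    have m: "{e. real k + 1 < \<bar>Z N e\<bar>} \<in> sets env" by (rule sets_env_Collect) measurable
    have "env.prob {e. real k + 1 < \<bar>Z N e\<bar>} = (\<bbbE> e. indicator {e. real k + 1 < \<bar>Z N e\<bar>} e)"
      using m by simp
    also have "\<dots> \<le> (\<bbbE> e. h k (Z N e))"
    proof (rule integral_mono')
      show "integrable env (\<lambda>e. h k (Z N e))" using h01 by (intro env.integrable_const_bound[where B=1]) auto
    qed (auto simp: h01 h_def indicator_def)
    finally show ?case using elim by simp
  qed
  then show thesis by (intro that[of "real k + 1"]) auto
qed

lemma conv_fdd_tight:
  assumes Y: "conv_fdd I Y M A" and "0 < \<epsilon>"
  obtains K where "\<And>u. u \<in> I ==> 0 < K u" "ev (\<lambda>N. \<forall>u\<in>I. env.prob {e. K u < \<bar>Y N u e\<bar>} \<le> \<epsilon>)"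
proof -
  have M: "prob_space M" and fin: "finite I" using Y by (auto simp: conv_fdd_def)
  have "\<forall>u\<in>I. \<exists>K. 0 < K \<and> ev (\<lambda>N. env.prob {e. K < \<bar>Y N u e\<bar>} \<le> \<epsilon>)"
  proof
    fix u assume u: "u \<in> I"
    then have m: "A u \<in> borel_measurable M" "\<And>N. Y N u \<in> borel_measurable env" using Y by (auto simp: conv_fdd_def)
    show "\<exists>K. 0 < K \<and> ev (\<lambda>N. env.prob {e. K < \<bar>Y N u e\<bar>} \<le> \<epsilon>)"
      by (rule conv_law_tight[OF conv_fdd_law[OF Y u] M m \<open>0 < \<epsilon>\<close>]) blast
  qed
  then obtain K where K: "\<And>u. u \<in> I ==> 0 < K u" "\<And>u. u \<in> I ==> ev (\<lambda>N. env.prob {e. K u < \<bar>Y N u e\<bar>} \<le> \<epsilon>)"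
    unfolding bchoice_iff by blast
  then have "ev (\<lambda>N. \<forall>u\<in>I. env.prob {e. K u < \<bar>Y N u e\<bar>} \<le> \<epsilon>)"
    by (intro eventually_ball_finite fin ballI)
  then show ?thesis using that K(1) by blast
qed

lemma integral_close_on_box:
  fixes Y :: "real => (nat \<times> nat => real) => real" and K :: "real => real"
  assumes fin: "finite I" and Y: "\<And>u. u \<in> I ==> Y u \<in> borel_measurable env" "\<And>u. u \<in> I ==> env.prob {e. K u < \<bar>Y u e\<bar>} \<le> \<epsilon>"
    and int: "integrable env f" "integrable env g" "integrable env h" and h: "\<And>e. 0 \<le> h e" and b: "\<And>e. \<bar>f e - g e\<bar> \<le> b"
    and box: "\<And>e. (\<And>u. u \<in> I ==> \<bar>Y u e\<bar> \<le> K u) ==> \<bar>f e - g e\<bar> \<le> h e"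
  shows "\<bar>(\<bbbE> e. f e) - (\<bbbE> e. g e)\<bar> \<le> (\<bbbE> e. h e) + b * (real (card I) * \<epsilon>)"
proof -
  let ?I = "\<lambda>u. {e. K u < \<bar>Y u e\<bar>}"
  have b0: "0 \<le> b" using b[of undefined] by linarith
  have I: "integrable env (indicator (?I u) :: _ => real)" "(\<bbbE> e. indicator (?I u) e) = env.prob (?I u)" if "u \<in> I" for u
  proof -
    note [measurable] = Y(1)[OF that]
    have "?I u \<in> sets env" by (rule sets_env_Collect) measurable
    then show "integrable env (indicator (?I u) :: _ => real)" "(\<bbbE> e. indicator (?I u) e) = env.prob (?I u)"
      by (simp_all add: env.emeasure_eq_measure)
  qed
  have iS: "integrable env (\<lambda>e. b * (\<Sum>u\<in>I. indicator (?I u) e))"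
    using I by (intro integrable_mult_right Bochner_Integration.integrable_sum) auto
  have "\<bar>(\<bbbE> e. f e) - (\<bbbE> e. g e)\<bar> \<le> (\<bbbE> e. h e + b * (\<Sum>u\<in>I. indicator (?I u) e))"
  proof (rule integral_env_close[OF int(1,2)])
    fix e
    show "\<bar>f e - g e\<bar> \<le> h e + b * (\<Sum>u\<in>I. indicator (?I u) e)"
    proof (cases "\<exists>u\<in>I. K u < \<bar>Y u e\<bar>")
      case True
      then obtain w where w: "w \<in> I" "K w < \<bar>Y w e\<bar>" by auto
      have "indicator (?I w) e \<le> (\<Sum>u\<in>I. indicator (?I u) e :: real)"
        using w fin by (intro member_le_sum) auto
      then have "b * 1 \<le> b * (\<Sum>u\<in>I. indicator (?I u) e :: real)"
        using w b0 by (intro mult_left_mono) auto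
      then show ?thesis using b[of e] h[of e] by linarith
    next
      case False
      then have "\<bar>f e - g e\<bar> \<le> h e" by (intro box) (meson not_less)
      moreover have "0 \<le> b * (\<Sum>u\<in>I. indicator (?I u) e :: real)" using b0 by (intro mult_nonneg_nonneg sum_nonneg) auto
      ultimately show ?thesis by linarith
    qed
  qed (use int(3) iS in auto)
  also have "\<dots> = (\<bbbE> e. h e) + b * (\<Sum>u\<in>I. env.prob (?I u))"
    using int(3) iS I by (simp add: Bochner_Integration.integral_sum)
  also have "(\<Sum>u\<in>I. env.prob (?I u)) \<le> (\<Sum>u\<in>I. \<epsilon>)" by (intro sum_mono Y)
  finally show ?thesis using b0 by (simp add: mult_left_mono)
qed

text \<open>The shape of the approximation to a full passage time: y collects the times up to points
  of a cut, z the times from there on, and T selects pairs of such points.\<close>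

definition max_plus :: "(real \<times> real) set => real => real => (real => real) => (real => real) => real" where
  "max_plus T c d y z = Max ((\<lambda>p. c * y (fst p) + d * z (snd p)) ` T)"

lemma max_plus_diff_le:
  assumes T: "finite T" "T \<noteq> {}"
    and d: "\<And>p. p \<in> T ==> c * y (fst p) + d * z (snd p) \<le> c' * y' (fst p) + d' * z' (snd p) + r"
  shows "max_plus T c d y z \<le> max_plus T c' d' y' z' + r"
proof -
  have "c * y (fst p) + d * z (snd p) \<le> Max ((\<lambda>p. c' * y' (fst p) + d' * z' (snd p)) ` T) + r" if "p \<in> T" for p
  proof -
    have "c' * y' (fst p) + d' * z' (snd p) \<le> Max ((\<lambda>p. c' * y' (fst p) + d' * z' (snd p)) ` T)"
      using T that by (intro Max_ge) auto
    then show ?thesis using d[OF that] by linarith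
  qed
  then show ?thesis unfolding max_plus_def using T by (subst Max_le_iff) auto
qed

lemma max_plus_lip:
  assumes T: "finite T" "T \<noteq> {}" "fst ` T \<subseteq> I" "snd ` T \<subseteq> J" and "finite I" "finite J" "0 \<le> c" "0 \<le> d"
  shows "\<bar>max_plus T c d y z - max_plus T c d y' z'\<bar> \<le> c * (\<Sum>u\<in>I. \<bar>y u - y' u\<bar>) + d * (\<Sum>v\<in>J. \<bar>z v - z' v\<bar>)"
    (is "_ \<le> ?r y y' z z'")
proof -
  have "max_plus T c d y z \<le> max_plus T c d y' z' + ?r y y' z z'" for y y' z z'
  proof (rule max_plus_diff_le[OF T(1,2)])
    fix p assume p: "p \<in> T"
    have "\<bar>y (fst p) - y' (fst p)\<bar> \<le> (\<Sum>u\<in>I. \<bar>y u - y' u\<bar>)"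
      using assms p by (intro member_le_sum[of "fst p" I "\<lambda>u. \<bar>y u - y' u\<bar>"]) auto
    moreover have "\<bar>z (snd p) - z' (snd p)\<bar> \<le> (\<Sum>v\<in>J. \<bar>z v - z' v\<bar>)"
      using assms p by (intro member_le_sum[of "snd p" J "\<lambda>v. \<bar>z v - z' v\<bar>"]) auto
    ultimately have "y (fst p) - y' (fst p) \<le> (\<Sum>u\<in>I. \<bar>y u - y' u\<bar>)" "z (snd p) - z' (snd p) \<le> (\<Sum>v\<in>J. \<bar>z v - z' v\<bar>)"
      by linarith+
    then have "c * (y (fst p) - y' (fst p)) \<le> c * (\<Sum>u\<in>I. \<bar>y u - y' u\<bar>)"
      "d * (z (snd p) - z' (snd p)) \<le> d * (\<Sum>v\<in>J. \<bar>z v - z' v\<bar>)"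
      using assms by (auto intro!: mult_left_mono)
    then show "c * y (fst p) + d * z (snd p) \<le> c * y' (fst p) + d * z' (snd p) + ?r y y' z z'"
      by (simp add: algebra_simps)
  qed
  from this[of y z y' z'] this[of y' z' y z] show ?thesis by (simp add: abs_minus_commute abs_le_iff)
qed

text \<open>A truncated product of the two passage times: \<open>y 0\<close> belongs to the diagonal
  point of the cut, hence to the smaller time.\<close>

definition prod_test :: "real => (real \<times> real) set => real => real => (real => real) => (real => real) => real" where
  "prod_test R T c d y z = clamp_R R (c * y 0) * clamp_R R (max_plus T c d y z)"

lemma prod_test_bound: "0 \<le> R ==> \<bar>prod_test R T c d y z\<bar> \<le> R * R"
  unfolding prod_test_def abs_mult by (intro mult_mono clamp_R_bound) auto

lemma prod_test_lip:
  assumes T: "finite T" "T \<noteq> {}" "fst ` T \<subseteq> I" "snd ` T \<subseteq> J" and IJ: "finite I" "finite J" "0 \<in> I"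
    and cd: "0 \<le> c" "0 \<le> d" "0 \<le> R"
  shows "\<bar>prod_test R T c d y z - prod_test R T c d y' z'\<bar>
    \<le> R * (2 * c) * (\<Sum>u\<in>I. \<bar>y u - y' u\<bar>) + R * d * (\<Sum>v\<in>J. \<bar>z v - z' v\<bar>)"
proof -
  have "\<bar>c * y 0 - c * y' 0\<bar> \<le> c * (\<Sum>u\<in>I. \<bar>y u - y' u\<bar>)"
    unfolding right_diff_distrib[symmetric] abs_mult using cd IJ
    by (auto intro!: mult_left_mono member_le_sum[of 0 I "\<lambda>u. \<bar>y u - y' u\<bar>"])
  then have "\<bar>prod_test R T c d y z - prod_test R T c d y' z'\<bar>
    \<le> R * (c * (\<Sum>u\<in>I. \<bar>y u - y' u\<bar>) + (c * (\<Sum>u\<in>I. \<bar>y u - y' u\<bar>) + d * (\<Sum>v\<in>J. \<bar>z v - z' v\<bar>)))"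
    unfolding prod_test_def using cd max_plus_lip[OF T IJ(1,2) cd(1,2), of y z y' z']
    by (intro order_trans[OF clamp_product_lip] mult_left_mono add_mono) auto
  then show ?thesis by (simp add: algebra_simps)
qed

text \<open>The inner mean g_N(z) converges for each z because the first family converges in law.
  All g_N share one Lipschitz constant, so the convergence is uniform on boxes, and tightness of the
  second family confines z to a box. The limit g' is then a test function for the second
  family.\<close>

lemma product_limit:
  assumes Y: "conv_fdd I Y M A" and Z: "conv_fdd J Z M' B"
    and T: "finite T" "T \<noteq> {}" "fst ` T \<subseteq> I" "snd ` T \<subseteq> J" and "0 \<in> I" and cd: "0 \<le> c" "0 \<le> d" and R: "0 \<le> R"
  shows "convergent (\<lambda>N. (\<bbbE> e'. (\<bbbE> e. prod_test R T c d (\<lambda>u. Y N u e) (\<lambda>v. Z N v e'))))"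
proof -
  let ?F = "prod_test R T c d"
  have fin: "finite I" "finite J" using Y Z by (auto simp: conv_fdd_def)
  interpret M: prob_space M using Y by (simp add: conv_fdd_def)
  have Ym: "\<And>N u. u \<in> I ==> Y N u \<in> borel_measurable env" and Zm: "\<And>N v. v \<in> J ==> Z N v \<in> borel_measurable env"
    and Am: "\<And>u. u \<in> I ==> A u \<in> borel_measurable M" and Bm: "\<And>v. v \<in> J ==> B v \<in> borel_measurable M'"
    using Y Z by (auto simp: conv_fdd_def)
  define L where "L = R * d"
  have L: "0 \<le> L" using cd R by (simp add: L_def)
  note lip = prod_test_lip[OF T fin \<open>0 \<in> I\<close> cd R]
  have testI: "lip_test I (\<lambda>y. ?F y z)" for z
  proof (rule lip_testI[of "R * (2 * c)" _ _ "R * R"])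
    show "\<bar>?F y z - ?F y' z\<bar> \<le> R * (2 * c) * (\<Sum>u\<in>I. \<bar>y u - y' u\<bar>)" for y y' using lip[of y z y' z] by simp
  qed (use cd R prod_test_bound in auto)
  define g where "g N z = (\<bbbE> e. ?F (\<lambda>u. Y N u e) z)" for N z
  define g' where "g' z = (\<integral>x. ?F (\<lambda>u. A u x) z \<partial>M)" for z
  have intY: "integrable env (\<lambda>e. ?F (\<lambda>u. Y N u e) z)" for N z
    using prod_test_bound[OF R] by (intro env.integrable_const_bound[where B="R * R"] lip_test_measurable[OF fin(1) testI] Ym) auto
  have intA: "integrable M (\<lambda>x. ?F (\<lambda>u. A u x) z)" for z
    using prod_test_bound[OF R] by (intro M.integrable_const_bound[where B="R * R"] lip_test_measurable[OF fin(1) testI] Am) auto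
  have gz: "(\<lambda>N. g N z) \<longlonglongrightarrow> g' z" for z
    using Y testI unfolding conv_fdd_def g_def g'_def by fast
  have glip: "\<bar>g N z - g N z'\<bar> \<le> L * (\<Sum>v\<in>J. \<bar>z v - z' v\<bar>)" for N z z'
  proof -
    have "\<bar>g N z - g N z'\<bar> \<le> (\<bbbE> e. L * (\<Sum>v\<in>J. \<bar>z v - z' v\<bar>))"
      unfolding g_def using lip[of _ z _ z'] by (intro integral_env_close intY) (auto simp: L_def intro!: order_trans[OF lip])
    then show ?thesis using env.prob_space by simp
  qed
  have g'lip: "\<bar>g' z - g' z'\<bar> \<le> L * (\<Sum>v\<in>J. \<bar>z v - z' v\<bar>)" for z z'
    using glip by (intro tendsto_upperbound[OF tendsto_rabs[OF tendsto_diff[OF gz gz]]]) auto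
  have gB: "\<bar>g N z\<bar> \<le> R * R" for N z
  proof -
    have "\<bar>g N z\<bar> \<le> (\<bbbE> e. \<bar>?F (\<lambda>u. Y N u e) z\<bar>)" unfolding g_def by (rule integral_abs_bound)
    also have "\<dots> \<le> (\<bbbE> e. R * R)" using intY prod_test_bound[OF R] by (intro integral_mono) auto
    finally show ?thesis using env.prob_space by simp
  qed
  have g'B: "\<bar>g' z\<bar> \<le> R * R" for z using gB by (intro tendsto_upperbound[OF tendsto_rabs[OF gz]]) auto
  have testg: "lip_test J (g N)" for N using glip gB L unfolding lip_test_def by blast
  have testg': "lip_test J g'" using g'lip g'B L unfolding lip_test_def by blast
  have gm: "(\<lambda>e. g N (\<lambda>v. Z N v e)) \<in> borel_measurable env" "(\<lambda>e. g' (\<lambda>v. Z N v e)) \<in> borel_measurable env" for N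
    using lip_test_measurable[OF fin(2) testg[of N], of "Z N" env] lip_test_measurable[OF fin(2) testg', of "Z N" env] Zm
    by blast+
  have gi: "integrable env (\<lambda>e. g N (\<lambda>v. Z N v e))" "integrable env (\<lambda>e. g' (\<lambda>v. Z N v e))" for N
    using gm gB g'B by (auto intro!: env.integrable_const_bound[where B="R * R"])
  have lim': "(\<lambda>N. (\<bbbE> e. g' (\<lambda>v. Z N v e))) \<longlonglongrightarrow> (\<integral>x. g' (\<lambda>v. B v x) \<partial>M')"
    using Z testg' unfolding conv_fdd_def by fast
  have "(\<lambda>N. (\<bbbE> e. g N (\<lambda>v. Z N v e))) \<longlonglongrightarrow> (\<integral>x. g' (\<lambda>v. B v x) \<partial>M')"
  proof (rule approx_limit)
    fix \<epsilon> :: real assume \<epsilon>: "0 < \<epsilon>"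
    define k where "k = real (card J)"
    define \<epsilon>' where "\<epsilon>' = \<epsilon> / (4 * (2 * (R * R) + 1) * (k + 1))"
    have k: "0 \<le> k" by (simp add: k_def)
    have cancel: "a * (b * (r / (c * a * b))) = r / c" "a * (b * (r / (c * b * a))) = r / c"
      if "a \<noteq> 0" "b \<noteq> 0" for a b c r :: real using that by auto
    have \<epsilon>': "0 < \<epsilon>'" using \<epsilon> k R unfolding \<epsilon>'_def by (intro divide_pos_pos mult_pos_pos add_nonneg_pos) auto
    define \<eta> where "\<eta> = \<epsilon> / (8 * (L + 1) * (k + 1))"
    have \<eta>: "0 < \<eta>" using \<epsilon> k L unfolding \<eta>_def by (intro divide_pos_pos mult_pos_pos add_nonneg_pos) auto
    obtain K where "\<And>v. v \<in> J ==> 0 < K v" and evK: "ev (\<lambda>N. \<forall>v\<in>J. env.prob {e. K v < \<bar>Z N v e\<bar>} \<le> \<epsilon>')"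
      using conv_fdd_tight[OF Z \<epsilon>'] by blast
    \<comment> \<open>A finite grid of mesh \<eta> in the box. Convergence at its points and the
      common Lipschitz constant give closeness on the whole box.\<close>
    define D where "D = (\<lambda>q v. \<eta> * of_int (q v)) ` (\<Pi>\<^sub>E v\<in>J. {\<lfloor>- K v / \<eta>\<rfloor>..\<lfloor>K v / \<eta>\<rfloor>})"
    have finD: "finite D" unfolding D_def using fin by (intro finite_imageI finite_PiE) auto
    have evD: "ev (\<lambda>N. \<forall>z\<in>D. \<bar>g N z - g' z\<bar> \<le> \<epsilon> / 4)"
    proof (intro eventually_ball_finite finD ballI)
      fix z
      show "ev (\<lambda>N. \<bar>g N z - g' z\<bar> \<le> \<epsilon> / 4)"
        using tendstoD[OF gz[of z], of "\<epsilon> / 4"] \<epsilon> by (auto simp: dist_real_def elim: eventually_mono)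
    qed
    from evD evK have "ev (\<lambda>N. \<bar>(\<bbbE> e. g N (\<lambda>v. Z N v e)) - (\<bbbE> e. g' (\<lambda>v. Z N v e))\<bar> \<le> \<epsilon>)"
    proof eventually_elim
      case (elim N)
      have pt: "\<bar>g N z - g' z\<bar> \<le> \<epsilon> / 2" if box: "\<And>v. v \<in> J ==> \<bar>z v\<bar> \<le> K v" for z
      proof -
        define q where "q = (\<lambda>v\<in>J. \<lfloor>z v / \<eta>\<rfloor>)"
        let ?z = "\<lambda>v. \<eta> * of_int (q v)"
        have "?z \<in> D"
        proof -
          have "q \<in> (\<Pi>\<^sub>E v\<in>J. {\<lfloor>- K v / \<eta>\<rfloor>..\<lfloor>K v / \<eta>\<rfloor>})"
            unfolding q_def
          proof (intro restrict_PiE_iff[THEN iffD2] ballI)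
            fix v assume "v \<in> J"
            then have "- K v \<le> z v" "z v \<le> K v" using box[of v] by (auto simp: abs_le_iff)
            then have "- K v / \<eta> \<le> z v / \<eta>" "z v / \<eta> \<le> K v / \<eta>"
              using \<eta> by (intro divide_right_mono; linarith)+
            then show "\<lfloor>z v / \<eta>\<rfloor> \<in> {\<lfloor>- K v / \<eta>\<rfloor>..\<lfloor>K v / \<eta>\<rfloor>}"
              unfolding atLeastAtMost_iff by (intro conjI floor_mono)
          qed
          then show ?thesis unfolding D_def by (rule imageI)
        qed
        then have 1: "\<bar>g N ?z - g' ?z\<bar> \<le> \<epsilon> / 4" using elim by blast
        have "(\<Sum>v\<in>J. \<bar>z v - ?z v\<bar>) \<le> (\<Sum>v\<in>J. \<eta>)"
          using floor_grid[OF \<eta>] by (intro sum_mono) (auto simp: q_def abs_minus_commute)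
        also have "\<dots> = k * \<eta>" by (simp add: k_def)
        finally have "L * (\<Sum>v\<in>J. \<bar>z v - ?z v\<bar>) \<le> L * (k * \<eta>)" using L by (rule mult_left_mono)
        also have "\<dots> \<le> (L + 1) * ((k + 1) * \<eta>)" using L k \<eta> by (intro mult_mono) auto
        also have "\<dots> = \<epsilon> / 8" unfolding \<eta>_def using L k by (intro cancel(1)) auto
        finally have 2: "L * (\<Sum>v\<in>J. \<bar>z v - ?z v\<bar>) \<le> \<epsilon> / 8" .
        show ?thesis using 1 2 glip[of N z ?z] g'lip[of z ?z] by linarith
      qed
      have "\<bar>(\<bbbE> e. g N (\<lambda>v. Z N v e)) - (\<bbbE> e. g' (\<lambda>v. Z N v e))\<bar> \<le> (\<bbbE> e. \<epsilon> / 2) + 2 * (R * R) * (real (card J) * \<epsilon>')"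
      proof (rule integral_close_on_box[OF fin(2) Zm _ gi])
        show "\<bar>g N (\<lambda>v. Z N v e) - g' (\<lambda>v. Z N v e)\<bar> \<le> 2 * (R * R)" for e
          using gB[of N "\<lambda>v. Z N v e"] g'B[of "\<lambda>v. Z N v e"] by linarith
      qed (use elim pt \<epsilon> in auto)
      also have "2 * (R * R) * (real (card J) * \<epsilon>') \<le> (2 * (R * R) + 1) * ((k + 1) * \<epsilon>')"
        using k R \<epsilon>' unfolding k_def by (intro mult_mono) auto
      also have "\<dots> = \<epsilon> / 4"
      proof -
        have "0 < 2 * (R * R) + 1" using R by (intro add_nonneg_pos) auto
        then show ?thesis unfolding \<epsilon>'_def using k by (intro cancel(1)) auto
      qed
      also have "(\<bbbE> e. \<epsilon> / 2) = \<epsilon> / 2" using env.prob_space by simp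
      finally show ?case using \<epsilon> by simp
    qed
    with lim' \<epsilon> show "\<exists>b l'. b \<longlonglongrightarrow> l' \<and> ev (\<lambda>N. \<bar>(\<bbbE> e. g N (\<lambda>v. Z N v e)) - b N\<bar> \<le> \<epsilon>)
        \<and> \<bar>l' - (\<integral>x. g' (\<lambda>v. B v x) \<partial>M')\<bar> \<le> \<epsilon>"
      by (intro exI conjI) auto
  qed
  then show ?thesis unfolding g_def by (rule convergentI)
qed

section \<open>Cutting paths\<close>

text \<open>Near a = 0 the stationary increments have means close to 2. The slope w is conceded so
  that the fourth moment of the running maximum is bounded independently of its length K.\<close>

definition WI :: "real => real => nat => nat => nat => (nat \<times> nat => real) => real" where
  "WI a w x y K e = runmax (\<lambda>i. Ist (1 / 2 + a) e (x + Suc i) y - (2 + w)) K"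

definition WJ :: "real => real => nat => nat => nat => (nat \<times> nat => real) => real" where
  "WJ a w x y K e = runmax (\<lambda>i. (2 - w) - Jst (1 / 2 + a) e x (y - i)) K"

lemma WI_nonneg: "0 \<le> WI a w x y K e" and WJ_nonneg: "0 \<le> WJ a w x y K e"
  by (simp_all add: WI_def WJ_def runmax_nonneg)

lemma inverse_half_bounds:
  fixes a :: real
  assumes "\<bar>a\<bar> \<le> 1 / 16"
  shows "1 / (1 / 2 - a) \<le> 2 + 5 * \<bar>a\<bar>" "2 - 5 * \<bar>a\<bar> \<le> 1 / (1 / 2 + a)" "1 / (1 / 2 - a)\<^sup>2 \<le> 11 / 2" "1 / (1 / 2 + a)\<^sup>2 \<le> 11 / 2"
proof -
  have "1 \<le> (2 + 5 * \<bar>a\<bar>) * (1 / 2 - a)" "(2 - 5 * \<bar>a\<bar>) * (1 / 2 + a) \<le> 1"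
  proof -
    have "0 \<le> \<bar>a\<bar> * (1 / 2 - 5 * \<bar>a\<bar>)" using assms by (intro mult_nonneg_nonneg) auto
    then have "5 * (\<bar>a\<bar> * \<bar>a\<bar>) \<le> \<bar>a\<bar> / 2" by (simp add: algebra_simps)
    moreover have "\<bar>a\<bar> * a \<le> \<bar>a\<bar> * \<bar>a\<bar>" "\<bar>a\<bar> * (- a) \<le> \<bar>a\<bar> * \<bar>a\<bar>"
      by (intro mult_left_mono; simp)+
    moreover have "(2 + 5 * \<bar>a\<bar>) * (1 / 2 - a) = 1 - 2 * a + 5 / 2 * \<bar>a\<bar> - 5 * (\<bar>a\<bar> * a)"
      "(2 - 5 * \<bar>a\<bar>) * (1 / 2 + a) = 1 + 2 * a - 5 / 2 * \<bar>a\<bar> - 5 * (\<bar>a\<bar> * a)"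
      by (simp_all only: algebra_simps)
    moreover have "\<bar>a\<bar> * (- a) = - (\<bar>a\<bar> * a)" by simp
    moreover have "- \<bar>a\<bar> \<le> a" "a \<le> \<bar>a\<bar>" by auto
    ultimately show "1 \<le> (2 + 5 * \<bar>a\<bar>) * (1 / 2 - a)" "(2 - 5 * \<bar>a\<bar>) * (1 / 2 + a) \<le> 1"
      by linarith+
  qed
  then show "1 / (1 / 2 - a) \<le> 2 + 5 * \<bar>a\<bar>" "2 - 5 * \<bar>a\<bar> \<le> 1 / (1 / 2 + a)"
    using assms by (auto simp: pos_divide_le_eq pos_le_divide_eq)
  have "(7 / 16)\<^sup>2 \<le> (1 / 2 - a)\<^sup>2" "(7 / 16)\<^sup>2 \<le> (1 / 2 + a)\<^sup>2"
    using assms by (intro power_mono; linarith)+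
  then have "1 / (1 / 2 - a)\<^sup>2 \<le> 1 / (7 / 16)\<^sup>2" "1 / (1 / 2 + a)\<^sup>2 \<le> 1 / (7 / 16)\<^sup>2"
    using assms by (auto intro!: divide_left_mono)
  moreover have "1 / (7 / 16)\<^sup>2 \<le> (11 / 2 :: real)" by (simp add: power2_eq_square)
  ultimately show "1 / (1 / 2 - a)\<^sup>2 \<le> 11 / 2" "1 / (1 / 2 + a)\<^sup>2 \<le> 11 / 2" by linarith+
qed

text \<open>In the slope condition 5 |a| bounds the deviation of the mean from 2, and 11 s is 2 s
  times the bound 11/2 on the squared mean.\<close>

lemma m4_WI:
  assumes "\<bar>a\<bar> \<le> 1 / 16" "0 < s" "s \<le> 1 / 16" "5 * \<bar>a\<bar> + 11 * s \<le> w" "y \<le> x"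
  shows "m4 (WI a w x y K) (C4 / s ^ 4)"
  unfolding WI_def[abs_def]
proof (rule m4_row)
  have "2 * s * (1 / (1 / 2 - a)\<^sup>2) \<le> 2 * s * (11 / 2)"
    using inverse_half_bounds(3)[OF assms(1)] assms by (intro mult_left_mono) auto
  then show "1 / (1 - (1 / 2 + a)) + 2 * s / (1 - (1 / 2 + a))\<^sup>2 \<le> 2 + w"
    using inverse_half_bounds(1)[OF assms(1)] assms by simp
qed (use assms in \<open>auto simp: abs_le_iff\<close>)

lemma m4_WJ:
  assumes "\<bar>a\<bar> \<le> 1 / 16" "0 < s" "s \<le> 1 / 16" "5 * \<bar>a\<bar> + 11 * s \<le> w" "K \<le> y" "y \<le> x"
  shows "m4 (WJ a w x y K) (C4 / s ^ 4)"
  unfolding WJ_def[abs_def]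
proof (rule m4_col)
  have "s * (1 / (1 / 2 + a)\<^sup>2) \<le> s * (11 / 2)"
    using inverse_half_bounds(4)[OF assms(1)] assms by (intro mult_left_mono) auto
  then show "2 - w \<le> 1 / (1 / 2 + a) - s / (1 / 2 + a)\<^sup>2"
    using inverse_half_bounds(2)[OF assms(1)] assms by simp
qed (use assms in \<open>auto simp: abs_le_iff\<close>)

text \<open>With diagonal rate \<open>1 / 2 - h\<close> the horizontal increments have mean less than \<open>2 - 2 * h\<close> and the
  vertical ones mean greater than \<open>2 + 2 * h\<close>.\<close>

lemma m4_W_drift:
  assumes h: "0 < h" "h \<le> 1 / 16" and xy: "y \<le> x"
  shows "m4 (WI (- h) (- 2 * h) x y K) (C4 * 10 ^ 4 / h ^ 4)"
    and "K \<le> y ==> m4 (WJ (- h) (- 2 * h) x y K) (C4 * 10 ^ 4 / h ^ 4)"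
proof -
  have C: "C4 / (h / 10) ^ 4 = C4 * 10 ^ 4 / h ^ 4" by (simp add: power_divide)
  have "1 / (1 / 2 + h) \<le> 2 - 7 / 2 * h"
  proof -
    have "0 \<le> h * (1 / 4 - 7 / 2 * h)" using h by (intro mult_nonneg_nonneg) auto
    then have "1 \<le> (2 - 7 / 2 * h) * (1 / 2 + h)" by (simp add: algebra_simps)
    then show ?thesis using h by (simp add: pos_divide_le_eq)
  qed
  moreover have "(1 / 2)\<^sup>2 \<le> (1 / 2 + h)\<^sup>2" using h by (intro power_mono) auto
  then have "2 * (h / 10) / (1 / 2 + h)\<^sup>2 \<le> 2 * (h / 10) / (1 / 2)\<^sup>2"
    using h by (intro divide_left_mono) auto
  moreover have "2 * (h / 10) / (1 / 2)\<^sup>2 = 4 / 5 * h" by (simp add: power2_eq_square)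
  moreover have "1 - (1 / 2 + - h) = 1 / 2 + h" by simp
  ultimately have I: "1 / (1 - (1 / 2 + - h)) + 2 * (h / 10) / (1 - (1 / 2 + - h))\<^sup>2 \<le> 2 + - 2 * h"
    using h by (simp only:)
  show "m4 (WI (- h) (- 2 * h) x y K) (C4 * 10 ^ 4 / h ^ 4)"
    unfolding WI_def[abs_def] C[symmetric] by (rule m4_row[OF _ _ xy _ _ I]) (use h in auto)
  have "2 + 4 * h \<le> 1 / (1 / 2 - h)"
  proof -
    have "0 \<le> h * h" by simp
    then have "(2 + 4 * h) * (1 / 2 - h) \<le> 1" by (simp add: algebra_simps)
    then show ?thesis using h by (simp add: pos_le_divide_eq)
  qed
  moreover have "h / 10 * (1 / (1 / 2 + - h)\<^sup>2) \<le> h / 10 * (11 / 2)"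
    using inverse_half_bounds(4)[of "- h"] h by (intro mult_left_mono) auto
  ultimately have J: "2 - - 2 * h \<le> 1 / (1 / 2 + - h) - (h / 10) / (1 / 2 + - h)\<^sup>2" using h by simp
  show "m4 (WJ (- h) (- 2 * h) x y K) (C4 * 10 ^ 4 / h ^ 4)" if "K \<le> y"
    unfolding WJ_def[abs_def] C[symmetric] by (rule m4_col[OF _ _ that xy _ _ J]) (use h in auto)
qed

text \<open>By attractiveness the horizontal point-to-point increments lie below the stationary
  ones, and the vertical ones above. Hence the effect of moving right or down can be bounded from
  above through the stationary model, whose sums are explicit.\<close>

lemma pp_right:
  assumes e: "nonneg e" and a: "\<bar>a\<bar> < 1 / 2" and "y \<le> x" "k \<le> K"
  shows "Gpp a e (x + k) y \<le> Gpp a e x y + (2 + w) * real k + WI a w x y K e"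
proof -
  have "Gpp a e (x + k) y = Gpp a e x y + (\<Sum>i<k. Inc (1 / (1 / 2 + a)) 0 e (x + Suc i) y)"
    using G_sum_Inc[of x "x + k"] by (simp add: sum_up)
  also have "(\<Sum>i<k. Inc (1 / (1 / 2 + a)) 0 e (x + Suc i) y) \<le> (\<Sum>i<k. Ist (1 / 2 + a) e (x + Suc i) y)"
    using a \<open>y \<le> x\<close> by (intro sum_mono Inc_compare e) auto
  also have "\<dots> = (\<Sum>i<k. Ist (1 / 2 + a) e (x + Suc i) y - (2 + w)) + (2 + w) * real k"
    by (simp add: sum_subtractf)
  also have "(\<Sum>i<k. Ist (1 / 2 + a) e (x + Suc i) y - (2 + w)) \<le> WI a w x y K e"
    unfolding WI_def using \<open>k \<le> K\<close> by (rule runmax_ge)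
  finally show ?thesis by simp
qed

lemma pp_down:
  assumes e: "nonneg e" and a: "\<bar>a\<bar> < 1 / 2" and "y \<le> x" "k \<le> K" "K \<le> y"
  shows "Gpp a e x (y - k) \<le> Gpp a e x y - (2 - w) * real k + WJ a w x y K e"
proof -
  have "Gpp a e x y = Gpp a e x (y - k) + (\<Sum>i<k. Jnc (1 / (1 / 2 + a)) 0 e x (y - i))"
    using G_sum_Jnc[of "y - k" y] assms by (simp add: sum_down)
  moreover have "(\<Sum>i<k. Jst (1 / 2 + a) e x (y - i)) \<le> (\<Sum>i<k. Jnc (1 / (1 / 2 + a)) 0 e x (y - i))"
    using a assms by (intro sum_mono Jnc_compare e) auto
  moreover have "(\<Sum>i<k. (2 - w) - Jst (1 / 2 + a) e x (y - i)) \<le> WJ a w x y K e"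
    unfolding WJ_def using \<open>k \<le> K\<close> by (rule runmax_ge)
  ultimately show ?thesis by (simp add: sum_subtractf mult.commute)
qed

lemma pp_right_down:
  assumes "nonneg e" "\<bar>a\<bar> < 1 / 2" "y \<le> x" "q \<le> y"
  shows "Gpp a e (x + p) (y - q) \<le> Gpp a e x y + 2 * (real p - real q) + w * (real p + real q)
    + WJ a w x y q e + WI a w x (y - q) p e"
proof -
  have "y - q \<le> x" using assms by simp
  then show ?thesis
    using pp_right[OF assms(1,2) _ order_refl, of "y - q" x p w] pp_down[OF assms(1,2,3) order_refl assms(4), of w]
    by (simp add: algebra_simps)
qed

text \<open>The cut is a staircase through the points \<open>(n + v j, n - v j)\<close>, followed below \<open>(n, n - v M)\<close> by
  the column \<open>n\<close>.\<close>

lemma stair_cut: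
  fixes v :: "nat => nat"
  assumes e: "nonneg e" and \<alpha>: "0 \<le> \<alpha>" and N: "N = n + m"
    and v: "v 0 = 0" "strict_mono_on {..M} v" "1 \<le> M" "v M < n" "v M \<le> m"
    and vert: "\<And>j y. j < M ==> n \<le> y + v (Suc j) ==> y + v j \<le> n ==>
      G \<alpha> 0 e (n + v j) y + G \<alpha> 0 (rev_env N e) (N + 1 - y) (N + 1 - (n + v j)) \<le> B"
    and hor: "\<And>j x. j < M ==> n + v j \<le> x ==> x \<le> n + v (Suc j) ==>
      G \<alpha> 0 e x (n - v (Suc j)) + G \<alpha> 0 (rev_env N e) (N + 1 - (n - v (Suc j))) (N + 1 - x) \<le> B"
    and tail: "\<And>y. 1 \<le> y ==> y + v M \<le> n ==> G \<alpha> 0 e n y + G \<alpha> 0 (rev_env N e) (N + 1 - y) (N + 1 - n) \<le> B"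
  shows "G \<alpha> 0 e N N \<le> B"
proof -
  \<comment> \<open>The points on or beyond the cut. Above the level of the last corner these are
    the points that are not strictly to the lower left of any corner (n + v j, n - v j); below that
    level they are the points with x \<ge> n.\<close>
  define Out where "Out = {(x, y). 1 \<le> y \<and> y \<le> x \<and> x \<le> N \<and> n \<le> x \<and>
    (y + v M \<le> n \<or> (\<forall>i<M. n + v (Suc i) \<le> x \<or> n \<le> y + v (Suc i)))}"
  have vm: "v i < v j" if "i < j" "j \<le> M" for i j using v(2) that by (auto simp: strict_mono_on_def)
  show ?thesis
  proof (rule G_cut_bound[OF e \<alpha>, where Out=Out])
    show "1 \<le> N" using N v by simp
    show "Out \<subseteq> {(x, y). 1 \<le> y \<and> y \<le> x \<and> x \<le> N}" by (auto simp: Out_def)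
    show "(N, N) \<in> Out" using N v by (auto simp: Out_def)
    fix x y assume xy: "(x, y) \<in> Out"
    then have b: "1 \<le> y" "y \<le> x" "x \<le> N" "n \<le> x" by (auto simp: Out_def)
    let ?b = "G \<alpha> 0 e x y + G \<alpha> 0 (rev_env N e) (N + 1 - y) (N + 1 - x) \<le> B"
    have v0: "v M \<le> n" using v by simp
    have low: "?b \<or> (n < x \<and> (y \<noteq> 1 \<longrightarrow> (x, y - 1) \<in> Out) \<and> (x - 1, y) \<in> Out \<and> y < x)" if t: "y + v M \<le> n"
    proof (cases "x = n")
      case True
      then show ?thesis using tail[of y] t b by auto
    next
      case False
      moreover have "y \<le> n" using t by simp
      ultimately show ?thesis using b t by (auto simp: Out_def)
    qed
    have high: "?b \<or> (n < x \<and> (x, y - 1) \<in> Out \<and> y \<noteq> 1 \<and> (y < x \<longrightarrow> (x - 1, y) \<in> Out))" if t: "n < y + v M"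
    proof -
      have st: "n + v (Suc i) \<le> x \<or> n \<le> y + v (Suc i)" if "i < M" for i
        using xy t that by (auto simp: Out_def)
      \<comment> \<open>Here a step to the left leaves \<open>Out\<close>, so the point lies on a
        vertical piece of the staircase. Likewise \<open>nh\<close> treats steps down and horizontal
        pieces.\<close>
      have nb: ?b if "n + v (Suc i) = x" "y + v (Suc i) < n" "i < M" for i
      proof -
        have "Suc i < M" using that t by (metis Suc_lessI add.commute less_asym)
        moreover from this have "n \<le> y + v (Suc (Suc i))"
          using st[of "Suc i"] that vm[of "Suc i" "Suc (Suc i)"] by auto
        ultimately show ?thesis using vert[of "Suc i" y] that by auto
      qed
      have nh: ?b if "y + v (Suc i) = n" "x < n + v (Suc i)" "i < M" for i
      proof -
        have "n + v i \<le> x"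
        proof (cases i)
          case 0
          then show ?thesis using v b by simp
        next
          case (Suc i')
          then show ?thesis using st[of i'] that vm[of "Suc i'" "Suc i"] by auto
        qed
        moreover have "n - v (Suc i) = y" using that by simp
        ultimately show ?thesis using hor[of i x] that by auto
      qed
      have n0: ?b if "x = n"
      proof -
        have "n \<le> y + v (Suc 0)" using st[of 0] that vm[of 0 1] v by auto
        then show ?thesis using vert[of 0 y] that b v by auto
      qed
      show ?thesis
      proof (cases ?b)
        case False
        then have "n < x" using n0 b by (metis le_neq_implies_less)
        moreover have left: "(x - 1, y) \<in> Out" if "y < x"
        proof -
          have "n + v (Suc i) \<le> x - 1 \<or> n \<le> y + v (Suc i)" if "i < M" for i
            using st[OF that] nb[OF _ _ that] False by fastforce
          then show ?thesis using b that \<open>n < x\<close> by (auto simp: Out_def)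
        qed
        moreover have y1: "y \<noteq> 1" using nh[of "M - 1"] False t v b st[of "M - 1"] \<open>n < x\<close>
          by (metis Suc_diff_1 add.commute diff_less le_neq_implies_less less_Suc_eq_le less_le_trans
              not_less plus_1_eq_Suc zero_less_one)
        moreover have "(x, y - 1) \<in> Out"
        proof -
          have "n + v (Suc i) \<le> x \<or> n \<le> (y - 1) + v (Suc i)" if "i < M" for i
            using st[OF that] nh[OF _ _ that] False b by fastforce
          then show ?thesis using b y1 \<open>n < x\<close> by (auto simp: Out_def)
        qed
        ultimately show ?thesis by blast
      qed simp
    qed
    show "?b \<or> (y < x \<longrightarrow> (x - 1, y) \<in> Out) \<and>
      (if y = 1 then (y < x \<and> G \<alpha> 0 e x 0 \<le> G \<alpha> 0 e (x - 1) 1) \<or>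
          G \<alpha> 0 e x 0 + G \<alpha> 0 (rev_env N e) N (N + 1 - x) \<le> B
        else (x, y - 1) \<in> Out)"
    proof (cases "y + v M \<le> n")
      case True
      have "0 \<le> G \<alpha> 0 e (x - 1) 1" if "y < x" "y = 1" using that e \<alpha> by (intro G_nonneg) auto
      then show ?thesis using low[OF True] by auto
    next
      case False
      then show ?thesis using high by auto
    qed
  qed
qed

text \<open>Along a block of the cut one half gains about 2 per step and the other loses about 2, so
  only conceded slopes and running maxima remain. The index m + 1 + v is the reflection of n - v,
  and m + 1 - v that of n + v.\<close>

lemma block_bound:
  fixes a w :: real
  assumes e: "nonneg e" and a: "\<bar>a\<bar> < 1 / 2" and w: "0 \<le> w" and N: "N = n + m" and vb: "v + b < n" "v + b \<le> m"
  defines "B \<equiv> Gpp a e (n + v) (n - v) + Gpp a (rev_env N e) (m + 1 + v) (m + 1 - v) + 4 * w * real b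
    + (WJ a w (n + v) (n - v) b e + WI a w (m + 1 + v) (m + 1 - v) b (rev_env N e)
    + (WI a w (n + v) (n - (v + b)) b e + WJ a w (m + 1 + (v + b)) (m + 1 - v) b (rev_env N e)))"
  shows "n \<le> y + (v + b) ==> y + v \<le> n ==>
      Gpp a e (n + v) y + Gpp a (rev_env N e) (N + 1 - y) (N + 1 - (n + v)) \<le> B"
    and "n + v \<le> x ==> x \<le> n + (v + b) ==>
      Gpp a e x (n - (v + b)) + Gpp a (rev_env N e) (N + 1 - (n - (v + b))) (N + 1 - x) \<le> B"
proof -
  let ?L = "Gpp a e" and ?L' = "Gpp a (rev_env N e)"
  have e': "nonneg (rev_env N e)" by (rule nonneg_rev_env[OF e])
  have vertical: "?L (n + v) (n - v - k) + ?L' (m + 1 + v + k) (m + 1 - v)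
      \<le> ?L (n + v) (n - v) + ?L' (m + 1 + v) (m + 1 - v) + 2 * w * real b
        + (WJ a w (n + v) (n - v) b e + WI a w (m + 1 + v) (m + 1 - v) b (rev_env N e))" if "k \<le> b" for k
  proof -
    have "2 * w * real k \<le> 2 * w * real b" using w that by (intro mult_left_mono) auto
    moreover have "n - v \<le> n + v" "b \<le> n - v" "m + 1 - v \<le> m + 1 + v" using vb by auto
    ultimately show ?thesis
      using pp_down[OF e a _ that, of "n - v" "n + v" w] pp_right[OF e' a _ that, of "m + 1 - v" "m + 1 + v" w]
      by (simp add: algebra_simps)
  qed
  have W: "0 \<le> WI a w (n + v) (n - (v + b)) b e + WJ a w (m + 1 + (v + b)) (m + 1 - v) b (rev_env N e)"
    "0 \<le> w * real b" using w by (auto simp: WI_nonneg WJ_nonneg)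
  show "?L (n + v) y + ?L' (N + 1 - y) (N + 1 - (n + v)) \<le> B" if "n \<le> y + (v + b)" "y + v \<le> n"
  proof -
    define k where "k = n - v - y"
    have k: "k \<le> b" "y = n - v - k" "N + 1 - y = m + 1 + v + k" "N + 1 - (n + v) = m + 1 - v"
      using that vb N by (auto simp: k_def)
    show ?thesis using vertical[OF k(1)] W unfolding k(3,4) k(2)[symmetric] B_def by linarith
  qed
  show "?L x (n - (v + b)) + ?L' (N + 1 - (n - (v + b))) (N + 1 - x) \<le> B" if "n + v \<le> x" "x \<le> n + (v + b)"
  proof -
    define k where "k = x - (n + v)"
    have k: "k \<le> b" "x = n + v + k" "N + 1 - (n - (v + b)) = m + 1 + (v + b)" "N + 1 - x = m + 1 - v - k"
      "n - v - b = n - (v + b)" "m + 1 + v + b = m + 1 + (v + b)" using that vb N by (auto simp: k_def)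
    have 1: "?L (n + v + k) (n - (v + b)) \<le> ?L (n + v) (n - (v + b)) + (2 + w) * real k + WI a w (n + v) (n - (v + b)) b e"
      using k by (intro pp_right[OF e a]) auto
    have 2: "?L' (m + 1 + (v + b)) (m + 1 - v - k) \<le> ?L' (m + 1 + (v + b)) (m + 1 - v) - (2 - w) * real k
        + WJ a w (m + 1 + (v + b)) (m + 1 - v) b (rev_env N e)" using k vb by (intro pp_down[OF e' a]) auto
    have 3: "2 * w * real k \<le> 2 * w * real b" using w k by (intro mult_left_mono) auto
    have 4: "(2 + w) * real k - (2 - w) * real k = 2 * w * real k" by (simp add: algebra_simps)
    show ?thesis using 1 2 3 4 vertical[of b] unfolding k(2)[symmetric] k(3,4,5,6) B_def by simp
  qed
qed

section \<open>Errors at the corners of the cut\<close>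

definition block_err :: "real => real => nat => nat => nat => nat => (nat \<times> nat => real) => real" where
  "block_err a w n m v v' e =
    (WJ a w (n + v) (n - v) (v' - v) e + WI a w (m + 1 + v) (m + 1 - v) (v' - v) (rev_env (n + m) e)
    + (WI a w (n + v) (n - v') (v' - v) e + WJ a w (m + 1 + v') (m + 1 - v) (v' - v) (rev_env (n + m) e)))"

text \<open>The pairs (p, p') and (s, s') are offsets of rounded grid points of the lower and the
  upper half. The halves have different length scales, so their grid points do not match. The corner
  v lies beyond both, and the error collects the moves from them to the corner.\<close>

definition corner_err :: "real => real => nat => nat => nat => nat => nat => nat => nat => (nat \<times> nat => real) => real" where
  "corner_err a w n m p p' s s' v e =
    (WJ a w (n + p) (n - p') (v - p') e + WI a w (n + p) (n - v) (v - p) e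
    + (WJ a w (m + s) (m - s') (v - 1 - s') (rev_env (n + m) e)
      + WI a w (m + s) (m + 1 - v) (1 + v - s) (rev_env (n + m) e)))"

definition lower_err :: "real => real => nat => nat => nat => nat => nat => nat => (nat \<times> nat => real) => real" where
  "lower_err a w n m p p' s s' e =
    WJ a w (m + 1 + p') (m - p) (s' - p) (rev_env (n + m) e)
    + WI a w (m + 1 + p') (m - s') (s - 1 - p') (rev_env (n + m) e)"

definition origin_err :: "real => real => nat => nat => (nat \<times> nat => real) => real" where
  "origin_err a w n m e = 1 / (1 / 2 + a) * rev_env (n + m) e (Suc m, Suc m) + WI a w m m 1 (rev_env (n + m) e)"

definition tail_value :: "real => nat => nat => nat => (nat \<times> nat => real) => real" where
  "tail_value h n m V e = Gpp (- h) e n n + Gpp (- h) (rev_env (n + m) e) (m + 1) (m + 1) - 4 * h * real V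
    + (WJ (- h) (- 2 * h) n n n e + WI (- h) (- 2 * h) (m + 1) (m + 1) n (rev_env (n + m) e))"

text \<open>Each half moves from its grid point to the corner by nearly equal amounts to the right
  and down, so the slopes 2 cancel up to rounding. The net differences 1 and 3, times 2, make up the
  constant 8.\<close>

lemma corner_compare:
  assumes e: "nonneg e" and a: "\<bar>a\<bar> < 1 / 2" and w: "0 \<le> w"
    and p: "p \<le> p'" "p' \<le> p + 1" and s: "s \<le> s'" "s' \<le> s + 1"
    and ps: "p' + 1 \<le> s" "s' + 1 \<le> v" "v \<le> p + b" and v: "v < n" "v \<le> m"
  shows "Gpp a e (n + v) (n - v) + Gpp a (rev_env (n + m) e) (m + 1 + v) (m + 1 - v)
    \<le> Gpp a e (n + p) (n - p') + Gpp a (rev_env (n + m) e) (m + s) (m - s') + 8 + 4 * w * real b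
      + corner_err a w n m p p' s s' v e"
proof -
  let ?e' = "rev_env (n + m) e"
  have e': "nonneg ?e'" by (rule nonneg_rev_env[OF e])
  have eq1: "n + p + (v - p) = n + v" "n - p' - (v - p') = n - v" using p s ps v by auto
  have eq2: "m + s + (1 + v - s) = m + 1 + v" "m - s' - (v - 1 - s') = m + 1 - v" using p s ps v by auto
  have 1: "Gpp a e (n + v) (n - v) \<le> Gpp a e (n + p) (n - p') + 2 * (real (v - p) - real (v - p'))
      + w * (real (v - p) + real (v - p')) + WJ a w (n + p) (n - p') (v - p') e + WI a w (n + p) (n - v) (v - p) e"
    using pp_right_down[OF e a, of "n - p'" "n + p" "v - p'" "v - p" w] p s ps v unfolding eq1 by simp
  have 2: "Gpp a ?e' (m + 1 + v) (m + 1 - v) \<le> Gpp a ?e' (m + s) (m - s')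
      + 2 * (real (1 + v - s) - real (v - 1 - s')) + w * (real (1 + v - s) + real (v - 1 - s'))
      + WJ a w (m + s) (m - s') (v - 1 - s') ?e' + WI a w (m + s) (m + 1 - v) (1 + v - s) ?e'"
    using pp_right_down[OF e' a, of "m - s'" "m + s" "v - 1 - s'" "1 + v - s" w] p s ps v unfolding eq2 by simp
  have 3: "real (v - p) - real (v - p') \<le> 1" "real (1 + v - s) - real (v - 1 - s') \<le> 3" using p s ps by auto
  have 4: "w * (real (v - p) + real (v - p')) \<le> w * (2 * real b)" using w p s ps by (intro mult_left_mono) auto
  have 5: "w * (real (1 + v - s) + real (v - 1 - s')) \<le> w * (2 * real b)"
    using w p s ps by (intro mult_left_mono) auto
  have "A + B \<le> P + Q + 8 + 4 * w * x + (W1 + W2 + (W3 + W4))"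
    if "A \<le> P + 2 * d1 + y1 + W1 + W2" "B \<le> Q + 2 * d2 + y2 + W3 + W4" "d1 \<le> 1" "d2 \<le> 3"
      "y1 \<le> w * (2 * x)" "y2 \<le> w * (2 * x)" for A B P Q x W1 W2 W3 W4 d1 d2 y1 y2 :: real
    using that by (simp add: mult.assoc mult.left_commute)
  from this[OF 1 2 3 4 5] show ?thesis unfolding corner_err_def .
qed

text \<open>A path through (n + p, n - p') can continue at (n + p + 1, n - p'), whose reflection is
  (m + 1 + p', m - p). As s lies beyond p', the grid point of the upper half is reached from there
  by moving right and down, and the rounding makes the net move to the right nonpositive.\<close>

lemma lower_compare:
  assumes e: "nonneg e" and a: "\<bar>a\<bar> < 1 / 2" and w: "0 \<le> w"
    and p: "p \<le> p'" "p' \<le> p + 1" and s: "s \<le> s'" "s' \<le> s + 1"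
    and ps: "p' + 1 \<le> s" "s' + 1 \<le> v" "v \<le> p + b" and v: "v < n" "v \<le> m"
  shows "Gpp a e (n + p) (n - p') + Gpp a (rev_env (n + m) e) (m + s) (m - s')
    \<le> Gpp a e (n + m) (n + m) + 2 * w * real b + lower_err a w n m p p' s s' e"
proof -
  let ?e' = "rev_env (n + m) e"
  have e': "nonneg ?e'" by (rule nonneg_rev_env[OF e])
  have eq: "m + 1 + p' + (s - 1 - p') = m + s" "m - p - (s' - p) = m - s'" using p s ps v by auto
  have 1: "Gpp a ?e' (m + s) (m - s') \<le> Gpp a ?e' (m + 1 + p') (m - p)
      + 2 * (real (s - 1 - p') - real (s' - p)) + w * (real (s - 1 - p') + real (s' - p))
      + WJ a w (m + 1 + p') (m - p) (s' - p) ?e' + WI a w (m + 1 + p') (m - s') (s - 1 - p') ?e'"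
    using pp_right_down[OF e' a, of "m - p" "m + 1 + p'" "s' - p" "s - 1 - p'" w] p s ps v unfolding eq by simp
  have idx: "n + m + 1 - (n - p') = m + 1 + p'" "n + m - (n + p) = m - p" using p s ps v by auto
  have 2: "Gpp a e (n + p) (n - p') + Gpp a ?e' (m + 1 + p') (m - p) \<le> Gpp a e (n + m) (n + m)"
    using G_rev_lower'[OF e, of "1 / (1 / 2 + a)" "n - p'" "n + p" "n + m"] a p s ps v unfolding idx by auto
  have 3: "real (s - 1 - p') - real (s' - p) \<le> 0" using p s ps by auto
  have 4: "w * (real (s - 1 - p') + real (s' - p)) \<le> w * (2 * real b)"
    using w p s ps by (intro mult_left_mono) auto
  have "P + Q \<le> X + 2 * w * x + (W1 + W2)"
    if "Q \<le> Q' + 2 * d1 + y1 + W1 + W2" "P + Q' \<le> X" "d1 \<le> 0" "y1 \<le> w * (2 * x)" for P Q Q' X x W1 W2 d1 y1 :: real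
    using that by (simp add: mult.assoc mult.left_commute)
  from this[OF 1 2 3 4] show ?thesis unfolding lower_err_def .
qed

lemma origin_compare:
  assumes e: "nonneg e" and a: "\<bar>a\<bar> < 1 / 2"
  shows "Gpp a (rev_env (n + m) e) (m + 1) (m + 1) \<le> Gpp a (rev_env (n + m) e) m m + (2 + w) + origin_err a w n m e"
  using pp_right[OF nonneg_rev_env[OF e] a, of m m 1 1 "n + m" w] unfolding origin_err_def by simp

lemma origin_lower:
  assumes e: "nonneg e" and a: "\<bar>a\<bar> < 1 / 2" and "1 \<le> n"
  shows "Gpp a e n n + Gpp a (rev_env (n + m) e) m m \<le> Gpp a e (n + m) (n + m)"
proof -
  have "Gpp a e n n + Gpp a (rev_env (n + m) e) (m + 1) m \<le> Gpp a e (n + m) (n + m)"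
    using G_rev_lower'[OF e, of "1 / (1 / 2 + a)" n n "n + m"] a assms(3) by simp
  moreover have "Gpp a (rev_env (n + m) e) m m \<le> Gpp a (rev_env (n + m) e) (Suc m) m"
    using a by (intro G_mono_right nonneg_rev_env e) auto
  ultimately show ?thesis by simp
qed

text \<open>Lowering the diagonal rate to 1/2 - h increases both times and creates a drift: up to
  running maxima, each step down column n costs the first time 2 + 2 h and gains the second at most
  2 - 2 h. From distance V on, the loss is at least 4 h V.\<close>

lemma tail_compare:
  assumes e: "nonneg e" and h: "0 < h" "h < 1 / 2" and a: "- h \<le> a" and y: "1 \<le> y" "y + V \<le> n"
  shows "Gpp a e n y + Gpp a (rev_env (n + m) e) (n + m + 1 - y) (n + m + 1 - n) \<le> tail_value h n m V e"
proof -
  let ?e' = "rev_env (n + m) e"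
  have e': "nonneg ?e'" by (rule nonneg_rev_env[OF e])
  define k where "k = n - y"
  have k: "V \<le> k" "k \<le> n" "n - k = y" "n + m + 1 - y = m + 1 + k" "n + m + 1 - n = m + 1"
    using y by (auto simp: k_def)
  have ha: "\<bar>- h\<bar> < 1 / 2" using h by simp
  have mono: "Gpp a e'' i j \<le> Gpp (- h) e'' i j" if "nonneg e''" "j \<le> i" for e'' i j
    using a h that by (intro G_mono_params) (auto intro!: divide_left_mono)
  have "Gpp (- h) e n (n - k) \<le> Gpp (- h) e n n - (2 - (- 2 * h)) * real k + WJ (- h) (- 2 * h) n n n e"
    using k by (intro pp_down[OF e ha]) auto
  moreover have "Gpp (- h) ?e' (m + 1 + k) (m + 1) \<le> Gpp (- h) ?e' (m + 1) (m + 1) + (2 + (- 2 * h)) * real k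
      + WI (- h) (- 2 * h) (m + 1) (m + 1) n ?e'" using k by (intro pp_right[OF e' ha]) auto
  moreover have "(2 - (- 2 * h)) * real k - (2 + (- 2 * h)) * real k = 4 * h * real k" by (simp add: algebra_simps)
  moreover have "4 * h * real V \<le> 4 * h * real k" using h k by (intro mult_left_mono) auto
  moreover have "Gpp a e n y \<le> Gpp (- h) e n (n - k)" unfolding k(3) by (intro mono e) (use y in simp)
  moreover have "Gpp a ?e' (m + 1 + k) (m + 1) \<le> Gpp (- h) ?e' (m + 1 + k) (m + 1)" by (intro mono e') auto
  ultimately show ?thesis unfolding tail_value_def k(4,5) by linarith
qed

text \<open>\<open>block_bound\<close> and \<open>tail_compare\<close> cover the points of the cut;
  then the corners are replaced by grid points. The corner j = 0 is (n, n) itself, where no rounding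
  occurs and only the step from (m, m) to (m + 1, m + 1) in the reflected environment has to be paid
  for.\<close>

lemma grid_upper:
  fixes v p p' s s' :: "nat => nat"
  assumes e: "nonneg e" and a: "\<bar>a\<bar> < 1 / 2" and w: "0 \<le> w" and h: "0 < h" "h < 1 / 2" "- h \<le> a"
    and v: "v 0 = 0" "strict_mono_on {..M} v" "1 \<le> M" "v M < n" "v M \<le> m"
    and vb: "\<And>j. j < M ==> v (Suc j) \<le> v j + b"
    and p: "\<And>j. 1 \<le> j ==> j < M ==> p j \<le> p' j \<and> p' j \<le> p j + 1 \<and> s j \<le> s' j \<and> s' j \<le> s j + 1
      \<and> p' j + 1 \<le> s j \<and> s' j + 1 \<le> v j \<and> v j \<le> p j + b"
    and LM0: "Gpp a e n n + Gpp a (rev_env (n + m) e) m m \<le> LM"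
    and LM: "\<And>j. 1 \<le> j ==> j < M ==>
      Gpp a e (n + p j) (n - p' j) + Gpp a (rev_env (n + m) e) (m + s j) (m - s' j) \<le> LM"
    and E: "\<And>j. j < M ==> block_err a w n m (v j) (v (Suc j)) e +
      (if j = 0 then origin_err a w n m e else corner_err a w n m (p j) (p' j) (s j) (s' j) (v j) e) \<le> Eb"
  shows "Gpp a e (n + m) (n + m) \<le> max (LM + 8 + w + 8 * w * real b + Eb) (tail_value h n m (v M) e)"
    (is "_ \<le> ?B")
proof -
  have vm: "v i < v j" if "i < j" "j \<le> M" for i j using v(2) that by (auto simp: strict_mono_on_def)
  have vle: "v i \<le> v M" if "i \<le> M" for i using vm[of i M] that by (cases "i = M") auto
  have corner: "Gpp a e (n + v j) (n - v j) + Gpp a (rev_env (n + m) e) (m + 1 + v j) (m + 1 - v j)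
      + 4 * w * real (v (Suc j) - v j) + block_err a w n m (v j) (v (Suc j)) e \<le> ?B" if j: "j < M" for j
  proof -
    have "4 * w * real (v (Suc j) - v j) \<le> 4 * w * real b" using w vb[OF j] by (intro mult_left_mono) auto
    moreover have "Gpp a e (n + v j) (n - v j) + Gpp a (rev_env (n + m) e) (m + 1 + v j) (m + 1 - v j)
      \<le> LM + 8 + w + 4 * w * real b
      + (if j = 0 then origin_err a w n m e else corner_err a w n m (p j) (p' j) (s j) (s' j) (v j) e)"
    proof (cases "j = 0")
      case True
      have "0 \<le> w * real b" using w by simp
      then show ?thesis using True v(1) LM0 origin_compare[OF e a, of n m w] by simp
    next
      case False
      then have j1: "1 \<le> j" by simp
      have "v j < n" "v j \<le> m" using vle[of j] j v by auto
      then have "Gpp a e (n + v j) (n - v j) + Gpp a (rev_env (n + m) e) (m + 1 + v j) (m + 1 - v j)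
        \<le> Gpp a e (n + p j) (n - p' j) + Gpp a (rev_env (n + m) e) (m + s j) (m - s' j) + 8 + 4 * w * real b
        + corner_err a w n m (p j) (p' j) (s j) (s' j) (v j) e"
        using p[OF j1 j] by (intro corner_compare[OF e a w]) auto
      then show ?thesis using False LM[OF j1 j] w by simp
    qed
    ultimately show ?thesis using E[OF j] by linarith
  qed
  have N: "n + m = n + m" ..
  show ?thesis
  proof (rule stair_cut[OF e _ N v])
    fix j y assume j: "j < M" and y: "n \<le> y + v (Suc j)" "y + v j \<le> n"
    have eq: "v j + (v (Suc j) - v j) = v (Suc j)" using vm[of j "Suc j"] j by auto
    have "v (Suc j) < n" "v (Suc j) \<le> m" using vle[of "Suc j"] j v by auto
    then show "Gpp a e (n + v j) y + Gpp a (rev_env (n + m) e) (n + m + 1 - y) (n + m + 1 - (n + v j)) \<le> ?B"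
      using block_bound(1)[OF e a w N, of "v j" "v (Suc j) - v j" y] corner[OF j] y
      unfolding eq block_err_def by linarith
  next
    fix j x assume j: "j < M" and x: "n + v j \<le> x" "x \<le> n + v (Suc j)"
    have eq: "v j + (v (Suc j) - v j) = v (Suc j)" using vm[of j "Suc j"] j by auto
    have "v (Suc j) < n" "v (Suc j) \<le> m" using vle[of "Suc j"] j v by auto
    then show "Gpp a e x (n - v (Suc j)) + Gpp a (rev_env (n + m) e) (n + m + 1 - (n - v (Suc j))) (n + m + 1 - x) \<le> ?B"
      using block_bound(2)[OF e a w N, of "v j" "v (Suc j) - v j" x] corner[OF j] x
      unfolding eq block_err_def by linarith
  next
    fix y assume "1 \<le> y" "y + v M \<le> n"
    then show "Gpp a e n y + Gpp a (rev_env (n + m) e) (n + m + 1 - y) (n + m + 1 - n) \<le> ?B"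
      using tail_compare[OF e h, of y "v M" n m] by simp
  qed (use a in auto)
qed

section \<open>Fourth moments of the errors\<close>

lemma m4_two: "m4 f A ==> m4 g A ==> 0 \<le> A ==> m4 (\<lambda>e. f e + g e) (16 * A)"
  using m4_add[of f A g A] by simp

lemma m4_four:
  assumes "m4 f1 A" "m4 f2 A" "m4 f3 A" "m4 f4 A" "0 \<le> A"
  shows "m4 (\<lambda>e. f1 e + f2 e + (f3 e + f4 e)) (256 * A)"
  using m4_two[OF m4_two[OF assms(1,2,5)] m4_two[OF assms(3,4,5)]] assms(5) by simp

lemma m4_coordinate: "m4 (\<lambda>e. e p) 8192"
proof -
  have "(\<bbbE>\<^sup>+ e. ennreal (e p ^ 4)) = (\<bbbE>\<^sup>+ e. \<integral>\<^sup>+x. ennreal (x ^ 4) \<partial>expo)"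
    using measurable_env_component[of p] by (subst nn_integral_env_update[of _ p]) auto
  also have "\<dots> = (\<integral>\<^sup>+x. ennreal (x ^ 4) \<partial>expo)" by simp
  also have "\<dots> \<le> (\<integral>\<^sup>+x. ennreal 4096 * ennreal (exp (1 / 2 * x)) \<partial>expo)"
  proof (rule nn_integral_mono_AE)
    show "AE x in expo. ennreal (x ^ 4) \<le> ennreal 4096 * ennreal (exp (1 / 2 * x))" using AE_expo_nonneg
    proof eventually_elim
      case (elim x)
      then have "x ^ 4 \<le> 4096 * exp (1 / 2 * x)" using power4_le_exp[of "x / 2"] by (simp add: power_divide)
      then have "ennreal (x ^ 4) \<le> ennreal (4096 * exp (1 / 2 * x))" by (rule ennreal_leI)
      then show ?case by (subst ennreal_mult'[symmetric]) auto
    qed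
  qed
  also have "\<dots> = ennreal (4096 / (1 - 1 / 2))" by (rule nn_integral_expo_cmult_exp) auto
  finally show ?thesis using measurable_env_component[of p] by (simp add: m4_def)
qed

text \<open>16^4 comes from four nested uses of \<open>m4_two\<close>, each costing 16. The number
  8192 bounds the fourth moment of a coordinate, and 4 bounds the diagonal multiplier near rate
  1/2.\<close>

definition K_err :: real where
  "K_err = 16 ^ 4 * (C4 + 8192 * 4 ^ 4)"

lemma errs_m4:
  assumes a: "\<bar>a\<bar> \<le> 1 / 16" and s0: "0 < \<sigma>" "\<sigma> \<le> 1 / 16" and w: "5 * \<bar>a\<bar> + 11 * \<sigma> \<le> w"
    and p: "p \<le> p'" "s \<le> s'" "p' \<le> v" "s' + 1 \<le> v" "v \<le> v'" "v' < n" "v' \<le> m" "p \<le> s'"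
  shows "m4 (\<lambda>e. block_err a w n m v v' e + corner_err a w n m p p' s s' v e + lower_err a w n m p p' s s' e) (K_err / \<sigma> ^ 4)"
proof -
  let ?A = "C4 / \<sigma> ^ 4"
  have A: "0 \<le> ?A" using C4_pos s0 by simp
  note WI = m4_WI[OF a s0 w] and WJ = m4_WJ[OF a s0 w]
  note r = m4_preserving[OF _ preserving_rev_env]
  have B: "m4 (\<lambda>e. block_err a w n m v v' e) (256 * ?A)"
    unfolding block_err_def by (intro m4_four A WJ WI r[OF WI] r[OF WJ]) (use p in auto)
  have C: "m4 (\<lambda>e. corner_err a w n m p p' s s' v e) (256 * ?A)"
    unfolding corner_err_def by (intro m4_four A WJ WI r[OF WI] r[OF WJ]) (use p in auto)
  have "m4 (\<lambda>e. lower_err a w n m p p' s s' e) (16 * ?A)"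
    unfolding lower_err_def by (intro m4_two A r[OF WI] r[OF WJ]) (use p in auto)
  then have L: "m4 (\<lambda>e. lower_err a w n m p p' s s' e) (16 * (256 * ?A))" by (rule m4_mono) (use A in simp)
  have "m4 (\<lambda>e. block_err a w n m v v' e + corner_err a w n m p p' s s' v e + lower_err a w n m p p' s s' e)
      (16 * (16 * (256 * ?A)))" using A by (intro m4_two B C L) auto
  then show ?thesis
  proof (rule m4_mono)
    have "16 ^ 4 * C4 / \<sigma> ^ 4 \<le> K_err / \<sigma> ^ 4"
      using s0 unfolding K_err_def by (intro divide_right_mono) auto
    then show "16 * (16 * (256 * ?A)) \<le> K_err / \<sigma> ^ 4" by simp
  qed
qed

lemma errs_m4_origin:
  assumes a: "\<bar>a\<bar> \<le> 1 / 16" and s0: "0 < \<sigma>" "\<sigma> \<le> 1 / 16" and w: "5 * \<bar>a\<bar> + 11 * \<sigma> \<le> w"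
    and v: "v' < n" "v' \<le> m"
  shows "m4 (\<lambda>e. block_err a w n m 0 v' e + origin_err a w n m e) (K_err / \<sigma> ^ 4)"
proof -
  let ?A = "(C4 + 8192 * 4 ^ 4) / \<sigma> ^ 4"
  have A: "0 \<le> ?A" using C4_pos s0 by simp
  have C4A: "C4 / \<sigma> ^ 4 \<le> ?A" using s0 by (intro divide_right_mono) auto
  note WI = m4_mono[OF m4_WI[OF a s0 w] C4A] and WJ = m4_mono[OF m4_WJ[OF a s0 w] C4A]
  note r = m4_preserving[OF _ preserving_rev_env]
  have B: "m4 (\<lambda>e. block_err a w n m 0 v' e) (256 * ?A)"
    unfolding block_err_def by (intro m4_four A WJ WI r[OF WI] r[OF WJ]) (use v in auto)
  have c: "m4 (\<lambda>e. 1 / (1 / 2 + a) * e (Suc m, Suc m)) ?A"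
  proof (rule m4_mono[OF m4_cmult[OF m4_coordinate]])
    have "1 / (1 / 2 + a) \<le> 1 / (7 / 16)" using a by (intro divide_left_mono) auto
    then have "(1 / (1 / 2 + a)) ^ 4 \<le> 4 ^ 4" using a by (intro power_mono) auto
    then have "(1 / (1 / 2 + a)) ^ 4 * 8192 \<le> 4 ^ 4 * 8192" by (rule mult_right_mono) simp
    also have "\<dots> \<le> (C4 + 8192 * 4 ^ 4) / 1" using C4_pos by simp
    also have "\<dots> \<le> ?A" using s0 C4_pos power_le_one[of \<sigma> 4] by (intro divide_left_mono) auto
    finally show "(1 / (1 / 2 + a)) ^ 4 * 8192 \<le> ?A" .
  qed
  have O: "m4 (\<lambda>e. origin_err a w n m e) (16 * ?A)"
    unfolding origin_err_def by (intro m4_two A r[OF WI] r[OF c]) auto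
  have "m4 (\<lambda>e. block_err a w n m 0 v' e + origin_err a w n m e) (16 * (256 * ?A))"
  proof (intro m4_two B m4_mono[OF O])
    show "16 * ?A \<le> 256 * ?A" using A by (intro mult_right_mono) auto
  qed (use A in \<open>intro mult_nonneg_nonneg; simp\<close>)
  then show ?thesis
  proof (rule m4_mono)
    have "16 * (256 * x) \<le> 16 ^ 4 * x" if "0 \<le> x" for x :: real using that by simp
    from this[OF A] have "16 * (256 * ?A) \<le> 16 ^ 4 * ?A" .
    then show "16 * (256 * ?A) \<le> K_err / \<sigma> ^ 4" unfolding K_err_def by simp
  qed
qed

lemma err_nonneg: "0 \<le> block_err a w n m v v' e" "0 \<le> corner_err a w n m p p' s s' v e" "0 \<le> lower_err a w n m p p' s s' e"
  unfolding block_err_def corner_err_def lower_err_def by (auto intro!: add_nonneg_nonneg simp: WI_nonneg WJ_nonneg)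

lemma le_plus_power4: "x \<le> q + x ^ 4 / q ^ 3" if "0 < q" for x q :: real
proof (cases "x \<le> q")
  case True
  moreover have "0 \<le> x ^ 4 / q ^ 3" using that by simp
  ultimately show ?thesis by linarith
next
  case False
  then have "q ^ 3 \<le> x ^ 3" using that by (intro power_mono) auto
  then have "x * q ^ 3 \<le> x * x ^ 3" using False that by (intro mult_left_mono) auto
  moreover have "x * x ^ 3 = x ^ 4" by (simp add: eval_nat_numeral)
  ultimately have "x \<le> x ^ 4 / q ^ 3" using that by (simp only: pos_le_divide_eq zero_less_power)
  then show ?thesis using that by linarith
qed

section \<open>Approximation by finitely many grid points\<close>

definition grid_value :: "real => nat => nat => nat \<times> nat => nat \<times> nat => (nat \<times> nat => real) => real" where
  "grid_value a n m p s e =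
    Gpp a e (n + fst p) (n - snd p) + Gpp a (rev_env (n + m) e) (m + fst s) (m - snd s)"

definition grid_err :: "real => real => nat => nat => nat => (nat => nat) => nat \<times> nat => nat \<times> nat => (nat \<times> nat => real) => real" where
  "grid_err a w n m j v p s e = (if j = 0 then block_err a w n m 0 (v 1) e + origin_err a w n m e
    else block_err a w n m (v j) (v (Suc j)) e + corner_err a w n m (fst p) (snd p) (fst s) (snd s) (v j) e
      + lower_err a w n m (fst p) (snd p) (fst s) (snd s) e)"

text \<open>By how much the tail of the cut can exceed the value at the grid origin before the drift
  is counted. The summand 4 is 4 (m + 1) - 4 m, written \<open>4 + 0\<close> to have the four-term
  shape of \<open>m4_four\<close>.\<close>

definition tail_excess :: "real => real => nat => nat => (nat \<times> nat => real) => real" where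
  "tail_excess a h n m e = max 0 (Gpp (- h) e n n - 4 * real n) + pp_deficit a n e
    + (max 0 (Gpp (- h) (rev_env (n + m) e) (m + 1) (m + 1) - 4 * real (m + 1)) + pp_deficit a m (rev_env (n + m) e))
    + (WJ (- h) (- 2 * h) n n n e + WI (- h) (- 2 * h) (m + 1) (m + 1) n (rev_env (n + m) e) + (4 + 0))"

lemma tail_value_le: "tail_value h n m V e \<le> grid_value a n m (0, 0) (0, 0) e + tail_excess a h n m e - 4 * h * real V"
proof -
  have arith: "A + A' - z + W \<le> Y + Y' + (U + d + (U' + d') + (W + 4)) - z"
    if "4 * x - Y \<le> d" "4 * x' - Y' \<le> d'" "A - 4 * x \<le> U" "A' - 4 * (x' + 1) \<le> U'"
    for A A' z W Y Y' U d U' d' x x' :: real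
    using add_mono[OF add_mono[OF that(1,2)] add_mono[OF that(3,4)]] by (simp add: algebra_simps)
  show ?thesis unfolding tail_value_def tail_excess_def grid_value_def fst_conv snd_conv add_0_right diff_zero
    by (rule arith[where x="real n" and x'="real m"]) (auto simp: pp_deficit_def simp del: G.simps)
qed

definition good_grid :: "nat => nat => nat => nat => (nat => nat) => (nat => nat \<times> nat) => (nat => nat \<times> nat) => bool" where
  "good_grid n m M b v p s \<longleftrightarrow> v 0 = 0 \<and> strict_mono_on {..M} v \<and> 1 \<le> M \<and> v M < n \<and> v M \<le> m \<and>
    p 0 = (0, 0) \<and> s 0 = (0, 0) \<and> (\<forall>j<M. v (Suc j) \<le> v j + b) \<and>
    (\<forall>j. 1 \<le> j \<and> j < M \<longrightarrow> fst (p j) \<le> snd (p j) \<and> snd (p j) \<le> fst (p j) + 1 \<and> fst (s j) \<le> snd (s j)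
      \<and> snd (s j) \<le> fst (s j) + 1 \<and> snd (p j) + 1 \<le> fst (s j) \<and> snd (s j) + 1 \<le> v j \<and> v j \<le> fst (p j) + b)"

text \<open>A maximum over the M corners is bounded through x \<le> q + x^4 / q^3, summed over the
  corners, so that only fourth moments enter. The tail is treated alike with \<kappa> in place of q,
  and there the drift 4 h v(M) cancels the term \<kappa>.\<close>

lemma grid_pointwise:
  assumes e: "nonneg e" and a: "\<bar>a\<bar> < 1 / 2" and w: "0 \<le> w" and h: "0 < h" "h < 1 / 2" "- h \<le> a"
    and g: "good_grid n m M b v p s" and q: "0 < q" and \<kappa>: "0 < \<kappa>" "\<kappa> \<le> 4 * h * real (v M)"
  shows "\<bar>Gpp a e (n + m) (n + m) - Max ((\<lambda>j. grid_value a n m (p j) (s j) e) ` {..<M})\<bar>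
    \<le> 8 + w + 8 * w * real b + q + (\<Sum>j<M. grid_err a w n m j v (p j) (s j) e ^ 4) / q ^ 3
      + tail_excess a h n m e ^ 4 / \<kappa> ^ 3"
proof -
  let ?X = "Gpp a e (n + m) (n + m)" and ?L = "\<lambda>j. grid_value a n m (p j) (s j) e"
  let ?E = "\<lambda>j. grid_err a w n m j v (p j) (s j) e" and ?R = "tail_excess a h n m e"
  define LM where "LM = Max (?L ` {..<M})"
  define Eb where "Eb = q + (\<Sum>j<M. ?E j ^ 4) / q ^ 3"
  have v: "v 0 = 0" "strict_mono_on {..M} v" "1 \<le> M" "v M < n" "v M \<le> m"
    and p0: "p 0 = (0, 0)" "s 0 = (0, 0)" and vb: "\<And>j. j < M ==> v (Suc j) \<le> v j + b"
    and pj: "\<And>j. 1 \<le> j ==> j < M ==> fst (p j) \<le> snd (p j) \<and> snd (p j) \<le> fst (p j) + 1 \<and> fst (s j) \<le> snd (s j)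
      \<and> snd (s j) \<le> fst (s j) + 1 \<and> snd (p j) + 1 \<le> fst (s j) \<and> snd (s j) + 1 \<le> v j \<and> v j \<le> fst (p j) + b"
    using g unfolding good_grid_def by blast+
  have vle: "v i < n \<and> v i \<le> m" if "i < M" for i
  proof -
    have "v i < v M" using v(2) that by (auto simp: strict_mono_on_def)
    then show ?thesis using v by linarith
  qed
  have L: "?L j \<le> LM" if "j < M" for j unfolding LM_def using that by (intro Max_ge) auto
  have Eb: "?E j \<le> Eb" if "j < M" for j
  proof -
    have "?E j ^ 4 \<le> (\<Sum>j<M. ?E j ^ 4)"
      using that by (intro member_le_sum[of j "{..<M}" "\<lambda>j. ?E j ^ 4"]) auto
    then have "?E j ^ 4 / q ^ 3 \<le> (\<Sum>j<M. ?E j ^ 4) / q ^ 3" using q by (intro divide_right_mono) auto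
    then show ?thesis using le_plus_power4[OF q, of "?E j"] unfolding Eb_def by linarith
  qed
  have E0: "0 \<le> Eb" unfolding Eb_def using q by (auto intro!: add_nonneg_nonneg divide_nonneg_nonneg sum_nonneg)
  have b0: "0 \<le> w * real b" using w by simp
  have R0: "0 \<le> ?R ^ 4 / \<kappa> ^ 3" using \<kappa> by simp
  have "?X \<le> max (LM + 8 + w + 8 * w * real b + Eb) (tail_value h n m (v M) e)"
  proof (rule grid_upper[where p="\<lambda>j. fst (p j)" and p'="\<lambda>j. snd (p j)" and s="\<lambda>j. fst (s j)" and s'="\<lambda>j. snd (s j)",
        OF e a w h v vb pj])
    show "Gpp a e n n + Gpp a (rev_env (n + m) e) m m \<le> LM" using L[of 0] v p0 by (simp add: grid_value_def)
    fix j assume j: "j < M"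
    show "Gpp a e (n + fst (p j)) (n - snd (p j)) + Gpp a (rev_env (n + m) e) (m + fst (s j)) (m - snd (s j)) \<le> LM"
      using L[OF j] by (simp add: grid_value_def)
    show "block_err a w n m (v j) (v (Suc j)) e + (if j = 0 then origin_err a w n m e
      else corner_err a w n m (fst (p j)) (snd (p j)) (fst (s j)) (snd (s j)) (v j) e) \<le> Eb"
      using Eb[OF j] err_nonneg(3)[of a w n m "fst (p j)" "snd (p j)" "fst (s j)" "snd (s j)" e] v(1)
      by (auto simp: grid_err_def split: if_splits)
  qed simp_all
  moreover have "tail_value h n m (v M) e \<le> LM + ?R ^ 4 / \<kappa> ^ 3"
    using tail_value_le[of h n m "v M" e a] L[of 0] v p0 \<kappa> le_plus_power4[OF \<kappa>(1), of ?R] by simp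
  ultimately have up: "?X \<le> LM + (8 + w + 8 * w * real b + Eb + ?R ^ 4 / \<kappa> ^ 3)"
    using R0 E0 b0 w by linarith
  have "?L j \<le> ?X + 2 * w * real b + Eb" if j: "j < M" for j
  proof (cases "j = 0")
    case True
    then show ?thesis using origin_lower[OF e a, of n m] v p0 E0 b0 by (simp add: grid_value_def)
  next
    case False
    then have j1: "1 \<le> j" by simp
    have "?L j \<le> ?X + 2 * w * real b + lower_err a w n m (fst (p j)) (snd (p j)) (fst (s j)) (snd (s j)) e"
      unfolding grid_value_def using pj[OF j1 j] vle[OF j] by (intro lower_compare[OF e a w, where v="v j"]) auto
    moreover have "lower_err a w n m (fst (p j)) (snd (p j)) (fst (s j)) (snd (s j)) e \<le> ?E j"
      using False err_nonneg(1,2) by (simp add: grid_err_def add_nonneg_nonneg)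
    ultimately show ?thesis using Eb[OF j] by linarith
  qed
  then have "LM \<le> ?X + 2 * w * real b + Eb"
    unfolding LM_def using v(3) by (intro Max.boundedI) (auto simp: lessThan_empty_iff)
  then show ?thesis using up R0 E0 b0 w unfolding LM_def[symmetric] Eb_def[symmetric] abs_le_iff
    by (simp only: Eb_def[symmetric] add.assoc) linarith
qed

lemma m4_grid_err:
  assumes a: "\<bar>a\<bar> \<le> 1 / 16" and s0: "0 < \<sigma>" "\<sigma> \<le> 1 / 16" and w: "5 * \<bar>a\<bar> + 11 * \<sigma> \<le> w"
    and g: "good_grid n m M b v p s" and j: "j < M"
  shows "m4 (grid_err a w n m j v (p j) (s j)) (K_err / \<sigma> ^ 4)"
proof -
  have v: "v 0 = 0" "strict_mono_on {..M} v" "1 \<le> M" "v M < n" "v M \<le> m"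
    and pj: "1 \<le> j ==> fst (p j) \<le> snd (p j) \<and> snd (p j) \<le> fst (p j) + 1 \<and> fst (s j) \<le> snd (s j)
      \<and> snd (s j) \<le> fst (s j) + 1 \<and> snd (p j) + 1 \<le> fst (s j) \<and> snd (s j) + 1 \<le> v j \<and> v j \<le> fst (p j) + b"
    using g j unfolding good_grid_def by blast+
  have "v (Suc j) \<le> v M"
  proof (cases "Suc j = M")
    case False
    then have "v (Suc j) < v M" using v(2) j by (auto simp: strict_mono_on_def)
    then show ?thesis by simp
  qed simp
  then have vS: "v (Suc j) < n" "v (Suc j) \<le> m" using v by linarith+
  have vj: "v j < v (Suc j)" using v(2) j by (auto simp: strict_mono_on_def)
  show ?thesis
  proof (cases "j = 0")
    case True
    then have "grid_err a w n m j v (p j) (s j) = (\<lambda>e. block_err a w n m 0 (v 1) e + origin_err a w n m e)"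
      by (simp add: grid_err_def fun_eq_iff)
    then show ?thesis using errs_m4_origin[OF a s0 w, of "v 1" n m] vS True by simp
  next
    case False
    then have "grid_err a w n m j v (p j) (s j) = (\<lambda>e. block_err a w n m (v j) (v (Suc j)) e
      + corner_err a w n m (fst (p j)) (snd (p j)) (fst (s j)) (snd (s j)) (v j) e
      + lower_err a w n m (fst (p j)) (snd (p j)) (fst (s j)) (snd (s j)) e)" by (simp add: grid_err_def fun_eq_iff)
    then show ?thesis using False vS vj pj by (auto intro!: errs_m4[OF a s0 w])
  qed
qed

lemma m4_sum4:
  assumes "m4 f C" and "0 \<le> C"
  shows "integrable env (\<lambda>e. f e ^ 4)" "(\<bbbE> e. f e ^ 4) \<le> C"
  using m4_integrable4[OF assms(1)] m4_integral4[OF assms(1)] assms(2) by auto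

lemma grid_expectation:
  assumes a: "\<bar>a\<bar> \<le> 1 / 16" and s0: "0 < \<sigma>" "\<sigma> \<le> 1 / 16" and w: "5 * \<bar>a\<bar> + 11 * \<sigma> \<le> w"
    and h: "0 < h" "h < 1 / 2" "- h \<le> a"
    and g: "good_grid n m M b v p s" and q: "0 < q" and \<kappa>: "0 < \<kappa>" "\<kappa> \<le> 4 * h * real (v M)"
    and R: "m4 (tail_excess a h n m) C" "0 \<le> C"
  shows "(\<bbbE>\<^sup>+ e. ennreal \<bar>Gpp a e (n + m) (n + m) - Max ((\<lambda>j. grid_value a n m (p j) (s j) e) ` {..<M})\<bar>)
    \<le> ennreal (8 + w + 8 * w * real b + q + (real M * (K_err / \<sigma> ^ 4)) / q ^ 3 + C / \<kappa> ^ 3)"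
proof -
  let ?E = "\<lambda>j. grid_err a w n m j v (p j) (s j)" and ?R = "tail_excess a h n m"
  let ?c = "8 + w + 8 * w * real b + q"
  have K: "0 \<le> K_err / \<sigma> ^ 4" using s0 C4_pos unfolding K_err_def by simp
  have w0: "0 \<le> w" using w s0 by linarith
  have c0: "0 \<le> ?c" using w0 q by simp
  note E = m4_sum4[OF m4_grid_err[OF a s0 w g] K]
  note R4 = m4_sum4[OF R]
  have int: "integrable env (\<lambda>e. ?c + (\<Sum>j<M. ?E j e ^ 4) / q ^ 3 + ?R e ^ 4 / \<kappa> ^ 3)"
    using E R4 by (intro Bochner_Integration.integrable_add Bochner_Integration.integrable_sum integrable_divide_zero impI) auto
  have "(\<bbbE>\<^sup>+ e. ennreal \<bar>Gpp a e (n + m) (n + m) - Max ((\<lambda>j. grid_value a n m (p j) (s j) e) ` {..<M})\<bar>)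
    \<le> (\<bbbE>\<^sup>+ e. ennreal (?c + (\<Sum>j<M. ?E j e ^ 4) / q ^ 3 + ?R e ^ 4 / \<kappa> ^ 3))"
  proof (rule nn_integral_mono_AE)
    show "AE e in env. ennreal \<bar>Gpp a e (n + m) (n + m) - Max ((\<lambda>j. grid_value a n m (p j) (s j) e) ` {..<M})\<bar>
      \<le> ennreal (?c + (\<Sum>j<M. ?E j e ^ 4) / q ^ 3 + ?R e ^ 4 / \<kappa> ^ 3)" using AE_env_pos
    proof eventually_elim
      case (elim e)
      show ?case by (rule ennreal_leI, rule grid_pointwise[OF elim _ w0 h g q \<kappa>]) (use a in simp)
    qed
  qed
  also have "\<dots> = ennreal (\<bbbE> e. ?c + (\<Sum>j<M. ?E j e ^ 4) / q ^ 3 + ?R e ^ 4 / \<kappa> ^ 3)"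
    using c0 q \<kappa> by (intro nn_integral_eq_integral int AE_I2) (auto intro!: add_nonneg_nonneg divide_nonneg_nonneg sum_nonneg)
  also have "(\<bbbE> e. ?c + (\<Sum>j<M. ?E j e ^ 4) / q ^ 3 + ?R e ^ 4 / \<kappa> ^ 3)
    = ?c + (\<Sum>j<M. (\<bbbE> e. ?E j e ^ 4)) / q ^ 3 + (\<bbbE> e. ?R e ^ 4) / \<kappa> ^ 3"
  proof -
    have 1: "integrable env (\<lambda>e. (\<Sum>j<M. ?E j e ^ 4) / q ^ 3)" "integrable env (\<lambda>e. ?R e ^ 4 / \<kappa> ^ 3)"
      using E R4 by (intro Bochner_Integration.integrable_sum integrable_divide_zero impI; auto)+
    have 2: "(\<bbbE> e. (\<Sum>j<M. ?E j e ^ 4) / q ^ 3) = (\<Sum>j<M. (\<bbbE> e. ?E j e ^ 4)) / q ^ 3"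
      "(\<bbbE> e. ?R e ^ 4 / \<kappa> ^ 3) = (\<bbbE> e. ?R e ^ 4) / \<kappa> ^ 3"
      using E by (subst integral_divide_zero, subst Bochner_Integration.integral_sum) auto
    have "(\<bbbE> e. ?c) = ?c" using env.prob_space by simp
    then show ?thesis
      unfolding 2[symmetric] using 1 Bochner_Integration.integral_add[OF Bochner_Integration.integrable_add[OF _ 1(1)] 1(2), of "\<lambda>_. ?c"]
        Bochner_Integration.integral_add[OF _ 1(1), of "\<lambda>_. ?c"] by (simp only: env.integrable_const simp_thms)
  qed
  also have "\<dots> \<le> ?c + (\<Sum>j<M. K_err / \<sigma> ^ 4) / q ^ 3 + C / \<kappa> ^ 3"
    using E R4 q \<kappa> by (intro add_mono divide_right_mono sum_mono order_refl; simp)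
  finally show ?thesis by (simp add: ennreal_leI)
qed

lemma m4_tail_excess:
  assumes h: "0 < h" "h \<le> 1 / 16" and n: "real n * h ^ 3 \<le> H" "real (m + 1) * h ^ 3 \<le> H"
    and C: "m4 (pp_deficit a n) C" "m4 (pp_deficit a m) C" "C4 * 10 ^ 4 / h ^ 4 \<le> C" "256 * exp (64 * H) / h ^ 4 \<le> C" "256 \<le> C"
    and "1 \<le> n"
  shows "m4 (tail_excess a h n m) (16 ^ 4 * C)"
proof -
  have C0: "0 \<le> C" using C(5) by simp
  note r = m4_preserving[OF _ preserving_rev_env]
  have U: "m4 (\<lambda>e. max 0 (Gpp (- h) e k k - 4 * real k)) C" if "real k * h ^ 3 \<le> H" for k
    using h by (intro m4_mono[OF pp_upper_tail C(4)] that) auto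
  have W: "m4 (WJ (- h) (- 2 * h) n n n) C" "m4 (\<lambda>e. WI (- h) (- 2 * h) (m + 1) (m + 1) n (rev_env (n + m) e)) C"
    using m4_mono[OF m4_W_drift(2)[OF h, of n n n] C(3)]
      r[OF m4_mono[OF m4_W_drift(1)[OF h, of "m + 1" "m + 1" n] C(3)], of "n + m"] by simp_all
  have k: "m4 (\<lambda>e. 4 :: real) C" "m4 (\<lambda>e. 0 :: real) C" using m4_mono[OF m4_const[of 4], of C] m4_mono[OF m4_const[of 0], of C] C(5) by auto
  have A: "m4 (\<lambda>e. max 0 (Gpp (- h) e n n - 4 * real n) + pp_deficit a n e
    + (max 0 (Gpp (- h) (rev_env (n + m) e) (m + 1) (m + 1) - 4 * real (m + 1)) + pp_deficit a m (rev_env (n + m) e))) (256 * C)"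
    by (intro m4_four C(1) U n C0 r[OF U[OF n(2)]] r[OF C(2)])
  have B: "m4 (\<lambda>e. WJ (- h) (- 2 * h) n n n e + WI (- h) (- 2 * h) (m + 1) (m + 1) n (rev_env (n + m) e) + (4 + 0)) (256 * C)"
    by (intro m4_four W k C0)
  have "m4 (tail_excess a h n m) (16 * (256 * C))"
    unfolding tail_excess_def[abs_def] by (rule m4_two[OF A B]) (use C0 in simp)
  then show ?thesis by (rule m4_mono) (use C0 in simp)
qed

section \<open>Choice of the grid\<close>

definition fluct_scale :: "nat => real" where
  "fluct_scale n = (2 * real n) powr (2 / 3)"

text \<open>Rounding down \<open>n + u * A\<close> and \<open>n - u * A\<close> shifts \<open>n\<close> by the floor and by the ceiling of \<open>u * A\<close>.\<close>

definition grid_pt :: "real => real => nat \<times> nat" where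
  "grid_pt A u = (nat \<lfloor>u * A\<rfloor>, nat \<lceil>u * A\<rceil>)"

lemma fst_grid_pt: "0 \<le> u * A ==> real (fst (grid_pt A u)) \<le> u * A \<and> u * A < real (fst (grid_pt A u)) + 1"
  unfolding grid_pt_def by simp

lemma snd_grid_pt: "0 \<le> u * A ==> u * A \<le> real (snd (grid_pt A u)) \<and> real (snd (grid_pt A u)) < u * A + 1"
  unfolding grid_pt_def by simp linarith

lemma grid_pt_le: "0 \<le> u * A ==> fst (grid_pt A u) \<le> snd (grid_pt A u) \<and> snd (grid_pt A u) \<le> fst (grid_pt A u) + 1"
  using fst_grid_pt[of u A] snd_grid_pt[of u A] by linarith

text \<open>In units of \<epsilon> A the grid points of the lower half lie at j, the corners at j +
  2/3, and the grid points of the upper half in between. The margins 3 absorb the rounding and the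
  off-by-one conditions of the comparisons.\<close>

lemma good_gridI:
  fixes A B \<epsilon> :: real
  defines "v \<equiv> \<lambda>j. if j = 0 then 0 else nat \<lceil>(real j + 2 / 3) * (\<epsilon> * A)\<rceil>"
  assumes \<epsilon>: "0 \<le> B" "9 \<le> \<epsilon> * A" and M: "1 \<le> M"
    and n: "(real M + 2 / 3) * (\<epsilon> * A) + 1 < real n" "(real M + 2 / 3) * (\<epsilon> * A) + 1 < real m"
    and t: "\<And>j. j < M ==> 0 \<le> t j" "t 0 = 0"
    and j: "\<And>j. 1 \<le> j ==> j < M ==> real j * (\<epsilon> * A) + 3 \<le> t j * B \<and> t j * B + 3 \<le> (real j + 2 / 3) * (\<epsilon> * A)"
  shows "good_grid n m M (nat \<lceil>2 * (\<epsilon> * A)\<rceil>) v (\<lambda>j. grid_pt A (real j * \<epsilon>)) (\<lambda>j. grid_pt B (t j))"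
proof -
  let ?A = "\<epsilon> * A" and ?b = "nat \<lceil>2 * (\<epsilon> * A)\<rceil>"
  have v: "(real j + 2 / 3) * ?A \<le> real (v j) \<and> real (v j) < (real j + 2 / 3) * ?A + 1" if "1 \<le> j" for j
  proof -
    have "0 \<le> (real j + 2 / 3) * ?A" using \<epsilon> by simp
    then show ?thesis using that unfolding v_def by simp linarith
  qed
  have v0: "v 0 = 0" by (simp add: v_def)
  have S: "(real (Suc j) + 2 / 3) * ?A = (real j + 2 / 3) * ?A + ?A" for j by (simp add: algebra_simps)
  have b: "2 * ?A \<le> real ?b" by linarith
  have step: "v j < v (Suc j) \<and> v (Suc j) \<le> v j + ?b" for j
  proof (cases "j = 0")
    case True
    have "real (v 1) < 5 / 3 * ?A + 1" "5 / 3 * ?A \<le> real (v 1)" using v[of 1] by simp_all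
    with \<epsilon>(2) b have "real (v 1) \<le> real ?b" "0 < real (v 1)" by linarith+
    then show ?thesis using True v0 by simp
  next
    case False
    then show ?thesis using v[of j] v[of "Suc j"] S[of j] \<epsilon> b by linarith
  qed
  have "strict_mono v" using step by (auto simp: strict_mono_Suc_iff)
  then have "strict_mono_on {..M} v" by (auto simp: strict_mono_on_def strict_mono_def)
  moreover have "v M < n" "v M \<le> m" using v[OF M] n by linarith+
  moreover have "fst (grid_pt A (real j * \<epsilon>)) \<le> snd (grid_pt A (real j * \<epsilon>)) \<and> snd (grid_pt A (real j * \<epsilon>)) \<le> fst (grid_pt A (real j * \<epsilon>)) + 1
      \<and> fst (grid_pt B (t j)) \<le> snd (grid_pt B (t j)) \<and> snd (grid_pt B (t j)) \<le> fst (grid_pt B (t j)) + 1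
      \<and> snd (grid_pt A (real j * \<epsilon>)) + 1 \<le> fst (grid_pt B (t j)) \<and> snd (grid_pt B (t j)) + 1 \<le> v j
      \<and> v j \<le> fst (grid_pt A (real j * \<epsilon>)) + ?b" if "1 \<le> j" "j < M" for j
  proof -
    have eq: "real j * \<epsilon> * A = real j * ?A" by simp
    have "0 \<le> real j * ?A" using \<epsilon> by simp
    then have p: "0 \<le> real j * \<epsilon> * A" unfolding eq .
    have s: "0 \<le> t j * B" using t \<epsilon> that by simp
    have S': "(real j + 2 / 3) * ?A = real j * ?A + 2 / 3 * ?A" by (simp add: algebra_simps)
    show ?thesis
      using grid_pt_le[OF p] grid_pt_le[OF s] fst_grid_pt[OF p] snd_grid_pt[OF p] fst_grid_pt[OF s] snd_grid_pt[OF s]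
        v[OF that(1)] j[OF that] S' b \<epsilon>(2) unfolding eq by linarith
  qed
  ultimately show ?thesis unfolding good_grid_def using M v0 step t(2) by (auto simp: grid_pt_def)
qed

definition lower_part :: "real => nat => nat" where
  "lower_part \<tau> N = nat \<lfloor>\<tau> * real N\<rfloor>"

lemma lower_part_bounds:
  assumes "0 < \<tau>" "\<tau> < 1"
  shows "\<tau> * real N - 1 \<le> real (lower_part \<tau> N)" "real (lower_part \<tau> N) \<le> \<tau> * real N" "lower_part \<tau> N \<le> N"
proof -
  have "0 \<le> \<tau> * real N" using assms by simp
  then show 1: "\<tau> * real N - 1 \<le> real (lower_part \<tau> N)" "real (lower_part \<tau> N) \<le> \<tau> * real N"
    unfolding lower_part_def by linarith+
  have "\<tau> * real N \<le> 1 * real N" using assms by (intro mult_right_mono) auto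
  then show "lower_part \<tau> N \<le> N" using 1 by linarith
qed

lemma lower_part_lim:
  assumes "0 < \<tau>" "\<tau> < 1"
  shows "(\<lambda>N. real (lower_part \<tau> N) / real N) \<longlonglongrightarrow> \<tau>" "(\<lambda>N. real (N - lower_part \<tau> N) / real N) \<longlonglongrightarrow> 1 - \<tau>"
proof -
  show 1: "(\<lambda>N. real (lower_part \<tau> N) / real N) \<longlonglongrightarrow> \<tau>"
  proof (rule tendsto_sandwich[where h="\<lambda>_. \<tau>" and f="\<lambda>N. \<tau> - 1 / real N"])
    show "ev (\<lambda>N. \<tau> - 1 / real N \<le> real (lower_part \<tau> N) / real N)"
      using eventually_gt_at_top[of 0]
    proof eventually_elim
      case (elim N)
      then show ?case using lower_part_bounds(1)[OF assms, of N] by (simp add: diff_divide_eq_iff pos_le_divide_eq divide_simps mult.commute)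
    qed
    show "ev (\<lambda>N. real (lower_part \<tau> N) / real N \<le> \<tau>)" using eventually_gt_at_top[of 0]
    proof eventually_elim
      case (elim N)
      then show ?case using lower_part_bounds(2)[OF assms, of N] by (simp add: pos_divide_le_eq)
    qed
    show "(\<lambda>N. \<tau> - 1 / real N) \<longlonglongrightarrow> \<tau>" by real_asymp
  qed simp
  have "ev (\<lambda>N. 1 - real (lower_part \<tau> N) / real N = real (N - lower_part \<tau> N) / real N)"
    using eventually_gt_at_top[of 0]
  proof eventually_elim
    case (elim N)
    then show ?case using lower_part_bounds(3)[OF assms, of N] by (simp add: of_nat_diff diff_divide_distrib)
  qed
  then show "(\<lambda>N. real (N - lower_part \<tau> N) / real N) \<longlonglongrightarrow> 1 - \<tau>"
    by (rule Lim_transform_eventually[rotated]) (intro tendsto_intros 1)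
qed

lemma upper_part_bounds:
  assumes "0 < \<tau>" "\<tau> < 1"
  shows "(1 - \<tau>) * real N \<le> real (N - lower_part \<tau> N)"
  using lower_part_bounds[OF assms, of N] by (simp add: of_nat_diff algebra_simps)

lemma filterlim_parts:
  assumes "0 < \<tau>" "\<tau> < 1"
  shows "filterlim (lower_part \<tau>) at_top sequentially" "filterlim (\<lambda>N. N - lower_part \<tau> N) at_top sequentially"
proof -
  have "filterlim (\<lambda>N. \<tau> * real N - 1) at_top sequentially" using assms by real_asymp
  then have "filterlim (\<lambda>N. real (lower_part \<tau> N)) at_top sequentially"
    by (rule filterlim_at_top_mono) (use lower_part_bounds(1)[OF assms] in auto)
  then show "filterlim (lower_part \<tau>) at_top sequentially" by (simp only: filterlim_real_sequentially filterlim_sequentially_iff_filterlim_real)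
  have "filterlim (\<lambda>N. (1 - \<tau>) * real N) at_top sequentially" using assms by real_asymp
  then have "filterlim (\<lambda>N. real (N - lower_part \<tau> N)) at_top sequentially"
    by (rule filterlim_at_top_mono) (use upper_part_bounds[OF assms] in auto)
  then show "filterlim (\<lambda>N. N - lower_part \<tau> N) at_top sequentially" by (simp only: filterlim_sequentially_iff_filterlim_real)
qed

lemma fluct_scale_ratio:
  assumes \<tau>: "0 < \<tau>" "\<tau> < 1"
  shows "(\<lambda>N. (\<tau> / (1 - \<tau>)) powr (2 / 3) * fluct_scale (N - lower_part \<tau> N) / fluct_scale (lower_part \<tau> N)) \<longlonglongrightarrow> 1"
    and "filterlim (\<lambda>N. fluct_scale (lower_part \<tau> N)) at_top sequentially"
    and "(\<lambda>N. fluct_scale (lower_part \<tau> N) / real N) \<longlonglongrightarrow> 0"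
proof -
  let ?n = "lower_part \<tau>" and ?m = "\<lambda>N. N - lower_part \<tau> N"
  have "(\<lambda>N. \<tau> / (1 - \<tau>) * ((real (?m N) / real N) / (real (?n N) / real N))) \<longlonglongrightarrow> \<tau> / (1 - \<tau>) * ((1 - \<tau>) / \<tau>)"
    using \<tau> by (intro tendsto_intros lower_part_lim) auto
  then have "(\<lambda>N. (\<tau> / (1 - \<tau>) * ((real (?m N) / real N) / (real (?n N) / real N))) powr (2 / 3)) \<longlonglongrightarrow> 1 powr (2 / 3)"
    using \<tau> by (intro tendsto_intros) auto
  moreover have "ev (\<lambda>N. (\<tau> / (1 - \<tau>) * ((real (?m N) / real N) / (real (?n N) / real N))) powr (2 / 3)
    = (\<tau> / (1 - \<tau>)) powr (2 / 3) * fluct_scale (?m N) / fluct_scale (?n N))"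
    using eventually_gt_at_top[of 0]
  proof eventually_elim
    case (elim N)
    have "(real (?m N) / real N) / (real (?n N) / real N) = (2 * real (?m N)) / (2 * real (?n N))" using elim by simp
    then show ?case unfolding fluct_scale_def using \<tau> by (simp only: powr_mult powr_divide times_divide_eq_right)
  qed
  ultimately show "(\<lambda>N. (\<tau> / (1 - \<tau>)) powr (2 / 3) * fluct_scale (?m N) / fluct_scale (?n N)) \<longlonglongrightarrow> 1"
    by (simp add: Lim_transform_eventually)
  have "filterlim (\<lambda>n. (2 * real n) powr (2 / 3)) at_top sequentially" by real_asymp
  then show "filterlim (\<lambda>N. fluct_scale (?n N)) at_top sequentially"
    unfolding fluct_scale_def by (rule filterlim_compose) (rule filterlim_parts[OF \<tau>])
  show "(\<lambda>N. fluct_scale (?n N) / real N) \<longlonglongrightarrow> 0"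
  proof (rule tendsto_sandwich[where f="\<lambda>_. 0" and h="\<lambda>N. (2 * real N) powr (2 / 3) / real N"])
    show "ev (\<lambda>N. fluct_scale (?n N) / real N \<le> (2 * real N) powr (2 / 3) / real N)"
      unfolding fluct_scale_def using lower_part_bounds(3)[OF \<tau>]
      by (intro always_eventually allI divide_right_mono powr_mono2) auto
    show "(\<lambda>N. (2 * real N) powr (2 / 3) / real N) \<longlonglongrightarrow> 0" by real_asymp
  qed (auto simp: fluct_scale_def)
qed

text \<open>The factor (\<tau> / (1 - \<tau>))^(2/3) is the limiting ratio of the two length scales.
  With it the upper grid points lie asymptotically at j + 1/3 in units of the lower scale.\<close>

lemma eventually_good_grid:
  fixes \<tau> \<epsilon> :: real
  assumes \<tau>: "0 < \<tau>" "\<tau> < 1" and \<epsilon>: "0 < \<epsilon>" and M: "1 \<le> M"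
  shows "ev (\<lambda>N. good_grid (lower_part \<tau> N) (N - lower_part \<tau> N) M (nat \<lceil>2 * (\<epsilon> * fluct_scale (lower_part \<tau> N))\<rceil>)
    (\<lambda>j. if j = 0 then 0 else nat \<lceil>(real j + 2 / 3) * (\<epsilon> * fluct_scale (lower_part \<tau> N))\<rceil>)
    (\<lambda>j. grid_pt (fluct_scale (lower_part \<tau> N)) (real j * \<epsilon>))
    (\<lambda>j. grid_pt (fluct_scale (N - lower_part \<tau> N)) (if j = 0 then 0 else (real j + 1 / 3) * \<epsilon> * (\<tau> / (1 - \<tau>)) powr (2 / 3))))"
proof -
  define A where "A N = fluct_scale (lower_part \<tau> N)" for N
  define B where "B N = fluct_scale (N - lower_part \<tau> N)" for N
  define k where "k = (\<tau> / (1 - \<tau>)) powr (2 / 3)"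
  note lim = fluct_scale_ratio[OF \<tau>, folded A_def B_def k_def]
  have inv: "(\<lambda>N. 1 / A N) \<longlonglongrightarrow> 0"
    using tendsto_inverse_0_at_top[OF lim(2)] by (simp add: inverse_eq_divide)
  have A0: "ev (\<lambda>N. 9 / \<epsilon> \<le> A N)" using lim(2) by (simp add: filterlim_at_top)
  have up: "ev (\<lambda>N. (real M + 2 / 3) * (\<epsilon> * A N) + 1 < c * real N - 1)" if "0 < c" for c
  proof -
    have "(\<lambda>N. (real M + 2 / 3) * (\<epsilon> * (A N / real N)) + 2 / real N) \<longlonglongrightarrow> (real M + 2 / 3) * (\<epsilon> * 0) + 0"
      by (intro tendsto_intros lim)
    then have "ev (\<lambda>N. (real M + 2 / 3) * (\<epsilon> * (A N / real N)) + 2 / real N < c)"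
      using that by (intro order_tendstoD) auto
    then show ?thesis using eventually_gt_at_top[of 0]
    proof eventually_elim
      case (elim N)
      then have "((real M + 2 / 3) * (\<epsilon> * (A N / real N)) + 2 / real N) * real N < c * real N"
        by (intro mult_strict_right_mono) auto
      moreover have "((real M + 2 / 3) * (\<epsilon> * (A N / real N)) + 2 / real N) * real N = (real M + 2 / 3) * (\<epsilon> * A N) + 2"
      proof -
        have "(x * (\<epsilon> * (A N / real N)) + 2 / real N) * real N = x * (\<epsilon> * A N) + 2" for x :: real
          using elim by (simp add: distrib_right)
        then show ?thesis .
      qed
      ultimately show ?case by linarith
    qed
  qed
  have j: "ev (\<lambda>N. real j * (\<epsilon> * A N) + 3 \<le> (real j + 1 / 3) * \<epsilon> * k * B N
      \<and> (real j + 1 / 3) * \<epsilon> * k * B N + 3 \<le> (real j + 2 / 3) * (\<epsilon> * A N))" for j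
  proof -
    have "(\<lambda>N. (real j + 1 / 3) * \<epsilon> * (k * B N / A N) - 3 * (1 / A N)) \<longlonglongrightarrow> (real j + 1 / 3) * \<epsilon> * 1 - 3 * 0"
      "(\<lambda>N. (real j + 1 / 3) * \<epsilon> * (k * B N / A N) + 3 * (1 / A N)) \<longlonglongrightarrow> (real j + 1 / 3) * \<epsilon> * 1 + 3 * 0"
      by (intro tendsto_intros lim inv)+
    moreover have "real j * \<epsilon> < (real j + 1 / 3) * \<epsilon> * 1 - 3 * 0" "(real j + 1 / 3) * \<epsilon> * 1 + 3 * 0 < (real j + 2 / 3) * \<epsilon>"
      using \<epsilon> by (auto simp: algebra_simps)
    ultimately have "ev (\<lambda>N. real j * \<epsilon> < (real j + 1 / 3) * \<epsilon> * (k * B N / A N) - 3 * (1 / A N))"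
      "ev (\<lambda>N. (real j + 1 / 3) * \<epsilon> * (k * B N / A N) + 3 * (1 / A N) < (real j + 2 / 3) * \<epsilon>)"
      by (auto intro: order_tendstoD)
    then show ?thesis using A0
    proof eventually_elim
      case (elim N)
      have "0 < 9 / \<epsilon>" using \<epsilon> by simp
      then have A: "0 < A N" using elim by linarith
      have "real j * \<epsilon> * A N \<le> ((real j + 1 / 3) * \<epsilon> * (k * B N / A N) - 3 * (1 / A N)) * A N"
        "((real j + 1 / 3) * \<epsilon> * (k * B N / A N) + 3 * (1 / A N)) * A N \<le> (real j + 2 / 3) * \<epsilon> * A N"
        using elim A by (intro mult_right_mono; simp)+
      moreover have "((real j + 1 / 3) * \<epsilon> * (k * B N / A N) - 3 * (1 / A N)) * A N = (real j + 1 / 3) * \<epsilon> * k * B N - 3"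
        "((real j + 1 / 3) * \<epsilon> * (k * B N / A N) + 3 * (1 / A N)) * A N = (real j + 1 / 3) * \<epsilon> * k * B N + 3"
      proof -
        have "(x * \<epsilon> * (k * B N / A N) - 3 * (1 / A N)) * A N = x * \<epsilon> * k * B N - 3"
          "(x * \<epsilon> * (k * B N / A N) + 3 * (1 / A N)) * A N = x * \<epsilon> * k * B N + 3" for x :: real
          using A by (simp_all add: distrib_right left_diff_distrib)
        then show "((real j + 1 / 3) * \<epsilon> * (k * B N / A N) - 3 * (1 / A N)) * A N = (real j + 1 / 3) * \<epsilon> * k * B N - 3"
          "((real j + 1 / 3) * \<epsilon> * (k * B N / A N) + 3 * (1 / A N)) * A N = (real j + 1 / 3) * \<epsilon> * k * B N + 3" .
      qed
      ultimately show ?case by (simp add: mult.assoc)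
    qed
  qed
  have "ev (\<lambda>N. \<forall>j\<in>{..<M}. real j * (\<epsilon> * A N) + 3 \<le> (real j + 1 / 3) * \<epsilon> * k * B N
      \<and> (real j + 1 / 3) * \<epsilon> * k * B N + 3 \<le> (real j + 2 / 3) * (\<epsilon> * A N))"
    by (intro eventually_ball_finite ballI j) simp
  moreover have "ev (\<lambda>N. (real M + 2 / 3) * (\<epsilon> * A N) + 1 < (1 - \<tau>) * real N - 1)"
    using \<tau> by (intro up) simp
  ultimately show ?thesis using A0 up[OF \<tau>(1)] unfolding A_def[symmetric] B_def[symmetric] k_def[symmetric]
  proof (eventually_elim, intro good_gridI M)
    fix N assume *: "\<forall>j\<in>{..<M}. real j * (\<epsilon> * A N) + 3 \<le> (real j + 1 / 3) * \<epsilon> * k * B N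
      \<and> (real j + 1 / 3) * \<epsilon> * k * B N + 3 \<le> (real j + 2 / 3) * (\<epsilon> * A N)"
      "9 / \<epsilon> \<le> A N" "(real M + 2 / 3) * (\<epsilon> * A N) + 1 < \<tau> * real N - 1" "(real M + 2 / 3) * (\<epsilon> * A N) + 1 < (1 - \<tau>) * real N - 1"
    show "0 \<le> B N" by (simp add: B_def fluct_scale_def)
    show "9 \<le> \<epsilon> * A N" using *(2) \<epsilon> by (simp add: field_simps)
    show "(real M + 2 / 3) * (\<epsilon> * A N) + 1 < real (lower_part \<tau> N)" using *(3) lower_part_bounds[OF \<tau>, of N] by linarith
    show "(real M + 2 / 3) * (\<epsilon> * A N) + 1 < real (N - lower_part \<tau> N)" using *(4) upper_part_bounds[OF \<tau>, of N] by linarith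
    fix j assume "j < M"
    show "0 \<le> (if j = 0 then 0 else (real j + 1 / 3) * \<epsilon> * k)" using \<epsilon> by (simp add: k_def)
    assume "1 \<le> j"
    then show "real j * (\<epsilon> * A N) + 3 \<le> (if j = 0 then 0 else (real j + 1 / 3) * \<epsilon> * k) * B N \<and>
      (if j = 0 then 0 else (real j + 1 / 3) * \<epsilon> * k) * B N + 3 \<le> (real j + 2 / 3) * (\<epsilon> * A N)"
      using *(1) \<open>j < M\<close> by simp
  qed simp_all
qed

lemma fluct_scale_cbrt: "fluct_scale N = 2 powr (2 / 3) * cbrt N ^ 2"
proof -
  have "real N powr (2 / 3) = cbrt N ^ 2"
    by (cases "N = 0") (simp_all add: cbrt_def powr_realpow[symmetric] powr_powr)
  then show ?thesis by (simp add: fluct_scale_def powr_mult)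
qed

lemma fluct_scale_lower_part:
  assumes \<tau>: "0 < \<tau>" "\<tau> < 1" and N: "2 \<le> \<tau> * real N"
  shows "\<tau> powr (2 / 3) * cbrt N ^ 2 \<le> fluct_scale (lower_part \<tau> N)" "fluct_scale (lower_part \<tau> N) \<le> 2 * cbrt N ^ 2"
proof -
  have "\<tau> * real N \<le> 2 * real (lower_part \<tau> N)" using lower_part_bounds(1)[OF \<tau>, of N] N by linarith
  then have "(\<tau> * real N) powr (2 / 3) \<le> fluct_scale (lower_part \<tau> N)"
    unfolding fluct_scale_def using \<tau> by (intro powr_mono2) auto
  moreover have "real N powr (2 / 3) = cbrt N ^ 2"
    by (cases "N = 0") (simp_all add: cbrt_def powr_realpow[symmetric] powr_powr)
  ultimately show "\<tau> powr (2 / 3) * cbrt N ^ 2 \<le> fluct_scale (lower_part \<tau> N)" by (simp add: powr_mult)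
  have "fluct_scale (lower_part \<tau> N) \<le> fluct_scale N"
    unfolding fluct_scale_def using lower_part_bounds(3)[OF \<tau>, of N] by (intro powr_mono2) auto
  also have "\<dots> \<le> 2 * cbrt N ^ 2"
    unfolding fluct_scale_cbrt using powr_mono[of "2 / 3" 1 "2 :: real"] by (intro mult_right_mono) auto
  finally show "fluct_scale (lower_part \<tau> N) \<le> 2 * cbrt N ^ 2" .
qed

lemma filterlim_cbrt: "filterlim cbrt at_top sequentially"
  unfolding cbrt_def by real_asymp

text \<open>The balance of the parameters, with c = cbrt N: blocks of length of order r^4 c^2, about
  K / r^4 of them, \<sigma> = 1 / (r^2 c) and q = r c. The slope conceded over a block then costs
  order r^2 c, and the corner errors cost K r^(-4) r^8 c^4 / (r c)^3 = K r c. Both are small against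
  c for small r, once K has been fixed by the tail.\<close>

lemma grid_bound_arith:
  fixes c r D K \<kappa> :: real
  assumes c: "1 \<le> c" and r: "0 < r" and K0: "0 \<le> K" "0 < \<kappa>" and Ke: "0 \<le> Ke"
    and M: "real M \<le> K / r ^ 4 + 1" and b: "real b \<le> 4 * r ^ 4 * c ^ 2 + 1"
    and rsmall: "160 * \<bar>D\<bar> * r ^ 4 + 352 * r\<^sup>2 + r + Ke * (K * r + r ^ 5) \<le> \<eta> / 2"
    and clarge: "8 + 9 * (5 * \<bar>D\<bar> + 11 / r\<^sup>2) \<le> \<eta> / 4 * c" and Klarge: "C / \<kappa> ^ 3 \<le> \<eta> / 4"
  defines "w \<equiv> (5 * \<bar>D\<bar> + 11 / r\<^sup>2) / c"
  shows "8 + w + 8 * w * real b + r * c + (real M * (Ke / (1 / (r\<^sup>2 * c)) ^ 4)) / (r * c) ^ 3 + (C * c ^ 4) / (\<kappa> * c) ^ 3 \<le> \<eta> * c"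
proof -
  define W where "W = 5 * \<bar>D\<bar> + 11 / r\<^sup>2"
  have W: "0 \<le> W" using r by (simp add: W_def)
  have w: "w = W / c" by (simp add: w_def W_def)
  have w0: "0 \<le> w" "w \<le> W" using W c by (auto simp: w divide_le_eq mult_le_cancel_left1)
  have "8 * w * real b \<le> 8 * w * (4 * r ^ 4 * c ^ 2 + 1)" using w0 b by (intro mult_left_mono) auto
  also have "\<dots> = 32 * W * r ^ 4 * c + 8 * w" using c by (simp add: w power2_eq_square distrib_left)
  also have "32 * W * r ^ 4 * c = (160 * \<bar>D\<bar> * r ^ 4 + 352 * r\<^sup>2) * c"
  proof -
    have "r ^ 4 / r\<^sup>2 = r ^ (4 - 2)" using r by (intro power_diff[symmetric]) auto
    then have "r ^ 4 / r\<^sup>2 = r\<^sup>2" by simp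
    moreover have "32 * (11 / r\<^sup>2) * r ^ 4 * c = 352 * (r ^ 4 / r\<^sup>2) * c" by simp
    ultimately have "32 * (11 / r\<^sup>2) * r ^ 4 * c = 352 * r\<^sup>2 * c" by (simp only:)
    then show ?thesis unfolding W_def by (simp add: distrib_left distrib_right)
  qed
  finally have 1: "8 * w * real b \<le> (160 * \<bar>D\<bar> * r ^ 4 + 352 * r\<^sup>2) * c + 8 * W" using w0 by linarith
  have "(real M * (Ke / (1 / (r\<^sup>2 * c)) ^ 4)) / (r * c) ^ 3 = real M * Ke * r ^ 5 * c"
    using r c by (simp add: field_simps power_mult_distrib power_mult[symmetric] power_divide power_add[symmetric] eval_nat_numeral)
  also have "\<dots> \<le> (K / r ^ 4 + 1) * Ke * r ^ 5 * c" using M Ke r c by (intro mult_right_mono) auto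
  also have "\<dots> = Ke * (K * r + r ^ 5) * c" using r by (simp add: field_simps eval_nat_numeral)
  finally have 2: "(real M * (Ke / (1 / (r\<^sup>2 * c)) ^ 4)) / (r * c) ^ 3 \<le> Ke * (K * r + r ^ 5) * c" .
  have 3: "(C * c ^ 4) / (\<kappa> * c) ^ 3 = C / \<kappa> ^ 3 * c" using c by (simp add: power_mult_distrib eval_nat_numeral)
  have 4: "C / \<kappa> ^ 3 * c \<le> \<eta> / 4 * c" using Klarge c by (intro mult_right_mono) auto
  have 5: "(160 * \<bar>D\<bar> * r ^ 4 + 352 * r\<^sup>2 + r + Ke * (K * r + r ^ 5)) * c \<le> \<eta> / 2 * c"
    using rsmall c by (intro mult_right_mono) auto
  have 6: "8 + W + 8 * W \<le> \<eta> / 4 * c" using clarge by (simp add: W_def)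
  have "8 + w + X + r * c + Y + Z \<le> \<eta> * c"
    if "X \<le> x1 * c + 8 * W" "Y \<le> x2 * c" "Z \<le> \<eta> / 4 * c" "(x1 + r + x2) * c \<le> \<eta> / 2 * c" for X Y Z x1 x2
  proof -
    have "(x1 + r + x2) * c = x1 * c + r * c + x2 * c" by (simp add: distrib_right)
    then show ?thesis using that 6 w0 by linarith
  qed
  from this[OF 1 2 4[folded 3]] 5 show ?thesis by (simp add: add.assoc)
qed

definition grid_max :: "real => real => (real \<times> real) set => nat => (nat \<times> nat => real) => real" where
  "grid_max D \<tau> T N e = Max ((\<lambda>t. grid_value (D / cbrt N) (lower_part \<tau> N) (N - lower_part \<tau> N)
      (grid_pt (fluct_scale (lower_part \<tau> N)) (fst t)) (grid_pt (fluct_scale (N - lower_part \<tau> N)) (snd t)) e) ` T)"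

lemma grid_approx:
  fixes D \<tau> \<eta> :: real
  assumes \<tau>: "0 < \<tau>" "\<tau> < 1" and \<eta>: "0 < \<eta>"
    and tight: "deficit_tight \<bar>D\<bar>"
  obtains T :: "(real \<times> real) set" where "finite T" "T \<subseteq> {0..} \<times> {0..}" "(0, 0) \<in> T"
    "ev (\<lambda>N. (\<bbbE>\<^sup>+ e. ennreal \<bar>Gpp (D / cbrt N) e N N - grid_max D \<tau> T N e\<bar>)
      \<le> ennreal (\<eta> * cbrt N))"
proof -
  obtain B N0 where B: "0 \<le> B" "1 \<le> N0"
    "\<And>N a. N0 \<le> N ==> - 1 / 2 < a ==> a \<le> \<bar>D\<bar> / cbrt N ==> m4 (pp_deficit a N) (B * cbrt N ^ 4)"
    using pp_lower_tail[OF _ tight] by (metis abs_ge_zero)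
  define H where "H = \<bar>D\<bar> + 1"
  have H: "0 < H" by (simp add: H_def)
  define C1 where "C1 = B + C4 * 10 ^ 4 / H ^ 4 + 256 * exp (64 * H ^ 3) / H ^ 4 + 256"
  have C1: "B \<le> C1" "C4 * 10 ^ 4 / H ^ 4 \<le> C1" "256 * exp (64 * H ^ 3) / H ^ 4 \<le> C1" "256 \<le> C1" "0 \<le> C1"
    using B(1) C4_pos H by (auto simp: C1_def intro!: add_nonneg_nonneg divide_nonneg_nonneg)
  define \<tau>p where "\<tau>p = \<tau> powr (2 / 3)"
  have \<tau>p: "0 < \<tau>p" using \<tau> by (simp add: \<tau>p_def)
  \<comment> \<open>K measures how far the staircase extends. It is chosen first, to make the tail
    negligible; r then depends on K, and the threshold for N on both.\<close>
  have "((\<lambda>K. 16 ^ 4 * C1 / (4 * H * \<tau>p * K) ^ 3) \<longlongrightarrow> 0) at_top"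
    using H \<tau>p C1 by real_asymp
  then have "eventually (\<lambda>K. 16 ^ 4 * C1 / (4 * H * \<tau>p * K) ^ 3 < \<eta> / 4 \<and> 1 \<le> K) at_top"
    using \<eta> by (intro eventually_conj order_tendstoD eventually_ge_at_top) auto
  then obtain K where K: "16 ^ 4 * C1 / (4 * H * \<tau>p * K) ^ 3 \<le> \<eta> / 4" "1 \<le> K"
    unfolding eventually_at_top_linorder by (meson less_imp_le order_refl)
  have "((\<lambda>r. 160 * \<bar>D\<bar> * r ^ 4 + 352 * r\<^sup>2 + r + K_err * (K * r + r ^ 5)) \<longlongrightarrow> 160 * \<bar>D\<bar> * 0 ^ 4 + 352 * 0\<^sup>2 + 0 + K_err * (K * 0 + 0 ^ 5)) (at_right 0)"
    by (intro tendsto_intros)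
  then have "eventually (\<lambda>r. 160 * \<bar>D\<bar> * r ^ 4 + 352 * r\<^sup>2 + r + K_err * (K * r + r ^ 5) < \<eta> / 2 \<and> 0 < r) (at_right 0)"
    using \<eta> by (intro eventually_conj order_tendstoD eventually_at_right_less) auto
  then obtain r where r: "160 * \<bar>D\<bar> * r ^ 4 + 352 * r\<^sup>2 + r + K_err * (K * r + r ^ 5) \<le> \<eta> / 2" "0 < r"
    using eventually_happens' trivial_limit_at_right_real by (metis (no_types, lifting) less_imp_le)
  define \<epsilon> where "\<epsilon> = r ^ 4"
  define M where "M = nat \<lceil>K / \<epsilon>\<rceil>"
  define W where "W = 5 * \<bar>D\<bar> + 11 / r\<^sup>2"
  have \<epsilon>: "0 < \<epsilon>" using r by (simp add: \<epsilon>_def)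
  have "0 < K / \<epsilon>" using K \<epsilon> by simp
  then have M: "K / \<epsilon> \<le> real M" "real M \<le> K / \<epsilon> + 1" "1 \<le> M" unfolding M_def by linarith+
  have KM: "K \<le> real M * \<epsilon>" using M(1) \<epsilon> by (simp add: pos_divide_le_eq)
  define u where "u j = (real j * \<epsilon>, if j = 0 then 0 else (real j + 1 / 3) * \<epsilon> * (\<tau> / (1 - \<tau>)) powr (2 / 3))" for j
  define T where "T = u ` {..<M}"
  have "ev (\<lambda>N. max 1 (max (16 * H) (max (16 / r\<^sup>2) ((8 + 9 * W) / (\<eta> / 4)))) \<le> cbrt N)"
    using filterlim_cbrt by (simp only: filterlim_at_top)
  moreover have "ev (\<lambda>N. N0 \<le> lower_part \<tau> N)" "ev (\<lambda>N. N0 \<le> N - lower_part \<tau> N)"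
    using filterlim_parts[OF \<tau>] by (simp_all only: filterlim_at_top)
  moreover have "filterlim (\<lambda>N. \<tau> * real N) at_top sequentially" using \<tau> by real_asymp
  then have "ev (\<lambda>N. 2 \<le> \<tau> * real N)" by (simp only: filterlim_at_top)
  ultimately have "ev (\<lambda>N. (\<bbbE>\<^sup>+ e. ennreal \<bar>Gpp (D / cbrt N) e N N - grid_max D \<tau> T N e\<bar>)
      \<le> ennreal (\<eta> * cbrt N))" using eventually_good_grid[OF \<tau> \<epsilon> M(3)]
  proof eventually_elim
    case (elim N)
    define n where "n = lower_part \<tau> N"
    define m where "m = N - n"
    define c where "c = cbrt N"
    define A where "A = fluct_scale n"
    have nm: "n + m = N" using lower_part_bounds(3)[OF \<tau>, of N] by (simp add: n_def m_def)
    have N0: "N0 \<le> n" "N0 \<le> m" using elim by (simp_all add: n_def m_def)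
    have c: "1 \<le> c" "16 * H \<le> c" "16 / r\<^sup>2 \<le> c" "(8 + 9 * W) / (\<eta> / 4) \<le> c" using elim by (auto simp: c_def)
    have A: "\<tau>p * c ^ 2 \<le> A" "A \<le> 2 * c ^ 2"
      using fluct_scale_lower_part[OF \<tau> elim(4)] by (auto simp: A_def \<tau>p_def c_def n_def)
    have cs: "cbrt n \<le> c" "cbrt m \<le> c" unfolding c_def by (intro cbrt_mono; use nm in simp)+
    have cp: "0 < cbrt n" "0 < cbrt m" using N0 B(2) by (auto intro!: cbrt_pos)
    define v where "v j = (if j = 0 then 0 else nat \<lceil>(real j + 2 / 3) * (\<epsilon> * A)\<rceil>)" for j
    define b where "b = nat \<lceil>2 * (\<epsilon> * A)\<rceil>"
    have g: "good_grid n m M b v (\<lambda>j. grid_pt A (fst (u j))) (\<lambda>j. grid_pt (fluct_scale m) (snd (u j)))"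
      using elim(5) unfolding u_def fst_conv snd_conv n_def[symmetric] m_def[symmetric] A_def[symmetric] v_def[abs_def] b_def .
    have A0: "0 \<le> A" using \<tau>p by (intro order_trans[OF _ A(1)]) simp
    let ?a = "D / c" and ?\<sigma> = "1 / (r\<^sup>2 * c)" and ?h = "H / c" and ?w = "W / c" and ?\<kappa> = "4 * H * \<tau>p * K * c"
    have c0: "0 < c" using c by simp
    have D: "\<bar>?a\<bar> = \<bar>D\<bar> / c" using c0 by simp
    have a16: "\<bar>?a\<bar> \<le> 1 / 16" using c unfolding D H_def by (simp add: divide_le_eq)
    have h: "0 < ?h" "?h \<le> 1 / 16" "- ?h \<le> ?a"
    proof -
      show "0 < ?h" "?h \<le> 1 / 16" using c H by (auto simp: divide_le_eq)
      have "- (H / c) = (- H) / c" by simp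
      also have "\<dots> \<le> D / c" using c0 by (intro divide_right_mono) (auto simp: H_def)
      finally show "- ?h \<le> ?a" .
    qed
    have \<sigma>: "0 < ?\<sigma>" "?\<sigma> \<le> 1 / 16" using c r by (auto simp: field_simps)
    have w: "5 * \<bar>?a\<bar> + 11 * ?\<sigma> \<le> ?w" unfolding D W_def by (simp add: add_divide_distrib)
    have "(real M + 2 / 3) * (\<epsilon> * A) \<le> real (v M)" using M(3) unfolding v_def by simp linarith
    moreover have "real M * (\<epsilon> * A) \<le> (real M + 2 / 3) * (\<epsilon> * A)" using \<epsilon> A0 by (intro mult_right_mono) auto
    moreover have "K * A \<le> real M * \<epsilon> * A" using KM A0 by (rule mult_right_mono)
    moreover have "K * (\<tau>p * c ^ 2) \<le> K * A" using A(1) K by (intro mult_left_mono) auto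
    ultimately have "K * (\<tau>p * c ^ 2) \<le> real (v M)" by (simp add: mult.assoc)
    then have "4 * ?h * (K * (\<tau>p * c ^ 2)) \<le> 4 * ?h * real (v M)" using h by (intro mult_left_mono) auto
    moreover have "4 * ?h * (K * (\<tau>p * c ^ 2)) = ?\<kappa>" using c0 by (simp add: power2_eq_square)
    ultimately have \<kappa>: "0 < ?\<kappa>" "?\<kappa> \<le> 4 * ?h * real (v M)" using H \<tau>p K c0 by auto
    have c4: "x / ?h ^ 4 = x / H ^ 4 * c ^ 4" for x using c0 H by (simp add: power_divide)
    have C: "m4 (tail_excess ?a ?h n m) (16 ^ 4 * (C1 * c ^ 4))"
    proof (rule m4_tail_excess[OF h(1,2), of n "H ^ 3" m])
      have "real k * ?h ^ 3 \<le> H ^ 3" if "k \<le> N" for k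
      proof -
        have "real k * ?h ^ 3 \<le> real N * ?h ^ 3" using that h by (intro mult_right_mono) auto
        also have "\<dots> = H ^ 3" using c0 cbrt_cube[of N] by (simp add: power_divide flip: c_def) (use c0 in auto)
        finally show ?thesis .
      qed
      moreover have "n \<le> N" "m + 1 \<le> N" using nm N0 B(2) by auto
      ultimately show "real n * ?h ^ 3 \<le> H ^ 3" "real (m + 1) * ?h ^ 3 \<le> H ^ 3" by blast+
      have dd: "m4 (pp_deficit ?a k) (C1 * c ^ 4)" if "N0 \<le> k" "cbrt k \<le> c" "0 < cbrt k" for k
      proof (rule m4_mono[OF B(3)[OF that(1)]])
        show "- 1 / 2 < ?a" using a16 by linarith
        have "D / c \<le> \<bar>D\<bar> / c" using c0 by (intro divide_right_mono) auto
        also have "\<dots> \<le> \<bar>D\<bar> / cbrt k" using that by (intro divide_left_mono) (auto intro: mult_pos_pos c0)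
        finally show "?a \<le> \<bar>D\<bar> / cbrt k" .
        show "B * cbrt k ^ 4 \<le> C1 * c ^ 4" using that C1 B(1) by (intro mult_mono power_mono) auto
      qed
      show "m4 (pp_deficit ?a n) (C1 * c ^ 4)" "m4 (pp_deficit ?a m) (C1 * c ^ 4)" using dd N0 cs cp by blast+
      show "C4 * 10 ^ 4 / ?h ^ 4 \<le> C1 * c ^ 4" "256 * exp (64 * H ^ 3) / ?h ^ 4 \<le> C1 * c ^ 4"
        unfolding c4 using C1 by (intro mult_right_mono; simp)+
      have "256 * 1 \<le> C1 * c ^ 4" using C1 c by (intro mult_mono) auto
      then show "256 \<le> C1 * c ^ 4" by simp
      show "1 \<le> n" using N0 B(2) by simp
    qed
    have "(\<bbbE>\<^sup>+ e. ennreal \<bar>Gpp ?a e (n + m) (n + m) - Max ((\<lambda>j. grid_value ?a n m (grid_pt A (fst (u j))) (grid_pt (fluct_scale m) (snd (u j))) e) ` {..<M})\<bar>)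
      \<le> ennreal (8 + ?w + 8 * ?w * real b + r * c + (real M * (K_err / ?\<sigma> ^ 4)) / (r * c) ^ 3 + (16 ^ 4 * (C1 * c ^ 4)) / ?\<kappa> ^ 3)"
      using h by (intro grid_expectation[OF a16 \<sigma> w _ _ _ g _ \<kappa> C]) (use r c0 C1 in auto)
    also have "\<dots> \<le> ennreal (\<eta> * c)"
    proof (rule ennreal_leI)
      have eb: "real b \<le> 4 * r ^ 4 * c ^ 2 + 1"
      proof -
        have "0 \<le> 2 * (\<epsilon> * A)" using \<epsilon> A0 by simp
        then have "real b \<le> 2 * (\<epsilon> * A) + 1" unfolding b_def by linarith
        moreover have "2 * (\<epsilon> * A) \<le> 2 * (\<epsilon> * (2 * c ^ 2))" using \<epsilon> A by (intro mult_left_mono) auto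
        moreover have "2 * (\<epsilon> * (2 * c ^ 2)) = 4 * r ^ 4 * c ^ 2" by (simp add: \<epsilon>_def)
        ultimately show ?thesis by linarith
      qed
      have "8 + 9 * W \<le> \<eta> / 4 * c" using c(4) \<eta> by (simp add: field_simps)
      then have "8 + ?w + 8 * ?w * real b + r * c + (real M * (K_err / ?\<sigma> ^ 4)) / (r * c) ^ 3 + ((16 ^ 4 * C1) * c ^ 4) / (4 * H * \<tau>p * K * c) ^ 3 \<le> \<eta> * c"
        unfolding W_def using r K M(2) H \<tau>p C4_pos
        by (intro grid_bound_arith[OF c(1) r(2) _ _ _ _ eb r(1)]) (auto simp: \<epsilon>_def K_err_def)
      then show "8 + ?w + 8 * ?w * real b + r * c + (real M * (K_err / ?\<sigma> ^ 4)) / (r * c) ^ 3 + (16 ^ 4 * (C1 * c ^ 4)) / ?\<kappa> ^ 3 \<le> \<eta> * c"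
        by (simp only: mult.assoc)
    qed
    finally show ?case
      unfolding grid_max_def T_def image_image n_def[symmetric] m_def[symmetric] A_def[symmetric] c_def[symmetric] nm .
  qed
  moreover have "u 0 = (0, 0)" by (simp add: u_def)
  then have "(0, 0) \<in> T" unfolding T_def using M(3) by (intro rev_image_eqI[of 0]) auto
  moreover have "T \<subseteq> {0..} \<times> {0..}" unfolding T_def u_def using \<epsilon> by auto
  moreover have "finite T" by (simp add: T_def)
  ultimately show ?thesis by (intro that) auto
qed

section \<open>Scaling limits\<close>

definition drift :: "real => real" where
  "drift \<delta> = \<delta> * 2 powr (- 4 / 3)"

lemma rho_eq: "rho \<delta> N = 1 / 2 + drift \<delta> / cbrt N"
  by (simp add: rho_def drift_def cbrt_def powr_minus_divide)

lemma drift_cmult: "drift (\<delta> * x) = drift \<delta> * x" by (simp add: drift_def)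

definition unit_scale :: real where
  "unit_scale = 2 powr (4 / 3)"

lemma unit_scale_pos: "0 < unit_scale" by (simp add: unit_scale_def)

definition pp_scaled :: "real => nat => real => (nat \<times> nat => real) => real" where
  "pp_scaled \<delta> N u e = (Gpp (drift \<delta> / cbrt N) e (N + fst (grid_pt (fluct_scale N) u)) (N - snd (grid_pt (fluct_scale N) u))
    - 4 * real N) / (unit_scale * cbrt N)"

definition st_scaled :: "real => nat => (nat \<times> nat => real) => real" where
  "st_scaled \<delta> N e = (Gst (drift \<delta> / cbrt N) e N N - 4 * real N) / (unit_scale * cbrt N)"

lemma measurable_pp_scaled [measurable]: "pp_scaled \<delta> N u \<in> borel_measurable env"
  unfolding pp_scaled_def[abs_def] by measurable

lemma measurable_st_scaled [measurable]: "st_scaled \<delta> N \<in> borel_measurable env"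
  unfolding st_scaled_def[abs_def] by measurable

lemma eventually_drift_small: "0 < c ==> ev (\<lambda>N. \<bar>x / cbrt N\<bar> < c)"
proof -
  assume "0 < c"
  have "((\<lambda>N. x / cbrt N) \<longlongrightarrow> 0) sequentially"
    by (intro tendsto_divide_0[OF tendsto_const] filterlim_at_top_imp_at_infinity filterlim_cbrt)
  from order_tendstoD(2)[OF tendsto_rabs[OF this]] \<open>0 < c\<close> show ?thesis by simp
qed

lemma eventually_fluct_le: "ev (\<lambda>N. u * fluct_scale N \<le> real N)"
  unfolding fluct_scale_def by real_asymp

lemma Q_floor:
  assumes "0 \<le> u" "u * fluct_scale N \<le> real N"
  shows "0 \<le> \<lfloor>snd (Q N u)\<rfloor>" "\<lfloor>snd (Q N u)\<rfloor> \<le> \<lfloor>fst (Q N u)\<rfloor>"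
    "nat \<lfloor>fst (Q N u)\<rfloor> = N + fst (grid_pt (fluct_scale N) u)" "nat \<lfloor>snd (Q N u)\<rfloor> = N - snd (grid_pt (fluct_scale N) u)"
proof -
  define t where "t = u * fluct_scale N"
  have Q: "Q N u = (real N + t, real N - t)" by (simp add: Q_def t_def fluct_scale_def)
  have t: "0 \<le> t" "t \<le> real N" using assms by (auto simp: t_def fluct_scale_def)
  have g: "grid_pt (fluct_scale N) u = (nat \<lfloor>t\<rfloor>, nat \<lceil>t\<rceil>)" by (simp add: grid_pt_def t_def)
  show "0 \<le> \<lfloor>snd (Q N u)\<rfloor>" "\<lfloor>snd (Q N u)\<rfloor> \<le> \<lfloor>fst (Q N u)\<rfloor>"
    unfolding Q fst_conv snd_conv using t by linarith+
  show "nat \<lfloor>fst (Q N u)\<rfloor> = N + fst (grid_pt (fluct_scale N) u)"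
    unfolding Q g fst_conv using t by linarith
  show "nat \<lfloor>snd (Q N u)\<rfloor> = N - snd (grid_pt (fluct_scale N) u)"
    unfolding Q g snd_conv using t by linarith
qed

lemma grid_pt_0 [simp]: "grid_pt A 0 = (0, 0)" by (simp add: grid_pt_def)

lemma scaled_pp_hs_env:
  assumes "0 \<le> u" "u * fluct_scale N \<le> real N"
  shows "scaled_lpp_process N u (hs_env (1 / rho \<delta> N) 0 e) = pp_scaled \<delta> N u e"
  unfolding scaled_lpp_process_def pp_scaled_def lpp_hs_env[OF Q_floor(1,2)[OF assms]] Q_floor(3,4)[OF assms] rho_eq
  by (simp add: cbrt_def unit_scale_def)

lemma scaled_st_hs_env:
  "scaled_lpp_process N 0 (hs_env (1 / rho \<delta> N) (1 / (1 - rho \<delta> N)) e) = st_scaled \<delta> N e"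
proof -
  have *: "0 \<le> (0::real)" "0 * fluct_scale N \<le> real N" by simp_all
  have "1 - (1 / 2 + drift \<delta> / cbrt N) = 1 / 2 - drift \<delta> / cbrt N" by simp
  then show ?thesis
    unfolding scaled_lpp_process_def st_scaled_def lpp_hs_env[OF Q_floor(1,2)[OF *]] Q_floor(3,4)[OF *] rho_eq
    by (simp add: cbrt_def unit_scale_def)
qed

lemma pp_conv_fdd:
  assumes A: "is_A_pp \<delta> M A" and I: "finite I" "I \<subseteq> {0..}"
  shows "conv_fdd I (pp_scaled \<delta>) M (\<lambda>u x. A u x - u\<^sup>2)"
  unfolding conv_fdd_def
proof (intro conjI ballI allI impI)
  show "prob_space M" using A by (simp add: is_A_pp_def)
  show "finite I" by fact
  fix u assume u: "u \<in> I"
  then have [measurable]: "A u \<in> borel_measurable M" using A I by (auto simp: is_A_pp_def)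
  show "(\<lambda>x. A u x - u\<^sup>2) \<in> borel_measurable M" by measurable
  show "pp_scaled \<delta> N u \<in> borel_measurable env" for N by measurable
next
  fix f assume f: "lip_test I f"
  have "fdd_convergence (\<lambda>N. pp_env (rho \<delta> N)) scaled_lpp_process M (\<lambda>u x. A u x - u\<^sup>2)"
    using A by (simp add: is_A_pp_def)
  from fdd_lip[OF this I f]
  have "(\<lambda>N. \<integral>\<omega>. f (\<lambda>u. scaled_lpp_process N u \<omega>) \<partial>pp_env (rho \<delta> N)) \<longlonglongrightarrow> (\<integral>x. f (\<lambda>u. A u x - u\<^sup>2) \<partial>M)" .
  moreover have "ev (\<lambda>N. \<forall>u\<in>I. u * fluct_scale N \<le> real N)"
    by (intro eventually_ball_finite I ballI eventually_fluct_le)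
  then have "ev (\<lambda>N. (\<integral>\<omega>. f (\<lambda>u. scaled_lpp_process N u \<omega>) \<partial>pp_env (rho \<delta> N)) = (\<bbbE> e. f (\<lambda>u. pp_scaled \<delta> N u e)))"
    using eventually_drift_small[of "1 / 2" "drift \<delta>", OF half_gt_zero[OF zero_less_one]]
  proof eventually_elim
    case (elim N)
    have \<rho>: "0 < rho \<delta> N" using elim(2) unfolding rho_eq by linarith
    have "(\<lambda>\<omega>. f (\<lambda>u. scaled_lpp_process N u \<omega>)) \<in> borel_measurable (pp_env (rho \<delta> N))"
    proof (rule lip_test_measurable[OF I(1) f])
      fix u assume "u \<in> I"
      then have "0 \<le> u" "u * fluct_scale N \<le> real N" using I elim(1) by auto
      from measurable_lpp_env(1)[OF Q_floor(1,2)[OF this]]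
      show "scaled_lpp_process N u \<in> borel_measurable (pp_env (rho \<delta> N))"
        unfolding scaled_lpp_process_def[abs_def] by measurable
    qed
    from integral_pp_env[OF \<rho> this]
    have "(\<integral>\<omega>. f (\<lambda>u. scaled_lpp_process N u \<omega>) \<partial>pp_env (rho \<delta> N))
      = (\<bbbE> e. f (\<lambda>u. scaled_lpp_process N u (hs_env (1 / rho \<delta> N) 0 e)))" .
    also have "\<dots> = (\<bbbE> e. f (\<lambda>u. pp_scaled \<delta> N u e))"
      using elim(1) I by (intro Bochner_Integration.integral_cong refl lip_test_cong[OF f] scaled_pp_hs_env) auto
    finally show ?case .
  qed
  ultimately show "(\<lambda>N. (\<bbbE> e. f (\<lambda>u. pp_scaled \<delta> N u e))) \<longlonglongrightarrow> (\<integral>x. f (\<lambda>u. A u x - u\<^sup>2) \<partial>M)"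
    by (rule Lim_transform_eventually)
qed

lemma pp_conv_law:
  assumes "is_A_pp \<delta> M A"
  shows "conv_law (\<lambda>N. pp_scaled \<delta> N 0) M (A 0)"
  using conv_fdd_law[OF pp_conv_fdd[OF assms, of "{0}"], of 0] by simp

lemma st_conv_law:
  assumes A: "is_A_st_hs \<delta> M A"
  shows "conv_law (st_scaled \<delta>) M (A 0)"
  unfolding conv_law_def
proof (intro allI impI, elim conjE)
  fix f :: "real => real" and L B
  assume f: "\<forall>x y. \<bar>f x - f y\<bar> \<le> L * \<bar>x - y\<bar>" "\<forall>x. \<bar>f x\<bar> \<le> B" and fm [measurable]: "f \<in> borel_measurable borel"
  have "0 \<le> \<bar>f 1 - f 0\<bar>" by simp
  also have "\<dots> \<le> L * \<bar>1 - 0\<bar>" using f(1) by blast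
  finally have L: "0 \<le> L" by simp
  have lt: "lip_test {0} (\<lambda>y. f (y 0))" using f by (intro lip_testI[OF L]) auto
  have "fdd_convergence (\<lambda>N. st_env (rho \<delta> N)) scaled_lpp_process M A" using A by (simp add: is_A_st_hs_def)
  from fdd_lip[OF this _ _ lt]
  have "(\<lambda>N. \<integral>\<omega>. f (scaled_lpp_process N 0 \<omega>) \<partial>st_env (rho \<delta> N)) \<longlonglongrightarrow> (\<integral>x. f (A 0 x) \<partial>M)" by simp
  moreover have "ev (\<lambda>N. (\<integral>\<omega>. f (scaled_lpp_process N 0 \<omega>) \<partial>st_env (rho \<delta> N)) = (\<bbbE> e. f (st_scaled \<delta> N e)))"
    using eventually_drift_small[of "1 / 2" "drift \<delta>", OF half_gt_zero[OF zero_less_one]]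
  proof eventually_elim
    case (elim N)
    have \<rho>: "0 < rho \<delta> N" "rho \<delta> N < 1" using elim unfolding rho_eq by linarith+
    have *: "0 \<le> (0::real)" "0 * fluct_scale N \<le> real N" by simp_all
    have [measurable]: "(\<lambda>\<omega>. lpp \<omega> (Q N 0)) \<in> borel_measurable (st_env (rho \<delta> N))"
      by (rule measurable_lpp_env(2)[OF Q_floor(1,2)[OF *]])
    have "(\<lambda>\<omega>. f (scaled_lpp_process N 0 \<omega>)) \<in> borel_measurable (st_env (rho \<delta> N))"
      unfolding scaled_lpp_process_def[abs_def] by measurable
    from integral_st_env[OF \<rho> this] show ?case by (simp only: scaled_st_hs_env)
  qed
  ultimately show "(\<lambda>N. (\<bbbE> e. f (st_scaled \<delta> N e))) \<longlonglongrightarrow> (\<integral>x. f (A 0 x) \<partial>M)"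
    by (rule Lim_transform_eventually)
qed

text \<open>Convergence in law of the one-point time gives tightness. The factor
  \<open>unit_scale\<close> in the parameter cancels the 2^(-4/3) in \<open>drift\<close>.\<close>

lemma pp_deficit_tight:
  assumes A: "is_A_pp (D * unit_scale) M A"
  shows "deficit_tight D"
proof (intro allI impI)
  fix \<epsilon> :: real assume "0 < \<epsilon>"
  have "prob_space M" "A 0 \<in> borel_measurable M" using A by (auto simp: is_A_pp_def)
  then obtain K where K: "0 < K" "ev (\<lambda>N. env.prob {e. K < \<bar>pp_scaled (D * unit_scale) N 0 e\<bar>} \<le> \<epsilon>)"
    using conv_law_tight[OF pp_conv_law[OF A] _ _ measurable_pp_scaled \<open>0 < \<epsilon>\<close>] by blast
  have D: "drift (D * unit_scale) = D" by (simp add: drift_def unit_scale_def powr_add[symmetric])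
  obtain N0 where N0: "\<And>N. N0 \<le> N ==> env.prob {e. K < \<bar>pp_scaled (D * unit_scale) N 0 e\<bar>} \<le> \<epsilon>"
    using K(2) by (auto simp: eventually_sequentially)
  have "env.prob {e. (K * unit_scale) * cbrt N < pp_deficit (D / cbrt N) N e} \<le> \<epsilon>" if N: "max 1 N0 \<le> N" for N
  proof -
    have c: "0 < cbrt N" using N by (intro cbrt_pos) simp
    have "{e. (K * unit_scale) * cbrt N < pp_deficit (D / cbrt N) N e} \<subseteq> {e. K < \<bar>pp_scaled (D * unit_scale) N 0 e\<bar>}"
    proof safe
      fix e assume "(K * unit_scale) * cbrt N < pp_deficit (D / cbrt N) N e"
      moreover have "0 \<le> (K * unit_scale) * cbrt N" using K unit_scale_pos c by simp
      ultimately have "K * (unit_scale * cbrt N) < 4 * real N - Gpp (D / cbrt N) e N N"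
        unfolding pp_deficit_def by (simp add: mult.assoc)
      then have "K < (4 * real N - Gpp (D / cbrt N) e N N) / (unit_scale * cbrt N)"
        using c unit_scale_pos by (simp add: pos_less_divide_eq)
      also have "\<dots> = - pp_scaled (D * unit_scale) N 0 e" by (simp add: pp_scaled_def D minus_divide_left)
      finally show "K < \<bar>pp_scaled (D * unit_scale) N 0 e\<bar>" by linarith
    qed
    then have "env.prob {e. (K * unit_scale) * cbrt N < pp_deficit (D / cbrt N) N e} \<le> env.prob {e. K < \<bar>pp_scaled (D * unit_scale) N 0 e\<bar>}"
      by (intro env.finite_measure_mono sets_env_Collect) measurable
    also have "\<dots> \<le> \<epsilon>" using N N0 by simp
    finally show ?thesis .
  qed
  then show "\<exists>K N\<^sub>0. \<forall>N\<ge>N\<^sub>0. env.prob {e. K * cbrt N < pp_deficit (D / cbrt N) N e} \<le> \<epsilon>" by blast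
qed

text \<open>The point-to-point time lies below the stationary one, so its deficit bounds both from
  below, and \<open>st_upper_tail\<close> bounds both from above. One fourth-moment bound serves the
  two models.\<close>

lemma G_moments:
  assumes D: "0 \<le> D"
    and tight: "deficit_tight D"
  obtains C N\<^sub>0 where "0 \<le> C" "1 \<le> N\<^sub>0"
    "\<And>N a. N\<^sub>0 \<le> N ==> \<bar>a\<bar> \<le> D / cbrt N ==> m4 (\<lambda>e. Gpp a e N N - 4 * real N) (C * cbrt N ^ 4)"
    "\<And>N a. N\<^sub>0 \<le> N ==> \<bar>a\<bar> \<le> D / cbrt N ==> m4 (\<lambda>e. Gst a e N N - 4 * real N) (C * cbrt N ^ 4)"
proof -
  obtain B N1 where B: "0 \<le> B" "1 \<le> N1"
    "\<And>N a. N1 \<le> N ==> - 1 / 2 < a ==> a \<le> D / cbrt N ==> m4 (pp_deficit a N) (B * cbrt N ^ 4)"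
    using pp_lower_tail[OF D tight] by blast
  obtain B' where B': "0 \<le> B'"
    "\<And>N h a. 1 \<le> N ==> 0 < h ==> h \<le> 1 / 8 ==> real N * h ^ 3 \<le> (2 * (D + 1)) ^ 3 ==> \<bar>a\<bar> \<le> h / 2 ==>
      m4 (\<lambda>e. max 0 (Gst a e N N - 4 * real N)) (B' / h ^ 4)"
    using st_upper_tail[of "(2 * (D + 1)) ^ 3"] by blast
  obtain N2 where N2: "\<And>N. N2 \<le> N ==> \<bar>2 * (D + 1) / cbrt N\<bar> < 1 / 8"
    using eventually_drift_small[of "1 / 8" "2 * (D + 1)"] by (auto simp: eventually_sequentially)
  define B2 where "B2 = B' / (2 * (D + 1)) ^ 4"
  have B2: "0 \<le> B2" using B' by (simp add: B2_def)
  have main: "m4 (\<lambda>e. Gpp a e N N - 4 * real N) (8 * (B2 + B) * cbrt N ^ 4) \<and> m4 (\<lambda>e. Gst a e N N - 4 * real N) (8 * (B2 + B) * cbrt N ^ 4)"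
    if N: "max N1 N2 \<le> N" and a: "\<bar>a\<bar> \<le> D / cbrt N" for N a
  proof -
    \<comment> \<open>This h makes N h^3 independent of N and leaves |a| \<le> h / 2.\<close>
    define h where "h = 2 * (D + 1) / cbrt N"
    have c: "0 < cbrt N" using N B(2) by (intro cbrt_pos) simp
    have h: "0 < h" "h \<le> 1 / 8" using N2[of N] N c D by (auto simp: h_def)
    have "2 * x / y / 2 = x / y" for x y :: real by simp
    then have "h / 2 = (D + 1) / cbrt N" unfolding h_def .
    moreover have "D / cbrt N \<le> (D + 1) / cbrt N" using c by (intro divide_right_mono) auto
    ultimately have ah: "\<bar>a\<bar> \<le> h / 2" using a by linarith
    have "real N * h ^ 3 = (2 * (D + 1)) ^ 3" using c unfolding h_def cbrt_cube[symmetric] by (simp add: power_divide)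
    then have U: "m4 (\<lambda>e. max 0 (Gst a e N N - 4 * real N)) (B' / h ^ 4)"
      using h N B(2) ah by (intro B'(2)) auto
    have "B' / h ^ 4 = B2 * cbrt N ^ 4" by (simp add: h_def B2_def power_divide)
    with U have U: "m4 (\<lambda>e. max 0 (Gst a e N N - 4 * real N)) (B2 * cbrt N ^ 4)" by (simp only:)
    have L: "m4 (pp_deficit a N) (B * cbrt N ^ 4)" using N ah h a by (intro B(3)) auto
    let ?B = "\<lambda>e. max 0 (Gst a e N N - 4 * real N) + pp_deficit a N e"
    have "8 * (B2 * cbrt N ^ 4 + B * cbrt N ^ 4) = 8 * (B2 + B) * cbrt N ^ 4"
      by (simp only: distrib_right distrib_left mult.assoc)
    then have M: "m4 ?B (8 * (B2 + B) * cbrt N ^ 4)" using m4_add[OF U L] B2 B(1) by simp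
    have "AE e in env. \<bar>Gpp a e N N - 4 * real N\<bar> \<le> \<bar>?B e\<bar> \<and> \<bar>Gst a e N N - 4 * real N\<bar> \<le> \<bar>?B e\<bar>"
      using AE_env_pos
    proof eventually_elim
      case (elim e)
      have "Gpp a e N N \<le> Gst a e N N" using ah h elim by (intro G_mono_params) auto
      then show ?case by (auto simp: pp_deficit_def abs_le_iff)
    qed
    then show ?thesis by (intro conjI m4_dom[OF M]; simp add: AE_conj_iff)
  qed
  show ?thesis by (rule that[of "8 * (B2 + B)" "max N1 N2"]) (use B B2 main in auto)
qed

section \<open>Change of size and of parameter\<close>

lemma conv_fdd_compose:
  assumes "conv_fdd I Y M A" "filterlim k at_top sequentially"
  shows "conv_fdd I (\<lambda>N. Y (k N)) M A"
  using assms filterlim_compose[OF _ assms(2)] unfolding conv_fdd_def by fast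

text \<open>A Slutsky argument: the multipliers converge and the differences vanish in L1. Tightness
  of \<open>Y\<close> serves to replace \<open>c N\<close> by its limit.\<close>

lemma conv_fdd_approx:
  fixes c :: "nat => real"
  assumes Y: "conv_fdd I Y M A" and Y': "\<And>N u. u \<in> I ==> Y' N u \<in> borel_measurable env" and c: "c \<longlonglongrightarrow> c0" and b: "b \<longlonglongrightarrow> 0"
    and close: "\<And>u. u \<in> I ==> ev (\<lambda>N. integrable env (\<lambda>e. Y' N u e - c N * Y N u e) \<and>
      (\<bbbE> e. \<bar>Y' N u e - c N * Y N u e\<bar>) \<le> b N)"
  shows "conv_fdd I Y' M (\<lambda>u x. c0 * A u x)"
  unfolding conv_fdd_def
proof (intro conjI ballI allI impI)
  have M: "prob_space M" and fin: "finite I" and Am: "\<And>u. u \<in> I ==> A u \<in> borel_measurable M"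
    and Ym: "\<And>N u. u \<in> I ==> Y N u \<in> borel_measurable env"
    and lim: "\<And>f. lip_test I f ==> (\<lambda>N. (\<bbbE> e. f (\<lambda>u. Y N u e))) \<longlonglongrightarrow> (\<integral>x. f (\<lambda>u. A u x) \<partial>M)"
    using Y by (auto simp: conv_fdd_def)
  show "prob_space M" "finite I" by fact+
  show "(\<lambda>x. c0 * A u x) \<in> borel_measurable M" if "u \<in> I" for u using Am[OF that] by measurable
  show "Y' N u \<in> borel_measurable env" if "u \<in> I" for u N using Y'[OF that] .
  fix f assume f: "lip_test I f"
  then obtain L B where L: "0 \<le> L" "\<And>y y'. \<bar>f y - f y'\<bar> \<le> L * (\<Sum>u\<in>I. \<bar>y u - y' u\<bar>)" and B: "\<And>y. \<bar>f y\<bar> \<le> B"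
    unfolding lip_test_def by blast
  have B0: "0 \<le> B" using B[of "\<lambda>_. 0"] by linarith
  define g where "g y = f (\<lambda>u. c0 * y u)" for y
  have "lip_test I g"
  proof (rule lip_testI[of "L * \<bar>c0\<bar>" _ _ B])
    show "\<bar>g y - g y'\<bar> \<le> L * \<bar>c0\<bar> * (\<Sum>u\<in>I. \<bar>y u - y' u\<bar>)" for y y'
      using L(2)[of "\<lambda>u. c0 * y u" "\<lambda>u. c0 * y' u"]
      by (simp add: g_def right_diff_distrib[symmetric] abs_mult sum_distrib_left[symmetric] mult.assoc)
  qed (use L B in \<open>auto simp: g_def\<close>)
  note glim = lim[OF this]
  have iY: "integrable env (\<lambda>e. f (\<lambda>u. Y' N u e))" "integrable env (\<lambda>e. g (\<lambda>u. Y N u e))" for N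
    using B lip_test_measurable[OF fin f, of "Y' N", OF Y'] lip_test_measurable[OF fin \<open>lip_test I g\<close>, of "Y N", OF Ym]
    by (auto intro!: env.integrable_const_bound[where B=B] simp: g_def)
  show "(\<lambda>N. (\<bbbE> e. f (\<lambda>u. Y' N u e))) \<longlonglongrightarrow> (\<integral>x. f (\<lambda>u. c0 * A u x) \<partial>M)"
  proof (rule approx_limit)
    fix \<epsilon> :: real assume \<epsilon>: "0 < \<epsilon>"
    define k where "k = real (card I)"
    have k: "0 \<le> k" by (simp add: k_def)
    define \<epsilon>' where "\<epsilon>' = \<epsilon> / (3 * (2 * B + 1) * (k + 1))"
    have \<epsilon>': "0 < \<epsilon>'" using \<epsilon> B0 k by (simp add: \<epsilon>'_def)
    obtain K where K: "\<And>u. u \<in> I ==> 0 < K u" "ev (\<lambda>N. \<forall>u\<in>I. env.prob {e. K u < \<bar>Y N u e\<bar>} \<le> \<epsilon>')"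
      using conv_fdd_tight[OF Y \<epsilon>'] by blast
    have "(\<lambda>N. L * (k * b N) + L * (\<bar>c N - c0\<bar> * (\<Sum>u\<in>I. K u))) \<longlonglongrightarrow> L * (k * 0) + L * (\<bar>c0 - c0\<bar> * (\<Sum>u\<in>I. K u))"
      by (intro tendsto_intros b c)
    then have "ev (\<lambda>N. L * (k * b N) + L * (\<bar>c N - c0\<bar> * (\<Sum>u\<in>I. K u)) < \<epsilon> / 2)"
      using \<epsilon> by (intro order_tendstoD) auto
    moreover note K(2)
    moreover have "ev (\<lambda>N. \<forall>u\<in>I. integrable env (\<lambda>e. Y' N u e - c N * Y N u e) \<and>
      (\<bbbE> e. \<bar>Y' N u e - c N * Y N u e\<bar>) \<le> b N)" by (intro eventually_ball_finite fin ballI close)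
    ultimately have "ev (\<lambda>N. \<bar>(\<bbbE> e. f (\<lambda>u. Y' N u e)) - (\<bbbE> e. g (\<lambda>u. Y N u e))\<bar> \<le> \<epsilon>)"
    proof eventually_elim
      case (elim N)
      let ?h = "\<lambda>e. L * (\<Sum>u\<in>I. \<bar>Y' N u e - c N * Y N u e\<bar>) + L * (\<bar>c N - c0\<bar> * (\<Sum>u\<in>I. K u))"
      have pt: "\<bar>f (\<lambda>u. Y' N u e) - g (\<lambda>u. Y N u e)\<bar> \<le> ?h e" if Kb: "\<And>u. u \<in> I ==> \<bar>Y N u e\<bar> \<le> K u" for e
      proof -
        have "\<bar>f (\<lambda>u. Y' N u e) - g (\<lambda>u. Y N u e)\<bar> \<le> L * (\<Sum>u\<in>I. \<bar>Y' N u e - c0 * Y N u e\<bar>)"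
          unfolding g_def by (rule L(2))
        also have "\<dots> \<le> L * (\<Sum>u\<in>I. \<bar>Y' N u e - c N * Y N u e\<bar> + \<bar>c N - c0\<bar> * K u)"
        proof (intro mult_left_mono sum_mono L)
          fix u assume u: "u \<in> I"
          have "Y' N u e - c0 * Y N u e = (Y' N u e - c N * Y N u e) + (c N - c0) * Y N u e" by (simp add: algebra_simps)
          then have "\<bar>Y' N u e - c0 * Y N u e\<bar> \<le> \<bar>Y' N u e - c N * Y N u e\<bar> + \<bar>c N - c0\<bar> * \<bar>Y N u e\<bar>"
            by (metis abs_mult abs_triangle_ineq)
          also have "\<bar>c N - c0\<bar> * \<bar>Y N u e\<bar> \<le> \<bar>c N - c0\<bar> * K u" using Kb[OF u] by (intro mult_left_mono) auto
          finally show "\<bar>Y' N u e - c0 * Y N u e\<bar> \<le> \<bar>Y' N u e - c N * Y N u e\<bar> + \<bar>c N - c0\<bar> * K u" by simp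
        qed
        also have "\<dots> = L * (\<Sum>u\<in>I. \<bar>Y' N u e - c N * Y N u e\<bar>) + L * (\<bar>c N - c0\<bar> * (\<Sum>u\<in>I. K u))"
          by (simp add: sum.distrib sum_distrib_left distrib_left)
        finally show ?thesis .
      qed
      have i1: "integrable env (\<lambda>e. \<Sum>u\<in>I. \<bar>Y' N u e - c N * Y N u e\<bar>)"
        using elim(3) by (intro Bochner_Integration.integrable_sum integrable_abs) auto
      have "\<bar>(\<bbbE> e. f (\<lambda>u. Y' N u e)) - (\<bbbE> e. g (\<lambda>u. Y N u e))\<bar> \<le> (\<bbbE> e. ?h e) + 2 * B * (real (card I) * \<epsilon>')"
      proof (rule integral_close_on_box[OF fin Ym _ iY])
        show "integrable env ?h" using i1 by simp
        show "0 \<le> ?h e" for e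
          by (intro add_nonneg_nonneg mult_nonneg_nonneg sum_nonneg L(1) abs_ge_zero less_imp_le[OF K(1)])
        show "\<bar>f (\<lambda>u. Y' N u e) - g (\<lambda>u. Y N u e)\<bar> \<le> 2 * B" for e
          using B[of "\<lambda>u. Y' N u e"] B[of "\<lambda>u. c0 * Y N u e"] unfolding g_def by linarith
      qed (use elim pt in auto)
      also have "(\<bbbE> e. ?h e) = L * (\<Sum>u\<in>I. (\<bbbE> e. \<bar>Y' N u e - c N * Y N u e\<bar>)) + L * (\<bar>c N - c0\<bar> * (\<Sum>u\<in>I. K u))"
      proof -
        have "(\<bbbE> e. (\<Sum>u\<in>I. \<bar>Y' N u e - c N * Y N u e\<bar>)) = (\<Sum>u\<in>I. (\<bbbE> e. \<bar>Y' N u e - c N * Y N u e\<bar>))"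
          using elim(3) by (intro Bochner_Integration.integral_sum integrable_abs) auto
        then show ?thesis using i1 env.prob_space by simp
      qed
      also have "\<dots> \<le> L * (\<Sum>u\<in>I. b N) + L * (\<bar>c N - c0\<bar> * (\<Sum>u\<in>I. K u))"
        using elim(3) L(1) by (intro add_mono mult_left_mono sum_mono order_refl) auto
      also have "\<dots> = L * (k * b N) + L * (\<bar>c N - c0\<bar> * (\<Sum>u\<in>I. K u))" by (simp add: k_def)
      also have "2 * B * (real (card I) * \<epsilon>') \<le> (2 * B + 1) * ((k + 1) * \<epsilon>')"
        using B0 \<epsilon>' unfolding k_def by (intro mult_mono) auto
      also have "\<dots> = \<epsilon> / 3"
      proof -
        have "a * (b * (\<epsilon> / (3 * a * b))) = \<epsilon> / 3" if "a \<noteq> 0" "b \<noteq> 0" for a b :: real using that by simp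
        from this[of "2 * B + 1" "k + 1"] show ?thesis unfolding \<epsilon>'_def using B0 k by linarith
      qed
      finally show ?case using elim(1) \<epsilon> by simp
    qed
    with glim show "\<exists>b l'. b \<longlonglongrightarrow> l' \<and> ev (\<lambda>N. \<bar>(\<bbbE> e. f (\<lambda>u. Y' N u e)) - b N\<bar> \<le> \<epsilon>)
        \<and> \<bar>l' - (\<integral>x. f (\<lambda>u. c0 * A u x) \<partial>M)\<bar> \<le> \<epsilon>"
      using \<epsilon> unfolding g_def by (intro exI conjI) auto
  qed
qed

lemma integral_env_coordinate:
  "integrable env (\<lambda>e. e p)" "(\<bbbE> e. e p) = 1"
proof -
  have expo: "expo = density lborel (exponential_density 1)" by (simp add: expo_def exponential_law_def)
  have "distr expo lborel (\<lambda>x. x) = density lborel (exponential_density 1)"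
    by (subst distr_id2) (simp_all add: expo)
  then have "distributed expo lborel (\<lambda>x. x) (exponential_density 1)" by (auto simp: distributed_def)
  from expo.exponential_distributed_expectation[OF _ this]
  have x: "(\<integral>x. x \<partial>expo) = 1" by simp
  show i: "integrable env (\<lambda>e. e p)" by (rule m4_integrable[OF m4_coordinate])
  have "distr env expo (\<lambda>e. e p) = expo"
    unfolding env_def by (rule distr_PiM_component) (simp_all add: prob_space_expo)
  moreover have "(\<integral>x. x \<partial>distr env expo (\<lambda>e. e p)) = (\<bbbE> e. e p)"
    using measurable_env_component[of p] by (intro integral_distr) (auto simp: measurable_def)
  ultimately show "(\<bbbE> e. e p) = 1" using x by simp
qed

lemma inverse_param_diff:
  fixes a a' :: real
  assumes "\<bar>a\<bar> \<le> 1 / 4" "\<bar>a'\<bar> \<le> 1 / 4"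
  shows "\<bar>1 / (1 / 2 + a) - 1 / (1 / 2 + a')\<bar> \<le> 16 * \<bar>a - a'\<bar>"
proof -
  have p: "1 / 4 \<le> 1 / 2 + a" "1 / 4 \<le> 1 / 2 + a'" using assms by linarith+
  have "1 / (1 / 2 + a) - 1 / (1 / 2 + a') = (a' - a) / ((1 / 2 + a) * (1 / 2 + a'))"
    using p by (simp add: diff_frac_eq)
  then have "\<bar>1 / (1 / 2 + a) - 1 / (1 / 2 + a')\<bar> = \<bar>a - a'\<bar> / ((1 / 2 + a) * (1 / 2 + a'))"
    using p by (simp add: abs_mult abs_minus_commute)
  also have "\<dots> \<le> \<bar>a - a'\<bar> / (1 / 4 * (1 / 4))"
    using p by (intro divide_left_mono mult_mono mult_pos_pos) auto
  finally show ?thesis by simp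
qed

lemma G_param_L1:
  assumes \<alpha>: "\<bar>\<alpha> - \<alpha>'\<bar> \<le> x" and \<beta>: "\<bar>\<beta> - \<beta>'\<bar> \<le> y" and "j \<le> i"
  shows "integrable env (\<lambda>e. G \<alpha> \<beta> e i j - G \<alpha>' \<beta>' e i j)"
    "(\<bbbE> e. \<bar>G \<alpha> \<beta> e i j - G \<alpha>' \<beta>' e i j\<bar>) \<le> x * real j + y * real i"
proof -
  let ?S = "\<lambda>e. x * (\<Sum>k=1..j. e (k, k) :: real) + y * (\<Sum>k=1..i. e (k, 0))"
  have ae: "AE e in env. \<bar>G \<alpha> \<beta> e i j - G \<alpha>' \<beta>' e i j\<bar> \<le> ?S e"
    using AE_env_pos
  proof eventually_elim
    case (elim e)
    have "\<bar>G \<alpha> \<beta> e i j - G \<alpha>' \<beta>' e i j\<bar> \<le> \<bar>\<alpha> - \<alpha>'\<bar> * (\<Sum>k=1..j. e (k, k)) + \<bar>\<beta> - \<beta>'\<bar> * (\<Sum>k=1..i. e (k, 0))"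
      by (rule G_lipschitz[OF elim assms(3)])
    also have "\<dots> \<le> ?S e"
      using \<alpha> \<beta> elim by (intro add_mono mult_right_mono sum_nonneg) (auto simp: nonneg_def)
    finally show ?case .
  qed
  have iS: "integrable env ?S"
    by (intro Bochner_Integration.integrable_add integrable_mult_right Bochner_Integration.integrable_sum integral_env_coordinate impI)
  show 1: "integrable env (\<lambda>e. G \<alpha> \<beta> e i j - G \<alpha>' \<beta>' e i j)"
    by (rule Bochner_Integration.integrable_bound[OF iS]) (use ae in \<open>auto elim!: eventually_mono\<close>)
  have "(\<bbbE> e. \<bar>G \<alpha> \<beta> e i j - G \<alpha>' \<beta>' e i j\<bar>) \<le> (\<bbbE> e. ?S e)"
    by (intro integral_mono_AE iS ae integrable_abs 1)
  also have "\<dots> = x * (\<Sum>k=1..j. 1) + y * (\<Sum>k=1..i. 1)"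
    by (simp add: Bochner_Integration.integral_sum Bochner_Integration.integral_add integral_env_coordinate)
  finally show "(\<bbbE> e. \<bar>G \<alpha> \<beta> e i j - G \<alpha>' \<beta>' e i j\<bar>) \<le> x * real j + y * real i" by simp
qed

lemma pp_param_L1:
  assumes "\<bar>a\<bar> \<le> 1 / 4" "\<bar>a'\<bar> \<le> 1 / 4" "j \<le> i"
  shows "integrable env (\<lambda>e. Gpp a e i j - Gpp a' e i j)"
    "(\<bbbE> e. \<bar>Gpp a e i j - Gpp a' e i j\<bar>) \<le> 16 * \<bar>a - a'\<bar> * real j"
  using G_param_L1[OF inverse_param_diff[OF assms(1,2)] _ assms(3), of 0 0 0] by simp_all

lemma st_param_L1:
  assumes "\<bar>a\<bar> \<le> 1 / 4" "\<bar>a'\<bar> \<le> 1 / 4"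
  shows "integrable env (\<lambda>e. Gst a e k k - Gst a' e k k)"
    "(\<bbbE> e. \<bar>Gst a e k k - Gst a' e k k\<bar>) \<le> 2 * (16 * \<bar>a - a'\<bar> * real k)"
  using G_param_L1[OF inverse_param_diff[OF assms] inverse_param_diff[of "- a" "- a'"] order_refl, of k] assms
  by (simp_all add: abs_minus_commute mult.commute)

section \<open>Convergence of the covariance\<close>

definition pp_part :: "real => (nat => nat) => nat => real => (nat \<times> nat => real) => real" where
  "pp_part \<delta> k N u e = (Gpp (drift \<delta> / cbrt N) e (k N + fst (grid_pt (fluct_scale (k N)) u)) (k N - snd (grid_pt (fluct_scale (k N)) u))
    - 4 * real (k N)) / (unit_scale * cbrt N)"

lemma cbrt_part:
  assumes t: "0 < \<tau>" and k: "\<bar>real k - \<tau> * real N\<bar> \<le> 1" and N: "1 \<le> N"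
  shows "\<bar>cbrt k / cbrt N - \<tau> powr (1 / 3)\<bar> \<le> 1 / ((\<tau> powr (1 / 3)) ^ 2 * cbrt N ^ 3)"
proof -
  define x t where "x = cbrt k / cbrt N" and "t = \<tau> powr (1 / 3)"
  have c: "0 < cbrt N" using N by (rule cbrt_pos)
  have t0: "0 < t" using t by (simp add: t_def)
  have x0: "0 \<le> x" by (simp add: x_def cbrt_nonneg)
  have t3: "t ^ 3 = \<tau>" using t by (simp add: t_def powr_realpow[symmetric] powr_powr)
  have x3: "x ^ 3 = real k / real N" by (simp add: x_def power_divide cbrt_cube)
  have "x ^ 3 - t ^ 3 = (real k - \<tau> * real N) / cbrt N ^ 3" using N by (simp add: x3 t3 cbrt_cube diff_divide_distrib)
  then have "\<bar>x ^ 3 - t ^ 3\<bar> = \<bar>real k - \<tau> * real N\<bar> / cbrt N ^ 3" using c by simp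
  also have "\<dots> \<le> 1 / cbrt N ^ 3" using c k by (intro divide_right_mono) auto
  finally have 1: "\<bar>x ^ 3 - t ^ 3\<bar> \<le> 1 / cbrt N ^ 3" .
  have "x ^ 3 - t ^ 3 = (x - t) * (x\<^sup>2 + x * t + t\<^sup>2)" by (simp add: algebra_simps power2_eq_square power3_eq_cube)
  then have "\<bar>x ^ 3 - t ^ 3\<bar> = \<bar>x - t\<bar> * \<bar>x\<^sup>2 + x * t + t\<^sup>2\<bar>" by (simp only: abs_mult)
  moreover have "\<bar>x - t\<bar> * t\<^sup>2 \<le> \<bar>x - t\<bar> * \<bar>x\<^sup>2 + x * t + t\<^sup>2\<bar>" using x0 t0 by (intro mult_left_mono) auto
  ultimately have "\<bar>x - t\<bar> * t\<^sup>2 \<le> 1 / cbrt N ^ 3" using 1 by linarith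
  then show ?thesis using t0 c unfolding x_def[symmetric] t_def[symmetric] by (simp add: field_simps)
qed

lemma cbrt_part_lim:
  assumes \<tau>: "0 < \<tau>" and k: "\<And>N. \<bar>real (k N) - \<tau> * real N\<bar> \<le> 1"
  shows "(\<lambda>N. cbrt (k N) / cbrt N) \<longlonglongrightarrow> \<tau> powr (1 / 3)"
proof -
  have "(\<lambda>N. 1 / ((\<tau> powr (1 / 3)) ^ 2 * cbrt N ^ 3)) \<longlonglongrightarrow> 0" using \<tau> unfolding cbrt_def by real_asymp
  moreover have "ev (\<lambda>N. norm (cbrt (k N) / cbrt N - \<tau> powr (1 / 3)) \<le> 1 / ((\<tau> powr (1 / 3)) ^ 2 * cbrt N ^ 3))"
    by (intro eventually_sequentiallyI[of 1]) (use cbrt_part[OF \<tau> k] in simp)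
  ultimately have "(\<lambda>N. cbrt (k N) / cbrt N - \<tau> powr (1 / 3)) \<longlonglongrightarrow> 0" by (rule Lim_null_comparison[rotated])
  then show ?thesis by (rule LIM_zero_cancel)
qed

text \<open>The perturbations of the rate at sizes N and k would agree for k = \<tau> N. Rounding
  separates them by a relative error of order 1 / N, whose effect on k diagonal weights is of order
  N^(-2/3) after scaling.\<close>

lemma param_gap:
  assumes \<tau>: "0 < \<tau>" and k: "\<bar>real k - \<tau> * real N\<bar> \<le> 1" "k \<le> N" "1 \<le> k"
  shows "16 * \<bar>drift \<delta> / cbrt N - drift (\<delta> * \<tau> powr (1 / 3)) / cbrt k\<bar> * real k / (unit_scale * cbrt N)
    \<le> 16 * \<bar>drift \<delta>\<bar> / ((\<tau> powr (1 / 3)) ^ 2 * unit_scale) * (1 / cbrt N ^ 2)"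
proof -
  let ?D = "drift \<delta>" and ?t = "\<tau> powr (1 / 3)"
  have c: "0 < cbrt N" "0 < cbrt k" using k by (auto intro: cbrt_pos)
  define x where "x = cbrt k / cbrt N"
  have x: "0 < x" "x \<le> 1" using c k by (auto simp: x_def cbrt_mono)
  have kx: "cbrt k = x * cbrt N" using c by (simp add: x_def)
  have "?D / cbrt N - drift (\<delta> * ?t) / cbrt k = ?D * (x - ?t) / (x * cbrt N)"
    using c x by (simp add: kx drift_cmult field_simps)
  then have "\<bar>?D / cbrt N - drift (\<delta> * ?t) / cbrt k\<bar> = \<bar>?D\<bar> * \<bar>x - ?t\<bar> / (x * cbrt N)" using c x by (simp add: abs_mult)
  moreover have "real k = x ^ 3 * cbrt N ^ 3" by (simp add: cbrt_cube[symmetric] kx power_mult_distrib)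
  ultimately have "16 * \<bar>?D / cbrt N - drift (\<delta> * ?t) / cbrt k\<bar> * real k / (unit_scale * cbrt N)
    = 16 * \<bar>?D\<bar> / unit_scale * (x ^ 2 * (\<bar>x - ?t\<bar> * cbrt N))"
    using c x unit_scale_pos by (simp add: field_simps eval_nat_numeral)
  also have "\<dots> \<le> 16 * \<bar>?D\<bar> / unit_scale * (1 * (1 / ((?t) ^ 2 * cbrt N ^ 3) * cbrt N))"
    using c unit_scale_pos x cbrt_part[OF \<tau> k(1)] k(2,3) unfolding x_def[symmetric]
    by (intro mult_left_mono mult_mono mult_right_mono power_le_one) auto
  also have "\<dots> = 16 * \<bar>?D\<bar> / ((?t) ^ 2 * unit_scale) * (1 / cbrt N ^ 2)"
    using c by (simp add: eval_nat_numeral)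
  finally show ?thesis .
qed

lemma unit_scale_cbrt_lim: "(\<lambda>N. x / (unit_scale * cbrt N)) \<longlonglongrightarrow> 0"
  using unit_scale_pos unfolding cbrt_def by real_asymp

text \<open>Seen from its own size k, close to s N, the perturbation \<delta> N^(-1/3) of the rate
  becomes \<delta> s^(1/3) k^(-1/3), and in units of N the fluctuations shrink by s^(1/3). The
  function \<open>H\<close> stands for either model, and r permits centring at 4 s N instead of 4
  k.\<close>

lemma rescaled_conv:
  fixes H :: "real => nat => real => (nat \<times> nat => real) => real" and k :: "nat => nat"
  assumes P: "conv_fdd I (\<lambda>n u e. (H (drift (\<delta> * s powr (1 / 3)) / cbrt n) n u e - 4 * real n) / (unit_scale * cbrt n)) M A"
    and H [measurable]: "\<And>a n u. H a n u \<in> borel_measurable env"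
    and L1: "\<And>a a' n u. \<bar>a\<bar> \<le> 1 / 4 ==> \<bar>a'\<bar> \<le> 1 / 4 ==> integrable env (\<lambda>e. H a n u e - H a' n u e) \<and>
      (\<bbbE> e. \<bar>H a n u e - H a' n u e\<bar>) \<le> 2 * (16 * \<bar>a - a'\<bar> * real n)"
    and s: "0 < s" and k: "\<And>N. \<bar>real (k N) - s * real N\<bar> \<le> 1" "\<And>N. k N \<le> N" "filterlim k at_top sequentially"
    and r: "\<And>N. \<bar>r N\<bar> \<le> 4"
  shows "conv_fdd I (\<lambda>N u e. (H (drift \<delta> / cbrt N) (k N) u e - 4 * real (k N) + r N) / (unit_scale * cbrt N)) M
    (\<lambda>u x. s powr (1 / 3) * A u x)"
proof -
  let ?t = "s powr (1 / 3)" and ?D = "drift \<delta>" and ?c = "\<lambda>N. unit_scale * cbrt N"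
  let ?b = "\<lambda>N. 2 * (16 * \<bar>?D\<bar> / ((?t) ^ 2 * unit_scale) * (1 / cbrt N ^ 2)) + 4 / ?c N"
  have "(\<lambda>N. 1 / cbrt N ^ 2) \<longlonglongrightarrow> 0" unfolding cbrt_def by real_asymp
  then have "?b \<longlonglongrightarrow> 2 * (16 * \<bar>?D\<bar> / ((?t) ^ 2 * unit_scale) * 0) + 0"
    by (intro tendsto_intros unit_scale_cbrt_lim)
  then have b: "?b \<longlonglongrightarrow> 0" by simp
  show ?thesis
  proof (rule conv_fdd_approx[OF conv_fdd_compose[OF P k(3)] _ cbrt_part_lim[OF s k(1)] b])
    fix u
    have q: "(0::real) < 1 / 4" by simp
    have "ev (\<lambda>N. \<bar>drift (\<delta> * ?t) / cbrt (k N)\<bar> < 1 / 4)"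
      using eventually_compose_filterlim[OF eventually_drift_small[OF q] k(3)] .
    moreover have "ev (\<lambda>N. 1 \<le> k N)" using k(3) by (simp add: filterlim_at_top)
    ultimately show "ev (\<lambda>N. integrable env (\<lambda>e. (H (?D / cbrt N) (k N) u e - 4 * real (k N) + r N) / ?c N
        - cbrt (k N) / cbrt N * ((H (drift (\<delta> * ?t) / cbrt (k N)) (k N) u e - 4 * real (k N)) / ?c (k N))) \<and>
      (\<bbbE> e. \<bar>(H (?D / cbrt N) (k N) u e - 4 * real (k N) + r N) / ?c N
        - cbrt (k N) / cbrt N * ((H (drift (\<delta> * ?t) / cbrt (k N)) (k N) u e - 4 * real (k N)) / ?c (k N))\<bar>) \<le> ?b N)"
      using eventually_drift_small[OF q, of ?D]
    proof eventually_elim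
      case (elim N)
      let ?a = "?D / cbrt N" and ?a' = "drift (\<delta> * ?t) / cbrt (k N)"
      let ?d = "\<lambda>e. H ?a (k N) u e - H ?a' (k N) u e"
      have kN: "1 \<le> N" using elim(2) k(2)[of N] by linarith
      have c: "0 < cbrt N" "0 < cbrt (k N)" "0 < ?c N" using kN elim(2) unit_scale_pos by (auto intro!: cbrt_pos mult_pos_pos)
      have eq: "(H ?a (k N) u e - 4 * real (k N) + r N) / ?c N - cbrt (k N) / cbrt N * ((H ?a' (k N) u e - 4 * real (k N)) / ?c (k N))
        = ?d e / ?c N + r N / ?c N" for e
        using c by (simp add: diff_divide_distrib add_divide_distrib right_diff_distrib)
      have L1: "integrable env ?d" "(\<bbbE> e. \<bar>?d e\<bar>) \<le> 2 * (16 * \<bar>?a - ?a'\<bar> * real (k N))"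
        using L1[of ?a ?a' "k N" u] elim by auto
      have i: "integrable env (\<lambda>e. \<bar>?d e\<bar> / ?c N)" using L1(1) by simp
      have "(\<bbbE> e. \<bar>?d e / ?c N + r N / ?c N\<bar>) \<le> (\<bbbE> e. \<bar>?d e\<bar> / ?c N + 4 / ?c N)"
      proof (rule integral_mono)
        fix e
        have "\<bar>?d e / ?c N + r N / ?c N\<bar> = \<bar>?d e + r N\<bar> / ?c N" using c by (simp add: add_divide_distrib[symmetric])
        also have "\<dots> \<le> (\<bar>?d e\<bar> + 4) / ?c N" using r[of N] c by (intro divide_right_mono) auto
        finally show "\<bar>?d e / ?c N + r N / ?c N\<bar> \<le> \<bar>?d e\<bar> / ?c N + 4 / ?c N" by (simp only: add_divide_distrib)
      qed (use L1(1) i in auto)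
      also have "\<dots> = (\<bbbE> e. \<bar>?d e\<bar>) / ?c N + 4 / ?c N" using i env.prob_space by simp
      also have "(\<bbbE> e. \<bar>?d e\<bar>) / ?c N \<le> 2 * (16 * \<bar>?a - ?a'\<bar> * real (k N)) / ?c N"
        using L1(2) c by (intro divide_right_mono) auto
      also have "2 * (16 * \<bar>?a - ?a'\<bar> * real (k N)) / ?c N = 2 * (16 * \<bar>?a - ?a'\<bar> * real (k N) / ?c N)" by simp
      also have "\<dots> \<le> 2 * (16 * \<bar>?D\<bar> / ((?t) ^ 2 * unit_scale) * (1 / cbrt N ^ 2))"
        using param_gap[OF s k(1,2) elim(2), of \<delta>] by simp
      finally have "(\<bbbE> e. \<bar>?d e / ?c N + r N / ?c N\<bar>) \<le> ?b N" by simp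
      then show ?case unfolding eq using L1(1) by auto
    qed
  qed measurable
qed

lemma pp_part_conv_offset:
  fixes k :: "nat => nat"
  assumes A: "is_A_pp (\<delta> * \<tau> powr (1 / 3)) M A" and I: "finite I" "I \<subseteq> {0..}"
    and k: "0 < \<tau>" "\<And>N. \<bar>real (k N) - \<tau> * real N\<bar> \<le> 1" "\<And>N. k N \<le> N" "filterlim k at_top sequentially"
    and r: "\<And>N. \<bar>r N\<bar> \<le> 4"
  shows "conv_fdd I (\<lambda>N u e. (Gpp (drift \<delta> / cbrt N) e (k N + fst (grid_pt (fluct_scale (k N)) u)) (k N - snd (grid_pt (fluct_scale (k N)) u))
    - 4 * real (k N) + r N) / (unit_scale * cbrt N)) M (\<lambda>u x. \<tau> powr (1 / 3) * (A u x - u\<^sup>2))"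
proof (rule rescaled_conv[where H="\<lambda>a n u e. Gpp a e (n + fst (grid_pt (fluct_scale n) u)) (n - snd (grid_pt (fluct_scale n) u))"])
  show "conv_fdd I (\<lambda>n u e. (Gpp (drift (\<delta> * \<tau> powr (1 / 3)) / cbrt n) e (n + fst (grid_pt (fluct_scale n) u)) (n - snd (grid_pt (fluct_scale n) u))
    - 4 * real n) / (unit_scale * cbrt n)) M (\<lambda>u x. A u x - u\<^sup>2)"
    using pp_conv_fdd[OF A I] unfolding pp_scaled_def[abs_def] .
  fix a a' u :: real and n
  let ?i = "n + fst (grid_pt (fluct_scale n) u)" and ?j = "n - snd (grid_pt (fluct_scale n) u)"
  assume a: "\<bar>a\<bar> \<le> 1 / 4" "\<bar>a'\<bar> \<le> 1 / 4"
  have "?j \<le> ?i" by simp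
  note L1 = pp_param_L1[OF a this]
  have "16 * \<bar>a - a'\<bar> * real ?j \<le> 16 * \<bar>a - a'\<bar> * real n" by (intro mult_left_mono) auto
  moreover have "0 \<le> 16 * \<bar>a - a'\<bar> * real n" by simp
  ultimately show "integrable env (\<lambda>e. Gpp a e ?i ?j - Gpp a' e ?i ?j) \<and>
    (\<bbbE> e. \<bar>Gpp a e ?i ?j - Gpp a' e ?i ?j\<bar>) \<le> 2 * (16 * \<bar>a - a'\<bar> * real n)"
    using L1 by (intro conjI) (rule L1(1), linarith)
qed (use k r in measurable)

lemma pp_part_conv:
  fixes k :: "nat => nat"
  assumes "is_A_pp (\<delta> * \<tau> powr (1 / 3)) M A" "finite I" "I \<subseteq> {0..}"
    and "0 < \<tau>" "\<And>N. \<bar>real (k N) - \<tau> * real N\<bar> \<le> 1" "\<And>N. k N \<le> N" "filterlim k at_top sequentially"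
  shows "conv_fdd I (pp_part \<delta> k) M (\<lambda>u x. \<tau> powr (1 / 3) * (A u x - u\<^sup>2))"
  using pp_part_conv_offset[OF assms, of "\<lambda>_. 0"] unfolding pp_part_def[abs_def] by simp

section \<open>Independence of the two halves\<close>

definition corner_region :: "nat => (real => nat) => (real => nat) => (nat \<times> nat) set" where
  "corner_region n p p' = {(k, l). \<exists>u. 1 \<le> l \<and> l \<le> k \<and> k \<le> n + p u \<and> l + p' u \<le> n}"

text \<open>The lower times read only \<open>corner_region\<close>, and the upper ones avoid it: a
  common entry would force s' < p \<le> p' < s \<le> s', whatever the pair of cut points. The bound
  on \<open>s v\<close> keeps the entries inside the triangle that is reflected.\<close>

lemma splice_corner:
  fixes p p' s s' :: "real => nat" and n :: nat
  defines "A \<equiv> corner_region n p p'"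
  assumes p: "\<And>u. p u \<le> p' u"
  shows "G \<alpha> 0 (splice A e e') (n + p u) (n - p' u) = G \<alpha> 0 e (n + p u) (n - p' u)"
    and "s v \<le> s' v ==> s v \<le> n ==>
      G \<alpha> 0 (rev_env (n + m) (splice A e e')) (m + s v) (m - s' v) = G \<alpha> 0 (rev_env (n + m) e') (m + s v) (m - s' v)"
proof -
  show "G \<alpha> 0 (splice A e e') (n + p u) (n - p' u) = G \<alpha> 0 e (n + p u) (n - p' u)"
    by (rule G_cong) (auto simp: splice_def A_def corner_region_def)
  assume s: "s v \<le> s' v" "s v \<le> n"
  show "G \<alpha> 0 (rev_env (n + m) (splice A e e')) (m + s v) (m - s' v) = G \<alpha> 0 (rev_env (n + m) e') (m + s v) (m - s' v)"
  proof (rule G_cong)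
    fix k l assume kl: "l \<le> k" "k \<le> m + s v" "l \<le> m - s' v" "(0::real) \<noteq> 0 \<or> 1 \<le> l"
    then have l: "1 \<le> l" "l + s' v \<le> m" "k \<le> n + m" using s by auto
    have r: "reflect (n + m) (k, l) = (n + m + 1 - l, n + m + 1 - k)" using l kl by (simp add: reflect_def)
    have "(n + m + 1 - l, n + m + 1 - k) \<notin> A"
    proof
      assume "(n + m + 1 - l, n + m + 1 - k) \<in> A"
      then obtain u where "n + m + 1 - l \<le> n + p u" "n + m + 1 - k + p' u \<le> n" by (auto simp: A_def corner_region_def)
      then show False using l kl s p[of u] by linarith
    qed
    then show "rev_env (n + m) (splice A e e') (k, l) = rev_env (n + m) e' (k, l)"
      by (simp add: rev_env_def r splice_def)
  qed simp
qed

lemma lower_part_parts: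
  assumes "0 < \<tau>" "\<tau> < 1"
  shows "\<bar>real (lower_part \<tau> N) - \<tau> * real N\<bar> \<le> 1" "\<bar>real (N - lower_part \<tau> N) - (1 - \<tau>) * real N\<bar> \<le> 1"
  using lower_part_bounds[OF assms, of N] by (simp_all add: of_nat_diff algebra_simps abs_le_iff)

definition env_test :: "real => (real \<times> real) set => real => real => nat => (nat \<times> nat => real) => (nat \<times> nat => real) => real" where
  "env_test R T \<delta> \<tau> N e e' = prod_test R T 1 1 (\<lambda>u. pp_part \<delta> (lower_part \<tau>) N u e) (\<lambda>v. pp_part \<delta> (\<lambda>N. N - lower_part \<tau> N) N v e')"

lemma measurable_pp_part [measurable]: "pp_part \<delta> k N u \<in> borel_measurable env"
  unfolding pp_part_def[abs_def] by measurable

lemma measurable_env_test: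
  assumes "finite T" and [measurable]: "f \<in> measurable M env" "g \<in> measurable M env"
  shows "(\<lambda>x. env_test R T \<delta> \<tau> N (f x) (g x)) \<in> borel_measurable M"
proof -
  have "(\<lambda>x. Max ((\<lambda>p. 1 * pp_part \<delta> (lower_part \<tau>) N (fst p) (f x) + 1 * pp_part \<delta> (\<lambda>N. N - lower_part \<tau> N) N (snd p) (g x)) ` T)) \<in> borel_measurable M"
    using assms(1) by (rule borel_measurable_Max) measurable
  note [measurable] = this
  show ?thesis unfolding env_test_def prod_test_def max_plus_def by measurable
qed

text \<open>Splicing along \<open>corner_region\<close> separates the two arguments, and
  \<open>rev_env\<close> preserves the law. So an environment paired with its own reflection gives
  the same mean as two independent environments.\<close>

lemma env_test_independent:
  assumes \<tau>: "0 < \<tau>" "\<tau> < 1" and T: "finite T" "T \<noteq> {}" and R: "0 \<le> R"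
    and s: "\<And>v. v \<in> snd ` T ==> fst (grid_pt (fluct_scale (N - lower_part \<tau> N)) v) \<le> lower_part \<tau> N"
  shows "(\<bbbE> e. env_test R T \<delta> \<tau> N e (rev_env N e)) = (\<bbbE> e'. (\<bbbE> e. env_test R T \<delta> \<tau> N e e'))"
proof -
  interpret P: pair_prob_space env env ..
  define n where "n = lower_part \<tau> N"
  define m where "m = N - n"
  have nm: "n + m = N" using lower_part_bounds(3)[OF \<tau>, of N] by (simp add: n_def m_def)
  define A where "A = corner_region n (\<lambda>u. fst (grid_pt (fluct_scale n) u)) (\<lambda>u. snd (grid_pt (fluct_scale n) u))"
  have fs: "fst (grid_pt x u) \<le> snd (grid_pt x u)" for x u
    unfolding grid_pt_def fst_conv snd_conv by (intro nat_mono) linarith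
  have y: "pp_part \<delta> (lower_part \<tau>) N u (splice A e e') = pp_part \<delta> (lower_part \<tau>) N u e" for u e e'
    unfolding pp_part_def n_def[symmetric] A_def by (subst splice_corner(1)) (rule fs, rule refl)
  have z: "pp_part \<delta> (\<lambda>N. N - lower_part \<tau> N) N v (rev_env N (splice A e e')) = pp_part \<delta> (\<lambda>N. N - lower_part \<tau> N) N v (rev_env N e')"
    if v: "v \<in> snd ` T" for v e e'
  proof -
    have sv: "fst (grid_pt (fluct_scale m) v) \<le> n" using s[OF v] by (simp add: n_def m_def)
    show ?thesis
      using splice_corner(2)[where p="\<lambda>u. fst (grid_pt (fluct_scale n) u)" and p'="\<lambda>u. snd (grid_pt (fluct_scale n) u)"
          and s="\<lambda>v. fst (grid_pt (fluct_scale m) v)" and s'="\<lambda>v. snd (grid_pt (fluct_scale m) v)" and n=n and m=m and v=v, OF fs fs sv]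
      unfolding pp_part_def n_def[symmetric] m_def[symmetric] A_def nm by simp
  qed
  have "env_test R T \<delta> \<tau> N (splice A e e') (rev_env N (splice A e e')) = env_test R T \<delta> \<tau> N e (rev_env N e')" for e e'
  proof -
    have "(\<lambda>p. 1 * pp_part \<delta> (lower_part \<tau>) N (fst p) e + 1 * pp_part \<delta> (\<lambda>N. N - lower_part \<tau> N) N (snd p) (rev_env N (splice A e e'))) ` T
      = (\<lambda>p. 1 * pp_part \<delta> (lower_part \<tau>) N (fst p) e + 1 * pp_part \<delta> (\<lambda>N. N - lower_part \<tau> N) N (snd p) (rev_env N e')) ` T"
      by (intro image_cong refl) (simp add: z)
    then show ?thesis unfolding env_test_def prod_test_def max_plus_def y by (simp only:)
  qed
  note eq = this
  have b: "\<bar>env_test R T \<delta> \<tau> N e e'\<bar> \<le> R * R" for e e' unfolding env_test_def by (rule prod_test_bound[OF R])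
  have "(\<bbbE> e. env_test R T \<delta> \<tau> N e (rev_env N e)) = (\<integral>z. env_test R T \<delta> \<tau> N (fst z) (rev_env N (snd z)) \<partial>(env \<Otimes>\<^sub>M env))"
    using integral_env_splice[OF measurable_env_test[OF T(1) measurable_ident measurable_rev_env], of R \<delta> \<tau> N N A] unfolding eq id_apply by simp
  also have "\<dots> = (\<bbbE> e'. (\<bbbE> e. env_test R T \<delta> \<tau> N e (rev_env N e')))"
  proof -
    have "integrable (env \<Otimes>\<^sub>M env) (\<lambda>z. env_test R T \<delta> \<tau> N (fst z) (rev_env N (snd z)))"
      by (rule P.integrable_const_bound[where B="R * R"]) (use b in \<open>auto intro!: measurable_env_test T\<close>)
    then have "integrable (env \<Otimes>\<^sub>M env) (\<lambda>(e, e'). env_test R T \<delta> \<tau> N e (rev_env N e'))" by (simp add: split_beta')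
    from P.integral_snd[OF this] show ?thesis by (simp add: split_beta')
  qed
  also have "\<dots> = (\<bbbE> e'. (\<bbbE> e. env_test R T \<delta> \<tau> N e e'))"
  proof (rule preserving_integral[OF preserving_rev_env])
    have "(\<lambda>(e', e). env_test R T \<delta> \<tau> N e e') \<in> borel_measurable (env \<Otimes>\<^sub>M env)"
      unfolding split_beta' by (rule measurable_env_test[OF T(1)]) measurable
    then show "(\<lambda>e'. (\<bbbE> e. env_test R T \<delta> \<tau> N e e')) \<in> borel_measurable env"
      by (rule env.borel_measurable_lebesgue_integral)
  qed
  finally show ?thesis .
qed

text \<open>The centring 4 \<tau> N is that of the theorem. It differs from the centring of
  \<open>pp_part\<close> by rounding, at most 4 before scaling.\<close>

definition pp_lower :: "real => real => nat => (nat \<times> nat => real) => real" where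
  "pp_lower \<delta> \<tau> N e = (Gpp (drift \<delta> / cbrt N) e (lower_part \<tau> N) (lower_part \<tau> N) - 4 * \<tau> * real N) / (unit_scale * cbrt N)"

lemma measurable_pp_lower [measurable]: "pp_lower \<delta> \<tau> N \<in> borel_measurable env"
  unfolding pp_lower_def[abs_def] by measurable

lemma m4_pp_scaled:
  assumes \<tau>: "0 < \<tau>" "\<tau> < 1"
    and tight: "deficit_tight \<bar>drift \<delta>\<bar>"
  obtains C where "0 \<le> C" "ev (\<lambda>N. m4 (pp_scaled \<delta> N 0) C)" "ev (\<lambda>N. m4 (pp_lower \<delta> \<tau> N) C)"
proof -
  obtain C N0 where C: "0 \<le> C" "1 \<le> N0"
    "\<And>N a. N0 \<le> N ==> \<bar>a\<bar> \<le> \<bar>drift \<delta>\<bar> / cbrt N ==> m4 (\<lambda>e. Gpp a e N N - 4 * real N) (C * cbrt N ^ 4)"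
    by (rule G_moments[OF abs_ge_zero tight]) (rule that; assumption)
  define K where "K = C / unit_scale ^ 4"
  have K: "0 \<le> K" using C by (simp add: K_def)
  have part: "m4 (\<lambda>e. (Gpp (drift \<delta> / cbrt N) e n n - 4 * real n) / (unit_scale * cbrt N)) K" if n: "N0 \<le> n" "n \<le> N" for n N
  proof -
    have c: "0 < cbrt n" "cbrt n \<le> cbrt N" "0 < cbrt N" using n C(2) by (auto intro: cbrt_pos cbrt_mono)
    have "\<bar>drift \<delta> / cbrt N\<bar> = \<bar>drift \<delta>\<bar> / cbrt N" using c by simp
    also have "\<dots> \<le> \<bar>drift \<delta>\<bar> / cbrt n" using c by (intro divide_left_mono mult_pos_pos) auto
    finally have "m4 (\<lambda>e. 1 / (unit_scale * cbrt N) * (Gpp (drift \<delta> / cbrt N) e n n - 4 * real n)) ((1 / (unit_scale * cbrt N)) ^ 4 * (C * cbrt n ^ 4))"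
      by (intro m4_cmult C(3) n(1))
    moreover have "(1 / (unit_scale * cbrt N)) ^ 4 * (C * cbrt n ^ 4) \<le> (1 / (unit_scale * cbrt N)) ^ 4 * (C * cbrt N ^ 4)"
      using c C by (intro mult_left_mono power_mono) auto
    moreover have "(1 / (unit_scale * cbrt N)) ^ 4 * (C * cbrt N ^ 4) = K"
      using c by (simp add: K_def power_divide power_mult_distrib)
    ultimately show ?thesis using m4_mono by simp
  qed
  define K2 where "K2 = 8 * (K + (4 / unit_scale) ^ 4)"
  have "ev (\<lambda>N. N0 \<le> lower_part \<tau> N)" using filterlim_parts(1)[OF \<tau>] by (simp add: filterlim_at_top)
  then have "ev (\<lambda>N. m4 (pp_lower \<delta> \<tau> N) K2)"
  proof eventually_elim
    case (elim N)
    define n where "n = lower_part \<tau> N"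
    have n: "N0 \<le> n" "n \<le> N" using elim lower_part_bounds(3)[OF \<tau>] by (auto simp: n_def)
    have "1 \<le> N" using n C(2) by linarith
    then have c: "1 \<le> cbrt N" using cbrt_mono[of 1 N] by (simp add: cbrt_def)
    have "m4 (\<lambda>e. (4 * (real n - \<tau> * real N)) / (unit_scale * cbrt N)) ((4 / unit_scale) ^ 4)"
    proof (rule m4_dom[OF m4_const])
      have "\<bar>4 * (real n - \<tau> * real N)\<bar> \<le> 4" using lower_part_parts(1)[OF \<tau>, of N] by (simp add: n_def)
      then have "\<bar>4 * (real n - \<tau> * real N)\<bar> / (unit_scale * cbrt N) \<le> 4 / (unit_scale * 1)"
        using c unit_scale_pos by (intro frac_le mult_left_mono) auto
      then show "AE e in env. \<bar>4 * (real n - \<tau> * real N) / (unit_scale * cbrt N)\<bar> \<le> \<bar>4 / unit_scale\<bar>"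
        using c unit_scale_pos by (simp add: abs_mult)
    qed simp
    then have "m4 (\<lambda>e. (Gpp (drift \<delta> / cbrt N) e n n - 4 * real n) / (unit_scale * cbrt N) + (4 * (real n - \<tau> * real N)) / (unit_scale * cbrt N)) K2"
      unfolding K2_def using K by (intro m4_add part n) auto
    moreover have "pp_lower \<delta> \<tau> N = (\<lambda>e. (Gpp (drift \<delta> / cbrt N) e n n - 4 * real n) / (unit_scale * cbrt N) + (4 * (real n - \<tau> * real N)) / (unit_scale * cbrt N))"
      by (simp add: pp_lower_def fun_eq_iff n_def[symmetric] add_divide_distrib[symmetric])
    ultimately show ?case by simp
  qed
  moreover have "ev (\<lambda>N. m4 (pp_scaled \<delta> N 0) K2)" using eventually_ge_at_top[of N0]
  proof eventually_elim
    case (elim N)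
    have "K \<le> K2" using K by (simp add: K2_def)
    then show ?case using m4_mono[OF part[OF elim order_refl]] by (simp add: pp_scaled_def[abs_def])
  qed
  moreover have "0 \<le> K2" using K by (simp add: K2_def)
  ultimately show ?thesis using that by blast
qed

lemma max_plus_grid_value:
  assumes T: "finite T" "T \<noteq> {}" and N: "n = lower_part \<tau> N" "m = N - lower_part \<tau> N" "n + m = N" and c: "0 < unit_scale * cbrt N"
  shows "max_plus T 1 1 (\<lambda>u. pp_part \<delta> (lower_part \<tau>) N u e) (\<lambda>v. pp_part \<delta> (\<lambda>N. N - lower_part \<tau> N) N v (rev_env N e))
    = (grid_max (drift \<delta>) \<tau> T N e - 4 * real N) / (unit_scale * cbrt N)"
proof -
  have mN: "N - n = m" using N(1,2) by simp
  let ?g = "\<lambda>t. grid_value (drift \<delta> / cbrt N) n m (grid_pt (fluct_scale n) (fst t)) (grid_pt (fluct_scale m) (snd t)) e"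
  have "mono (\<lambda>x. (x - 4 * real N) / (unit_scale * cbrt N))" using c by (intro monoI divide_right_mono) auto
  from mono_Max_commute[OF this, of "?g ` T"] T
  have "(Max (?g ` T) - 4 * real N) / (unit_scale * cbrt N) = Max ((\<lambda>t. (?g t - 4 * real N) / (unit_scale * cbrt N)) ` T)"
    by (simp add: image_image)
  moreover have "1 * pp_part \<delta> (lower_part \<tau>) N (fst t) e + 1 * pp_part \<delta> (\<lambda>N. N - lower_part \<tau> N) N (snd t) (rev_env N e)
    = (?g t - 4 * real N) / (unit_scale * cbrt N)" for t
  proof -
    have rN: "real N = real n + real m" using N(3) by (metis of_nat_add)
    show ?thesis
      unfolding pp_part_def grid_value_def N(1)[symmetric] mN N(3) mult_1_left add_divide_distrib[symmetric] rN
      by (rule arg_cong[where f="\<lambda>x. x / (unit_scale * cbrt N)"]) (simp only: distrib_left diff_conv_add_uminus minus_add_distrib ac_simps)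
  qed
  ultimately show ?thesis unfolding max_plus_def grid_max_def N(1)[symmetric] mN by (simp only:)
qed

text \<open>The product is truncated at R and the larger time replaced by a maximum over finitely
  many grid points; independence then brings it into the form of \<open>product_limit\<close>.
  Approximation by convergent sequences within every \<epsilon> gives convergence, without
  identifying the limit.\<close>

lemma scaled_product_convergent:
  fixes \<delta> \<tau> :: real
  assumes \<tau>: "0 < \<tau>" "\<tau> < 1"
    and A: "is_A_pp (\<delta> * \<tau> powr (1 / 3)) M A" and B: "is_A_pp (\<delta> * (1 - \<tau>) powr (1 / 3)) M' B"
    and tight: "deficit_tight \<bar>drift \<delta>\<bar>"
  shows "convergent (\<lambda>N. (\<bbbE> e. pp_lower \<delta> \<tau> N e * pp_scaled \<delta> N 0 e))"
proof (rule approx_convergent)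
  fix \<epsilon> :: real assume \<epsilon>: "0 < \<epsilon>"
  let ?X = "\<lambda>N. pp_scaled \<delta> N 0" and ?Y = "pp_lower \<delta> \<tau>"
  obtain C where C: "0 \<le> C" "ev (\<lambda>N. m4 (?X N) C)" "ev (\<lambda>N. m4 (?Y N) C)"
    using m4_pp_scaled[OF \<tau> tight] by blast
  \<comment> \<open>24 C / \<epsilon> makes the truncation error 8 C / R^2 at most \<epsilon> / 3,
    as R \<le> R^2.\<close>
  define R where "R = max 1 (24 * C / \<epsilon>)"
  have R: "1 \<le> R" "8 * C / R\<^sup>2 \<le> \<epsilon> / 3"
  proof -
    show 1: "1 \<le> R" by (simp add: R_def)
    have "24 * C \<le> R * \<epsilon>" using \<epsilon> by (simp add: R_def pos_divide_le_eq[symmetric])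
    also have "\<dots> \<le> R\<^sup>2 * \<epsilon>" using 1 \<epsilon> by (intro mult_right_mono) (auto simp: power2_eq_square)
    finally show "8 * C / R\<^sup>2 \<le> \<epsilon> / 3" using 1 by (simp add: pos_divide_le_eq mult.commute)
  qed
  \<comment> \<open>R is the Lipschitz constant of the truncated product, so the grid error
    contributes R \<eta> / \<open>unit_scale\<close> = \<epsilon> / 3.\<close>
  define \<eta> where "\<eta> = \<epsilon> * unit_scale / (3 * R)"
  have \<eta>: "0 < \<eta>" using \<epsilon> R unit_scale_pos by (simp add: \<eta>_def)
  obtain T where T: "finite T" "T \<subseteq> {0..} \<times> {0..}" "(0, 0) \<in> T"
    and approx: "ev (\<lambda>N. (\<bbbE>\<^sup>+ e. ennreal \<bar>Gpp (drift \<delta> / cbrt N) e N N - grid_max (drift \<delta>) \<tau> T N e\<bar>) \<le> ennreal (\<eta> * cbrt N))"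
    using grid_approx[OF \<tau> \<eta> tight] by blast
  have T0: "T \<noteq> {}" using T(3) by auto
  define b where "b N = (\<bbbE> e'. (\<bbbE> e. env_test R T \<delta> \<tau> N e e'))" for N
  have I: "finite (fst ` T)" "fst ` T \<subseteq> {0..}" "finite (snd ` T)" "snd ` T \<subseteq> {0..}" "0 \<in> fst ` T"
    using T by force+
  have \<tau>': "0 < 1 - \<tau>" using \<tau> by simp
  note P = pp_part_conv[OF A I(1,2) \<tau>(1) lower_part_parts(1)[OF \<tau>] lower_part_bounds(3)[OF \<tau>] filterlim_parts(1)[OF \<tau>]]
  note Q = pp_part_conv[OF B I(3,4) \<tau>' lower_part_parts(2)[OF \<tau>] diff_le_self filterlim_parts(2)[OF \<tau>]]
  have "convergent b"
    unfolding b_def env_test_def using R by (intro product_limit[OF P Q T(1) T0 order_refl order_refl I(5)]) auto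
  moreover have "ev (\<lambda>N. \<bar>(\<bbbE> e. ?Y N e * ?X N e) - b N\<bar> \<le> \<epsilon>)"
  proof -
    have ev: "ev (\<lambda>N. \<forall>v\<in>snd ` T. v * (2 * real N) powr (2 / 3) \<le> \<tau> * real N - 1)"
    proof (intro eventually_ball_finite I ballI)
      fix v
      show "ev (\<lambda>N. v * (2 * real N) powr (2 / 3) \<le> \<tau> * real N - 1)" using \<tau> by real_asymp
    qed
    have "filterlim (\<lambda>N. unit_scale * cbrt N) at_top sequentially"
      using unit_scale_pos unfolding cbrt_def by real_asymp
    then have ev2: "ev (\<lambda>N. 12 * R / \<epsilon> \<le> unit_scale * cbrt N)" by (simp only: filterlim_at_top)
    from C(2,3) approx ev ev2 eventually_ge_at_top[of 1] show ?thesis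
    proof eventually_elim
      case (elim N)
      define n where "n = lower_part \<tau> N"
      define m where "m = N - lower_part \<tau> N"
      have nm: "n + m = N" using lower_part_bounds(3)[OF \<tau>, of N] by (simp add: n_def m_def)
      have c: "0 < unit_scale * cbrt N" using elim(6) unit_scale_pos by (simp add: cbrt_pos)
      let ?c = "unit_scale * cbrt N"
      let ?y = "\<lambda>e u. pp_part \<delta> (lower_part \<tau>) N u e" and ?z = "\<lambda>e v. pp_part \<delta> (\<lambda>N. N - lower_part \<tau> N) N v (rev_env N e)"
      let ?L = "\<lambda>e. max_plus T 1 1 (?y e) (?z e)"
      let ?gv = "grid_max (drift \<delta>) \<tau> T N"
      have XL: "?X N e - ?L e = (Gpp (drift \<delta> / cbrt N) e N N - ?gv e) / ?c" for e
        unfolding max_plus_grid_value[OF T(1) T0 n_def m_def nm c] by (simp add: pp_scaled_def diff_divide_distrib[symmetric])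
      have gm: "(\<lambda>e. Gpp (drift \<delta> / cbrt N) e N N - ?gv e) \<in> borel_measurable env"
      proof -
        have "?gv \<in> borel_measurable env"
          unfolding grid_max_def[abs_def] using T(1) by (rule borel_measurable_Max) (unfold grid_value_def, measurable)
        note [measurable] = this
        show ?thesis by measurable
      qed
      have nn: "(\<bbbE>\<^sup>+ e. ennreal \<bar>Gpp (drift \<delta> / cbrt N) e N N - ?gv e\<bar>) \<le> ennreal (\<eta> * cbrt N)"
        by (rule elim(3))
      have gi: "integrable env (\<lambda>e. Gpp (drift \<delta> / cbrt N) e N N - ?gv e)"
        using gm nn by (intro integrableI_bounded) (auto simp: le_less_trans ennreal_less_top)
      have g1: "(\<bbbE> e. \<bar>Gpp (drift \<delta> / cbrt N) e N N - ?gv e\<bar>) \<le> \<eta> * cbrt N"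
      proof -
        have "ennreal (\<bbbE> e. \<bar>Gpp (drift \<delta> / cbrt N) e N N - ?gv e\<bar>) \<le> ennreal (\<eta> * cbrt N)"
          using nn gi by (subst nn_integral_eq_integral[symmetric]) auto
        then show ?thesis using \<eta> cbrt_nonneg[of N] by (simp add: ennreal_le_iff)
      qed
      have iXL: "integrable env (\<lambda>e. \<bar>?X N e - ?L e\<bar>)" "(\<bbbE> e. \<bar>?X N e - ?L e\<bar>) \<le> \<eta> / unit_scale"
      proof -
        show "integrable env (\<lambda>e. \<bar>?X N e - ?L e\<bar>)" unfolding XL using gi by simp
        have "(\<bbbE> e. \<bar>?X N e - ?L e\<bar>) = (\<bbbE> e. \<bar>Gpp (drift \<delta> / cbrt N) e N N - ?gv e\<bar>) / ?c"
          unfolding XL abs_divide using c by simp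
        also have "\<dots> \<le> \<eta> * cbrt N / ?c" using g1 c by (intro divide_right_mono) auto
        also have "\<dots> = \<eta> / unit_scale" using elim(6) by (simp add: cbrt_pos less_imp_neq[symmetric])
        finally show "(\<bbbE> e. \<bar>?X N e - ?L e\<bar>) \<le> \<eta> / unit_scale" .
      qed
      have Yy: "\<bar>?Y N e - ?y e 0\<bar> \<le> 4 / ?c" for e
      proof -
        have eq: "?Y N e - ?y e 0 = 4 * (real n - \<tau> * real N) / ?c"
          by (simp add: pp_lower_def pp_part_def n_def[symmetric] diff_divide_distrib[symmetric])
        have "\<bar>4 * (real n - \<tau> * real N)\<bar> \<le> 4" using lower_part_parts(1)[OF \<tau>, of N] by (simp add: n_def)
        then have "\<bar>4 * (real n - \<tau> * real N)\<bar> / ?c \<le> 4 / ?c" using c by (intro divide_right_mono) auto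
        moreover have "\<bar>4 * (real n - \<tau> * real N) / ?c\<bar> = \<bar>4 * (real n - \<tau> * real N)\<bar> / ?c" unfolding abs_divide using c by simp
        ultimately show ?thesis unfolding eq by (simp only:)
      qed
      have E: "(\<bbbE> e. env_test R T \<delta> \<tau> N e (rev_env N e)) = b N" unfolding b_def
      proof (rule env_test_independent[OF \<tau> T(1) T0])
        fix v assume v: "v \<in> snd ` T"
        then have v0: "0 \<le> v" using I by auto
        have "v * fluct_scale (N - lower_part \<tau> N) \<le> v * (2 * real N) powr (2 / 3)"
          unfolding fluct_scale_def using v0 by (intro mult_left_mono powr_mono2) auto
        also have "\<dots> \<le> \<tau> * real N - 1" using elim(4) v by blast
        also have "\<dots> \<le> real (lower_part \<tau> N)" by (rule lower_part_bounds(1)[OF \<tau>])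
        finally have "v * fluct_scale (N - lower_part \<tau> N) \<le> real (lower_part \<tau> N)" .
        moreover have "0 \<le> v * fluct_scale (N - lower_part \<tau> N)" using v0 by (simp add: fluct_scale_def)
        ultimately show "fst (grid_pt (fluct_scale (N - lower_part \<tau> N)) v) \<le> lower_part \<tau> N"
          using fst_grid_pt[of v "fluct_scale (N - lower_part \<tau> N)"] by linarith
      qed (use R in simp)
      let ?r = "\<lambda>e. 4 * (?Y N e ^ 4 + ?X N e ^ 4) / R\<^sup>2 + R * (4 / ?c + \<bar>?X N e - ?L e\<bar>)"
      have pt: "\<bar>?Y N e * ?X N e - env_test R T \<delta> \<tau> N e (rev_env N e)\<bar> \<le> ?r e" for e
      proof -
        have "\<bar>?Y N e * ?X N e - clamp_R R (?Y N e) * clamp_R R (?X N e)\<bar> \<le> 4 * (?Y N e ^ 4 + ?X N e ^ 4) / R\<^sup>2"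
          using R by (intro clamp_product_error) simp
        moreover have "\<bar>clamp_R R (?Y N e) * clamp_R R (?X N e) - clamp_R R (?y e 0) * clamp_R R (?L e)\<bar>
          \<le> R * (\<bar>?Y N e - ?y e 0\<bar> + \<bar>?X N e - ?L e\<bar>)" using R by (intro clamp_product_lip) simp
        moreover have "R * (\<bar>?Y N e - ?y e 0\<bar> + \<bar>?X N e - ?L e\<bar>) \<le> R * (4 / ?c + \<bar>?X N e - ?L e\<bar>)"
          using R Yy[of e] by (intro mult_left_mono) auto
        moreover have "env_test R T \<delta> \<tau> N e (rev_env N e) = clamp_R R (?y e 0) * clamp_R R (?L e)"
          by (simp add: env_test_def prod_test_def)
        ultimately show ?thesis by linarith
      qed
      have i4: "integrable env (\<lambda>e. ?X N e ^ 4)" "integrable env (\<lambda>e. ?Y N e ^ 4)"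
        "(\<bbbE> e. ?X N e ^ 4) \<le> C" "(\<bbbE> e. ?Y N e ^ 4) \<le> C"
        using m4_integrable4[OF elim(1)] m4_integrable4[OF elim(2)] m4_integral4[OF elim(1) C(1)] m4_integral4[OF elim(2) C(1)] by auto
      have iYX: "integrable env (\<lambda>e. ?Y N e * ?X N e)" by (rule m4_integrable2[OF elim(2,1)])
      have iF: "integrable env (\<lambda>e. env_test R T \<delta> \<tau> N e (rev_env N e))"
      proof (rule env.integrable_const_bound[where B="R * R"])
        show "(\<lambda>e. env_test R T \<delta> \<tau> N e (rev_env N e)) \<in> borel_measurable env"
          by (rule measurable_env_test[OF T(1) measurable_ident_sets[OF refl] measurable_rev_env])
      qed (use R prod_test_bound in \<open>auto simp: env_test_def\<close>)
      have i1: "integrable env (\<lambda>e. 4 * (?Y N e ^ 4 + ?X N e ^ 4) / R\<^sup>2)" "integrable env (\<lambda>e. R * (4 / ?c + \<bar>?X N e - ?L e\<bar>))"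
        using i4 iXL(1) by auto
      have "\<bar>(\<bbbE> e. ?Y N e * ?X N e) - b N\<bar> \<le> (\<bbbE> e. ?r e)"
        unfolding E[symmetric] by (rule integral_env_close[OF iYX iF Bochner_Integration.integrable_add[OF i1] pt])
      also have "\<dots> = 4 * ((\<bbbE> e. ?Y N e ^ 4) + (\<bbbE> e. ?X N e ^ 4)) / R\<^sup>2 + R * (4 / ?c + (\<bbbE> e. \<bar>?X N e - ?L e\<bar>))"
      proof -
        have "(\<bbbE> e. 4 * (?Y N e ^ 4 + ?X N e ^ 4) / R\<^sup>2) = 4 * ((\<bbbE> e. ?Y N e ^ 4) + (\<bbbE> e. ?X N e ^ 4)) / R\<^sup>2"
          using i4 by simp
        moreover have "(\<bbbE> e. R * (4 / ?c + \<bar>?X N e - ?L e\<bar>)) = R * (4 / ?c + (\<bbbE> e. \<bar>?X N e - ?L e\<bar>))"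
          using iXL(1) env.prob_space by simp
        ultimately show ?thesis unfolding Bochner_Integration.integral_add[OF i1] by (simp only:)
      qed
      also have "\<dots> \<le> 4 * (C + C) / R\<^sup>2 + R * (4 / ?c + \<eta> / unit_scale)"
        using i4 iXL(2) R c by (intro add_mono divide_right_mono mult_left_mono order_refl) auto
      also have "\<dots> = 8 * C / R\<^sup>2 + (R * (4 / ?c) + \<epsilon> / 3)"
      proof -
        have "R * (\<eta> / unit_scale) = \<epsilon> / 3" using R unit_scale_pos by (simp add: \<eta>_def)
        then show ?thesis by (simp add: distrib_left)
      qed
      also have "R * (4 / ?c) \<le> \<epsilon> / 3"
        using elim(5) \<epsilon> c by (simp add: pos_divide_le_eq field_simps)
      finally show ?case using R(2) by simp
    qed
  qed
  ultimately show "\<exists>b. convergent b \<and> ev (\<lambda>N. \<bar>(\<bbbE> e. ?Y N e * ?X N e) - b N\<bar> \<le> \<epsilon>)"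
    by blast
qed

section \<open>The stationary increment\<close>

text \<open>\<open>burke\<close> moves the boundary from row 0 to row n without changing the law of
  the environment; \<open>G_shift\<close> then reads the time beyond (n, n) as a stationary time of
  size m.\<close>

lemma burke_increment:
  assumes \<rho>: "0 < \<rho>" "\<rho> < 1"
  obtains \<Phi> where "preserving \<Phi>"
    "\<And>e. G (1 / \<rho>) (1 / (1 - \<rho>)) e (n + m) (n + m) - G (1 / \<rho>) (1 / (1 - \<rho>)) e n n = G (1 / \<rho>) (1 / (1 - \<rho>)) (\<Phi> e) m m"
proof -
  \<comment> \<open>\<open>burke\<close> keeps the new boundary in row 0, so row 0 is shifted to the
    right only, and the other rows also upwards.\<close>
  define \<sigma> where "\<sigma> p = (if snd p = 0 then (n + fst p, 0) else (n + fst p, n + snd p))" for p :: "nat \<times> nat"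
  have "inj \<sigma>"
  proof (rule injI)
    fix p q assume "\<sigma> p = \<sigma> q"
    then show "p = q" by (cases p; cases q) (auto simp: \<sigma>_def split: if_splits)
  qed
  define \<Phi> where "\<Phi> e = (\<lambda>p. burke \<rho> (n + m) n e (\<sigma> p))" for e
  show ?thesis
  proof
    show "preserving \<Phi>" unfolding \<Phi>_def[abs_def]
      by (rule preserving_comp[OF preserving_reindex[OF \<open>inj \<sigma>\<close>] preserving_burke[OF \<rho>]])
    fix e
    note b = burke_inv[OF \<rho>, of n "n + m" e, OF le_add1]
    have "G (1 / \<rho>) (1 / (1 - \<rho>)) e (n + m) (n + m) = G (1 / \<rho>) (1 / (1 - \<rho>)) e n n + G (1 / \<rho>) (1 / (1 - \<rho>)) (\<Phi> e) m m"
    proof (rule G_shift[where m=m])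
      fix i j :: nat assume "1 \<le> j" "j \<le> i"
      then show "\<Phi> e (i, j) = e (n + i, n + j)" using b by (simp add: \<Phi>_def \<sigma>_def)
    next
      fix i :: nat assume "1 \<le> i" "i \<le> m"
      then have "burke \<rho> (n + m) n e (n + i, 0) = (1 - \<rho>) * Ist \<rho> e (n + i) n" using b by simp
      then show "1 / (1 - \<rho>) * \<Phi> e (i, 0) = Ist \<rho> e (n + i) n" using \<rho> by (simp add: \<Phi>_def \<sigma>_def)
    qed simp_all
    then show "G (1 / \<rho>) (1 / (1 - \<rho>)) e (n + m) (n + m) - G (1 / \<rho>) (1 / (1 - \<rho>)) e n n = G (1 / \<rho>) (1 / (1 - \<rho>)) (\<Phi> e) m m"
      by simp
  qed
qed

text \<open>Along row 0 and then up column m the time is a sum of increments, each a scaled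
  exponential by stationarity; the mean is therefore exact for every m.\<close>

lemma st_mean:
  assumes \<rho>: "0 < \<rho>" "\<rho> < 1"
  shows "(\<bbbE> e. G (1 / \<rho>) (1 / (1 - \<rho>)) e m m) = real m * (1 / \<rho> + 1 / (1 - \<rho>))"
proof -
  note b = burke_inv[OF \<rho>, of m m, OF order_refl]
  note P = preserving_burke[OF \<rho>, of m m]
  have coord: "integrable env (\<lambda>e. burke \<rho> m m e p)" "(\<bbbE> e. burke \<rho> m m e p) = 1" for p
    using preserving_integrable[OF P measurable_env_component[of p]] preserving_integral[OF P measurable_env_component[of p]]
      integral_env_coordinate[of p] by simp_all
  have "G (1 / \<rho>) (1 / (1 - \<rho>)) e m m = 1 / (1 - \<rho>) * (\<Sum>k=1..m. e (k, 0)) + (\<Sum>j\<in>{0<..m}. 1 / \<rho> * burke \<rho> m m e (m, j))" for e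
  proof -
    have "G (1 / \<rho>) (1 / (1 - \<rho>)) e m m = G (1 / \<rho>) (1 / (1 - \<rho>)) e m 0 + (\<Sum>j\<in>{0<..m}. Jst \<rho> e m j)"
      by (rule G_sum_Jnc) simp
    also have "(\<Sum>j\<in>{0<..m}. Jst \<rho> e m j) = (\<Sum>j\<in>{0<..m}. 1 / \<rho> * burke \<rho> m m e (m, j))"
    proof (rule sum.cong)
      fix j assume "j \<in> {0<..m}"
      then have "burke \<rho> m m e (m, j) = \<rho> * Jst \<rho> e m j" using b[of e] by simp
      then show "Jst \<rho> e m j = 1 / \<rho> * burke \<rho> m m e (m, j)" using \<rho> by simp
    qed simp
    finally show ?thesis by (simp only: G_row0)
  qed
  then have "(\<bbbE> e. G (1 / \<rho>) (1 / (1 - \<rho>)) e m m)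
    = (\<bbbE> e. 1 / (1 - \<rho>) * (\<Sum>k=1..m. e (k, 0)) + (\<Sum>j\<in>{0<..m}. 1 / \<rho> * burke \<rho> m m e (m, j)))" by (simp only:)
  also have "\<dots> = 1 / (1 - \<rho>) * (\<bbbE> e. (\<Sum>k=1..m. e (k, 0))) + (\<bbbE> e. (\<Sum>j\<in>{0<..m}. 1 / \<rho> * burke \<rho> m m e (m, j)))"
  proof -
    have i: "integrable env (\<lambda>e. \<Sum>k=1..m. e (k, 0))" "integrable env (\<lambda>e. \<Sum>j\<in>{0<..m}. 1 / \<rho> * burke \<rho> m m e (m, j))"
      by (intro Bochner_Integration.integrable_sum integrable_mult_right impI coord integral_env_coordinate)+
    show ?thesis unfolding Bochner_Integration.integral_add[OF integrable_mult_right[OF i(1)] i(2)] by simp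
  qed
  also have "(\<bbbE> e. (\<Sum>k=1..m. e (k, 0))) = real m"
    by (subst Bochner_Integration.integral_sum) (simp_all add: integral_env_coordinate)
  also have "(\<bbbE> e. (\<Sum>j\<in>{0<..m}. 1 / \<rho> * burke \<rho> m m e (m, j))) = 1 / \<rho> * real m"
    using coord by (subst Bochner_Integration.integral_sum) (auto intro!: integrable_mult_right)
  finally show ?thesis by (simp add: algebra_simps)
qed

text \<open>A single variable is treated as a family indexed by {0}, so that
  \<open>rescaled_conv\<close> also applies to the stationary time.\<close>

lemma conv_law_fdd:
  assumes X: "conv_law X M A" and M: "prob_space M" "A \<in> borel_measurable M" and Xm: "\<And>N. X N \<in> borel_measurable env"
  shows "conv_fdd {0} (\<lambda>N u. X N) M (\<lambda>u. A)"
  unfolding conv_fdd_def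
proof (intro conjI ballI allI impI M Xm)
  fix f assume f: "lip_test {0} f"
  then obtain L B where L: "0 \<le> L" "\<And>y y'. \<bar>f y - f y'\<bar> \<le> L * \<bar>y 0 - y' 0\<bar>" and B: "\<And>y. \<bar>f y\<bar> \<le> B"
    unfolding lip_test_def by (auto simp del: fun_upd_apply)
  have "(\<lambda>x. f (\<lambda>u. x)) \<in> borel_measurable borel"
    using lip_test_measurable[OF _ f, of "\<lambda>u x. x" borel] by simp
  then show "(\<lambda>N. (\<bbbE> e. f (\<lambda>u. X N e))) \<longlonglongrightarrow> (\<integral>x. f (\<lambda>u. A x) \<partial>M)"
    using X[unfolded conv_law_def, rule_format, of "\<lambda>x. f (\<lambda>u. x)" L B] L(2)[of "\<lambda>_. _" "\<lambda>_. _"] B by simp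
qed simp

definition st_upper :: "real => real => nat => (nat \<times> nat => real) => real" where
  "st_upper \<delta> \<tau> N e = (Gst (drift \<delta> / cbrt N) e (N - lower_part \<tau> N) (N - lower_part \<tau> N) - 4 * (1 - \<tau>) * real N) / (unit_scale * cbrt N)"

lemma measurable_st_upper [measurable]: "st_upper \<delta> \<tau> N \<in> borel_measurable env"
  unfolding st_upper_def[abs_def] by measurable

lemma pp_lower_conv_law:
  assumes A: "is_A_pp (\<delta> * \<tau> powr (1 / 3)) M A" and \<tau>: "0 < \<tau>" "\<tau> < 1"
  shows "conv_law (pp_lower \<delta> \<tau>) M (\<lambda>x. \<tau> powr (1 / 3) * A 0 x)"
proof -
  define r where "r N = 4 * (real (lower_part \<tau> N) - \<tau> * real N)" for N
  have "\<bar>r N\<bar> \<le> 4" for N using lower_part_parts(1)[OF \<tau>, of N] by (simp add: r_def)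
  from pp_part_conv_offset[OF A _ _ \<tau>(1) lower_part_parts(1)[OF \<tau>] lower_part_bounds(3)[OF \<tau>] filterlim_parts(1)[OF \<tau>], of "{0}" r, OF _ _ this, THEN conv_fdd_law, of 0]
  show ?thesis by (simp add: r_def pp_lower_def[abs_def] algebra_simps)
qed

lemma st_upper_conv_law:
  assumes A: "is_A_st_hs (\<delta> * (1 - \<tau>) powr (1 / 3)) M A" and \<tau>: "0 < \<tau>" "\<tau> < 1"
  shows "conv_law (st_upper \<delta> \<tau>) M (\<lambda>x. (1 - \<tau>) powr (1 / 3) * A 0 x)"
proof -
  define k where "k N = N - lower_part \<tau> N" for N
  have k: "\<bar>real (k N) - (1 - \<tau>) * real N\<bar> \<le> 1" "k N \<le> N" "filterlim k at_top sequentially" for N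
    using lower_part_parts(2)[OF \<tau>] filterlim_parts(2)[OF \<tau>] by (auto simp: k_def[abs_def])
  have r: "\<bar>4 * (real (k N) - (1 - \<tau>) * real N)\<bar> \<le> 4" for N using k(1)[of N] by simp
  have M: "prob_space M" "A 0 \<in> borel_measurable M" and s: "0 < 1 - \<tau>" using A \<tau> by (auto simp: is_A_st_hs_def)
  have "conv_fdd {0} (\<lambda>N u e. (Gst (drift \<delta> / cbrt N) e (k N) (k N) - 4 * real (k N)
      + 4 * (real (k N) - (1 - \<tau>) * real N)) / (unit_scale * cbrt N)) M (\<lambda>u x. (1 - \<tau>) powr (1 / 3) * A 0 x)"
  proof (rule rescaled_conv[where H="\<lambda>a n u e. Gst a e n n", OF _ _ _ s k r])
    show "conv_fdd {0} (\<lambda>n u e. (Gst (drift (\<delta> * (1 - \<tau>) powr (1 / 3)) / cbrt n) e n n - 4 * real n) / (unit_scale * cbrt n)) M (\<lambda>u. A 0)"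
      using conv_law_fdd[OF st_conv_law[OF A] M measurable_st_scaled] unfolding st_scaled_def[abs_def] .
  qed (use st_param_L1 in auto)
  from conv_fdd_law[OF this, of 0] show ?thesis by (simp add: st_upper_def[abs_def] k_def algebra_simps)
qed

section \<open>Comparison of the variances\<close>

definition env_var :: "((nat \<times> nat => real) => real) => real" where
  "env_var f = (\<bbbE> e. (f e)\<^sup>2) - (\<bbbE> e. f e)\<^sup>2"

text \<open>|V^2 - U^2| \<le> 2 (V - U) W. Where W \<le> 1 this is at most 2 (V - U), elsewhere at
  most 2 W^2 \<le> 2 W^4. So the difference is linear in the mean gap and the fourth moments, which
  are both of order 1 - \<tau> in the application.\<close>

lemma env_var_compare:
  assumes V: "m4 V K" and L: "m4 L K" and K: "0 \<le> K" and Um [measurable]: "U \<in> borel_measurable env"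
    and LU: "AE e in env. L e \<le> U e" and UV: "AE e in env. U e \<le> V e"
    and d: "(\<bbbE> e. V e - U e) \<le> d"
  shows "\<bar>env_var V - env_var U\<bar> \<le> 4 * d + 32 * K * (1 + d)"
proof -
  define W where "W e = \<bar>V e\<bar> + \<bar>L e\<bar>" for e
  note [measurable] = m4_measurable[OF V] m4_measurable[OF L]
  have absV: "m4 (\<lambda>e. \<bar>V e\<bar>) K" "m4 (\<lambda>e. \<bar>L e\<bar>) K"
    by (rule m4_dom[OF V], simp_all) (rule m4_dom[OF L], simp_all)
  have W: "m4 W (16 * K)" unfolding W_def[abs_def] by (rule m4_two[OF absV K])
  have UW: "AE e in env. 0 \<le> V e - U e \<and> \<bar>U e\<bar> \<le> W e \<and> V e - U e \<le> W e"
    using LU UV by eventually_elim (auto simp: W_def)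
  have U: "m4 U (16 * K)"
  proof (rule m4_dom[OF W])
    show "AE e in env. \<bar>U e\<bar> \<le> \<bar>W e\<bar>" using UW by eventually_elim auto
  qed simp
  have iV: "integrable env V" "integrable env U" "integrable env W" using m4_integrable V U W by blast+
  have iV2: "integrable env (\<lambda>e. (V e)\<^sup>2)" "integrable env (\<lambda>e. (U e)\<^sup>2)"
    using m4_integrable_power[OF V, of 2] m4_integrable_power[OF U, of 2] by simp_all
  have iW4: "integrable env (\<lambda>e. W e ^ 4)" "(\<bbbE> e. W e ^ 4) \<le> 16 * K"
    using m4_integrable4[OF W] m4_integral4[OF W] K by auto
  let ?d = "(\<bbbE> e. V e - U e)"
  have d0: "0 \<le> ?d"
  proof (rule integral_nonneg_AE)
    show "AE e in env. 0 \<le> V e - U e" using UW by eventually_elim simp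
  qed
  have sq: "\<bar>(\<bbbE> e. (V e)\<^sup>2) - (\<bbbE> e. (U e)\<^sup>2)\<bar> \<le> 2 * ?d + 2 * (16 * K)"
  proof -
    have "\<bar>(\<bbbE> e. (V e)\<^sup>2) - (\<bbbE> e. (U e)\<^sup>2)\<bar> = \<bar>(\<bbbE> e. (V e)\<^sup>2 - (U e)\<^sup>2)\<bar>" using iV2 by simp
    also have "\<dots> \<le> (\<bbbE> e. \<bar>(V e)\<^sup>2 - (U e)\<^sup>2\<bar>)" by (rule integral_abs_bound)
    also have "\<dots> \<le> (\<bbbE> e. 2 * (V e - U e) + 2 * W e ^ 4)"
    proof (rule integral_mono_AE)
      show "AE e in env. \<bar>(V e)\<^sup>2 - (U e)\<^sup>2\<bar> \<le> 2 * (V e - U e) + 2 * W e ^ 4" using UW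
      proof eventually_elim
        case (elim e)
        have "(V e)\<^sup>2 - (U e)\<^sup>2 = (V e - U e) * (V e + U e)" by (simp add: power2_eq_square algebra_simps)
        then have "\<bar>(V e)\<^sup>2 - (U e)\<^sup>2\<bar> = (V e - U e) * \<bar>V e + U e\<bar>" using elim by (simp add: abs_mult)
        also have "\<dots> \<le> (V e - U e) * (2 * W e)" using elim by (intro mult_left_mono) (auto simp: W_def)
        also have "\<dots> \<le> 2 * (V e - U e) + 2 * W e ^ 4"
        proof (cases "W e \<le> 1")
          case True
          then have "(V e - U e) * W e \<le> (V e - U e) * 1" using elim by (intro mult_left_mono) auto
          moreover have "0 \<le> W e ^ 4" by simp
          ultimately show ?thesis by linarith
        next
          case False
          then have "(V e - U e) * W e \<le> W e * W e" using elim by (intro mult_right_mono) auto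
          also have "\<dots> \<le> W e ^ 4" using power_increasing[of 2 4 "W e"] False by (simp add: power2_eq_square)
          finally have "(V e - U e) * W e \<le> W e ^ 4" .
          moreover have "x * (2 * w) \<le> 2 * x + 2 * z" if "x * w \<le> z" "0 \<le> x" for x w z :: real
            using that by simp
          ultimately show ?thesis using elim by blast
        qed
        finally show ?case .
      qed
    qed (use iV2 iV iW4 in auto)
    also have "\<dots> = 2 * ?d + 2 * (\<bbbE> e. W e ^ 4)" using iV iW4 by simp
    finally show ?thesis using iW4(2) by linarith
  qed
  have mean: "\<bar>(\<bbbE> e. V e)\<^sup>2 - (\<bbbE> e. U e)\<^sup>2\<bar> \<le> ?d * (2 * (1 + 16 * K))"
  proof -
    have EW: "(\<bbbE> e. W e) \<le> 1 + 16 * K" using m4_abs_integral[OF W, of 1] K by (simp add: W_def)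
    have "\<bar>(\<bbbE> e. V e + U e)\<bar> \<le> (\<bbbE> e. \<bar>V e + U e\<bar>)" by (rule integral_abs_bound)
    also have "\<dots> \<le> (\<bbbE> e. 2 * W e)"
    proof (rule integral_mono_AE)
      show "AE e in env. \<bar>V e + U e\<bar> \<le> 2 * W e" using UW by eventually_elim (auto simp: W_def)
    qed (use iV in auto)
    finally have s: "\<bar>(\<bbbE> e. V e) + (\<bbbE> e. U e)\<bar> \<le> 2 * (1 + 16 * K)" using iV EW by simp
    have "(\<bbbE> e. V e)\<^sup>2 - (\<bbbE> e. U e)\<^sup>2 = ?d * ((\<bbbE> e. V e) + (\<bbbE> e. U e))"
      using iV by (simp add: power2_eq_square algebra_simps)
    then have "\<bar>(\<bbbE> e. V e)\<^sup>2 - (\<bbbE> e. U e)\<^sup>2\<bar> = ?d * \<bar>(\<bbbE> e. V e) + (\<bbbE> e. U e)\<bar>"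
      using d0 by (simp only: abs_mult abs_of_nonneg)
    then show ?thesis using s d0 by (simp add: mult_left_mono)
  qed
  have "\<bar>env_var V - env_var U\<bar> \<le> 2 * ?d + 2 * (16 * K) + ?d * (2 * (1 + 16 * K))"
    using sq mean unfolding env_var_def by linarith
  also have "\<dots> \<le> 2 * d + 2 * (16 * K) + d * (2 * (1 + 16 * K))"
    using d K by (intro add_mono mult_right_mono) auto
  also have "\<dots> = 4 * d + 32 * K * (1 + d)" by (simp add: algebra_simps)
  finally show ?thesis .
qed

text \<open>At size k close to s N the fourth moment is of order (k / N)^(4/3) \<le> k / N \<le> 2
  s. Rounding contributes order N^(-4/3), which is at most s because 1 \<le> s N.\<close>

lemma m4_rescale:
  assumes F: "m4 (\<lambda>e. F e - 4 * real k) (C * cbrt k ^ 4)" and C: "0 \<le> C" and s: "0 < s" and k: "\<bar>real k - s * real N\<bar> \<le> 1" "k \<le> N" "1 / s \<le> real N"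
  shows "m4 (\<lambda>e. (F e - 4 * s * real N) / (unit_scale * cbrt N)) (8 * (2 * (C / unit_scale ^ 4) + (4 / unit_scale) ^ 4) * s)"
proof -
  have sN: "1 \<le> s * real N" using k(3) s by (simp add: pos_divide_le_eq mult.commute)
  have "0 < N" using sN by (cases N) auto
  then have c: "1 \<le> cbrt N" using cbrt_mono[of 1 N] by (simp add: cbrt_def)
  let ?c = "unit_scale * cbrt N"
  have c0: "0 < ?c" using c unit_scale_pos by simp
  have rat: "(cbrt k / cbrt N) ^ 4 \<le> 2 * s"
  proof -
    have x: "0 \<le> cbrt k / cbrt N" "cbrt k / cbrt N \<le> 1" using c cbrt_mono[OF k(2)] cbrt_nonneg by auto
    have "(cbrt k / cbrt N) ^ 4 \<le> (cbrt k / cbrt N) ^ 3" using power_decreasing[of 3 4, OF _ x] by simp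
    also have "\<dots> = real k / real N" by (simp add: power_divide cbrt_cube)
    also have "\<dots> \<le> 2 * s" using k(1) sN \<open>0 < N\<close> by (simp add: pos_divide_le_eq)
    finally show ?thesis .
  qed
  have c4: "1 / cbrt N ^ 4 \<le> s"
  proof -
    have "1 / cbrt N ^ 4 \<le> 1 / cbrt N ^ 3" using c by (intro divide_left_mono power_increasing) auto
    also have "\<dots> \<le> s" using sN \<open>0 < N\<close> by (simp add: cbrt_cube pos_divide_le_eq)
    finally show ?thesis .
  qed
  have A: "m4 (\<lambda>e. 1 / ?c * (F e - 4 * real k)) (2 * (C / unit_scale ^ 4) * s)"
  proof (rule m4_mono[OF m4_cmult[OF F]])
    have "(1 / ?c) ^ 4 * (C * cbrt k ^ 4) = C / unit_scale ^ 4 * (cbrt k / cbrt N) ^ 4"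
      by (simp add: power_divide power_mult_distrib)
    also have "\<dots> \<le> C / unit_scale ^ 4 * (2 * s)" using rat C unit_scale_pos by (intro mult_left_mono) auto
    finally show "(1 / ?c) ^ 4 * (C * cbrt k ^ 4) \<le> 2 * (C / unit_scale ^ 4) * s" by (simp only: mult_ac)
  qed
  have B: "m4 (\<lambda>e. 4 / ?c) ((4 / unit_scale) ^ 4 * s)"
  proof (rule m4_mono[OF m4_const])
    have "(4 / ?c) ^ 4 = (4 / unit_scale) ^ 4 * (1 / cbrt N ^ 4)" by (simp add: power_divide power_mult_distrib)
    also have "\<dots> \<le> (4 / unit_scale) ^ 4 * s" using c4 by (intro mult_left_mono) auto
    finally show "(4 / ?c) ^ 4 \<le> (4 / unit_scale) ^ 4 * s" .
  qed
  have B': "m4 (\<lambda>e. 4 * (real k - s * real N) / ?c) ((4 / unit_scale) ^ 4 * s)"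
  proof (rule m4_dom[OF B])
    have "\<bar>4 * (real k - s * real N)\<bar> / ?c \<le> 4 / ?c" using k(1) c0 by (intro divide_right_mono) auto
    moreover have "\<bar>4 * (real k - s * real N) / ?c\<bar> = \<bar>4 * (real k - s * real N)\<bar> / ?c" "\<bar>4 / ?c\<bar> = 4 / ?c"
      unfolding abs_divide using c0 by simp_all
    ultimately show "AE e in env. \<bar>4 * (real k - s * real N) / ?c\<bar> \<le> \<bar>4 / ?c\<bar>" by (simp only:) simp
  qed simp
  have "m4 (\<lambda>e. 1 / ?c * (F e - 4 * real k) + 4 * (real k - s * real N) / ?c)
      (8 * (2 * (C / unit_scale ^ 4) * s + (4 / unit_scale) ^ 4 * s))"
    using C s unit_scale_pos by (intro m4_add A B') auto
  moreover have "1 / ?c * (F e - 4 * real k) + 4 * (real k - s * real N) / ?c = (F e - 4 * s * real N) / ?c" for e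
    by (simp add: add_divide_distrib[symmetric])
  ultimately show ?thesis by (simp only: distrib_right mult.assoc)
qed

section \<open>Means of the point-to-point limits\<close>

lemma pp_limit_moments:
  assumes H: "\<And>d. is_A_pp d (Mpp d) (App d)"
  shows "integrable (Mpp d) (\<lambda>x. (App d 0 x)\<^sup>2)" "integrable (Mpp d) (App d 0)"
    "(\<lambda>N. (\<bbbE> e. pp_scaled d N 0 e)) \<longlonglongrightarrow> (\<integral>x. App d 0 x \<partial>Mpp d)"
    "(\<lambda>N. (\<bbbE> e. (pp_scaled d N 0 e)\<^sup>2)) \<longlonglongrightarrow> (\<integral>x. (App d 0 x)\<^sup>2 \<partial>Mpp d)"
    "ev (\<lambda>N. integrable env (pp_scaled d N 0))"
proof -
  \<comment> \<open>Any \<tau> between 0 and 1 would do in place of 1/2, as \<open>pp_scaled\<close>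
    does not involve it.\<close>
  obtain C where C: "0 \<le> C" "ev (\<lambda>N. m4 (pp_scaled d N 0) C)"
    using m4_pp_scaled[of "1 / 2" d, OF _ _ pp_deficit_tight[OF H]] by auto
  have M: "prob_space (Mpp d)" "App d 0 \<in> borel_measurable (Mpp d)" using H[of d] by (auto simp: is_A_pp_def)
  show "integrable (Mpp d) (\<lambda>x. (App d 0 x)\<^sup>2)" "integrable (Mpp d) (App d 0)"
    "(\<lambda>N. (\<bbbE> e. pp_scaled d N 0 e)) \<longlonglongrightarrow> (\<integral>x. App d 0 x \<partial>Mpp d)"
    "(\<lambda>N. (\<bbbE> e. (pp_scaled d N 0 e)\<^sup>2)) \<longlonglongrightarrow> (\<integral>x. (App d 0 x)\<^sup>2 \<partial>Mpp d)"
    using weak_moments[OF M pp_conv_law[OF H] C(2,1)] by blast+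
  show "ev (\<lambda>N. integrable env (pp_scaled d N 0))" using C(2) by eventually_elim (rule m4_integrable)
qed

text \<open>Convexity in the diagonal rate: \<open>G\<close> is a maximum of functions that are affine and
  nondecreasing in \<open>\<alpha>\<close>, and \<open>\<alpha> = 1 / (1 / 2 + a)\<close> is convex in \<open>a\<close>.\<close>

lemma Gpp_convex:
  assumes e: "nonneg e" and t: "0 \<le> t" "t \<le> 1" and a: "\<bar>a\<bar> < 1 / 2"
  shows "Gpp (t * a) e N N \<le> (1 - t) * Gpp 0 e N N + t * Gpp a e N N"
proof -
  have ta: "\<bar>t * a\<bar> \<le> 1 * \<bar>a\<bar>" unfolding abs_mult using t by (intro mult_right_mono) auto
  then have p: "0 < 1 / 2 + a" "0 < 1 / 2 + t * a" using a by linarith+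
  have "1 / (1 / 2 + t * a) \<le> (1 - t) * (1 / (1 / 2 + 0)) + t * (1 / (1 / 2 + a))"
  proof -
    have "((1 - t) * 2 + t * (1 / (1 / 2 + a))) * (1 / 2 + t * a) - 1 = 2 * t * (1 - t) * (a * a) / (1 / 2 + a)"
      using p by (simp add: field_simps)
    moreover have "0 \<le> 2 * t * (1 - t) * (a * a) / (1 / 2 + a)" using t p by simp
    ultimately show ?thesis using p by (simp add: pos_divide_le_eq)
  qed
  then have "Gpp (t * a) e N N \<le> G ((1 - t) * (1 / (1 / 2 + 0)) + t * (1 / (1 / 2 + a))) 0 e N N"
    using e by (intro G_mono_params) auto
  also have "\<dots> \<le> (1 - t) * Gpp 0 e N N + t * Gpp a e N N" using t by (intro G_convex) auto
  finally show ?thesis .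
qed

lemma pp_limit_mean_convex:
  assumes H: "\<And>d. is_A_pp d (Mpp d) (App d)" and t: "0 \<le> t" "t \<le> 1"
  shows "(\<integral>x. App (d * t) 0 x \<partial>Mpp (d * t)) \<le> (1 - t) * (\<integral>x. App 0 0 x \<partial>Mpp 0) + t * (\<integral>x. App d 0 x \<partial>Mpp d)"
proof (rule tendsto_le[OF sequentially_bot])
  note L = pp_limit_moments(3,5)[of Mpp App, OF H]
  show "(\<lambda>N. (1 - t) * (\<bbbE> e. pp_scaled 0 N 0 e) + t * (\<bbbE> e. pp_scaled d N 0 e))
    \<longlonglongrightarrow> (1 - t) * (\<integral>x. App 0 0 x \<partial>Mpp 0) + t * (\<integral>x. App d 0 x \<partial>Mpp d)"
    by (intro tendsto_intros L)
  show "(\<lambda>N. (\<bbbE> e. pp_scaled (d * t) N 0 e)) \<longlonglongrightarrow> (\<integral>x. App (d * t) 0 x \<partial>Mpp (d * t))" by (rule L)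
  show "ev (\<lambda>N. (\<bbbE> e. pp_scaled (d * t) N 0 e)
    \<le> (1 - t) * (\<bbbE> e. pp_scaled 0 N 0 e) + t * (\<bbbE> e. pp_scaled d N 0 e))"
    using L(2)[of 0] L(2)[of d] L(2)[of "d * t"] eventually_drift_small[of "1 / 2" "drift d", OF half_gt_zero[OF zero_less_one]]
      eventually_ge_at_top[of 1]
  proof eventually_elim
    case (elim N)
    have c: "0 < unit_scale * cbrt N" using elim(5) unit_scale_pos cbrt_pos by simp
    have "(\<bbbE> e. pp_scaled (d * t) N 0 e) \<le> (\<bbbE> e. (1 - t) * pp_scaled 0 N 0 e + t * pp_scaled d N 0 e)"
    proof (rule integral_mono_AE)
      show "AE e in env. pp_scaled (d * t) N 0 e \<le> (1 - t) * pp_scaled 0 N 0 e + t * pp_scaled d N 0 e"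
        using AE_env_pos
      proof eventually_elim
        case (elim e)
        let ?c = "unit_scale * cbrt N" and ?a = "drift d / cbrt N"
        have "Gpp (t * ?a) e N N \<le> (1 - t) * Gpp 0 e N N + t * Gpp ?a e N N"
          using elim \<open>\<bar>drift d / cbrt N\<bar> < 1 / 2\<close> t by (intro Gpp_convex)
        then have "Gpp (t * ?a) e N N - 4 * real N \<le> (1 - t) * (Gpp 0 e N N - 4 * real N) + t * (Gpp ?a e N N - 4 * real N)"
          by (simp add: algebra_simps)
        then have "(Gpp (t * ?a) e N N - 4 * real N) / ?c \<le> ((1 - t) * (Gpp 0 e N N - 4 * real N) + t * (Gpp ?a e N N - 4 * real N)) / ?c"
          using c by (intro divide_right_mono) auto
        moreover have "drift (d * t) / cbrt N = t * ?a" "drift 0 / cbrt N = 0" by (simp_all add: drift_def)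
        ultimately show ?case
          unfolding pp_scaled_def grid_pt_0 fst_conv snd_conv add_0_right diff_zero times_divide_eq_right add_divide_distrib
          by (simp only: add_0_right)
      qed
    qed (use elim in auto)
    then show ?case using elim by simp
  qed
qed

text \<open>With x = \<tau>^(1/3) the left side is the limit of E(Y) - E(X), which has to be bounded
  from above. Convexity along the segment from 0 to d gives this with a constant made of the two end
  values; later 1 - x \<le> 1 - \<tau> is used.\<close>

lemma pp_limit_mean_increment:
  assumes H: "\<And>d. is_A_pp d (Mpp d) (App d)" and x: "0 \<le> x" "x \<le> 1"
  defines "m \<equiv> \<lambda>d. \<integral>y. App d 0 y \<partial>Mpp d"
  shows "x * m (d * x) - m d \<le> (1 - x) * (2 * \<bar>m d\<bar> + \<bar>m 0\<bar>)"
proof -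
  have "m (d * x) \<le> (1 - x) * m 0 + x * m d" unfolding m_def using pp_limit_mean_convex[OF H x] .
  then have "x * m (d * x) \<le> x * ((1 - x) * m 0 + x * m d)" using x(1) by (rule mult_left_mono)
  then have "x * m (d * x) - m d \<le> (1 - x) * (x * m 0 - (1 + x) * m d)" by (simp add: algebra_simps)
  also have "\<dots> \<le> (1 - x) * (2 * \<bar>m d\<bar> + \<bar>m 0\<bar>)"
  proof (intro mult_left_mono)
    have "x * m 0 \<le> x * \<bar>m 0\<bar>" using x by (intro mult_left_mono) auto
    also have "\<dots> \<le> 1 * \<bar>m 0\<bar>" using x by (intro mult_right_mono) auto
    finally have "x * m 0 \<le> 1 * \<bar>m 0\<bar>" .
    moreover have "- ((1 + x) * m d) \<le> (1 + x) * \<bar>m d\<bar>" 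
    proof -
      have "(1 + x) * (- m d) \<le> (1 + x) * \<bar>m d\<bar>" using x by (intro mult_left_mono) auto
      then show ?thesis by simp
    qed
    moreover have "(1 + x) * \<bar>m d\<bar> \<le> 2 * \<bar>m d\<bar>" using x by (intro mult_right_mono) auto
    ultimately show "x * m 0 - (1 + x) * m d \<le> 2 * \<bar>m d\<bar> + \<bar>m 0\<bar>" by linarith
  qed (use x in simp)
  finally show ?thesis .
qed

lemma scaled_time_hs_env:
  assumes "0 < \<tau>" "\<tau> < 1"
  shows "scaled_lpp_time N 1 (hs_env (1 / rho \<delta> N) 0 e) = pp_scaled \<delta> N 0 e"
    "scaled_lpp_time N \<tau> (hs_env (1 / rho \<delta> N) 0 e) = pp_lower \<delta> \<tau> N e"
proof -
  have *: "0 \<le> \<lfloor>snd (t * real N, t * real N)\<rfloor>" "\<lfloor>snd (t * real N, t * real N)\<rfloor> \<le> \<lfloor>fst (t * real N, t * real N)\<rfloor>"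
    if "0 \<le> t" for t :: real using that by auto
  show "scaled_lpp_time N 1 (hs_env (1 / rho \<delta> N) 0 e) = pp_scaled \<delta> N 0 e"
    unfolding scaled_lpp_time_def pp_scaled_def lpp_hs_env[OF *[OF zero_le_one]] rho_eq
    by (simp add: cbrt_def unit_scale_def)
  show "scaled_lpp_time N \<tau> (hs_env (1 / rho \<delta> N) 0 e) = pp_lower \<delta> \<tau> N e"
    unfolding scaled_lpp_time_def pp_lower_def lpp_hs_env[OF *[OF less_imp_le[OF assms(1)]]] rho_eq
    by (simp add: cbrt_def unit_scale_def lower_part_def)
qed

lemma covariance_env:
  assumes \<tau>: "0 < \<tau>" "\<tau> < 1" and \<rho>: "0 < rho \<delta> N"
    and X: "m4 (pp_scaled \<delta> N 0) C" and Y: "m4 (pp_lower \<delta> \<tau> N) C"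
  shows "covariance (pp_env (rho \<delta> N)) (scaled_lpp_time N 1) (scaled_lpp_time N \<tau>)
    = (\<bbbE> e. pp_lower \<delta> \<tau> N e * pp_scaled \<delta> N 0 e)
      - (\<bbbE> e. pp_lower \<delta> \<tau> N e) * (\<bbbE> e. pp_scaled \<delta> N 0 e)"
proof -
  have m: "scaled_lpp_time N t \<in> borel_measurable (pp_env (rho \<delta> N))" if "0 \<le> t" for t
  proof -
    have [measurable]: "(\<lambda>\<omega>. lpp \<omega> (t * real N, t * real N)) \<in> borel_measurable (pp_env (rho \<delta> N))"
      using that by (intro measurable_lpp_env(1)) auto
    show ?thesis unfolding scaled_lpp_time_def[abs_def] by measurable
  qed
  have [measurable]: "scaled_lpp_time N 1 \<in> borel_measurable (pp_env (rho \<delta> N))" "scaled_lpp_time N \<tau> \<in> borel_measurable (pp_env (rho \<delta> N))"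
    using m \<tau> by simp_all
  note T = scaled_time_hs_env[OF \<tau>]
  define x where "x = (\<bbbE> e. pp_scaled \<delta> N 0 e)"
  define y where "y = (\<bbbE> e. pp_lower \<delta> \<tau> N e)"
  have E: "(\<integral>\<omega>. scaled_lpp_time N 1 \<omega> \<partial>pp_env (rho \<delta> N)) = x" "(\<integral>\<omega>. scaled_lpp_time N \<tau> \<omega> \<partial>pp_env (rho \<delta> N)) = y"
    by (subst integral_pp_env[OF \<rho>]; simp add: T x_def y_def)+
  have i: "integrable env (pp_scaled \<delta> N 0)" "integrable env (pp_lower \<delta> \<tau> N)"
    "integrable env (\<lambda>e. pp_lower \<delta> \<tau> N e * pp_scaled \<delta> N 0 e)"
    using m4_integrable[OF X] m4_integrable[OF Y] m4_integrable2[OF Y X] by blast+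
  have "covariance (pp_env (rho \<delta> N)) (scaled_lpp_time N 1) (scaled_lpp_time N \<tau>)
    = (\<integral>\<omega>. (scaled_lpp_time N 1 \<omega> - x) * (scaled_lpp_time N \<tau> \<omega> - y) \<partial>pp_env (rho \<delta> N))"
    unfolding covariance_def E ..
  also have "\<dots> = (\<bbbE> e. (pp_scaled \<delta> N 0 e - x) * (pp_lower \<delta> \<tau> N e - y))"
    by (subst integral_pp_env[OF \<rho>]) (simp_all add: T)
  also have "\<dots> = (\<bbbE> e. pp_lower \<delta> \<tau> N e * pp_scaled \<delta> N 0 e - x * pp_lower \<delta> \<tau> N e - y * pp_scaled \<delta> N 0 e + x * y)"
    by (intro Bochner_Integration.integral_cong refl) (simp add: algebra_simps)
  also have "\<dots> = (\<bbbE> e. pp_lower \<delta> \<tau> N e * pp_scaled \<delta> N 0 e) - x * y - y * x + x * y"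
    using i env.prob_space by (simp add: x_def y_def)
  finally show ?thesis by (simp add: x_def y_def algebra_simps)
qed

section \<open>Mean and variance of the increment\<close>

lemma st_sum_bound:
  fixes a :: real
  assumes "\<bar>a\<bar> \<le> 1 / 4"
  shows "1 / (1 / 2 + a) + 1 / (1 / 2 - a) \<le> 4 + 32 * a\<^sup>2"
proof -
  have p: "0 < 1 / 2 + a" "0 < 1 / 2 - a" using assms by (auto simp: abs_le_iff)
  have "a\<^sup>2 \<le> (1 / 4)\<^sup>2" using assms by (intro abs_le_square_iff[THEN iffD1]) simp
  then have q: "a\<^sup>2 \<le> 1 / 16" by (simp add: power2_eq_square)
  have "1 / (1 / 2 + a) + 1 / (1 / 2 - a) = 1 / (1 / 4 - a\<^sup>2)"
  proof -
    have "1 / (1 / 2 + a) + 1 / (1 / 2 - a) = 1 / ((1 / 2 + a) * (1 / 2 - a))" using p by (simp add: add_frac_eq)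
    also have "(1 / 2 + a) * (1 / 2 - a) = 1 / 4 - a\<^sup>2" by (simp add: power2_eq_square algebra_simps)
    finally show ?thesis .
  qed
  also have "\<dots> \<le> 4 + 32 * a\<^sup>2"
  proof -
    have "0 \<le> a\<^sup>2 * (4 - 32 * a\<^sup>2)" using q by (intro mult_nonneg_nonneg) auto
    then have "1 \<le> (4 + 32 * a\<^sup>2) * (1 / 4 - a\<^sup>2)" by (simp add: algebra_simps)
    then show ?thesis using q by (simp add: pos_divide_le_eq)
  qed
  finally show ?thesis .
qed

text \<open>The exact mean exceeds 4 per unit of size by at most 32 a^2, of order N^(-2/3). Over a
  size of order (1 - \<tau>) N and in units of N^(1/3) this is of order 1 - \<tau>. The + 1 in the
  constant absorbs the rounding, which vanishes as N grows.\<close>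

lemma st_upper_mean_bound:
  assumes \<tau>: "0 < \<tau>" "\<tau> < 1"
  shows "ev (\<lambda>N. (\<bbbE> e. st_upper \<delta> \<tau> N e) \<le> (64 * (drift \<delta>)\<^sup>2 / unit_scale + 1) * (1 - \<tau>))"
proof -
  define s where "s = 1 - \<tau>"
  have s: "0 < s" using \<tau> by (simp add: s_def)
  have "ev (\<lambda>N. 4 / (unit_scale * cbrt N) < s)" using order_tendstoD(2)[OF unit_scale_cbrt_lim s] .
  moreover have "ev (\<lambda>N. 1 / s \<le> real N)"
    using eventually_ge_at_top[of "nat \<lceil>1 / s\<rceil>"] by eventually_elim linarith
  ultimately show ?thesis
    using eventually_drift_small[of "1 / 4", OF divide_pos_pos[OF zero_less_one zero_less_numeral], of "drift \<delta>"] eventually_ge_at_top[of 1] unfolding s_def[symmetric]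
  proof eventually_elim
    case (elim N)
    define m where "m = N - lower_part \<tau> N"
    let ?a = "drift \<delta> / cbrt N" and ?c = "unit_scale * cbrt N"
    have c: "0 < cbrt N" "0 < ?c" using elim(4) unit_scale_pos cbrt_pos by auto
    have m: "\<bar>real m - s * real N\<bar> \<le> 1" using lower_part_parts(2)[OF \<tau>, of N] by (simp add: m_def s_def)
    have a: "\<bar>?a\<bar> \<le> 1 / 4" using elim(3) by simp
    then have \<rho>: "0 < 1 / 2 + ?a" "1 / 2 + ?a < 1" "0 < 1 / 2 - ?a" by linarith+
    have h: "1 - (1 / 2 + ?a) = 1 / 2 - ?a" by simp
    have mean: "(\<bbbE> e. Gst ?a e m m) = real m * (1 / (1 / 2 + ?a) + 1 / (1 / 2 - ?a))"
      using st_mean[OF \<rho>(1,2), of m] unfolding h .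
    have i: "integrable env (\<lambda>e. Gst ?a e m m)"
    proof (cases "m = 0")
      case False
      then have "(\<bbbE> e. Gst ?a e m m) \<noteq> 0" 
        unfolding mean using \<rho> by (intro less_imp_neq[symmetric] mult_pos_pos add_pos_pos) auto
      then show ?thesis using not_integrable_integral_eq by blast
    qed simp
    have "(\<bbbE> e. st_upper \<delta> \<tau> N e) = ((\<bbbE> e. Gst ?a e m m) - 4 * s * real N) / ?c"
      unfolding st_upper_def m_def[symmetric] s_def[symmetric] using i env.prob_space by simp
    also have "\<dots> \<le> (real m * (4 + 32 * ?a\<^sup>2) - 4 * s * real N) / ?c"
      unfolding mean using c st_sum_bound[OF a] by (intro divide_right_mono diff_right_mono mult_left_mono) auto
    also have "\<dots> \<le> (4 + 2 * s * real N * (32 * ?a\<^sup>2)) / ?c"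
    proof (intro divide_right_mono)
      have "1 \<le> s * real N" using elim(2) s by (simp add: pos_divide_le_eq mult.commute)
      then have "real m \<le> 2 * s * real N" using m by linarith
      then have "real m * (32 * ?a\<^sup>2) \<le> 2 * s * real N * (32 * ?a\<^sup>2)" by (intro mult_right_mono) auto
      then show "real m * (4 + 32 * ?a\<^sup>2) - 4 * s * real N \<le> 4 + 2 * s * real N * (32 * ?a\<^sup>2)"
        using m unfolding distrib_left by linarith
    qed (use c in simp)
    also have "\<dots> = 4 / ?c + 64 * (drift \<delta>)\<^sup>2 / unit_scale * s"
      unfolding cbrt_cube[symmetric] using c unit_scale_pos by (simp add: field_simps eval_nat_numeral)
    also have "\<dots> \<le> (64 * (drift \<delta>)\<^sup>2 / unit_scale + 1) * s" using elim(1) by (simp add: distrib_right)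
    finally show ?case .
  qed
qed

text \<open>Superadditivity bounds U from below by a point-to-point time of size k, and
  attractiveness bounds it from above by the stationary increment, which has the law of
  \<open>st_upper\<close>. The constants do not depend on \<tau>; the threshold for N does.\<close>

lemma increment_variance_bound:
  assumes H: "\<And>d. is_A_pp d (Mpp d) (App d)"
  obtains C K where "0 \<le> C" "\<And>\<tau>. 0 < \<tau> ==> \<tau> < 1 ==> ev (\<lambda>N. m4 (st_upper \<delta> \<tau> N) K)" "0 \<le> K"
    "\<And>\<tau>. 0 < \<tau> ==> \<tau> < 1 ==>
      ev (\<lambda>N. \<bar>env_var (st_upper \<delta> \<tau> N) - env_var (\<lambda>e. pp_scaled \<delta> N 0 e - pp_lower \<delta> \<tau> N e)\<bar> \<le> C * (1 - \<tau>))"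
proof -
  define m where "m d = (\<integral>y. App d 0 y \<partial>Mpp d)" for d
  obtain B N1 where B: "0 \<le> B" "1 \<le> N1"
    "\<And>N a. N1 \<le> N ==> \<bar>a\<bar> \<le> \<bar>drift \<delta>\<bar> / cbrt N ==> m4 (\<lambda>e. Gpp a e N N - 4 * real N) (B * cbrt N ^ 4)"
    "\<And>N a. N1 \<le> N ==> \<bar>a\<bar> \<le> \<bar>drift \<delta>\<bar> / cbrt N ==> m4 (\<lambda>e. Gst a e N N - 4 * real N) (B * cbrt N ^ 4)"
    using G_moments[OF abs_ge_zero pp_deficit_tight[OF H]] by blast
  define K where "K = 8 * (2 * (B / unit_scale ^ 4) + (4 / unit_scale) ^ 4)"
  have K0: "0 \<le> K" using B(1) unit_scale_pos by (auto simp: K_def intro!: add_nonneg_nonneg)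
  define C0 where "C0 = (64 * (drift \<delta>)\<^sup>2 / unit_scale + 1) + (2 * \<bar>m \<delta>\<bar> + \<bar>m 0\<bar>) + 1"
  have C0: "0 \<le> C0" using unit_scale_pos by (auto simp: C0_def intro!: add_nonneg_nonneg)
  define C where "C = 4 * C0 + 32 * K * (1 + C0)"
  have main: "ev (\<lambda>N. m4 (st_upper \<delta> \<tau> N) (K * (1 - \<tau>)) \<and>
    \<bar>env_var (st_upper \<delta> \<tau> N) - env_var (\<lambda>e. pp_scaled \<delta> N 0 e - pp_lower \<delta> \<tau> N e)\<bar> \<le> C * (1 - \<tau>))"
    if \<tau>: "0 < \<tau>" "\<tau> < 1" for \<tau>
  proof -
    define s where "s = 1 - \<tau>"
    have s: "0 < s" "s \<le> 1" using \<tau> by (auto simp: s_def)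
    let ?x = "\<tau> powr (1 / 3)"
    have x: "0 \<le> ?x" "?x \<le> 1" "\<tau> \<le> ?x" using \<tau> powr_mono'[of "1 / 3" 1 \<tau>] by (auto simp: powr_le1)
    obtain C4 where C4: "0 \<le> C4" "ev (\<lambda>N. m4 (pp_scaled \<delta> N 0) C4)" "ev (\<lambda>N. m4 (pp_lower \<delta> \<tau> N) C4)"
      using m4_pp_scaled[OF \<tau> pp_deficit_tight[OF H]] by blast
    have A: "prob_space (Mpp (\<delta> * ?x))" "(\<lambda>y. ?x * App (\<delta> * ?x) 0 y) \<in> borel_measurable (Mpp (\<delta> * ?x))"
    proof -
      have A: "is_A_pp (\<delta> * ?x) (Mpp (\<delta> * ?x)) (App (\<delta> * ?x))" by (rule H)
      then show "prob_space (Mpp (\<delta> * ?x))" unfolding is_A_pp_def by blast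
      have [measurable]: "App (\<delta> * ?x) 0 \<in> borel_measurable (Mpp (\<delta> * ?x))" using A order_refl[of "0::real"] unfolding is_A_pp_def by blast
      show "(\<lambda>y. ?x * App (\<delta> * ?x) 0 y) \<in> borel_measurable (Mpp (\<delta> * ?x))" by measurable
    qed
    have EY: "(\<lambda>N. (\<bbbE> e. pp_lower \<delta> \<tau> N e)) \<longlonglongrightarrow> ?x * m (\<delta> * ?x)"
      using weak_moments(3)[OF A pp_lower_conv_law[OF H \<tau>] C4(3,1)] by (simp add: m_def)
    have EX: "(\<lambda>N. (\<bbbE> e. pp_scaled \<delta> N 0 e)) \<longlonglongrightarrow> m \<delta>"
      using pp_limit_moments(3)[OF H] by (simp add: m_def)
    have "?x * m (\<delta> * ?x) - m \<delta> \<le> (1 - ?x) * (2 * \<bar>m \<delta>\<bar> + \<bar>m 0\<bar>)"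
      unfolding m_def using pp_limit_mean_increment[OF H x(1,2)] .
    also have "\<dots> \<le> s * (2 * \<bar>m \<delta>\<bar> + \<bar>m 0\<bar>)" using x by (intro mult_right_mono) (auto simp: s_def)
    also have "\<dots> < s * (2 * \<bar>m \<delta>\<bar> + \<bar>m 0\<bar>) + s" using s by simp
    finally have "ev (\<lambda>N. (\<bbbE> e. pp_lower \<delta> \<tau> N e) - (\<bbbE> e. pp_scaled \<delta> N 0 e) < s * (2 * \<bar>m \<delta>\<bar> + \<bar>m 0\<bar>) + s)"
      by (rule order_tendstoD(2)[OF tendsto_diff[OF EY EX]])
    moreover have "ev (\<lambda>N. 1 / s \<le> real N)"
      using eventually_ge_at_top[of "nat \<lceil>1 / s\<rceil>"] by eventually_elim linarith
    moreover have "ev (\<lambda>N. N1 \<le> N - lower_part \<tau> N)"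
      using filterlim_parts(2)[OF \<tau>] by (simp only: filterlim_at_top)
    ultimately show ?thesis
      using st_upper_mean_bound[OF \<tau>, of \<delta>] eventually_drift_small[of "1 / 4", OF divide_pos_pos[OF zero_less_one zero_less_numeral], of "drift \<delta>"] C4(2,3)
      unfolding s_def[symmetric]
    proof eventually_elim
      case (elim N)
      define n where "n = lower_part \<tau> N"
      define k where "k = N - n"
      have nk: "n + k = N" using lower_part_bounds(3)[OF \<tau>, of N] by (simp add: n_def k_def)
      have kN: "N1 \<le> k" "k \<le> N" "1 \<le> k" using elim(3) B(2) by (auto simp: k_def n_def)
      have ks: "\<bar>real k - s * real N\<bar> \<le> 1" using lower_part_parts(2)[OF \<tau>, of N] by (simp add: k_def n_def s_def)
      let ?a = "drift \<delta> / cbrt N" and ?c = "unit_scale * cbrt N"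
      have c: "0 < cbrt k" "cbrt k \<le> cbrt N" "0 < cbrt N" using kN cbrt_pos[of k] cbrt_mono[of k N] by linarith+
      have c0: "0 < ?c" using c unit_scale_pos by simp
      have "\<bar>?a\<bar> = \<bar>drift \<delta>\<bar> / cbrt N" using c by simp
      also have "\<dots> \<le> \<bar>drift \<delta>\<bar> / cbrt k" using c by (intro divide_left_mono mult_pos_pos) auto
      finally have ak: "\<bar>?a\<bar> \<le> \<bar>drift \<delta>\<bar> / cbrt k" .
      have a: "\<bar>?a\<bar> < 1 / 4" by (rule elim)
      then have \<rho>: "0 < 1 / 2 + ?a" "1 / 2 + ?a < 1" "0 < 1 / 2 - ?a" by linarith+
      have h: "1 - (1 / 2 + ?a) = 1 / 2 - ?a" by simp
      have mS: "m4 (st_upper \<delta> \<tau> N) (K * s)"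
        unfolding st_upper_def[abs_def] n_def[symmetric] k_def[symmetric] s_def[symmetric] K_def
        by (rule m4_rescale[OF B(4)[OF kN(1) ak] B(1) s(1) ks kN(2) elim(2)])
      obtain \<Phi> where \<Phi>: "preserving \<Phi>" "\<And>e. Gst ?a e N N - Gst ?a e n n = Gst ?a (\<Phi> e) k k"
        using burke_increment[OF \<rho>(1,2), of n k] unfolding h nk by blast
      define V where "V e = st_upper \<delta> \<tau> N (\<Phi> e)" for e
      have V: "V e = (Gst ?a e N N - Gst ?a e n n - 4 * s * real N) / ?c" for e
        unfolding V_def st_upper_def n_def[symmetric] k_def[symmetric] s_def[symmetric] \<Phi>(2) ..
      have mV: "m4 V (K * s)" unfolding V_def[abs_def] by (rule m4_preserving[OF mS \<Phi>(1)])
      have varV: "env_var V = env_var (st_upper \<delta> \<tau> N)" unfolding env_var_def V_def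
        using preserving_integral[OF \<Phi>(1), of "\<lambda>e. (st_upper \<delta> \<tau> N e)\<^sup>2"] preserving_integral[OF \<Phi>(1), of "st_upper \<delta> \<tau> N"] by simp
      define L where "L e = (Gpp ?a (shift n e) k k - 4 * s * real N) / ?c" for e
      have mL: "m4 L (K * s)" unfolding L_def[abs_def] K_def
        by (rule m4_rescale[OF m4_preserving[OF B(3)[OF kN(1) ak] preserving_shift] B(1) s(1) ks kN(2) elim(2)])
      define U where "U e = pp_scaled \<delta> N 0 e - pp_lower \<delta> \<tau> N e" for e
      have U: "U e = (Gpp ?a e N N - Gpp ?a e n n - 4 * s * real N) / ?c" for e
        unfolding U_def pp_scaled_def pp_lower_def n_def[symmetric] s_def
        by (simp add: diff_divide_distrib[symmetric] algebra_simps)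
      have \<alpha>: "0 \<le> 1 / (1 / 2 + ?a)" "0 \<le> 1 / (1 / 2 - ?a)" using \<rho> by (intro divide_nonneg_nonneg; linarith)+
      have LU: "AE e in env. L e \<le> U e" and UV: "AE e in env. U e \<le> V e"
      proof -
        show "AE e in env. L e \<le> U e" using AE_env_pos
        proof eventually_elim
          case (elim e)
          show ?case unfolding L_def U using G_superadditive[OF elim \<alpha>(1) order_refl, of n k] c0 unfolding nk
            by (intro divide_right_mono) auto
        qed
        show "AE e in env. U e \<le> V e" using AE_env_pos
        proof eventually_elim
          case (elim e)
          show ?case
            unfolding V U using G_attractive[OF elim \<alpha>(2) order_refl, of "1 / (1 / 2 + ?a)" n k] c0 unfolding nk
            by (intro divide_right_mono) auto
        qed
      qed
      have iX: "integrable env (pp_scaled \<delta> N 0)" "integrable env (pp_lower \<delta> \<tau> N)"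
        using elim(6,7) m4_integrable by blast+
      have "(\<bbbE> e. V e - U e) = (\<bbbE> e. V e) - ((\<bbbE> e. pp_scaled \<delta> N 0 e) - (\<bbbE> e. pp_lower \<delta> \<tau> N e))"
        using m4_integrable[OF mV] iX unfolding U_def by simp
      also have "(\<bbbE> e. V e) = (\<bbbE> e. st_upper \<delta> \<tau> N e)"
        unfolding V_def by (rule preserving_integral[OF \<Phi>(1)]) simp
      finally have d: "(\<bbbE> e. V e - U e) \<le> C0 * s"
        using elim(1,4) unfolding C0_def by (simp add: algebra_simps)
      have "0 \<le> K * s" using K0 s by simp
      from env_var_compare[OF mV mL this _ LU UV d]
      have "\<bar>env_var V - env_var U\<bar> \<le> 4 * (C0 * s) + 32 * (K * s) * (1 + C0 * s)" unfolding U_def by simp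
      also have "\<dots> \<le> C * s"
      proof -
        have "C0 * s \<le> C0 * 1" using C0 s by (intro mult_left_mono) auto
        then have "32 * (K * s) * (1 + C0 * s) \<le> 32 * (K * s) * (1 + C0)" using K0 s by (intro mult_left_mono) auto
        then show ?thesis by (simp add: C_def algebra_simps)
      qed
      finally show ?case using mS unfolding varV U_def by simp
    qed
  qed
  show ?thesis
  proof
    show "0 \<le> C" using C0 K0 by (simp add: C_def)
    show "0 \<le> K" by (rule K0)
    fix \<tau> :: real assume \<tau>: "0 < \<tau>" "\<tau> < 1"
    have "K * (1 - \<tau>) \<le> K * 1" using K0 \<tau> by (intro mult_left_mono) auto
    then show "ev (\<lambda>N. m4 (st_upper \<delta> \<tau> N) K)"
      using main[OF \<tau>] by (auto elim!: eventually_mono intro: m4_mono)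
    show "ev (\<lambda>N. \<bar>env_var (st_upper \<delta> \<tau> N) - env_var (\<lambda>e. pp_scaled \<delta> N 0 e - pp_lower \<delta> \<tau> N e)\<bar> \<le> C * (1 - \<tau>))"
      using main[OF \<tau>] by (auto elim!: eventually_mono)
  qed
qed

section \<open>The covariance\<close>

lemma powr_third_square: "0 < x ==> (x powr (1 / 3))\<^sup>2 = x powr (2 / 3)" for x :: real
  by (simp add: power2_eq_square powr_add[symmetric])

text \<open>The powers \<tau>^(2/3) and (1 - \<tau>)^(2/3) are the squares of the factors y and z of
  the limit variables. The variance bound for finite N passes to the limit because both variances
  converge.\<close>

lemma covariance_limit:
  fixes \<tau> :: real
  assumes H: "\<And>d. is_A_pp d (Mpp d) (App d)" and Hst: "\<And>d. is_A_st_hs d (Mst d) (Ast d)"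
    and \<tau>: "0 < \<tau>" "\<tau> < 1"
    and K: "ev (\<lambda>N. m4 (st_upper \<delta> \<tau> N) K)" "0 \<le> K"
    and bound: "ev (\<lambda>N. \<bar>env_var (st_upper \<delta> \<tau> N) - env_var (\<lambda>e. pp_scaled \<delta> N 0 e - pp_lower \<delta> \<tau> N e)\<bar> \<le> B)"
  obtains l where "(\<lambda>N. covariance (pp_env (rho \<delta> N)) (scaled_lpp_time N 1) (scaled_lpp_time N \<tau>)) \<longlonglongrightarrow> l"
    "\<bar>l - (1 / 2 * prob_space.variance (Mpp \<delta>) (App \<delta> 0)
         + 1 / 2 * \<tau> powr (2 / 3) * prob_space.variance (Mpp (\<delta> * \<tau> powr (1 / 3))) (App (\<delta> * \<tau> powr (1 / 3)) 0)
         - 1 / 2 * (1 - \<tau>) powr (2 / 3) * prob_space.variance (Mst (\<delta> * (1 - \<tau>) powr (1 / 3))) (Ast (\<delta> * (1 - \<tau>) powr (1 / 3)) 0))\<bar> \<le> B / 2"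
proof -
  let ?X = "\<lambda>N. pp_scaled \<delta> N 0" and ?Y = "pp_lower \<delta> \<tau>" and ?V = "st_upper \<delta> \<tau>"
  define y where "y = \<tau> powr (1 / 3)"
  define z where "z = (1 - \<tau>) powr (1 / 3)"
  have y2: "y\<^sup>2 = \<tau> powr (2 / 3)" and z2: "z\<^sup>2 = (1 - \<tau>) powr (2 / 3)"
    using \<tau> by (simp_all add: y_def z_def powr_third_square)
  define M where "M = Mpp (\<delta> * y)"
  define A where "A = App (\<delta> * y) 0"
  define M' where "M' = Mst (\<delta> * z)"
  define A' where "A' = Ast (\<delta> * z) 0"
  obtain C where C: "0 \<le> C" "ev (\<lambda>N. m4 (?X N) C)" "ev (\<lambda>N. m4 (?Y N) C)"
    using m4_pp_scaled[OF \<tau> pp_deficit_tight[OF H]] by blast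
  have M: "prob_space M" and Am: "A \<in> borel_measurable M"
    using H[of "\<delta> * y"] order_refl[of "0::real"] unfolding is_A_pp_def M_def A_def by blast+
  have M': "prob_space M'" and Am': "A' \<in> borel_measurable M'"
    using Hst[of "\<delta> * z"] order_refl[of "0::real"] unfolding is_A_st_hs_def M'_def A'_def by blast+
  have M0: "prob_space (Mpp \<delta>)" using H[of \<delta>] unfolding is_A_pp_def by blast
  have ymeas: "(\<lambda>x. y * A x) \<in> borel_measurable M" using Am by measurable
  have zmeas: "(\<lambda>x. z * A' x) \<in> borel_measurable M'" using Am' by measurable
  note X = pp_limit_moments[of Mpp App \<delta>, OF H]
  note iA = pp_limit_moments(1,2)[of Mpp App "\<delta> * y", OF H, folded M_def A_def]
  have lawY: "conv_law ?Y M (\<lambda>x. y * A x)"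
    unfolding M_def A_def y_def by (rule pp_lower_conv_law[OF H \<tau>])
  have lawV: "conv_law ?V M' (\<lambda>x. z * A' x)"
    unfolding M'_def A'_def z_def by (rule st_upper_conv_law[OF Hst \<tau>])
  note Y = weak_moments[OF M ymeas lawY C(3,1)]
  note V = weak_moments[OF M' zmeas lawV K]
  have z0: "0 < z" using \<tau> by (simp add: z_def)
  have iA': "integrable M' (\<lambda>x. (A' x)\<^sup>2)" "integrable M' A'"
    using V(1,2) z0 by (simp_all add: power_mult_distrib)
  have EY: "(\<lambda>N. (\<bbbE> e. ?Y N e)) \<longlonglongrightarrow> y * (\<integral>x. A x \<partial>M)" "(\<lambda>N. (\<bbbE> e. (?Y N e)\<^sup>2)) \<longlonglongrightarrow> y\<^sup>2 * (\<integral>x. (A x)\<^sup>2 \<partial>M)"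
    using Y(3,4) by (simp_all add: power_mult_distrib)
  have EV: "(\<lambda>N. (\<bbbE> e. ?V N e)) \<longlonglongrightarrow> z * (\<integral>x. A' x \<partial>M')" "(\<lambda>N. (\<bbbE> e. (?V N e)\<^sup>2)) \<longlonglongrightarrow> z\<^sup>2 * (\<integral>x. (A' x)\<^sup>2 \<partial>M')"
    using V(3,4) by (simp_all add: power_mult_distrib)
  obtain q where q: "(\<lambda>N. (\<bbbE> e. ?Y N e * ?X N e)) \<longlonglongrightarrow> q"
    using scaled_product_convergent[OF \<tau> H H pp_deficit_tight[OF H]] unfolding convergent_def by blast
  define l where "l = q - y * (\<integral>x. A x \<partial>M) * (\<integral>x. App \<delta> 0 x \<partial>Mpp \<delta>)"
  define vX where "vX = prob_space.variance (Mpp \<delta>) (App \<delta> 0)"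
  define vA where "vA = prob_space.variance M A"
  define vA' where "vA' = prob_space.variance M' A'"
  have vX: "vX = (\<integral>x. (App \<delta> 0 x)\<^sup>2 \<partial>Mpp \<delta>) - (\<integral>x. App \<delta> 0 x \<partial>Mpp \<delta>)\<^sup>2"
    unfolding vX_def by (rule prob_space.variance_eq[OF M0 X(2,1)])
  have vA: "vA = (\<integral>x. (A x)\<^sup>2 \<partial>M) - (\<integral>x. A x \<partial>M)\<^sup>2"
    unfolding vA_def by (rule prob_space.variance_eq[OF M iA(2,1)])
  have vA': "vA' = (\<integral>x. (A' x)\<^sup>2 \<partial>M') - (\<integral>x. A' x \<partial>M')\<^sup>2"
    unfolding vA'_def by (rule prob_space.variance_eq[OF M' iA'(2,1)])
  have "(\<lambda>N. (\<bbbE> e. ?Y N e * ?X N e) - (\<bbbE> e. ?Y N e) * (\<bbbE> e. ?X N e)) \<longlonglongrightarrow> l"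
    unfolding l_def by (intro tendsto_intros q EY X)
  moreover have "ev (\<lambda>N. (\<bbbE> e. ?Y N e * ?X N e) - (\<bbbE> e. ?Y N e) * (\<bbbE> e. ?X N e)
      = covariance (pp_env (rho \<delta> N)) (scaled_lpp_time N 1) (scaled_lpp_time N \<tau>))"
    using C(2,3) eventually_drift_small[of "1 / 2" "drift \<delta>", OF half_gt_zero[OF zero_less_one]]
  proof eventually_elim
    case (elim N)
    have "0 < rho \<delta> N" using elim(3) unfolding rho_eq by linarith
    from covariance_env[OF \<tau> this elim(1,2)] show ?case by (rule sym)
  qed
  ultimately have cov: "(\<lambda>N. covariance (pp_env (rho \<delta> N)) (scaled_lpp_time N 1) (scaled_lpp_time N \<tau>)) \<longlonglongrightarrow> l"
    by (rule Lim_transform_eventually)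
  have "(\<lambda>N. (\<bbbE> e. (?X N e)\<^sup>2) - 2 * (\<bbbE> e. ?Y N e * ?X N e) + (\<bbbE> e. (?Y N e)\<^sup>2) - ((\<bbbE> e. ?X N e) - (\<bbbE> e. ?Y N e))\<^sup>2)
    \<longlonglongrightarrow> (\<integral>x. (App \<delta> 0 x)\<^sup>2 \<partial>Mpp \<delta>) - 2 * q + y\<^sup>2 * (\<integral>x. (A x)\<^sup>2 \<partial>M) - ((\<integral>x. App \<delta> 0 x \<partial>Mpp \<delta>) - y * (\<integral>x. A x \<partial>M))\<^sup>2"
    by (intro tendsto_intros q EY X)
  also have "(\<integral>x. (App \<delta> 0 x)\<^sup>2 \<partial>Mpp \<delta>) - 2 * q + y\<^sup>2 * (\<integral>x. (A x)\<^sup>2 \<partial>M) - ((\<integral>x. App \<delta> 0 x \<partial>Mpp \<delta>) - y * (\<integral>x. A x \<partial>M))\<^sup>2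
    = vX + y\<^sup>2 * vA - 2 * l" unfolding vX vA l_def by (simp add: power2_eq_square algebra_simps)
  finally have "(\<lambda>N. (\<bbbE> e. (?X N e)\<^sup>2) - 2 * (\<bbbE> e. ?Y N e * ?X N e) + (\<bbbE> e. (?Y N e)\<^sup>2) - ((\<bbbE> e. ?X N e) - (\<bbbE> e. ?Y N e))\<^sup>2)
    \<longlonglongrightarrow> vX + y\<^sup>2 * vA - 2 * l" .
  moreover have "ev (\<lambda>N. (\<bbbE> e. (?X N e)\<^sup>2) - 2 * (\<bbbE> e. ?Y N e * ?X N e) + (\<bbbE> e. (?Y N e)\<^sup>2) - ((\<bbbE> e. ?X N e) - (\<bbbE> e. ?Y N e))\<^sup>2
    = env_var (\<lambda>e. ?X N e - ?Y N e))" using C(2,3)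
  proof eventually_elim
    case (elim N)
    have i: "integrable env (?X N)" "integrable env (?Y N)" using elim m4_integrable by blast+
    have i2: "integrable env (\<lambda>e. (?X N e)\<^sup>2)" "integrable env (\<lambda>e. (?Y N e)\<^sup>2)"
      using m4_integrable_power[OF elim(1), of 2] m4_integrable_power[OF elim(2), of 2] by simp_all
    have i3: "integrable env (\<lambda>e. 2 * (?Y N e * ?X N e))" by (intro integrable_mult_right m4_integrable2[OF elim(2,1)])
    have "(\<bbbE> e. (?X N e - ?Y N e)\<^sup>2) = (\<bbbE> e. ((?X N e)\<^sup>2 - 2 * (?Y N e * ?X N e)) + (?Y N e)\<^sup>2)"
      by (intro Bochner_Integration.integral_cong refl) (simp add: power2_eq_square algebra_simps)
    also have "\<dots> = (\<bbbE> e. (?X N e)\<^sup>2) - (\<bbbE> e. 2 * (?Y N e * ?X N e)) + (\<bbbE> e. (?Y N e)\<^sup>2)"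
      unfolding Bochner_Integration.integral_add[OF Bochner_Integration.integrable_diff[OF i2(1) i3] i2(2)]
        Bochner_Integration.integral_diff[OF i2(1) i3] ..
    finally show ?case unfolding env_var_def Bochner_Integration.integral_diff[OF i] by simp
  qed
  ultimately have vU: "(\<lambda>N. env_var (\<lambda>e. ?X N e - ?Y N e)) \<longlonglongrightarrow> vX + y\<^sup>2 * vA - 2 * l"
    by (rule Lim_transform_eventually)
  have "(\<lambda>N. env_var (?V N)) \<longlonglongrightarrow> z\<^sup>2 * (\<integral>x. (A' x)\<^sup>2 \<partial>M') - (z * (\<integral>x. A' x \<partial>M'))\<^sup>2"
    unfolding env_var_def by (intro tendsto_intros EV)
  also have "z\<^sup>2 * (\<integral>x. (A' x)\<^sup>2 \<partial>M') - (z * (\<integral>x. A' x \<partial>M'))\<^sup>2 = z\<^sup>2 * vA'"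
    unfolding vA' by (simp add: power_mult_distrib right_diff_distrib)
  finally have vV: "(\<lambda>N. env_var (?V N)) \<longlonglongrightarrow> z\<^sup>2 * vA'" .
  have "\<bar>z\<^sup>2 * vA' - (vX + y\<^sup>2 * vA - 2 * l)\<bar> \<le> B"
    by (rule tendsto_upperbound[OF tendsto_rabs[OF tendsto_diff[OF vV vU]] bound sequentially_bot])
  moreover have "l - (1 / 2 * vX + 1 / 2 * y\<^sup>2 * vA - 1 / 2 * z\<^sup>2 * vA') = (z\<^sup>2 * vA' - (vX + y\<^sup>2 * vA - 2 * l)) / 2"
    by (simp add: field_simps)
  moreover have "\<bar>w / 2\<bar> \<le> B / 2" if "\<bar>w\<bar> \<le> B" for w using that by simp
  ultimately have "\<bar>l - (1 / 2 * vX + 1 / 2 * y\<^sup>2 * vA - 1 / 2 * z\<^sup>2 * vA')\<bar> \<le> B / 2" by (simp only:)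
  then show ?thesis
    using that[OF cov] unfolding vX_def vA_def vA'_def M_def A_def M'_def A'_def y2 z2 unfolding y_def z_def by blast
qed

theorem corollary2p4:
  fixes \<delta> \<theta> :: real
    and Mpp :: "real => 'a measure" and App :: "real => real => 'a => real"
    and Mst :: "real => 'b measure" and Ast :: "real => real => 'b => real"
  assumes "\<And>d. is_A_pp d (Mpp d) (App d)"
    and "\<And>d. is_A_st_hs d (Mst d) (Ast d)"
    and "0 < \<theta>" and "\<theta> < 1 / 3"
  shows "\<exists>C :: real => real.
    (\<forall>\<tau>. 0 < \<tau> \<and> \<tau> < 1 \<longrightarrow>
       (\<lambda>N. covariance (pp_env (rho \<delta> N)) (scaled_lpp_time N 1) (scaled_lpp_time N \<tau>))
         \<longlonglongrightarrow> C \<tau>) \<and>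
    (\<lambda>\<tau>. C \<tau> -
        (1 / 2 * prob_space.variance (Mpp \<delta>) (App \<delta> 0)
         + 1 / 2 * \<tau> powr (2 / 3)
             * prob_space.variance (Mpp (\<delta> * \<tau> powr (1 / 3))) (App (\<delta> * \<tau> powr (1 / 3)) 0)
         - 1 / 2 * (1 - \<tau>) powr (2 / 3)
             * prob_space.variance (Mst (\<delta> * (1 - \<tau>) powr (1 / 3)))
                 (Ast (\<delta> * (1 - \<tau>) powr (1 / 3)) 0)))
      \<in> O[at_left 1](\<lambda>\<tau>. (1 - \<tau>) powr (1 - \<theta>))"
proof -
  let ?F = "\<lambda>\<tau>. 1 / 2 * prob_space.variance (Mpp \<delta>) (App \<delta> 0)
         + 1 / 2 * \<tau> powr (2 / 3)
             * prob_space.variance (Mpp (\<delta> * \<tau> powr (1 / 3))) (App (\<delta> * \<tau> powr (1 / 3)) 0)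
         - 1 / 2 * (1 - \<tau>) powr (2 / 3)
             * prob_space.variance (Mst (\<delta> * (1 - \<tau>) powr (1 / 3)))
                 (Ast (\<delta> * (1 - \<tau>) powr (1 / 3)) 0)"
  obtain B K where B: "0 \<le> B" "\<And>\<tau>. 0 < \<tau> ==> \<tau> < 1 ==> ev (\<lambda>N. m4 (st_upper \<delta> \<tau> N) K)" "0 \<le> K"
    "\<And>\<tau>. 0 < \<tau> ==> \<tau> < 1 ==>
      ev (\<lambda>N. \<bar>env_var (st_upper \<delta> \<tau> N) - env_var (\<lambda>e. pp_scaled \<delta> N 0 e - pp_lower \<delta> \<tau> N e)\<bar> \<le> B * (1 - \<tau>))"
    using increment_variance_bound[of Mpp App \<delta>, OF assms(1)] by blast
  \<comment> \<open>With the implication inside the existential the claim holds for every real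
    \<tau>, so \<open>choice\<close> turns the limits into one function.\<close>
  have "\<exists>l. 0 < \<tau> \<and> \<tau> < 1 \<longrightarrow>
      (\<lambda>N. covariance (pp_env (rho \<delta> N)) (scaled_lpp_time N 1) (scaled_lpp_time N \<tau>)) \<longlonglongrightarrow> l \<and> \<bar>l - ?F \<tau>\<bar> \<le> B * (1 - \<tau>) / 2" for \<tau>
  proof (cases "0 < \<tau> \<and> \<tau> < 1")
    case True
    then have \<tau>: "0 < \<tau>" "\<tau> < 1" by auto
    show ?thesis by (rule covariance_limit[OF assms(1,2) \<tau> B(2)[OF \<tau>] B(3) B(4)[OF \<tau>]]) blast
  next
    case False
    then show ?thesis by blast
  qed
  then have "\<forall>\<tau>. \<exists>l. 0 < \<tau> \<and> \<tau> < 1 \<longrightarrow>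
      (\<lambda>N. covariance (pp_env (rho \<delta> N)) (scaled_lpp_time N 1) (scaled_lpp_time N \<tau>)) \<longlonglongrightarrow> l \<and> \<bar>l - ?F \<tau>\<bar> \<le> B * (1 - \<tau>) / 2"
    by (rule allI)
  from choice[OF this] obtain C where C: "\<forall>\<tau>. 0 < \<tau> \<and> \<tau> < 1 \<longrightarrow>
      (\<lambda>N. covariance (pp_env (rho \<delta> N)) (scaled_lpp_time N 1) (scaled_lpp_time N \<tau>)) \<longlonglongrightarrow> C \<tau> \<and> \<bar>C \<tau> - ?F \<tau>\<bar> \<le> B * (1 - \<tau>) / 2"
    by (rule exE)
  have "(\<lambda>\<tau>. C \<tau> - ?F \<tau>) \<in> O[at_left 1](\<lambda>\<tau>. (1 - \<tau>) powr (1 - \<theta>))"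
  proof (rule bigoI)
    show "eventually (\<lambda>\<tau>. norm (C \<tau> - ?F \<tau>) \<le> B * norm ((1 - \<tau>) powr (1 - \<theta>))) (at_left 1)"
    proof (rule eventually_at_leftI[of 0])
      fix \<tau> :: real assume "\<tau> \<in> {0<..<1}"
      then have \<tau>: "0 < \<tau>" "\<tau> < 1" by auto
      \<comment> \<open>The error is linear in 1 - \<tau>, and on (0, 1) a smaller exponent gives a
        larger power.\<close>
      have "(1 - \<tau>) powr 1 \<le> (1 - \<tau>) powr (1 - \<theta>)" using \<tau> assms(3) by (intro powr_mono') auto
      then have "B * (1 - \<tau>) \<le> B * (1 - \<tau>) powr (1 - \<theta>)" using \<tau> B(1) by (intro mult_left_mono) auto
      moreover have "0 \<le> B * (1 - \<tau>)" using \<tau> B(1) by simp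
      moreover have "\<bar>C \<tau> - ?F \<tau>\<bar> \<le> B * (1 - \<tau>) / 2" using C \<tau> by blast
      ultimately show "norm (C \<tau> - ?F \<tau>) \<le> B * norm ((1 - \<tau>) powr (1 - \<theta>))" by simp
    qed simp
  qed
  with C show ?thesis by blast
qed

end
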